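(* Let $a,c\in\mathbb{R}$ with $a+c>0$ and $\min\{a,c\}>-2$. Let $(H(t))_{t\in[0,1]}$ be the process (with $H(0)=0$) whose law is the Corwin–Knizel stationary measure for the open KPZ equation on $[0,1]$ with parameters $a,c$. Let $(Y_t)_{t\in[0,1/4]}$ be the Markov process defined in the context with parameters $a,c$ and $\tau=1/4$, and let $(B_t)_{t\ge0}$ be a standard Brownian motion independent of $Y$. Then $$(H(t))_{t\in[0,1]}\stackrel{d}{=}\left(B_{t/2}-Y_{t/4}+Y_0\right)_{t\in[0,1]},$$ where $\stackrel{d}{=}$ denotes equality of all finite dimensional distributions.
   Context: Notation: $(x)_j=x(x+1)\cdots(x+j-1)$, $(x)_0=1$. **Process $Y$.** $K_{iu}(x)=\int_0^\infty e^{-x\cosh w}\cos(uw)\,dw$ ($u\in\mathbb{R}$, $x>0$), $\mu(du)=\frac{2}{\pi}\frac{du}{|\Gamma(iu)|^2}$ on $(0,\infty)$, $p_t(x,y)=\int_0^\infty e^{-tu^2}K_{iu}(e^x)K_{iu}(e^y)\,\mu(du)$, and $C^{(\tau)}_{a,c}=\int_{\mathbb{R}}\int_{\mathbb{R}}e^{ax+cy}p_\tau(x,y)\,dx\,dy$ (finite for $a+c>0$). $(Y_t)_{t\in[0,\tau]}$ is the Markov process (which exists for $a+c>0$) such that for all $d\ge 0$ and $0=t_0<t_1<\dots<t_{d+1}=\tau$ the vector $(Y_{t_0},\dots,Y_{t_{d+1}})$ has density $\frac{1}{C^{(\tau)}_{a,c}}e^{cx_0+ax_{d+1}}\prod_{k=1}^{d+1}p_{t_k-t_{k-1}}(x_{k-1},x_k)$.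 **Open KPZ stationary measure.** The open KPZ equation is formally $\partial_th=\frac12\partial_s^2h+\frac12(\partial_sh)^2+\zeta$ on $s\in[0,1]$ with $\zeta$ space-time white noise; the Hopf–Cole solution is $h=\log Z$ with $\partial_tZ=\frac12\partial_s^2Z+Z\zeta$ and boundary conditions $\partial_sZ|_{s=0}=\frac{c-1}{2}Z(t,0)$, $\partial_sZ|_{s=1}=\frac{1-a}{2}Z(t,1)$. A stationary measure is the law of $H$ with $H(0)=0$ such that $h(0,\cdot)=H$ implies $(h(t,s)-h(t,0))_{s\in[0,1]}\stackrel d=(H(s))_{s\in[0,1]}$ for all $t\ge0$. Corwin and Knizel constructed a stationary measure for each $a,c$; write $H^{(a,c)}$ for a process with this law. For the present purpose its law for $a+c>0$, $\min\{a,c\}>-2$ is characterized by the following two facts proved by Corwin and Knizel, which may be taken as the definition of $H=H^{(a,c)}$. (1) If $c>0$: put $S=\min\{c,2\}$. For all $d\ge 1$, $0=t_0<t_1<\dots<t_d\le t_{d+1}=1$ and $S>s_1>\dots>s_d>s_{d+1}=0$, $$\mathbb{E}\left[e^{-\sum_{k=1}^d(s_k-s_{k+1})H(t_k)}\right]=e^{\frac14\sum_{k=1}^{d+1}(t_k-t_{k-1})s_k^2}\cdot\frac{1}{\mathfrak K}\int_{\mathbb{R}}\mathbb{E}\left[e^{-\frac14\sum_{k=1}^{d+1}(t_k-t_{k-1})\mathbb{T}_{s_k}}\,\middle|\,\mathbb{T}_{0}=x\right]\mathfrak p_0(dx),\qquad \mathfrak K=\int_{\mathbb{R}}e^{-x/4}\,\mathfrak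 p_0(dx),$$ with $\mathbb{T}$ and $\mathfrak p_0$ defined below. (2) $(H^{(a,c)}(1-t)-H^{(a,c)}(1))_{t\in[0,1]}\stackrel d=(H^{(c,a)}(t))_{t\in[0,1]}$ (this determines the law when $c\le0$, since then $a>0$). **Continuous dual Hahn process $\mathbb{T}$.** For $\alpha\in\mathbb{R}$ and $\beta,\gamma$ either both real or complex conjugates, let $A_n=(n+\alpha+\beta)(n+\alpha+\gamma)$, $C_n=n(n-1+\beta+\gamma)$, and let $p_n(x)=p_n(x|\alpha,\beta,\gamma)$ be the monic polynomials given by $p_{-1}=0$, $p_0=1$, $x\,p_n(x)=p_{n+1}(x)+(A_n+C_n-\alpha^2)p_n(x)+A_{n-1}C_n\,p_{n-1}(x)$. If $\prod_{k=0}^nA_kC_{k+1}\ge0$ for all $n$, then $\rho(dx|\alpha,\beta,\gamma)$ denotes the unique probability measure on $\mathbb{R}$ with $\int_{\mathbb{R}} p_n(\frac x4|\alpha,\beta,\gamma)\,p_m(\frac x4|\alpha,\beta,\gamma)\,\rho(dx|\alpha,\beta,\gamma)=0$ for $m\neq n$. $(\mathbb{T}_s)_{s\in(-\infty,c)}$ is the Markov process on $\mathbb{R}$ with transition probabilities, $s<t$, $$\mathfrak p_{s,t}(x,dy)=\begin{cases}\rho\left(dy\,\middle|\,\frac{c-t}{2},\frac{t-s-i\sqrt x}{2},\frac{t-s+i\sqrt x}{2}\right)& x\ge0,\\[2pt] \rho\left(dy\,\middle|\,\frac{c-t}{2},\frac{t-s-\sqrt{-x}}{2},\frac{t-s+\sqrt{-x}}{2}\right)&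 -(c-s)^2\le x<0,\\[2pt] \delta_{-(c-t)^2}(dy)& x<-(c-s)^2.\end{cases}$$ **Measure $\mathfrak p_0$** (for $c>0$, $a+c>0$): $$\mathfrak p_0(dx)=\frac{(a+c)(a+c+2)}{16\pi}\,\frac{\left|\Gamma\left(\frac{a+i\sqrt x}{2}\right)\Gamma\left(\frac{c+i\sqrt x}{2}\right)\right|^2}{2\sqrt x\,|\Gamma(i\sqrt x)|^2}1_{x>0}\,dx+\sum_{j\ge0:\,2j+a<0}p_j\,\delta_{-(2j+a)^2}(dx),$$ $$p_j=\frac{(a+c)(a+c+2)}{4}\cdot\frac{\Gamma\left(\frac{c-a}{2}\right)\Gamma\left(\frac{a+c}{2}\right)}{\Gamma(-a)}\cdot\frac{(a+2j)\,(a)_j\left(\frac{a+c}{2}\right)_j}{a\,j!\,\left(1+\frac{a-c}{2}\right)_j}$$ (the sum is empty if $a\ge 0$). Fact: for $a+c>0$, $c>0$, $\{\mathfrak p_s\}$ is an entrance law for $\mathbb{T}$: for $0<s<c$ with $s>-a$, $\int_{\mathbb{R}}\mathfrak p_{0,s}(x,dy)\,\mathfrak p_0(dx)=\frac{(a+c)(a+c+2)}{16\pi}\frac{|\Gamma(\frac{s+a+i\sqrt y}{2})\Gamma(\frac{c-s+i\sqrt y}{2})|^2}{2\sqrt y|\Gamma(i\sqrt y)|^2}1_{y>0}\,dy$. *)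

theory Defs
  imports "HOL-Probability.Probability"
begin

section \<open>Processes\<close>

text \<open>Equality of all finite dimensional distributions over the index set \<open>T\<close>; the two
  processes may live on different probability spaces.\<close>

definition fdd_eq ::
  "real set \<Rightarrow> 'a measure \<Rightarrow> (real \<Rightarrow> 'a \<Rightarrow> real) \<Rightarrow> 'b measure \<Rightarrow> (real \<Rightarrow> 'b \<Rightarrow> real) \<Rightarrow> bool" where
  "fdd_eq T M X N Z \<longleftrightarrow>
    (\<forall>J. finite J \<and> J \<subseteq> T \<longrightarrow>
      distr M (PiM J (\<lambda>_. borel)) (\<lambda>\<omega>. \<lambda>t\<in>J. X t \<omega>) =
      distr N (PiM J (\<lambda>_. borel)) (\<lambda>\<omega>. \<lambda>t\<in>J. Z t \<omega>))"

definition indep_processes ::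
  "'a measure \<Rightarrow> real set \<Rightarrow> (real \<Rightarrow> 'a \<Rightarrow> real) \<Rightarrow> real set \<Rightarrow> (real \<Rightarrow> 'a \<Rightarrow> real) \<Rightarrow> bool" where
  "indep_processes M S X T Z \<longleftrightarrow>
    prob_space.indep_var M
      (PiM S (\<lambda>_. borel)) (\<lambda>\<omega>. \<lambda>s\<in>S. X s \<omega>)
      (PiM T (\<lambda>_. borel)) (\<lambda>\<omega>. \<lambda>t\<in>T. Z t \<omega>)"

definition standard_brownian_motion :: "'a measure \<Rightarrow> (real \<Rightarrow> 'a \<Rightarrow> real) \<Rightarrow> bool" where
  "standard_brownian_motion M B \<longleftrightarrow>
    prob_space M \<and>
    (\<forall>t\<ge>0. B t \<in> borel_measurable M) \<and>
    (AE \<omega> in M. B 0 \<omega> = 0) \<and>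
    (\<forall>s t. 0 \<le> s \<and> s < t \<longrightarrow>
      distributed M lborel (\<lambda>\<omega>. B t \<omega> - B s \<omega>) (\<lambda>x. ennreal (normal_density 0 (sqrt (t - s)) x))) \<and>
    (\<forall>(n::nat) t. 0 \<le> t 0 \<and> (\<forall>k<n. t k < t (Suc k)) \<longrightarrow>
      prob_space.indep_vars M (\<lambda>_. borel) (\<lambda>k \<omega>. B (t (Suc k)) \<omega> - B (t k) \<omega>) {..<n}) \<and>
    (AE \<omega> in M. continuous_on {0..} (\<lambda>t. B t \<omega>))"

text \<open>For a Markov process \<open>X\<close> with transition probabilities \<open>P\<^sub>s\<^sub>,\<^sub>u(x, dy) = P s u x\<close> and times
  \<open>s < u\<^sub>1 < \<dots> < u\<^sub>n\<close>, \<open>markov_expect P s x [u\<^sub>1, \<dots>, u\<^sub>n] F\<close> is the conditional expectation of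
  \<open>F [X\<^bsub>u\<^sub>1\<^esub>, \<dots>, X\<^bsub>u\<^sub>n\<^esub>]\<close> given \<open>X\<^bsub>s\<^esub> = x\<close>.\<close>

fun markov_expect ::
  "(real \<Rightarrow> real \<Rightarrow> 'a \<Rightarrow> 'a measure) \<Rightarrow> real \<Rightarrow> 'a \<Rightarrow> real list \<Rightarrow> ('a list \<Rightarrow> ennreal) \<Rightarrow> ennreal" where
  "markov_expect P s x [] F = F []"
| "markov_expect P s x (u # us) F =
    (\<integral>\<^sup>+y. markov_expect P u y us (\<lambda>ys. F (y # ys)) \<partial>(P s u x))"


section \<open>The process \<open>Y\<close>\<close>

definition bessel_K :: "real \<Rightarrow> real \<Rightarrow> real" where  \<comment> \<open>\<open>bessel_K u x\<close> is \<open>K\<^bsub>iu\<^esub>(x)\<close>\<close>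
  "bessel_K u x = (LBINT w:{0<..}. exp (- x * cosh w) * cos (u * w))"

definition mu :: "real measure" where
  "mu = density lborel (\<lambda>u. indicator {0<..} u *
     ennreal (2 / pi * (1 / (cmod (Gamma (\<i> * complex_of_real u)))\<^sup>2)))"

definition p_kernel :: "real \<Rightarrow> real \<Rightarrow> real \<Rightarrow> real" where
  "p_kernel t x y = (\<integral>u. exp (- t * u\<^sup>2) * bessel_K u (exp x) * bessel_K u (exp y) \<partial>mu)"

definition C_norm :: "real \<Rightarrow> real \<Rightarrow> real \<Rightarrow> real" where
  "C_norm \<tau> a c = (\<integral>x. (\<integral>y. exp (a * x + c * y) * p_kernel \<tau> x y \<partial>lborel) \<partial>lborel)"

definition Y_process ::
  "real \<Rightarrow> real \<Rightarrow> real \<Rightarrow> 'a measure \<Rightarrow> (real \<Rightarrow> 'a \<Rightarrow> real) \<Rightarrow> bool" where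
  "Y_process \<tau> a c M Y \<longleftrightarrow>
    prob_space M \<and>
    (\<forall>(d::nat) t. t 0 = 0 \<and> (\<forall>k\<le>d. t k < t (Suc k)) \<and> t (Suc d) = \<tau> \<longrightarrow>
      distributed M (PiM {0..Suc d} (\<lambda>_. lborel))
        (\<lambda>\<omega>. \<lambda>k\<in>{0..Suc d}. Y (t k) \<omega>)
        (\<lambda>x. ennreal (1 / C_norm \<tau> a c * exp (c * x 0 + a * x (Suc d)) *
           (\<Prod>k=1..Suc d. p_kernel (t k - t (k - 1)) (x (k - 1)) (x k)))))"


section \<open>The continuous dual Hahn process\<close>

text \<open>The parameters \<open>\<beta>, \<gamma>\<close> are either both real or complex conjugates, so that the quantities
  under \<open>Re\<close> are real.\<close>

definition cdh_A :: "real \<Rightarrow> complex \<Rightarrow> complex \<Rightarrow> nat \<Rightarrow> real" where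
  "cdh_A \<alpha> \<beta> \<gamma> n = Re ((of_nat n + of_real \<alpha> + \<beta>) * (of_nat n + of_real \<alpha> + \<gamma>))"

definition cdh_C :: "complex \<Rightarrow> complex \<Rightarrow> nat \<Rightarrow> real" where
  "cdh_C \<beta> \<gamma> n = Re (of_nat n * (of_nat n - 1 + \<beta> + \<gamma>))"

fun cdh_poly :: "real \<Rightarrow> complex \<Rightarrow> complex \<Rightarrow> nat \<Rightarrow> real \<Rightarrow> real" where
  "cdh_poly \<alpha> \<beta> \<gamma> 0 x = 1"
| "cdh_poly \<alpha> \<beta> \<gamma> (Suc 0) x = x - (cdh_A \<alpha> \<beta> \<gamma> 0 + cdh_C \<beta> \<gamma> 0 - \<alpha>\<^sup>2)"
| "cdh_poly \<alpha> \<beta> \<gamma> (Suc (Suc n)) x =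
     (x - (cdh_A \<alpha> \<beta> \<gamma> (Suc n) + cdh_C \<beta> \<gamma> (Suc n) - \<alpha>\<^sup>2)) * cdh_poly \<alpha> \<beta> \<gamma> (Suc n) x
     - cdh_A \<alpha> \<beta> \<gamma> n * cdh_C \<beta> \<gamma> (Suc n) * cdh_poly \<alpha> \<beta> \<gamma> n x"

definition is_cdh_measure :: "real \<Rightarrow> complex \<Rightarrow> complex \<Rightarrow> real measure \<Rightarrow> bool" where
  "is_cdh_measure \<alpha> \<beta> \<gamma> R \<longleftrightarrow>
    (\<forall>n. (\<Prod>k\<le>n. cdh_A \<alpha> \<beta> \<gamma> k * cdh_C \<beta> \<gamma> (Suc k)) \<ge> 0) \<and>
    prob_space R \<and> sets R = sets borel \<and>
    (\<forall>m n. m \<noteq> n \<longrightarrow>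
      has_bochner_integral R (\<lambda>x. cdh_poly \<alpha> \<beta> \<gamma> n (x / 4) * cdh_poly \<alpha> \<beta> \<gamma> m (x / 4)) 0)"

definition cdh_measure :: "real \<Rightarrow> complex \<Rightarrow> complex \<Rightarrow> real measure" where
  "cdh_measure \<alpha> \<beta> \<gamma> = (THE R. is_cdh_measure \<alpha> \<beta> \<gamma> R)"

definition T_trans :: "real \<Rightarrow> real \<Rightarrow> real \<Rightarrow> real \<Rightarrow> real measure" where
  "T_trans c s t x =
    (if 0 \<le> x then
       cdh_measure ((c - t) / 2)
         ((of_real (t - s) - \<i> * of_real (sqrt x)) / 2) ((of_real (t - s) + \<i> * of_real (sqrt x)) / 2)
     else if - (c - s)\<^sup>2 \<le> x then
       cdh_measure ((c - t) / 2)
         (of_real ((t - s - sqrt (- x)) / 2)) (of_real ((t - s + sqrt (- x)) / 2))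
     else return borel (- (c - t)\<^sup>2))"


section \<open>The measure \<open>p\<^sub>0\<close>\<close>

definition p0_dens :: "real \<Rightarrow> real \<Rightarrow> real \<Rightarrow> real" where
  "p0_dens a c x =
    (a + c) * (a + c + 2) / (16 * pi) *
    ((cmod (Gamma ((of_real a + \<i> * of_real (sqrt x)) / 2) * Gamma ((of_real c + \<i> * of_real (sqrt x)) / 2)))\<^sup>2
      / (2 * sqrt x * (cmod (Gamma (\<i> * of_real (sqrt x))))\<^sup>2))"

definition p0_mass :: "real \<Rightarrow> real \<Rightarrow> nat \<Rightarrow> real" where
  "p0_mass a c j =
    (a + c) * (a + c + 2) / 4 *
    (Gamma ((c - a) / 2) * Gamma ((a + c) / 2) / Gamma (- a)) *
    ((a + 2 * real j) * pochhammer a j * pochhammer ((a + c) / 2) j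
      / (a * fact j * pochhammer (1 + (a - c) / 2) j))"

text \<open>For \<open>c > 0\<close> and \<open>a + c > 0\<close> all the masses in the (finite) sum are positive.\<close>

definition p0 :: "real \<Rightarrow> real \<Rightarrow> real measure" where
  "p0 a c = measure_of UNIV (sets borel) (\<lambda>E.
     emeasure (density lborel (\<lambda>x. ennreal (p0_dens a c x) * indicator {0<..} x)) E +
     (\<Sum>j | 2 * real j + a < 0. ennreal (p0_mass a c j) * emeasure (return borel (- (2 * real j + a)\<^sup>2)) E))"

lemma sets_p0 [simp, measurable_cong]: "sets (p0 a c) = sets borel"
  unfolding p0_def using sets.sigma_sets_eq[of "borel :: real measure"] by simp

lemma space_p0 [simp]: "space (p0 a c) = UNIV"
  unfolding p0_def by (simp add: space_measure_of_conv)

text \<open>The set function passed to \<open>measure_of\<close> is countably additive, hence not discarded.\<close>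

lemma emeasure_p0:
  assumes E: "E \<in> sets borel"
  shows "emeasure (p0 a c) E =
     emeasure (density lborel (\<lambda>x. ennreal (p0_dens a c x) * indicator {0<..} x)) E +
     (\<Sum>j | 2 * real j + a < 0. ennreal (p0_mass a c j) * emeasure (return borel (- (2 * real j + a)\<^sup>2)) E)"
proof (rule emeasure_measure_of[OF p0_def])
  let ?D = "density lborel (\<lambda>x. ennreal (p0_dens a c x) * indicator {0<..} x)"
  let ?R = "\<lambda>j. return borel (- (2 * real j + a)\<^sup>2)"
  show "countably_additive (sets (p0 a c))
     (\<lambda>E. emeasure ?D E + (\<Sum>j | 2 * real j + a < 0. ennreal (p0_mass a c j) * emeasure (?R j) E))"
  proof (rule countably_additiveI)
    fix F :: "nat \<Rightarrow> real set"
    assume F: "range F \<subseteq> sets (p0 a c)" "disjoint_family F"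
    have "(\<Sum>i. emeasure ?D (F i)) = emeasure ?D (\<Union>i. F i)"
      using F by (intro suminf_emeasure) auto
    moreover have "(\<Sum>i. emeasure (?R j) (F i)) = emeasure (?R j) (\<Union>i. F i)" for j
      using F by (intro suminf_emeasure) auto
    ultimately show "(\<Sum>i. emeasure ?D (F i) +
          (\<Sum>j | 2 * real j + a < 0. ennreal (p0_mass a c j) * emeasure (?R j) (F i))) =
        emeasure ?D (\<Union>i. F i) +
          (\<Sum>j | 2 * real j + a < 0. ennreal (p0_mass a c j) * emeasure (?R j) (\<Union>i. F i))"
      by (simp add: suminf_add[symmetric] suminf_sum summableI)
  qed
qed (use E in \<open>auto simp: positive_def\<close>)


section \<open>The stationary measure\<close>

text \<open>The formula for the Laplace transform of \<open>H\<close>, in which \<open>T\<close> runs through the times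
  \<open>0 = s\<^bsub>d+1\<^esub> < s\<^bsub>d\<^esub> < \<dots> < s\<^bsub>1\<^esub>\<close>. The list \<open>ys\<close> holds the values at \<open>s\<^bsub>d\<^esub>, \<dots>, s\<^bsub>1\<^esub>\<close>
  in this order, so that \<open>(x # ys) ! (Suc d - k)\<close> is the value at \<open>s\<^bsub>k\<^esub>\<close>. All integrands are
  positive, and the expectations are integrals with values in the extended nonnegative reals.\<close>

definition H_laplace :: "real \<Rightarrow> real \<Rightarrow> 'b measure \<Rightarrow> (real \<Rightarrow> 'b \<Rightarrow> real) \<Rightarrow> bool" where
  "H_laplace a c N H \<longleftrightarrow>
    (\<forall>(d::nat) t s. 1 \<le> d \<and>
       t 0 = 0 \<and> (\<forall>k<d. t k < t (Suc k)) \<and> t d \<le> t (Suc d) \<and> t (Suc d) = 1 \<and>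
       s 1 < min c 2 \<and> (\<forall>k\<in>{1..d}. s k > s (Suc k)) \<and> s (Suc d) = 0 \<longrightarrow>
      (\<integral>\<^sup>+\<omega>. ennreal (exp (- (\<Sum>k=1..d. (s k - s (Suc k)) * H (t k) \<omega>))) \<partial>N) =
      ennreal (exp (1 / 4 * (\<Sum>k=1..Suc d. (t k - t (k - 1)) * (s k)\<^sup>2))) *
      ((\<integral>\<^sup>+x. markov_expect (T_trans c) 0 x (map s (rev [1..<Suc d]))
          (\<lambda>ys. ennreal (exp (- 1 / 4 *
             (\<Sum>k=1..Suc d. (t k - t (k - 1)) * (x # ys) ! (Suc d - k))))) \<partial>(p0 a c))
       / (\<integral>\<^sup>+x. ennreal (exp (- x / 4)) \<partial>(p0 a c))))"

text \<open>The Corwin--Knizel law \<open>H\<^bsup>(a,c)\<^esup>\<close>, for \<open>a + c > 0\<close> and \<open>min a c > - 2\<close>. The process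
  \<open>H(1 - t) - H(1)\<close> has the law \<open>H\<^bsup>(c,a)\<^esup>\<close>; hence it too satisfies the Laplace transform formula,
  with \<open>a\<close> and \<open>c\<close> interchanged, provided that \<open>a > 0\<close>. If \<open>c \<le> 0\<close>, then \<open>a > 0\<close>, and
  this is what determines the law.\<close>

definition corwin_knizel :: "real \<Rightarrow> real \<Rightarrow> 'b measure \<Rightarrow> (real \<Rightarrow> 'b \<Rightarrow> real) \<Rightarrow> bool" where
  "corwin_knizel a c N H \<longleftrightarrow>
    prob_space N \<and>
    (\<forall>t\<in>{0..1}. H t \<in> borel_measurable N) \<and>
    (AE \<omega> in N. H 0 \<omega> = 0) \<and>
    (c > 0 \<longrightarrow> H_laplace a c N H) \<and>
    (a > 0 \<longrightarrow> H_laplace c a N (\<lambda>t \<omega>. H (1 - t) \<omega> - H 1 \<omega>))"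

end

theory Submission
 imports Defs "HOL-Complex_Analysis.Complex_Analysis" "HOL-Real_Asymp.Real_Asymp"
begin

text \<open>Both sides have the same Laplace transform of their increments, and a finite measure is determined
 by its Laplace transform on an open box. On the side of \<open>Y\<close> the Brownian part gives the Gaussian factor
 and the rest is an iterated integral of \<open>exp (d\<^sub>k x\<^sub>k)\<close> against the kernels \<open>p_kernel\<close>. These are diagonal
 in the Macdonald functions \<open>K\<^sub>i\<^sub>u(e\<^sup>x)\<close>, and the matrix of multiplication by \<open>exp (d x)\<close> in that
 basis is the Mellin transform of a product of two Macdonald functions, a quotient of Gamma functions that
 is, up to normalisation, the transition kernel of the dual Hahn process in the variable \<open>x = u\<^sup>2\<close>;
 the end points \<open>exp (c x)\<close>, \<open>exp (a x)\<close> produce the initial measure in the same way. Parseval then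
 identifies the two chains of integrals, and the constants agree by total mass. For \<open>a < 0\<close> a
 multiple of \<open>K\<^sub>a\<close> is subtracted from \<open>exp (a x)\<close>, which accounts for the atoms. Positivity of
 \<open>p_kernel\<close> comes from a minimum principle for the resolvent of \<open>d\<^sup>2/dx\<^sup>2 - e\<^sup>2\<^sup>x\<close>, and the
 orthogonality measures are identified through their Stieltjes moments. The case \<open>c \<le> 0\<close> is time reversal.\<close>

text \<open>The spectral weight \<open>ww v\<close> grows like \<open>exp (pi * abs v)\<close>, so
  every exchange of integrals needs decay in the index. Rotating the contour supplies it:
  \<open>hR\<close> and \<open>kt g\<close> decay at rate \<open>th0\<close> and \<open>Mm\<close>
  at rate \<open>2 * th0\<close>, and the total exceeds pi exactly when \<open>th0 > pi / 3\<close>.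

  Inversion of the index transform is proved for \<open>exp (x - s * exp x)\<close> with s > 1, from
  ordinary Fourier inversion; mixtures of these functions, halving of \<open>de\<close> and analytic
  continuation supply the rest.

  \<open>cdh_measure\<close> is a definite description. A competing measure is given by
  orthogonality alone and might charge the negative half-line, whereas the moment theorem speaks of
  measures on a half-line. Its support is therefore bounded below first, by means of the recurrence.

  The condition a > -2 leaves at most one atom in \<open>p0\<close>, and it is also what makes a
  single subtracted Macdonald function enough. The atom and the subtraction belong together: both
  carry the constant \<open>kap a\<close>.\<close>

abbreviation L1 :: "('a::euclidean_space => 'b::{banach, second_countable_topology}) => bool" where
 "L1 \<equiv> integrable lborel"

abbreviation nn_integral_lborel :: "('a::euclidean_space => ennreal) => ennreal" (binder "NN " 10) where
 "nn_integral_lborel \<equiv> nn_integral lborel"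

abbreviation cx :: "real => complex" where
 "cx \<equiv> of_real"

abbreviation lborel2 :: "('a::euclidean_space \<times> 'b::euclidean_space) measure" where
 "lborel2 \<equiv> lborel \<Otimes>\<^sub>M lborel"

abbreviation iu :: "real => complex" where
 "iu u \<equiv> \<i> * cx u"

lemmas lintegrable_add = Bochner_Integration.integrable_add
 and lintegrable_bound = Bochner_Integration.integrable_bound
 and lintegrable_diff = Bochner_Integration.integrable_diff
 and lintegrable_sum = Bochner_Integration.integrable_sum
 and lintegral_add = Bochner_Integration.integral_add
 and lintegral_cong = Bochner_Integration.integral_cong
 and lintegral_diff = Bochner_Integration.integral_diff
 and lintegral_nonneg = Bochner_Integration.integral_nonneg
 and lintegral_sum = Bochner_Integration.integral_sum

lemma borel_measurable_cosh [measurable (raw)]: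
 "f \<in> borel_measurable M ==> (%x. cosh (f x) :: real) \<in> borel_measurable M"
 by (rule borel_measurable_continuous_on[of cosh]) (auto intro!: continuous_intros)

lemma borel_measurable_sinh [measurable (raw)]:
 "f \<in> borel_measurable M ==> (%x. sinh (f x) :: real) \<in> borel_measurable M"
 by (rule borel_measurable_continuous_on[of sinh]) (auto intro!: continuous_intros)

section \<open>Integrals depending holomorphically on a parameter\<close>

text \<open>Only the integrand itself is dominated, locally uniformly. Cauchy's estimate on a
  smaller disc turns this into a bound for the derivative, which in turn dominates the difference
  quotients.\<close>

lemma has_field_derivative_integral_parameter:
 fixes F :: "'a => complex => complex"
 assumes S: "open S"
  and meas: "!!z. z \<in> S ==> (%w. F w z) \<in> borel_measurable M"
  and hol: "!!w. F w holomorphic_on S"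
  and dom: "!!z. z \<in> S ==> \<exists>r>0. \<exists>g. cball z r \<subseteq> S & integrable M g &
         (\<forall>w. \<forall>ze\<in>cball z r. norm (F w ze) <= g w)"
  and z: "z \<in> S"
 shows "((%z. \<integral>w. F w z \<partial>M) has_field_derivative (\<integral>w. deriv (F w) z \<partial>M)) (at z)"
  and "(%w. deriv (F w) z) \<in> borel_measurable M"
proof -
 let ?A = "%z M. \<integral>w. deriv (F w) z \<partial>M"
 from dom[OF z] obtain r g where r: "r > 0" "cball z r \<subseteq> S" and g: "integrable M g"
  and Fg: "!!w ze. ze \<in> cball z r ==> norm (F w ze) <= g w" by blast
 have int: "integrable M (%w. F w y)" if "y \<in> cball z r" for y
 proof (rule lintegrable_bound[OF g])
  show "(%w. F w y) \<in> borel_measurable M" using meas that r by blast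
  show "AE w in M. norm (F w y) <= norm (g w)" using Fg[OF that] by (intro AE_I2) (metis abs_ge_self order_trans real_norm_def)
 qed
 have diff: "(F w has_field_derivative deriv (F w) ze) (at ze)" if "ze \<in> S" for w ze using hol[of w] S that by (simp add: holomorphic_derivI)
 have db: "norm (deriv (F w) ze) <= 2 * g w / r" if "ze \<in> ball z (r/2)" for w ze
 proof -
  have sub: "cball ze (r/2) \<subseteq> cball z r"
  proof
   fix x assume "x \<in> cball ze (r/2)"
   then show "x \<in> cball z r" using that dist_triangle[of z x ze] by simp
  qed
  have "norm ((deriv ^^ 1) (F w) ze) <= fact 1 * g w / (r/2) ^ 1"
  proof (rule Cauchy_inequality)
   show "F w holomorphic_on ball ze (r/2)" using hol[of w] sub r(2) ball_subset_cball holomorphic_on_subset by (metis subset_trans)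
   show "continuous_on (cball ze (r/2)) (F w)" using hol[of w] sub r(2) by (meson holomorphic_on_imp_continuous_on holomorphic_on_subset subset_trans)
   show "0 < r/2" using r by simp
   fix x assume "norm (ze - x) = r/2"
   then have "x \<in> cball ze (r/2)" by (simp add: dist_norm)
   with sub show "norm (F w x) <= g w" using Fg by blast
  qed
  then show ?thesis by (simp add: field_simps)
 qed
 have lip: "norm ((F w y - F w z) / (y - z)) <= 2 * g w / r" if "y \<in> ball z (r/2)" "y ~= z" for w y
 proof -
  have "norm (F w y - F w z) <= 2 * g w / r * norm (y - z)"
  proof (rule field_differentiable_bound[where S = "ball z (r/2)"])
   fix x assume x: "x \<in> ball z (r/2)"
   then have "x \<in> S" using r by (auto simp: subset_iff)
   then show "(F w has_field_derivative deriv (F w) x) (at x within ball z (r/2))" using diff has_field_derivative_at_within by blast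
   show "norm (deriv (F w) x) <= 2 * g w / r" using db[OF x] .
  qed (use that r in auto)
  then show ?thesis using that by (simp add: norm_divide field_simps)
 qed
 have quot: "(%i. (F w (X i) - F w z) / (X i - z)) \<longlonglongrightarrow> deriv (F w) z"
  if "!!i. X i ~= z" "X \<longlonglongrightarrow> z" for w and X :: "nat => complex"
 proof -
  have "((%y. (F w y - F w z) / (y - z)) \<longlongrightarrow> deriv (F w) z) (at z)" using diff[OF z] by (simp add: has_field_derivative_iff)
  then show ?thesis unfolding tendsto_at_iff_sequentially using that by (auto simp: comp_def)
 qed
 \<comment> \<open>The derivative is the pointwise limit of measurable quotients along one fixed
   sequence; the denominator \<open>2 + real i\<close> keeps each of its points in the disc and off
   the centre.\<close>
 show m: "(%w. deriv (F w) z) \<in> borel_measurable M"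
 proof (rule borel_measurable_LIMSEQ_metric)
  define X where "X i = z + cx (r / (2 + real i))" for i :: nat
  have Xz: "X i ~= z" and Xr: "X i \<in> cball z r" for i
  proof -
   have q: "0 < r / (2 + real i)" "r / (2 + real i) < r" using r divide_strict_left_mono[of 1 "2 + real i" r] by auto
   show "X i ~= z" using q by (simp add: X_def del: of_real_divide)
   show "X i \<in> cball z r" using q by (simp add: X_def dist_norm del: of_real_divide)
  qed
  have "(%i. r / (2 + real i)) \<longlonglongrightarrow> 0" by real_asymp
  then have "(%i. z + cx (r / (2 + real i))) \<longlonglongrightarrow> z + cx 0" by (intro tendsto_intros)
  then have Xl: "X \<longlonglongrightarrow> z" by (simp add: X_def[abs_def])
  show "(%w. (F w (X i) - F w z) / (X i - z)) \<in> borel_measurable M" for i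
   using meas[OF z] meas[of "X i"] Xr[of i] r(2) by (intro borel_measurable_divide borel_measurable_diff) auto
  show "(%i. (F w (X i) - F w z) / (X i - z)) \<longlonglongrightarrow> deriv (F w) z" for w using Xz Xl by (rule quot)
 qed
 show "((%z. \<integral>w. F w z \<partial>M) has_field_derivative (?A z M)) (at z)"
  unfolding has_field_derivative_iff tendsto_at_iff_sequentially comp_def
 proof (intro allI impI)
  fix X :: "nat => complex"
  assume X: "\<forall>i. X i \<in> UNIV - {z}" "X \<longlonglongrightarrow> z"
  have "\<forall>\<^sub>F i in sequentially. X i \<in> ball z (r/2)" using X(2) r by (intro topological_tendstoD) auto
  then obtain k where k: "!!i. i >= k ==> X i \<in> ball z (r/2)" by (auto simp: eventually_sequentially)
  have kr: "X (i + k) \<in> cball z r" for i using k[of "i + k"] r by (auto simp: dist_norm)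
  have "(%i. \<integral>w. (F w (X (i + k)) - F w z) / (X (i + k) - z) \<partial>M) \<longlonglongrightarrow> (?A z M)"
  proof (rule integral_dominated_convergence[where w = "%w. 2 * g w / r"])
   show "AE w in M. (%i. (F w (X (i + k)) - F w z) / (X (i + k) - z)) \<longlonglongrightarrow> deriv (F w) z"
    using X by (intro AE_I2 quot) (auto intro: LIMSEQ_ignore_initial_segment)
   show "AE w in M. norm ((F w (X (i + k)) - F w z) / (X (i + k) - z)) <= 2 * g w / r" for i using X(1) k[of "i + k"] by (intro AE_I2 lip) auto
   show "(%w. (F w (X (i + k)) - F w z) / (X (i + k) - z)) \<in> borel_measurable M" for i using meas[OF z] meas[of "X (i + k)"] kr[of i] r(2)
    by (intro borel_measurable_divide borel_measurable_diff) auto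
  qed (use g m in auto)
  moreover have "(\<integral>w. (F w (X (i + k)) - F w z) / (X (i + k) - z) \<partial>M) =
    ((\<integral>w. F w (X (i + k)) \<partial>M) - (\<integral>w. F w z \<partial>M)) / (X (i + k) - z)" for i using int[OF kr] int[of z] r by simp
  ultimately have "(%i. ((\<integral>w. F w (X (i + k)) \<partial>M) - (\<integral>w. F w z \<partial>M)) / (X (i + k) - z)) \<longlonglongrightarrow> (?A z M)"
   by (simp only:)
  then show "(%i. ((\<integral>w. F w (X i) \<partial>M) - (\<integral>w. F w z \<partial>M)) / (X i - z)) \<longlonglongrightarrow> (?A z M)"
   by (rule LIMSEQ_offset)
 qed
qed

lemma holomorphic_on_integral_parameter:
 fixes F :: "'a => complex => complex"
 assumes S: "open S"
  and meas: "!!z. z \<in> S ==> (%w. F w z) \<in> borel_measurable M"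
  and hol: "!!w. F w holomorphic_on S"
  and dom: "!!z. z \<in> S ==> \<exists>r>0. \<exists>g. cball z r \<subseteq> S & integrable M g &
         (\<forall>w. \<forall>ze\<in>cball z r. norm (F w ze) <= g w)"
 shows "(%z. \<integral>w. F w z \<partial>M) holomorphic_on S" unfolding holomorphic_on_def field_differentiable_def
 using has_field_derivative_integral_parameter(1)[OF assms] has_field_derivative_at_within by blast

text \<open>The midpoint of the segment is a limit point of it, so the identity theorem applies. The
  direction \<open>d\<close> is \<open>1\<close> when real parameters are the accessible ones and
  \<open>\<i>\<close> when imaginary ones are.\<close>

lemma holomorphic_equal_on_line:
 assumes "open S" "connected S" "f holomorphic_on S" "g holomorphic_on S"
  and eq: "!!t. l < t ==> t < r ==> f (sg + cx t * d) = g (sg + cx t * d)"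
  and sub: "!!t. l < t ==> t < r ==> sg + cx t * d \<in> S"
  and "l < r" "d ~= 0" "z \<in> S"
 shows "f z = g z"
proof -
 define U where "U = (%t. sg + cx t * d) ` {l<..<r}"
 define m where "m = (l + r) / 2"
 have m: "l < m" "m < r" using \<open>l < r\<close> by (auto simp: m_def)
 have lim: "(sg + cx m * d) islimpt U" unfolding islimpt_sequential
 proof (intro exI conjI allI)
  define X where "X i = sg + cx (m + (r - m) / (2 + real i)) * d" for i :: nat
  show "X i \<in> U - {sg + cx m * d}" for i
  proof -
   have q: "0 < (r - m) / (2 + real i)" "(r - m) / (2 + real i) < r - m" using m divide_strict_left_mono[of 1 "2 + real i" "r - m"] by auto
   have "l < m + (r - m) / (2 + real i)" "m + (r - m) / (2 + real i) < r" using q m by linarith+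
   moreover have "(r - m) / (2 + real i) ~= 0" using m by auto
   ultimately show ?thesis using \<open>d ~= 0\<close> unfolding U_def X_def by (auto simp del: of_real_add of_real_divide)
  qed
  have "(%i. m + (r - m) / (2 + real i)) \<longlonglongrightarrow> m" by real_asymp
  then show "X \<longlonglongrightarrow> sg + cx m * d" unfolding X_def by (intro tendsto_intros)
 qed
 have "(%z. f z - g z) z = 0"
 proof (rule analytic_continuation[of "%z. f z - g z" S U "sg + cx m * d"])
  show "(%z. f z - g z) holomorphic_on S" using assms by (intro holomorphic_intros)
  show "U \<subseteq> S" using sub by (auto simp: U_def)
  show "sg + cx m * d \<in> S" using sub m by auto
  fix z assume "z \<in> U" then show "f z - g z = 0" using eq by (auto simp: U_def)
 qed (use assms lim in auto)
 then show ?thesis by simp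
qed

section \<open>Uniqueness theorems for Laplace transforms and moments\<close>

text \<open>On a small disc \<open>exp (Re z * X)\<close> lies below the sum of its values at the
  two extreme real parts, whatever the sign of \<open>X\<close>. Integrability at real parameters
  therefore gives the local domination.\<close>

lemma holomorphic_on_laplace:
 fixes f :: "'a => complex" and X :: "'a => real"
 assumes [measurable]: "f \<in> borel_measurable M" "X \<in> borel_measurable M"
  and int: "!!s. l < s ==> s < r ==> integrable M (%w. exp (s * X w) * norm (f w))"
 shows "(%z. \<integral>w. exp (z * cx (X w)) * f w \<partial>M) holomorphic_on {z. l < Re z & Re z < r}"
proof (rule holomorphic_on_integral_parameter)
 show "open {z. l < Re z & Re z < r}" by (intro open_Collect_conj open_Collect_less continuous_intros)
 fix z assume "z \<in> {z. l < Re z & Re z < r}"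
 then have z: "l < Re z" "Re z < r" by auto
 define rh where "rh = min (Re z - l) (r - Re z) / 2"
 have rh: "rh > 0" "l < Re z - rh" "Re z + rh < r" using z by (auto simp: rh_def min_def field_simps)
 define g where "g w = exp ((Re z - rh) * X w) * norm (f w) + exp ((Re z + rh) * X w) * norm (f w)" for w
 have cb: "Re z - rh <= Re ze & Re ze <= Re z + rh" if "ze \<in> cball z rh" for ze using that abs_Re_le_cmod[of "z - ze"] by (auto simp: dist_norm)
 have "cball z rh \<subseteq> {z. l < Re z & Re z < r}" using cb rh by force
 moreover have "integrable M g" unfolding g_def using int rh z by (intro lintegrable_add int) auto
 moreover have "norm (exp (ze * cx (X w)) * f w) <= g w" if "ze \<in> cball z rh" for ze w
 proof -
  have "Re ze * X w <= (Re z - rh) * X w \<or> Re ze * X w <= (Re z + rh) * X w"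
   using cb[OF that] by (cases "X w >= 0") (auto intro: mult_right_mono mult_right_mono_neg)
  then have "exp (Re ze * X w) <= exp ((Re z - rh) * X w) + exp ((Re z + rh) * X w)"
  proof
   assume "Re ze * X w <= (Re z - rh) * X w"
   then have "exp (Re ze * X w) <= exp ((Re z - rh) * X w)" by (simp only: exp_le_cancel_iff)
   then show ?thesis using exp_gt_zero[of "(Re z + rh) * X w"] by linarith
  next
   assume "Re ze * X w <= (Re z + rh) * X w"
   then have "exp (Re ze * X w) <= exp ((Re z + rh) * X w)" by (simp only: exp_le_cancel_iff)
   then show ?thesis using exp_gt_zero[of "(Re z - rh) * X w"] by linarith
  qed
  then have "exp (Re ze * X w) * norm (f w) <= g w" unfolding g_def by (metis distrib_right mult_right_mono norm_ge_zero)
  then show ?thesis by (simp add: norm_mult)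
 qed
 ultimately show "\<exists>rh>0. \<exists>g. cball z rh \<subseteq> {z. l < Re z & Re z < r} & integrable M g &
   (\<forall>w. \<forall>ze\<in>cball z rh. norm (exp (ze * cx (X w)) * f w) <= g w)" using rh(1) by blast
qed (auto intro!: holomorphic_intros)

lemma open_strip: "open {z. l < Re z & Re z < r}" by (intro open_Collect_conj open_Collect_less continuous_intros)

lemma connected_strip: "connected {z. l < Re z & Re z < r}"
proof -
 have "{z. l < Re z & Re z < r} = {z. l < Re z} \<inter> {z. Re z < r}" by auto
 then show ?thesis using convex_halfspace_Re_gt[of l] convex_halfspace_Re_lt[of r] by (simp add: convex_Int convex_connected)
qed

text \<open>The transforms continue analytically to a strip. On the vertical line through
  \<open>sg\<close> they are, up to the mass \<open>m\<close>, the characteristic functions of the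
  measures tilted by \<open>exp (sg * x)\<close>; Levy's theorem identifies these and the tilt is
  undone.\<close>

lemma laplace_unique:
 fixes M1 M2 :: "real measure"
 assumes sets1: "sets M1 = sets borel" and sets2: "sets M2 = sets borel"
  and lr: "l < r"
  and eq: "!!s. l < s ==> s < r ==> (\<integral>\<^sup>+x. ennreal (exp (s * x)) \<partial>M1) = (\<integral>\<^sup>+x. ennreal (exp (s * x)) \<partial>M2)"
  and fin: "!!s. l < s ==> s < r ==> (\<integral>\<^sup>+x. ennreal (exp (s * x)) \<partial>M1) < \<infinity>"
 shows "M1 = M2"
proof -
 let ?A = "%m sg. %x. ennreal (m * exp (- sg * x))"
 let ?B = "%t K. enn2real (\<integral>\<^sup>+x. ennreal (exp (t * x)) \<partial>K)"
 let ?C = "%sg. \<integral>\<^sup>+x. ennreal (exp (sg * x)) \<partial>M1"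
 define sg where "sg = (l + r) / 2"
 have sg: "l < sg" "sg < r" using lr by (auto simp: sg_def)
 define m where "m = enn2real (?C sg)"
 have m: "(?C sg) = ennreal m" "(\<integral>\<^sup>+x. ennreal (exp (sg * x)) \<partial>M2) = ennreal m"
  using fin[OF sg] eq[OF sg] by (auto simp: m_def ennreal_enn2real_if)
 have m0: "m >= 0" by (simp add: m_def)
 note [measurable_cong] = sets1 sets2
 have sp: "space M1 = UNIV" "space M2 = UNIV" using sets_eq_imp_space_eq[OF sets1] sets_eq_imp_space_eq[OF sets2] by auto
 show ?thesis
 proof (cases "m = 0")
  \<comment> \<open>The tilted measure cannot be normalised here, but a strictly positive function
    has integral zero only under the null measure.\<close>
  case True
  have "emeasure K A = 0" if "sets K = sets borel" "(\<integral>\<^sup>+x. ennreal (exp (sg * x)) \<partial>K) = 0" for K :: "real measure" and A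
  proof -
   note [measurable_cong] = that(1)
   have "AE x in K. ennreal (exp (sg * x)) = 0" using that(2) by (subst (asm) nn_integral_0_iff_AE) auto
   then have "AE x in K. False" by eventually_elim simp
   then have "emeasure K (space K) = 0" using AE_iff_measurable[of "space K" K "%_. False"] by auto
   then show ?thesis using emeasure_space[of K A] by simp
  qed
  then show ?thesis using m True sets1 sets2 by (intro measure_eqI) auto
 next
  case False
  then have mp: "m > 0" using m0 by simp
  define T where "T K = density K (%x::real. ennreal (exp (sg * x) / m))" for K :: "real measure"
  have int: "integrable K (%x. exp (s * x) * norm (1::complex))"
   if "K = M1 \<or> K = M2" "l < s" "s < r" for K s using that fin[of s] eq[of s] by (intro integrableI_nonneg) auto
  have hol: "(%z. \<integral>x. exp (z * cx x) * 1 \<partial>K) holomorphic_on {z. l < Re z & Re z < r}"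
   if "K = M1 \<or> K = M2" for K :: "real measure" using that by (intro holomorphic_on_laplace int[OF that]) auto
  have eqc: "(\<integral>x. exp (z * cx x) * 1 \<partial>M1) = (\<integral>x. exp (z * cx x) * 1 \<partial>M2)"
   if "l < Re z" "Re z < r" for z :: complex
  proof -
   define Ph where "Ph K z = (\<integral>x. exp (z * cx x) * (1::complex) \<partial>K)" for K :: "real measure" and z
   have "Ph M1 (cx t) = Ph M2 (cx t)" if t: "l < t" "t < r" for t
   proof -
    have "Ph K (cx t) = cx (?B t K)"
     if "K = M1 \<or> K = M2" for K :: "real measure"
    proof -
     have "Ph K (cx t) = (\<integral>x. cx (exp (t * x)) \<partial>K)" unfolding Ph_def by (intro lintegral_cong) (auto simp flip: exp_of_real)
     also have "... = cx (?B t K)"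
      using that by (subst integral_complex_of_real, subst integral_eq_nn_integral) auto
     finally show ?thesis .
    qed
    then show ?thesis using eq[OF t] by simp
   qed
   moreover have "Ph M1 holomorphic_on {z. l < Re z & Re z < r}" "Ph M2 holomorphic_on {z. l < Re z & Re z < r}" using hol unfolding Ph_def by auto
   ultimately have "Ph M1 z = Ph M2 z" using holomorphic_equal_on_line[OF open_strip connected_strip, of "Ph M1" l r "Ph M2" l r 0 1 z] lr that
    by auto
   then show ?thesis by (simp add: Ph_def)
  qed
  have prob: "prob_space (T K)" if "K = M1 \<or> K = M2" for K
  proof
   have [measurable_cong]: "sets K = sets borel" using that sets1 sets2 by auto
   have "emeasure (T K) (space (T K)) = (\<integral>\<^sup>+x. ennreal (exp (sg * x) / m) \<partial>K)"
    unfolding T_def by (subst emeasure_density) (auto intro!: nn_integral_cong)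
   also have "... = (\<integral>\<^sup>+x. ennreal (1 / m) * ennreal (exp (sg * x)) \<partial>K)"
    using mp by (intro nn_integral_cong) (simp flip: ennreal_mult)
   also have "... = ennreal (1 / m) * ennreal m" using that m by (subst nn_integral_cmult) auto
   also have "... = 1" using mp by (simp flip: ennreal_mult)
   finally show "emeasure (T K) (space (T K)) = 1" .
  qed
  have rd: "real_distribution (T K)" if "K = M1 \<or> K = M2" for K unfolding real_distribution_def real_distribution_axioms_def
   using prob[OF that] that sp by (auto simp: T_def sets1 sets2)
  have ch: "char (T K) t = (\<integral>x. exp ((cx sg + iu t) * cx x) * 1 \<partial>K) / cx m"
   if "K = M1 \<or> K = M2" for K t
  proof -
   have [measurable_cong]: "sets K = sets borel" using that sets1 sets2 by auto
   have "char (T K) t = (\<integral>x. (exp (sg * x) / m) *\<^sub>R iexp (t * x) \<partial>K)"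
    unfolding char_def T_def using mp by (subst integral_density) auto
   also have "... = (\<integral>x. (exp ((cx sg + iu t) * cx x) * 1) / cx m \<partial>K)" by (intro lintegral_cong refl)
     (simp add: scaleR_conv_of_real exp_add distrib_right mult.assoc flip: exp_of_real)
   finally show ?thesis by simp
  qed
  have "char (T M1) = char (T M2)" using eqc sg by (intro ext) (simp add: ch)
  then have TT: "T M1 = T M2" using rd by (intro Levy_uniqueness) auto
  have untilt: "density (T K) (?A m sg) = K" if "K = M1 \<or> K = M2" for K
  proof -
   have [measurable_cong]: "sets K = sets borel" using that sets1 sets2 by auto
   have "density (T K) (?A m sg) = density K (%x. ennreal (exp (sg * x) / m) * ennreal (m * exp (- sg * x)))"
    unfolding T_def by (subst density_density_eq) auto
   also have "... = density K (%x. 1)" using mp by (intro density_cong) (auto simp: ennreal_mult[symmetric] exp_minus field_simps)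
   finally show ?thesis by (simp add: density_1)
  qed
  have "M1 = density (T M1) (?A m sg)" by (rule untilt[symmetric]) simp
  also have "... = density (T M2) (?A m sg)" by (simp only: TT)
  also have "... = M2" by (rule untilt) simp
  finally show ?thesis .
 qed
qed

text \<open>The coordinates are localised one at a time: in \<open>key\<close> the exponential
  weights are accompanied by indicators of the coordinates in \<open>J\<close>. With all other
  coordinates frozen, the dependence on one exponent is a one-dimensional Laplace transform, so
  \<open>laplace_unique\<close> allows one more indicator to be inserted.\<close>

lemma laplace_unique_vec:
 fixes X :: "'i => 'a => real" and Z :: "'i => 'b => real"
 assumes I: "finite I"
  and X [measurable]: "!!i. i \<in> I ==> X i \<in> borel_measurable M"
  and Z [measurable]: "!!i. i \<in> I ==> Z i \<in> borel_measurable N"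
  and lr: "!!i. i \<in> I ==> l i < r i"
  and eq: "!!s. (!!i. i \<in> I ==> l i < s i & s i < r i) ==>
    (\<integral>\<^sup>+om. ennreal (exp (\<Sum>i\<in>I. s i * X i om)) \<partial>M) = (\<integral>\<^sup>+om. ennreal (exp (\<Sum>i\<in>I. s i * Z i om)) \<partial>N)"
  and fin: "!!s. (!!i. i \<in> I ==> l i < s i & s i < r i) ==>
    (\<integral>\<^sup>+om. ennreal (exp (\<Sum>i\<in>I. s i * X i om)) \<partial>M) < \<infinity>"
 shows "distr M (PiM I (%_. borel)) (%om. \<lambda>i\<in>I. X i om) = distr N (PiM I (%_. borel)) (%om. \<lambda>i\<in>I. Z i om)"
proof -
 let ?A = "PiM I (%_. borel)"
 let ?B = "%V. %om. \<lambda>i\<in>I. V i om"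
 let ?C = "%s om. exp (\<Sum>i\<in>I. s i * X i om)"
 let ?F = "%s V. %om. ennreal (exp (\<Sum>i\<in>I. s i * V i om))"
 let ?G = "%s. %x. ennreal (exp (- (\<Sum>i\<in>I. s i * x i)))"
 let ?H = "%V om. \<lambda>i\<in>I. V i om"
 have mprod: "(%om. (\<Prod>i\<in>J. indicator (A i) (V i om)) * ennreal (exp (\<Sum>i\<in>K. s i * V i om))) \<in> borel_measurable L"
  if [measurable]: "!!i. i \<in> I ==> V i \<in> borel_measurable L" "!!i. i \<in> I ==> A i \<in> sets borel" and "J \<subseteq> I" "K \<subseteq> I"
  for V :: "'i => 'c => real" and L J K A s
 proof -
  have [measurable]: "V i \<in> borel_measurable L" "A i \<in> sets borel" if "i \<in> J" for i using that \<open>J \<subseteq> I\<close> by auto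
  have [measurable]: "V i \<in> borel_measurable L" if "i \<in> K" for i using that \<open>K \<subseteq> I\<close> by auto
  show ?thesis by measurable
 qed
 have key: "(\<integral>\<^sup>+om. (\<Prod>i\<in>J. indicator (A i) (X i om)) * ennreal (?C s om) \<partial>M) =
   (\<integral>\<^sup>+om. (\<Prod>i\<in>J. indicator (A i) (Z i om)) * ennreal (exp (\<Sum>i\<in>I. s i * Z i om)) \<partial>N)"
  if "finite J" "J \<subseteq> I" and "!!i. i \<in> I ==> A i \<in> sets borel" and "!!i. i \<in> I ==> l i < s i & s i < r i" for J A s using that
 proof (induction J arbitrary: s rule: finite_induct)
  case empty
  then show ?case using eq by simp
 next
  case (insert j J)
  have jI: "j \<in> I" and JI: "J \<subseteq> I" and jJ: "j \<notin> J" using insert by auto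
  define K where "K = I - {j}"
  have K: "I = insert j K" "finite K" "j \<notin> K" "K \<subseteq> I" using jI I by (auto simp: K_def)
  have A: "A i \<in> sets borel" if "i \<in> I" for i using insert.prems that by auto
  have [measurable]: "A j \<in> sets borel" using A jI .
  \<comment> \<open>The weight collects every factor that does not involve coordinate
    \<open>j\<close>, so the image of \<open>density M gX\<close> under \<open>X j\<close> has the
    transform known from the induction hypothesis.\<close>
  define gX where "gX om = (\<Prod>i\<in>J. indicator (A i) (X i om)) * ennreal (exp (\<Sum>i\<in>K. s i * X i om))" for om
  define gZ where "gZ om = (\<Prod>i\<in>J. indicator (A i) (Z i om)) * ennreal (exp (\<Sum>i\<in>K. s i * Z i om))" for om
  have [measurable]: "gX \<in> borel_measurable M" "gZ \<in> borel_measurable N" unfolding gX_def gZ_def using JI K(4) A X Z by (auto intro!: mprod)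
  have [measurable]: "X j \<in> borel_measurable M" "Z j \<in> borel_measurable N" using X Z jI by auto
  define MX where "MX = distr (density M gX) borel (X j)"
  define MZ where "MZ = distr (density N gZ) borel (Z j)"
  have lapX: "(\<integral>\<^sup>+x. f x \<partial>MX) = (\<integral>\<^sup>+om. gX om * f (X j om) \<partial>M)" if [measurable]: "f \<in> borel_measurable borel" for f
   unfolding MX_def by (subst nn_integral_distr) (auto simp: nn_integral_density)
  have lapZ: "(\<integral>\<^sup>+x. f x \<partial>MZ) = (\<integral>\<^sup>+om. gZ om * f (Z j om) \<partial>N)" if [measurable]: "f \<in> borel_measurable borel" for f
   unfolding MZ_def by (subst nn_integral_distr) (auto simp: nn_integral_density)
  have sum: "(\<Sum>i\<in>I. (s(j := u)) i * x i) = u * x j + (\<Sum>i\<in>K. s i * x i)" for u x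
   unfolding K(1) using K by (subst sum.insert) (auto intro!: sum.cong)
  have stepX: "gX om * ennreal (exp (u * X j om)) =
    (\<Prod>i\<in>J. indicator (A i) (X i om)) * ennreal (exp (\<Sum>i\<in>I. (s(j := u)) i * X i om))" for u om
   unfolding sum[of u "%i. X i om"] by (simp add: gX_def exp_add ennreal_mult mult_ac)
  have stepZ: "gZ om * ennreal (exp (u * Z j om)) =
    (\<Prod>i\<in>J. indicator (A i) (Z i om)) * ennreal (exp (\<Sum>i\<in>I. (s(j := u)) i * Z i om))" for u om
   unfolding sum[of u "%i. Z i om"] by (simp add: gZ_def exp_add ennreal_mult mult_ac)
  have box: "l i < (s(j := u)) i & (s(j := u)) i < r i" if "l j < u" "u < r j" "i \<in> I" for u i using that insert.prems(3) by auto
  have IH: "(\<integral>\<^sup>+om. gX om * ennreal (exp (u * X j om)) \<partial>M) = (\<integral>\<^sup>+om. gZ om * ennreal (exp (u * Z j om)) \<partial>N)"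
    if "l j < u" "u < r j" for u unfolding stepX stepZ by (rule insert.IH[OF JI insert.prems(2) box[OF that]])
  have fu: "(\<integral>\<^sup>+om. gX om * ennreal (exp (u * X j om)) \<partial>M) < \<infinity>" if "l j < u" "u < r j" for u
  proof -
   have p1: "(\<Prod>i\<in>J. indicator (A i) (X i om)) <= (1::ennreal)" for om by (intro prod_le_1) (auto simp: indicator_def)
   have "(\<integral>\<^sup>+om. gX om * ennreal (exp (u * X j om)) \<partial>M) <= (\<integral>\<^sup>+om. ennreal (exp (\<Sum>i\<in>I. (s(j := u)) i * X i om)) \<partial>M)"
    unfolding stepX
   proof (rule nn_integral_mono)
    fix om
    show "(\<Prod>i\<in>J. indicator (A i) (X i om)) * ennreal (exp (\<Sum>i\<in>I. (s(j := u)) i * X i om)) <= ennreal (exp (\<Sum>i\<in>I. (s(j := u)) i * X i om))"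
     using mult_right_mono[OF p1[of om], of "ennreal (exp (\<Sum>i\<in>I. (s(j := u)) i * X i om))"] by simp
   qed
   also have "... < \<infinity>" by (rule fin) (rule box[OF that])
   finally show ?thesis .
  qed
  have MM: "MX = MZ"
  proof (rule laplace_unique)
   show "l j < r j" using lr jI .
   show "sets MX = sets borel" "sets MZ = sets borel" by (simp_all add: MX_def MZ_def)
   fix u assume u: "l j < u" "u < r j"
   show "(\<integral>\<^sup>+x. ennreal (exp (u * x)) \<partial>MX) = (\<integral>\<^sup>+x. ennreal (exp (u * x)) \<partial>MZ)"
    "(\<integral>\<^sup>+x. ennreal (exp (u * x)) \<partial>MX) < \<infinity>" using IH[OF u] fu[OF u] by (simp_all add: lapX lapZ)
  qed
  have rew: "(\<Prod>i\<in>insert j J. indicator (A i) (X i om)) * ennreal (?C s om) = gX om * (indicator (A j) (X j om) * ennreal (exp (s j * X j om)))"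
   "(\<Prod>i\<in>insert j J. indicator (A i) (Z i om')) * ennreal (exp (\<Sum>i\<in>I. s i * Z i om')) = gZ om' * (indicator (A j) (Z j om') * ennreal (exp (s j * Z j om')))" for om om'
  proof -
   have 1: "(\<Prod>i\<in>J. indicator (A i) (X i om)) * ennreal (?C s om) = gX om * ennreal (exp (s j * X j om))"
    using stepX[of om "s j"] by simp
   have 2: "(\<Prod>i\<in>J. indicator (A i) (Z i om')) * ennreal (exp (\<Sum>i\<in>I. s i * Z i om')) = gZ om' * ennreal (exp (s j * Z j om'))"
    using stepZ[of om' "s j"] by simp
   show "(\<Prod>i\<in>insert j J. indicator (A i) (X i om)) * ennreal (?C s om) = gX om * (indicator (A j) (X j om) * ennreal (exp (s j * X j om)))"
    unfolding prod.insert[OF insert.hyps] mult.assoc 1 by (rule mult.left_commute)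
   show "(\<Prod>i\<in>insert j J. indicator (A i) (Z i om')) * ennreal (exp (\<Sum>i\<in>I. s i * Z i om')) = gZ om' * (indicator (A j) (Z j om') * ennreal (exp (s j * Z j om')))"
    unfolding prod.insert[OF insert.hyps] mult.assoc 2 by (rule mult.left_commute)
  qed
  show ?case unfolding rew by (subst lapX[symmetric], measurable, subst lapZ[symmetric], measurable) (simp add: MM)
 qed
 \<comment> \<open>With all indicators inserted, the laws tilted by the midpoint exponents agree on
   boxes, which generate the product sigma-algebra. The tilt makes these measures finite and is
   removed at the end.\<close>
 define s where "s i = (l i + r i) / 2" for i
 have s: "l i < s i & s i < r i" if "i \<in> I" for i using lr[OF that] by (auto simp: s_def)
 define P where "P = distr (density M (%om. ennreal (?C s om))) ?A (%om. \<lambda>i\<in>I. X i om)"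
 define Q where "Q = distr (density N (%om. ennreal (exp (\<Sum>i\<in>I. s i * Z i om)))) ?A (%om. \<lambda>i\<in>I. Z i om)"
 have setm: "emeasure (distr (density L (?F s V)) ?A (?B V)) (Pi\<^sub>E I A)
   = (\<integral>\<^sup>+om. (\<Prod>i\<in>I. indicator (A i) (V i om)) * ennreal (exp (\<Sum>i\<in>I. s i * V i om)) \<partial>L)"
  if [measurable]: "!!i. i \<in> I ==> V i \<in> borel_measurable L" "!!i. i \<in> I ==> A i \<in> sets borel" for V :: "'i => 'c => real" and L A
 proof -
  have AA: "Pi\<^sub>E I A \<in> sets ?A" using I that by (intro sets_PiM_I_finite) auto
  have m: "(?B V) \<in> measurable L ?A" by measurable
  have ind: "indicator (Pi\<^sub>E I A) (?H V om) = (\<Prod>i\<in>I. indicator (A i) (V i om) :: ennreal)" for om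
  proof (cases "\<forall>i\<in>I. V i om \<in> A i")
   case True
   then show ?thesis by (auto simp: indicator_def PiE_iff)
  next
   case False
   then obtain i where "i \<in> I" "V i om \<notin> A i" by auto
   then have "(\<Prod>i\<in>I. indicator (A i) (V i om) :: ennreal) = 0" using I by (intro prod_zero bexI[of _ i]) auto
   moreover have "(?H V om) \<notin> Pi\<^sub>E I A" using \<open>i \<in> I\<close> \<open>V i om \<notin> A i\<close> by (auto simp: PiE_iff)
   ultimately show ?thesis by simp
  qed
  have "emeasure (distr (density L (?F s V)) ?A (?B V)) (Pi\<^sub>E I A)
   = (\<integral>\<^sup>+x. indicator (Pi\<^sub>E I A) x \<partial>(distr (density L (?F s V)) ?A (?B V)))"
   using AA by simp
  also have "... = (\<integral>\<^sup>+om. ennreal (exp (\<Sum>i\<in>I. s i * V i om)) * indicator (Pi\<^sub>E I A) (?H V om) \<partial>L)"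
   using AA m by (subst nn_integral_distr) (auto simp: nn_integral_density)
  finally show ?thesis by (simp add: ind mult.commute)
 qed
 have PQ: "P = Q"
 proof (rule measure_eqI_PiM_finite[OF I])
  show "sets P = sets ?A" "sets Q = sets ?A" by (simp_all add: P_def Q_def)
  show "emeasure P (Pi\<^sub>E I A) = emeasure Q (Pi\<^sub>E I A)" if "!!i. i \<in> I ==> A i \<in> sets borel" for A
   unfolding P_def Q_def using key[OF I order_refl that s] setm[OF X that] setm[OF Z that] by simp
  show "range (%_::nat. space ?A) \<subseteq> prod_algebra I (%_. borel :: real measure)"
   using prod_algebraI_finite[OF I, of "%_. UNIV" "%_. borel"] by (auto simp: space_PiM)
  have "emeasure P (Pi\<^sub>E I (%_. UNIV)) = (\<integral>\<^sup>+om. ennreal (?C s om) \<partial>M)"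
   unfolding P_def by (subst setm[OF X]) auto
  then show "emeasure P (space ?A) ~= \<infinity>" using fin[of s] s by (auto simp: space_PiM less_top[symmetric])
 qed simp
 have untilt: "distr L ?A (?B V) =
   density (distr (density L (?F s V)) ?A (?B V))
    (?G s)" (is "?D = ?E")
  if [measurable]: "!!i. i \<in> I ==> V i \<in> borel_measurable L" for V :: "'i => 'c => real" and L
 proof (rule measure_eqI)
  fix E assume "E \<in> sets ?D"
  then have E[measurable]: "E \<in> sets ?A" by simp
  have m[measurable]: "(?B V) \<in> measurable L ?A" by measurable
  have m2[measurable]: "(%x. \<Sum>i\<in>I. s i * x i) \<in> borel_measurable (PiM I (%_. borel :: real measure))" by measurable
  have "emeasure ?E E = (\<integral>\<^sup>+om. ennreal (exp (\<Sum>i\<in>I. s i * V i om)) * (ennreal (exp (- (\<Sum>i\<in>I. s i * V i om))) * indicator E (?H V om)) \<partial>L)"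
   by (subst emeasure_density) (auto simp: nn_integral_distr nn_integral_density)
  also have "... = (\<integral>\<^sup>+om. indicator E (?H V om) \<partial>L)"
   by (intro nn_integral_cong) (simp add: ennreal_mult[symmetric] mult.assoc[symmetric] exp_minus)
  also have "... = (\<integral>\<^sup>+x. indicator E x \<partial>?D)" by (subst nn_integral_distr) auto
  finally show "emeasure ?D E = emeasure ?E E" by simp
 qed simp
 have "distr M ?A (%om. \<lambda>i\<in>I. X i om) = density P (?G s)"
  unfolding P_def by (rule untilt) (rule X)
 moreover have "distr N ?A (%om. \<lambda>i\<in>I. Z i om) = density Q (?G s)"
  unfolding Q_def by (rule untilt) (rule Z)
 ultimately show ?thesis using PQ by simp
qed

text \<open>Symmetrise: for an independent fair sign, the signed square root has characteristic
  function E cos(t sqrt x), a power series in t whose coefficients are the moments. The exponential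
  moment gives agreement for \<open>abs t < k\<close> and holomorphy in the strip
  \<open>abs (Im z) < k\<close>, which contains the whole real axis.\<close>

lemma stieltjes_moment_unique:
 fixes M1 M2 :: "real measure"
 assumes p1: "prob_space M1" and p2: "prob_space M2"
  and sets1: "sets M1 = sets borel" and sets2: "sets M2 = sets borel"
  and nn1: "AE x in M1. x >= 0" and nn2: "AE x in M2. x >= 0"
  and int1: "!!n. integrable M1 (%x. x ^ n)" and int2: "!!n. integrable M2 (%x. x ^ n)"
  and eq: "!!n. (\<integral>x. x ^ n \<partial>M1) = (\<integral>x. x ^ n \<partial>M2)"
  and k: "k > 0" and fin: "integrable M1 (%x. exp (k * sqrt x))"
 shows "M1 = M2"
proof -
 let ?A = "%n x. k ^ (2 * n) * x ^ n / fact (2 * n)"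
 let ?B = "%M B. M \<Otimes>\<^sub>M B"
 let ?C = "%M. \<integral>\<^sup>+x. ennreal (cosh (k * sqrt x)) \<partial>M"
 let ?D = "%m. \<Sum>n. ennreal (k ^ (2 * n) * m n / fact (2 * n))"
 let ?E = "%ze x. \<i> * (ze * cx (sqrt x))"
 let ?F = "%x. k * abs (sqrt x)"
 let ?G = "%t M. \<integral>x. cos (t * sqrt x) \<partial>M"
 let ?H = "%M1. \<integral>\<^sup>+x. ennreal (cosh (k * sqrt x)) \<partial>M1"
 note [measurable_cong] = sets1 sets2
 interpret M1: prob_space M1 by fact
 interpret M2: prob_space M2 by fact
 define m where "m n = (\<integral>x. x ^ n \<partial>M1)" for n
 have m0: "m n >= 0" for n unfolding m_def using nn1 by (intro integral_nonneg_AE) auto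
 have mom: "(\<integral>x. x ^ n \<partial>M) = m n" "integrable M (%x. x ^ n)" "AE x in M. x >= 0" "sets M = sets borel" "prob_space M"
  if "M = M1 \<or> M = M2" for M n using that int1 int2 nn1 nn2 eq sets1 sets2 p1 p2 by (auto simp: m_def)
 have sm: "strict_mono (%n::nat. 2 * n)" by (simp add: strict_mono_def)
 have rng: "odd n" if "n \<notin> range (%n::nat. 2 * n)" for n using that by (metis evenE rangeI)
 have pw: "(t * sqrt x) ^ (2 * n) = t ^ (2 * n) * x ^ n" if "x >= 0" for t x :: real and n
  by (metis power_mult power_mult_distrib real_sqrt_pow2 that)
 have coshs: "(%n. t ^ (2 * n) * x ^ n / fact (2 * n)) sums cosh (t * sqrt x)" if "x >= 0" for t x :: real
 proof -
  have "(%n. if even (2 * n) then (t * sqrt x) ^ (2 * n) /\<^sub>R fact (2 * n) else 0) sums cosh (t * sqrt x)"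
   using sums_mono_reindex[OF sm, of "%n. if even n then (t * sqrt x) ^ n /\<^sub>R fact n else 0"] rng
    cosh_converges[of "t * sqrt x"] by simp
  moreover have "(if even (2 * n) then (t * sqrt x) ^ (2 * n) /\<^sub>R fact (2 * n) else 0) = t ^ (2 * n) * x ^ n / fact (2 * n)" for n
   unfolding pw[OF that] by (simp add: divide_inverse)
  ultimately show ?thesis by (simp only:)
 qed
 have coss: "(%n. (-1) ^ n * t ^ (2 * n) * x ^ n / fact (2 * n)) sums cos (t * sqrt x)" if "x >= 0" for t x :: real
 proof -
  have "(%n. cos_coeff (2 * n) * (t * sqrt x) ^ (2 * n)) sums cos (t * sqrt x)"
   using sums_mono_reindex[OF sm, of "%n. cos_coeff n * (t * sqrt x) ^ n"] rng
    cos_converges[of "t * sqrt x"] by (simp add: cos_coeff_def)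
  moreover have "cos_coeff (2 * n) * (t * sqrt x) ^ (2 * n) = (-1) ^ n * t ^ (2 * n) * x ^ n / fact (2 * n)" for n
   unfolding pw[OF that] by (simp add: cos_coeff_def)
  ultimately show ?thesis by (simp only:)
 qed
 \<comment> \<open>The series of cosh has nonnegative terms, so its integral is determined by the
   moments. This carries the exponential bound, assumed for \<open>M1\<close>, over to
   \<open>M2\<close>.\<close>
 have cosh_nn: "(?C M) = (?D m)"
  if M: "M = M1 \<or> M = M2" for M
 proof -
  note [measurable_cong] = mom(4)[OF M]
  have "(?C M) = (\<integral>\<^sup>+x. (\<Sum>n. ennreal (?A n x)) \<partial>M)"
   using mom(3)[OF M]
  proof (intro nn_integral_cong_AE, eventually_elim)
   fix x :: real assume x: "x >= 0"
   have "(\<Sum>n. ennreal (?A n x)) = ennreal (\<Sum>n. k ^ (2 * n) * x ^ n / fact (2 * n))"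
    using x coshs[OF x, of k] by (intro suminf_ennreal2) (auto simp: sums_iff)
   also have "... = ennreal (cosh (k * sqrt x))" using coshs[OF x, of k] by (simp add: sums_iff)
   finally show "ennreal (cosh (k * sqrt x)) = (\<Sum>n. ennreal (?A n x))" by simp
  qed
  also have "... = (\<Sum>n. \<integral>\<^sup>+x. ennreal (?A n x) \<partial>M)" by (intro nn_integral_suminf) auto
  also have "... = (?D m)"
  proof (intro suminf_cong)
   fix n
   have "(\<integral>\<^sup>+x. ennreal (?A n x) \<partial>M) = ennreal (\<integral>x. k ^ (2 * n) * x ^ n / fact (2 * n) \<partial>M)"
    using mom(2)[OF M, of n] mom(3)[OF M] by (intro nn_integral_eq_integral) auto
   then show "(\<integral>\<^sup>+x. ennreal (?A n x) \<partial>M) = ennreal (k ^ (2 * n) * m n / fact (2 * n))"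
    using mom(1)[OF M, of n] by simp
  qed
  finally show ?thesis .
 qed
 have "(?H M1) <= (\<integral>\<^sup>+x. ennreal (exp (k * sqrt x)) \<partial>M1)" using nn1
 proof (intro nn_integral_mono_AE, eventually_elim)
  fix x :: real assume "x >= 0"
  then have "exp (- (k * sqrt x)) <= exp (k * sqrt x)" using k by simp
  then show "ennreal (cosh (k * sqrt x)) <= ennreal (exp (k * sqrt x))" by (intro ennreal_leI) (simp add: cosh_def)
 qed
 also have "... < \<infinity>" using fin by (simp add: real_integrable_def less_top[symmetric])
 finally have c1: "(?H M1) < \<infinity>" .
 have cfin: "(?C M) < \<infinity>" if "M = M1 \<or> M = M2" for M
  using that c1 cosh_nn[of M1] cosh_nn[of M2] by auto
 have cint: "integrable M (%x. cosh (k * sqrt x))" if "M = M1 \<or> M = M2" for M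
 proof -
  note [measurable_cong] = mom(4)[OF that]
  show ?thesis using cfin[OF that] by (intro integrableI_nonneg) auto
 qed
 have sumk: "summable (%n. k ^ (2 * n) * m n / fact (2 * n))"
 proof (rule summable_suminf_not_top)
  show "0 <= k ^ (2 * n) * m n / fact (2 * n)" for n using m0[of n] k by simp
  show "(?D m) ~= \<top>" using c1 cosh_nn[of M1] by auto
 qed
 have coss_int: "(?G t M) = (\<Sum>n. (-1) ^ n * t ^ (2 * n) * m n / fact (2 * n))"
  if M: "M = M1 \<or> M = M2" and t: "abs t < k" for M t
 proof -
  note [measurable_cong] = mom(4)[OF M]
  let ?f = "%n x. (-1) ^ n * t ^ (2 * n) * x ^ n / fact (2 * n) :: real"
  have "(?G t M) = (\<integral>x. (\<Sum>n. ?f n x) \<partial>M)" using mom(3)[OF M]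
  proof (intro integral_cong_AE, measurable, eventually_elim)
   fix x :: real assume "x >= 0"
   then show "cos (t * sqrt x) = (\<Sum>n. ?f n x)" using coss[of x t] by (simp add: sums_iff)
  qed
  also have "... = (\<Sum>n. \<integral>x. ?f n x \<partial>M)"
  proof (rule integral_suminf)
   show "integrable M (?f n)" for n using mom(2)[OF M, of n] by simp
   show "AE x in M. summable (%n. norm (?f n x))" using mom(3)[OF M]
   proof eventually_elim
    fix x :: real assume x: "x >= 0"
    have "norm (?f n x) = t ^ (2 * n) * x ^ n / fact (2 * n)" for n using x by (simp add: abs_mult power_mult)
    then show "summable (%n. norm (?f n x))" using coshs[OF x, of t] by (simp add: sums_iff)
   qed
   have nm: "(\<integral>x. norm (?f n x) \<partial>M) = t ^ (2 * n) * m n / fact (2 * n)" for n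
   proof -
    have "(\<integral>x. norm (?f n x) \<partial>M) = (\<integral>x. t ^ (2 * n) * x ^ n / fact (2 * n) \<partial>M)" using mom(3)[OF M]
    proof (intro integral_cong_AE, measurable, eventually_elim)
     fix x :: real assume x: "x >= 0"
     then show "norm (?f n x) = t ^ (2 * n) * x ^ n / fact (2 * n)" by (simp add: abs_mult power_mult)
    qed
    then show ?thesis using mom(1)[OF M, of n] by simp
   qed
   show "summable (%n. \<integral>x. norm (?f n x) \<partial>M)" unfolding nm
   proof (rule summable_comparison_test'[OF sumk])
    fix n
    have "abs t ^ (2 * n) <= k ^ (2 * n)" using t by (intro power_mono) auto
    moreover have "abs t ^ (2 * n) = t ^ (2 * n)" by (rule power_even_abs) simp
    ultimately have 1: "t ^ (2 * n) <= k ^ (2 * n)" by simp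
    have 2: "t ^ (2 * n) >= 0" by (rule zero_le_even_power) simp
    show "norm (t ^ (2 * n) * m n / fact (2 * n)) <= k ^ (2 * n) * m n / fact (2 * n)" unfolding real_norm_def using 2 m0[of n]
     by (subst abs_of_nonneg) (auto intro!: divide_right_mono mult_right_mono 1)
   qed
  qed
  also have "... = (\<Sum>n. (-1) ^ n * t ^ (2 * n) * m n / fact (2 * n))" using mom(1)[OF M] by simp
  finally show ?thesis .
 qed
 define C where "C M z = (\<integral>x. cos (z * cx (sqrt x)) \<partial>M)" for M :: "real measure" and z :: complex
 have Chol: "C M holomorphic_on {z. - k < Im z & Im z < k}" if M: "M = M1 \<or> M = M2" for M unfolding C_def
 proof (rule holomorphic_on_integral_parameter)
  note [measurable_cong] = mom(4)[OF M]
  show op: "open {z. - k < Im z & Im z < k}" by (intro open_Collect_conj open_Collect_less continuous_intros)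
  show "(%x. cos (z * cx (sqrt x))) \<in> borel_measurable M" for z :: complex
   by (intro measurable_compose[OF _ borel_measurable_continuous_onI[of cos]] continuous_intros) measurable
  show "(%z. cos (z * cx (sqrt x))) holomorphic_on {z. - k < Im z & Im z < k}" for x by (intro holomorphic_intros)
  fix z :: complex assume z: "z \<in> {z. - k < Im z & Im z < k}"
  with op obtain r where r: "r > 0" "cball z r \<subseteq> {z. - k < Im z & Im z < k}" using open_contains_cball by blast
  have "norm (cos (ze * cx (sqrt x))) <= 2 * cosh (k * sqrt x)" if "ze \<in> cball z r" for ze x
  proof -
   have "abs (Im ze) <= k" using r that by auto
   then have "abs (Im ze) * abs (sqrt x) <= k * abs (sqrt x)" by (intro mult_right_mono) auto
   then have "abs (Im ze * sqrt x) <= k * abs (sqrt x)" by (simp only: abs_mult)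
   then have "Im ze * sqrt x <= k * abs (sqrt x)" "- (Im ze * sqrt x) <= k * abs (sqrt x)" by linarith+
   then have "exp (Im ze * sqrt x) <= exp (?F x)" "exp (- (Im ze * sqrt x)) <= exp (?F x)"
    by (simp_all only: exp_le_cancel_iff)
   then have 1: "norm (exp (?E ze x)) <= exp (?F x)"
     "norm (exp (- (?E ze x))) <= exp (?F x)" unfolding norm_exp_eq_Re by simp_all
   have "norm (cos (ze * cx (sqrt x))) = norm (exp (?E ze x) + exp (- (?E ze x))) / 2"
    by (simp add: cos_exp_eq norm_divide)
   also have "... <= (norm (exp (?E ze x)) + norm (exp (- (?E ze x)))) / 2"
    by (intro divide_right_mono norm_triangle_ineq) auto
   also have "... <= exp (?F x)" by (rule order.trans[OF divide_right_mono[OF add_mono[OF 1]]]) simp_all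
   also have "... <= 2 * cosh (?F x)" by (simp add: cosh_def)
   also have "cosh (?F x) = cosh (k * sqrt x)" by (cases "x >= 0") (auto simp: abs_if)
   finally show ?thesis .
  qed
  moreover have "integrable M (%x. 2 * cosh (k * sqrt x))" using cint[OF M] by simp
  ultimately show "\<exists>r>0. \<exists>g. cball z r \<subseteq> {z. - k < Im z & Im z < k} & integrable M g &
    (\<forall>w. \<forall>ze\<in>cball z r. norm (cos (ze * cx (sqrt w))) <= g w)" using r by blast
 qed
 have Creal: "C M (cx t) = cx (?G t M)" for M t
 proof -
  have "cos (cx t * cx (sqrt x)) = cx (cos (t * sqrt x))" for x by (metis cos_of_real of_real_mult)
  then show ?thesis unfolding C_def by (simp only: integral_complex_of_real)
 qed
 have Ceq: "C M1 (cx t) = C M2 (cx t)" for t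
 proof (rule holomorphic_equal_on_line[where f = "C M1" and g = "C M2" and z = "cx t" and S = "{z. - k < Im z & Im z < k}" and sg = 0 and d = 1 and l = "-k" and r = k])
  show "open {z. - k < Im z & Im z < k}" by (intro open_Collect_conj open_Collect_less continuous_intros)
  have "{z. - k < Im z & Im z < k} = {z. - k < Im z} \<inter> {z. Im z < k}" by auto
  then show "connected {z. - k < Im z & Im z < k}"
   using convex_halfspace_Im_gt[of "-k"] convex_halfspace_Im_lt[of k] by (simp add: convex_Int convex_connected)
  show "C M1 (0 + cx t * 1) = C M2 (0 + cx t * 1)" if "- k < t" "t < k" for t
   using coss_int[of M1 t] coss_int[of M2 t] that by (simp add: Creal abs_less_iff)
 qed (use k Chol in auto)
 \<comment> \<open>The fair coin that chooses the sign of the root; squaring later recovers the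
   original measure.\<close>
 define B where "B = measure_pmf (bernoulli_pmf (1/2))"
 interpret B: prob_space B by (simp add: B_def prob_space_measure_pmf)
 define V where "V = (%(x, b). if b then sqrt x else - sqrt x :: real)"
 have V[measurable]: "V \<in> borel_measurable (?B M B)" if [measurable_cong]: "sets M = sets borel" for M
  unfolding V_def B_def by measurable
 define S where "S M = distr (?B M B) borel V" for M
 have S: "S M1 = S M2"
 proof (rule Levy_uniqueness)
  show "real_distribution (S M1)" "real_distribution (S M2)" unfolding S_def
   by (auto intro!: prob_space.real_distribution_distr V sets1 sets2 prob_space_pair p1 p2 B.prob_space_axioms)
  have "char (S M) t = C M (cx t)" if M: "M = M1 \<or> M = M2" for M t
  proof -
   note [measurable_cong] = mom(4)[OF M]
   interpret M: prob_space M by (rule mom(5)[OF M])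
   interpret P: pair_prob_space M B ..
   have [measurable]: "V \<in> borel_measurable (?B M B)" by (rule V) (rule mom(4)[OF M])
   have "char (S M) t = (\<integral>p. iexp (t * V p) \<partial>(?B M B))" unfolding char_def S_def by (subst integral_distr) auto
   also have "... = (\<integral>x. (\<integral>b. iexp (t * V (x, b)) \<partial>B) \<partial>M)"
   proof (rule P.integral_fst'[symmetric])
    show "integrable (?B M B) (%p. iexp (t * V p))" by (rule P.P.integrable_const_bound[where B = 1]) auto
   qed
   also have "... = (\<integral>x. cos (cx t * cx (sqrt x)) \<partial>M)" by (intro lintegral_cong refl)
     (simp add: B_def V_def cos_exp_eq integral_measure_pmf[of UNIV] UNIV_bool scaleR_conv_of_real algebra_simps)
   finally show ?thesis by (simp add: C_def)
  qed
  then show "char (S M1) = char (S M2)" using Ceq by (intro ext) simp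
 qed
 have untilt: "distr (S M) borel (%v. v^2) = M" if M: "M = M1 \<or> M = M2" for M
 proof -
  note [measurable_cong] = mom(4)[OF M]
  have [measurable]: "V \<in> borel_measurable (?B M B)" by (rule V) (rule mom(4)[OF M])
  have "distr (S M) borel (%v. v^2) = distr (?B M B) borel ((%v. v^2) \<circ> V)" unfolding S_def by (rule distr_distr) auto
  also have "... = distr (?B M B) borel ((%x. (sqrt x)^2) \<circ> fst)" by (intro distr_cong) (auto simp: V_def)
  also have "... = distr (distr (?B M B) M fst) borel (%x. (sqrt x)^2)" by (rule distr_distr[symmetric]) auto
  also have "... = distr M borel (%x. (sqrt x)^2)" by (simp add: B.distr_pair_fst)
  also have "... = distr M borel (%x. x)" using mom(3)[OF M] by (intro distr_cong_AE) (auto elim!: eventually_mono)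
  also have "... = M" using mom(4)[OF M] by (intro distr_id2) simp
  finally show ?thesis .
 qed
 have "M1 = distr (S M1) borel (%v. v^2)" by (rule untilt[symmetric]) simp
 also have "... = distr (S M2) borel (%v. v^2)" by (simp only: S)
 also have "... = M2" by (rule untilt) simp
 finally show ?thesis .
qed

section \<open>Gamma integrals in a logarithmic variable\<close>

text \<open>Places a Gaussian above \<open>exp (- b * cosh w)\<close>, strong enough to absorb any
  factor \<open>exp (s * w)\<close>.\<close>

lemma cosh_ge_quadratic: "cosh w >= 1 + w^2 / 2" for w :: real
proof -
 have "abs (w / 2) <= abs (sinh (w / 2))"
 proof -
  have "x <= sinh x" if "x >= 0" for x :: real
  proof -
   have "sinh 0 - (0::real) <= sinh x - x" by (rule DERIV_nonneg_imp_nondecreasing[where f = "%x::real. sinh x - x", OF that])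
     (auto intro!: exI derivative_eq_intros simp: cosh_real_ge_1)
   then show ?thesis by simp
  qed
  from this[of "abs (w/2)"] show ?thesis by (cases "w >= 0") auto
 qed
 then have "(w / 2)^2 <= (sinh (w / 2))^2" by (rule abs_le_square_iff[THEN iffD1])
 moreover have "cosh w = 1 + 2 * (sinh (w / 2))^2" using cosh_double[of "w / 2"] by (simp add: cosh_square_eq)
 ultimately show ?thesis by (simp add: power2_eq_square)
qed

lemma gaussian_integral:
 fixes b s :: real
 assumes b: "b > 0"
 shows "L1 (%w. exp (- b * w^2 + s * w))"
  and "(LBINT w. exp (- b * w^2 + s * w)) = sqrt (pi / b) * exp (s^2 / (4 * b))"
proof -
 define sg where "sg = sqrt (1 / (2 * b))"
 have sg: "sg > 0" "sg^2 = 1 / (2 * b)" using b by (auto simp: sg_def)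
 have eq: "exp (- b * w^2 + s * w) = sqrt (pi / b) * exp (s^2 / (4 * b)) * normal_density (s / (2 * b)) sg w" for w
 proof -
  have "normal_density (s / (2 * b)) sg w = 1 / sqrt (pi / b) * exp (- b * (w - s / (2 * b))^2)"
   unfolding normal_density_def sg(2) using b by (simp add: field_simps)
  moreover have "- b * w^2 + s * w = s^2 / (4 * b) + (- b * (w - s / (2 * b))^2)" using b by (simp add: power2_eq_square field_simps)
  ultimately show ?thesis using b by (simp add: exp_add[symmetric])
 qed
 show "L1 (%w. exp (- b * w^2 + s * w))" unfolding eq using sg by simp
 show "(LBINT w. exp (- b * w^2 + s * w)) = sqrt (pi / b) * exp (s^2 / (4 * b))" unfolding eq using sg by simp
qed

lemma integrable_exp_cosh:
 assumes "b > 0"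
 shows "L1 (%w::real. exp (- b * cosh w + s * w))"
proof (rule lintegrable_bound)
 show "L1 (%w. exp (- (b / 2) * w^2 + s * w))" using assms by (intro gaussian_integral) auto
 show "AE w in lborel. norm (exp (- b * cosh w + s * w)) <= norm (exp (- (b / 2) * w^2 + s * w))"
 proof (intro AE_I2)
  fix w :: real
  have "b * (w^2 / 2) <= b * cosh w" using assms cosh_ge_quadratic[of w] by (intro mult_left_mono) auto
  then show "norm (exp (- b * cosh w + s * w)) <= norm (exp (- (b / 2) * w^2 + s * w))" by simp
 qed
qed measurable

text \<open>Euler's integral under the substitution \<open>t = exp x\<close>.\<close>

lemma Gamma_integral_log:
 assumes A: "Re A > 0"
 shows "L1 (%x::real. exp (A * cx x - cx (exp x)))"
  and "(LBINT x. exp (A * cx (x::real) - cx (exp x))) = Gamma A"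
proof -
 let ?A = "%x. A * cx x - cx (exp x)"
 define f where "f t = cx t powr (A - 1) / cx (exp t)" for t :: real
 have "range (exp :: real => real) = {0<..}" by (auto simp: image_iff) (metis exp_ln)
 moreover have "f absolutely_integrable_on {0<..}" "integral {0<..} f = Gamma A"
  unfolding f_def using absolutely_integrable_Gamma_integral'[OF A] Gamma_integral_complex'[OF A] by (auto simp: integral_unique)
 ultimately have *: "(%x. abs (exp x) *\<^sub>R f (exp x)) absolutely_integrable_on UNIV &
   integral UNIV (%x. abs (exp x) *\<^sub>R f (exp x)) = Gamma A" using has_absolute_integral_change_of_variables_real[of UNIV exp exp f "Gamma A"]
  by (auto intro!: derivative_eq_intros simp: inj_on_def)
 have eq: "abs (exp x) *\<^sub>R f (exp x) = exp (?A x)" for x :: real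
 proof -
  have "cx (exp x) powr (A - 1) = exp ((A - 1) * cx x)" by (simp add: powr_def Ln_of_real)
  then show ?thesis by (simp add: f_def scaleR_conv_of_real exp_diff exp_of_real[symmetric] left_diff_distrib)
 qed
 have m: "(%x::real. exp (?A x)) \<in> borel_measurable lborel" by measurable
 show i: "L1 (%x::real. exp (?A x))" using * unfolding eq by (simp add: set_integrable_def integrable_completion)
 have "(LBINT x. exp (A * cx (x::real) - cx (exp x))) = integral UNIV (%x::real. exp (?A x))"
  using i by (rule integral_lborel[symmetric])
 then show "(LBINT x. exp (A * cx (x::real) - cx (exp x))) = Gamma A" using * unfolding eq by simp
qed

lemma Gamma_integral_log_scaled:
 assumes A: "Re A > 0" and b: "b > 0"
 shows "L1 (%x::real. exp (A * cx x - cx (b * exp x)))"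
  and "(LBINT x. exp (A * cx (x::real) - cx (b * exp x))) = Gamma A * exp (- A * cx (ln b))"
proof -
 let ?A = "%b x. A * cx (ln b + 1 * x) - cx (exp (ln b + 1 * x))"
 have eq: "exp (?A b x) * exp (- A * cx (ln b)) = exp (A * cx x - cx (b * exp x))" for x
  using b by (simp add: exp_add[symmetric] algebra_simps exp_add)
 have "L1 (%x. exp (?A b x))" by (rule lborel_integrable_real_affine[OF Gamma_integral_log(1)[OF A]]) simp
 from integrable_mult_left[OF this, of "exp (- A * cx (ln b))"]
 show "L1 (%x::real. exp (A * cx x - cx (b * exp x)))" unfolding eq .
 have "Gamma A = (LBINT x. exp (?A b x))"
  using lborel_integral_real_affine[of 1 "%x. exp (A * cx x - cx (exp x))" "ln b"] Gamma_integral_log(2)[OF A] by simp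
 then have "Gamma A * exp (- A * cx (ln b)) = (LBINT x. exp (?A b x) * exp (- A * cx (ln b)))" by simp
 then show "(LBINT x. exp (A * cx (x::real) - cx (b * exp x))) = Gamma A * exp (- A * cx (ln b))" unfolding eq by simp
qed

lemma Gamma_integral_log_real:
 assumes A: "A > 0" and b: "b > 0"
 shows "L1 (%x::real. exp (A * x - b * exp x))"
  and "(LBINT x. exp (A * x - b * exp x)) = Gamma A * b powr (- A)"
proof -
 let ?A = "LBINT x. exp (A * x - b * exp x)"
 have eq: "exp (cx A * cx x - cx (b * exp x)) = cx (exp (A * x - b * exp x))" for x by (simp flip: exp_of_real)
 from Gamma_integral_log_scaled(1)[of "cx A" b] A b
 have "L1 (%x. cx (exp (A * x - b * exp x)))" unfolding eq by simp
 then show "L1 (%x::real. exp (A * x - b * exp x))" by (simp add: complex_of_real_integrable_eq)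
 from Gamma_integral_log_scaled(2)[of "cx A" b] A b
 have "cx ?A = Gamma (cx A) * exp (- cx A * cx (ln b))" unfolding eq by simp
 also have "... = cx (Gamma A * b powr (- A))" using b by (simp add: Gamma_complex_of_real powr_def flip: exp_of_real)
 finally have "cx ?A = cx (Gamma A * b powr (- A))" .
 then show "?A = Gamma A * b powr (- A)" by (simp only: of_real_eq_iff)
qed

text \<open>The substitution x = m + p, y = m - p of Jacobian 2, carried out as two affine
  substitutions in one variable. It is done for nonnegative integrands first, to obtain
  integrability, and then repeated with Fubini.\<close>

lemma pair_lborel_rotate:
 fixes f :: "real => real => complex"
 assumes [measurable]: "case_prod f \<in> borel_measurable (borel \<Otimes>\<^sub>M borel)"
 assumes int: "integrable lborel2 (%(m, p). f (m + p) (m - p))"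
 shows "integrable lborel2 (%(x, y). f x y)"
  and "(LBINT y. (LBINT x. f x y)) = 2 * (LBINT p. (LBINT m. f (m + p) (m - p)))"
proof -
 let ?A = "\<integral>\<^sup>+z. norm ((%(y, p). f (y + 2 * p) y) z) \<partial>lborel2"
 let ?B = "\<integral>\<^sup>+z. norm (case_prod f z) \<partial>lborel2"
 let ?C = "NN p. (NN m. norm (f (m + p) (m - p)))"
 have nn: "(NN y. (NN x. g x y)) = 2 * (NN p. (NN m. g (m + p) (m - p)))"
  if [measurable]: "case_prod g \<in> borel_measurable (borel \<Otimes>\<^sub>M borel)" for g :: "real => real => ennreal"
 proof -
  have "(NN y. (NN x. g x y)) = (NN y. ennreal (abs 2) * (NN p. g (y + 2 * p) y))" by (rule nn_integral_cong, rule nn_integral_real_affine) auto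
  also have "... = 2 * (NN y. (NN p. g (y + 2 * p) y))" by (simp add: nn_integral_cmult)
  also have "(NN y. (NN p. g (y + 2 * p) y)) = (NN p. (NN y. g (y + 2 * p) y))" by (rule lborel_pair.Fubini') measurable
  also have "... = (NN p. (NN m. g (m + p) (m - p)))"
  proof (rule nn_integral_cong)
   fix p :: real
   have "(NN y. g (y + 2 * p) y) = ennreal (abs 1) * (NN m. g (- p + 1 * m + 2 * p) (- p + 1 * m))" by (rule nn_integral_real_affine) auto
   then show "(NN y. g (y + 2 * p) y) = (NN m. g (m + p) (m - p))" by (simp add: algebra_simps)
  qed
  finally show ?thesis .
 qed
 have "?B = (NN y. (NN x. norm (f x y)))"
  by (subst lborel_pair.nn_integral_snd[symmetric]) auto
 also have "... = 2 * ?C" by (rule nn) measurable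
 also have "?C = (\<integral>\<^sup>+z. norm ((%(m, p). f (m + p) (m - p)) z) \<partial>lborel2)"
  by (subst lborel_pair.nn_integral_snd[symmetric]) auto
 also have "2 * ... < \<infinity>" using int by (simp add: integrable_iff_bounded ennreal_mult_less_top)
 finally show intf: "integrable lborel2 (%(x, y). f x y)" by (intro integrableI_bounded) auto
 have int1: "integrable lborel2 (%(y, p). f (y + 2 * p) y)"
 proof (rule integrableI_bounded)
  have "?A = (NN y. (NN p. norm (f (y + 2 * p) y)))"
   by (subst lborel.nn_integral_fst[symmetric]) auto
  also have "2 * ... = (NN y. ennreal (abs 2) * (NN p. norm (f (y + 2 * p) y)))" by (simp add: nn_integral_cmult)
  also have "... = (NN y. (NN x. norm (f x y)))" by (rule nn_integral_cong, rule nn_integral_real_affine[symmetric]) auto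
  also have "... = ?B" by (subst lborel_pair.nn_integral_snd[symmetric]) auto
  also have "... < \<infinity>" using intf by (simp add: integrable_iff_bounded)
  finally show "?A < \<infinity>" by (auto simp: ennreal_mult_less_top)
 qed measurable
 have "(LBINT y. (LBINT x. f x y)) = (LBINT y. abs 2 *\<^sub>R (LBINT p. f (y + 2 * p) y))"
  by (rule lintegral_cong[OF refl], rule lborel_integral_real_affine) auto
 also have "... = 2 * (LBINT y. (LBINT p. f (y + 2 * p) y))" by (simp add: scaleR_conv_of_real)
 also have "(LBINT y. (LBINT p. f (y + 2 * p) y)) = (LBINT p. (LBINT y. f (y + 2 * p) y))"
  by (rule lborel_pair.Fubini_integral[symmetric]) (use int1 in simp)
 also have "... = (LBINT p. (LBINT m. f (m + p) (m - p)))"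
 proof (rule lintegral_cong[OF refl])
  fix p :: real
  have "(LBINT y. f (y + 2 * p) y) = abs 1 *\<^sub>R (LBINT m. f (- p + 1 * m + 2 * p) (- p + 1 * m))" by (rule lborel_integral_real_affine) auto
  then show "(LBINT y. f (y + 2 * p) y) = (LBINT m. f (m + p) (m - p))" by (simp add: algebra_simps)
 qed
 finally show "(LBINT y. (LBINT x. f x y)) = 2 * (LBINT p. (LBINT m. f (m + p) (m - p)))" .
qed

section \<open>The Macdonald function with complex index\<close>

abbreviation kern :: "complex => real => real => complex" where
 "kern nu x w \<equiv> exp (nu * cx w - cx (exp x * cosh w))"

text \<open>\<open>KB nu x\<close> is the Macdonald function of index \<open>nu\<close> at \<open>exp x\<close>, \<open>KR\<close> its version for real index.\<close>

definition KB :: "complex => real => complex" where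
 "KB nu x = (LBINT w. kern nu x w) / 2"

definition KR :: "real => real => real" where
 "KR s x = (LBINT w. exp (s * w - exp x * cosh w)) / 2"

abbreviation KR0 :: "real => real" where
 "KR0 x \<equiv> KR 0 (x - 1)"

lemma exp_diff_cosh: "exp (a - c) + exp (- a - c) = 2 * (cosh a * exp (- c))" for a c :: real by (simp add: cosh_def exp_diff exp_minus field_simps)

lemma KR_integrable: "L1 (%w::real. exp (s * w - exp x * cosh w))" using integrable_exp_cosh[of "exp x" s] by (simp add: algebra_simps)

lemma KB_integrable: "L1 (%w. exp ((nu::complex) * cx w - cx (exp (x::real) * cosh w)))"
proof (rule lintegrable_bound[OF KR_integrable[of "Re nu" x]])
 show "AE w in lborel. norm (kern nu x w) <= norm (exp (Re nu * w - exp x * cosh w))" by (intro AE_I2) (simp add: norm_exp_eq_Re)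
qed measurable

lemma norm_KB_le: "norm (KB nu x) <= KR (Re nu) x"
proof -
 have "norm (LBINT w. kern nu x w) <=
   (LBINT w. norm (kern nu x w))" by (rule integral_norm_bound)
 also have "... = 2 * KR (Re nu) x" by (simp add: KR_def norm_exp_eq_Re)
 finally show ?thesis by (simp add: KB_def norm_divide)
qed

lemma KB_of_real: "KB (cx s) x = cx (KR s x)"
proof -
 have "exp (cx s * cx w - cx (exp x * cosh w)) = cx (exp (s * w - exp x * cosh w))" for w by (simp flip: exp_of_real)
 then show ?thesis by (simp add: KB_def KR_def)
qed

lemma KB_minus: "KB (- nu) x = KB nu x" unfolding KB_def by (subst lborel_integral_real_affine[of "-1" _ 0]) auto

lemma KR_minus: "KR (- s) x = KR s x" unfolding KR_def by (subst lborel_integral_real_affine[of "-1" _ 0]) auto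

lemma KR_nonneg: "KR s x >= 0" unfolding KR_def by (intro divide_nonneg_pos integral_nonneg) auto

text \<open>Averaging over \<open>s\<close> and \<open>- s\<close> replaces the exponential by
  \<open>cosh (s * w)\<close>, which is increasing in \<open>abs s\<close>.\<close>

lemma KR_mono:
 assumes "abs s <= s'"
 shows "KR s x <= KR s' x"
proof -
 let ?A = "%s. %w. (exp (s * w - exp x * cosh w) + exp (- s * w - exp x * cosh w)) / 2"
 have eq: "KR s x = (LBINT w. cosh (s * w) * exp (- (exp x * cosh w))) / 2" for s
 proof -
  have "KR s x = (KR s x + KR (- s) x) / 2" by (simp add: KR_minus)
  also have "... = (LBINT w. exp (s * w - exp x * cosh w) + exp (- s * w - exp x * cosh w)) / 4"
   using KR_integrable[of s x] KR_integrable[of "-s" x] by (simp add: KR_def)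
  also have "(%w. exp (s * w - exp x * cosh w) + exp (- s * w - exp x * cosh w)) = (%w. 2 * (cosh (s * w) * exp (- (exp x * cosh w))))"
   using exp_diff_cosh[of "s * w" "exp x * cosh w" for w] by (simp add: fun_eq_iff)
  finally show ?thesis by simp
 qed
 have int: "L1 (%w. cosh (s * w) * exp (- (exp x * cosh w)))" for s
 proof -
  have "L1 (?A s)" using KR_integrable[of s x] KR_integrable[of "-s" x] by simp
  also have "(?A s) = (%w. cosh (s * w) * exp (- (exp x * cosh w)))"
   using exp_diff_cosh[of "s * w" "exp x * cosh w" for w] by (simp add: fun_eq_iff)
  finally show ?thesis .
 qed
 have "cosh (s * w) <= cosh (s' * w)" for w
 proof -
  have "abs (s * w) <= abs (s' * w)" using assms by (auto simp: abs_mult intro!: mult_right_mono)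
  then have "cosh (abs (s * w)) <= cosh (abs (s' * w))" by (subst cosh_real_nonneg_le_iff) auto
  then show ?thesis by simp
 qed
 then show ?thesis unfolding eq using int by (intro divide_right_mono integral_mono) auto
qed

lemma borel_measurable_KB [measurable (raw)]:
 assumes [measurable]: "f \<in> borel_measurable M" "g \<in> borel_measurable M"
 shows "(%m. KB (f m) (g m)) \<in> borel_measurable M" unfolding KB_def by measurable

lemma borel_measurable_KR [measurable (raw)]:
 assumes [measurable]: "f \<in> borel_measurable M" "g \<in> borel_measurable M"
 shows "(%m. KR (f m) (g m)) \<in> borel_measurable M" unfolding KR_def by measurable

lemma integral_even_half:
 fixes f :: "real => 'a :: {banach, second_countable_topology}"
 assumes int: "L1 f" and even: "!!x. f (- x) = f x"
 shows "integral\<^sup>L lborel f = 2 *\<^sub>R (LBINT x. indicator {0<..} x *\<^sub>R f x)"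
proof -
 have i: "L1 (%x. indicator A x *\<^sub>R f x)" if "A \<in> sets borel" for A using int that by (intro integrable_mult_indicator) auto
 have "integral\<^sup>L lborel f = (LBINT x. indicator {0<..} x *\<^sub>R f x + indicator {..<0} x *\<^sub>R f x)"
 proof (rule integral_cong_AE)
  show "AE x in lborel. f x = indicator {0<..} x *\<^sub>R f x + indicator {..<0} x *\<^sub>R f x"
   using AE_lborel_singleton[of 0] by eventually_elim (auto simp: indicator_def)
 qed (use int i in auto)
 also have "... = (LBINT x. indicator {0<..} x *\<^sub>R f x) + (LBINT x. indicator {..<0} x *\<^sub>R f x)" using i by (intro lintegral_add) auto
 also have "(LBINT x. indicator {..<0} x *\<^sub>R f x) = (LBINT x. indicator {0<..} x *\<^sub>R f x)"
  by (subst lborel_integral_real_affine[of "-1" _ 0])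
   (auto intro!: lintegral_cong simp: even indicator_def)
 finally show ?thesis by (simp add: scaleR_2)
qed

lemma KB_imaginary: "KB (iu u) x = cx (bessel_K u (exp x))"
proof -
 let ?A = "%w. exp (- exp x * cosh w) * cos (u * w)"
 let ?B = "%w. - (iu u) * cx w - cx (exp x * cosh w)"
 let ?C = "%w. iu u * cx w - cx (exp x * cosh w)"
 have "KB (iu u) x = (KB (iu u) x + KB (- (iu u)) x) / 2" by (simp add: KB_minus)
 also have "... = (LBINT w. exp (?C w) + exp (?B w)) / 4"
  using KB_integrable[of "iu u" x] KB_integrable[of "- (iu u)" x] by (simp add: KB_def)
 also have "(%w. exp (?C w) + exp (?B w))
   = (%w. cx (2 * (?A w)))"
 proof
  fix w
  define A c where "A = iu u * cx w" and "c = cx (exp x * cosh w)"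
  have "exp (A - c) + exp (- A - c) = exp (- c) * (exp A + exp (- A))" by (simp add: distrib_left minus_diff_commute[of A c] flip: exp_add)
  moreover have "exp A + exp (- A) = cx (2 * cos (u * w))"
  proof -
   have "A = iu (u * w)" by (simp add: A_def)
   then have "cos (cx (u * w)) = (exp A + exp (- A)) / 2" by (simp only: cos_exp_eq)
   then have "exp A + exp (- A) = 2 * cx (cos (u * w))" by (simp only: cos_of_real) simp
   then show ?thesis by simp
  qed
  moreover have "exp (- c) = cx (exp (- exp x * cosh w))" by (simp add: c_def flip: exp_of_real)
  ultimately show "exp (?C w) + exp (?B w) = cx (2 * (?A w))"
   unfolding A_def[symmetric] c_def[symmetric] mult_minus_left by (simp del: exp_of_real of_real_exp)
 qed
 also have "(LBINT w. cx (2 * (?A w))) = cx (LBINT w. 2 * (?A w))"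
  by (rule integral_complex_of_real)
 finally have 1: "KB (iu u) x = cx ((LBINT w. exp (- exp x * cosh w) * cos (u * w)) / 2)" by (simp del: of_real_exp exp_of_real)
 have "L1 (%w. exp (- exp x * cosh w) * cos (u * w))"
 proof (rule lintegrable_bound[OF KR_integrable[of 0 x]])
  show "AE w in lborel. norm (?A w) <= norm (exp (0 * w - exp x * cosh w))"
   by (intro AE_I2) (simp add: abs_mult mult_left_le)
 qed measurable
 from integral_even_half[OF this]
 show ?thesis unfolding 1 bessel_K_def set_lebesgue_integral_def by simp
qed

section \<open>Mellin transforms of Macdonald functions\<close>

lemma integrable_exp_abs:
 assumes c: "c > 0"
 shows "L1 (%x::real. exp (- c * abs x))"
proof -
 have 1: "L1 (%x::real. exp (- x) * indicator {0<..} x)" using has_bochner_integral_I0i_power_exp_m[of 0] by (simp add: has_bochner_integral_iff)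
 have 2: "L1 (%x::real. exp (- (0 + c * x)) * indicator {0<..} (0 + c * x))" by (rule lborel_integrable_real_affine[OF 1]) (use c in simp)
 have 3: "L1 (%x::real. exp (- (0 + (- c) * x)) * indicator {0<..} (0 + (- c) * x))" by (rule lborel_integrable_real_affine[OF 1]) (use c in simp)
 show ?thesis
 proof (rule lintegrable_bound[OF lintegrable_add[OF 2 3]])
  show "AE x in lborel. norm (exp (- c * abs x)) <=
    norm (exp (- (0 + c * x)) * indicator {0<..} (0 + c * x) + exp (- (0 + (- c) * x)) * indicator {0<..} (0 + (- c) * x))"
   using AE_lborel_singleton[of 0]
  proof eventually_elim
   case (elim x)
   then show ?case using c by (cases "x > 0") (auto simp: indicator_def zero_less_mult_iff mult_less_0_iff)
  qed
 qed measurable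
qed

lemma integrable_prod_pair:
 fixes f g :: "real => 'a :: {real_normed_field, banach, second_countable_topology}"
 assumes f: "L1 f" and g: "L1 g"
 shows "integrable lborel2 (%(x, y). f x * g y)"
proof (rule lborel_pair.Fubini_integrable)
 have [measurable]: "f \<in> borel_measurable borel" "g \<in> borel_measurable borel" using f g by auto
 show "(%(x, y). f x * g y) \<in> borel_measurable lborel2" by measurable
 show "L1 (%x. (LBINT y. norm (case (x, y) of (x, y) => f x * g y)))" using f by (simp add: norm_mult)
 show "AE x in lborel. L1 (%y. case (x, y) of (x, y) => f x * g y)" using g by simp
qed

lemma cosh_powr_integrable:
 assumes d: "d > (abs (Re nu))"
 shows "L1 (%w. exp (nu * cx w) * cx (cosh w powr (- d)))"
proof (rule lintegrable_bound)
 let ?A = "%w. - (d - abs (Re nu)) * abs w"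
 show "L1 (%w::real. 2 powr d * exp (?A w))" using d by (intro integrable_mult_right integrable_exp_abs) auto
 show "AE w in lborel. norm (exp (nu * cx w) * cx (cosh w powr (- d))) <= norm (2 powr d * exp (?A w))"
 proof (intro AE_I2)
  fix w :: real
  have "exp (abs w) / 2 <= cosh w" by (cases "w >= 0") (auto simp: cosh_def)
  then have "cosh w powr (- d) <= (exp (abs w) / 2) powr (- d)" using d by (intro powr_mono2') auto
  also have "... = 2 powr d * exp (- d * abs w)" by (simp add: powr_divide powr_minus exp_minus powr_def[of "exp (abs w)"] field_simps)
  finally have 1: "cosh w powr (- d) <= 2 powr d * exp (- d * abs w)" .
  have "Re nu * w <= abs (Re nu) * abs w" by (metis abs_ge_self abs_mult)
  then have "exp (Re nu * w) * cosh w powr (- d) <= exp (abs (Re nu) * abs w) * (2 powr d * exp (- d * abs w))" using 1 by (intro mult_mono) auto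
  also have "... = 2 powr d * exp (?A w)" by (simp add: algebra_simps flip: exp_add)
  finally show "norm (exp (nu * cx w) * cx (cosh w powr (- d))) <= norm (2 powr d * exp (?A w))" by (simp add: norm_mult)
 qed
qed measurable

text \<open>The integral over \<open>x\<close> is a Gamma integral with value
  \<open>Gamma d * b w powr (- d)\<close>, so the double integral reduces to the hypothesis
  \<open>int\<close>. The Mellin transforms below are instances with different \<open>M\<close> and
  \<open>b\<close>.\<close>

lemma mellin_joint_integrable:
 assumes d: "d > 0" and [measurable]: "f \<in> borel_measurable M" "b \<in> borel_measurable M"
  and b: "!!w. b w > 0" and M: "sigma_finite_measure M"
  and int: "integrable M (%w. f w * cx (b w powr (- d)) :: complex)"
 shows "integrable (lborel \<Otimes>\<^sub>M M) (%(x, w). f w * cx (exp (d * x - b w * exp x)))"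
  and "(LBINT x. (\<integral>w. f w * cx (exp (d * x - b w * exp x)) \<partial>M)) = cx (Gamma d) * (\<integral>w. f w * cx (b w powr (- d)) \<partial>M)"
proof -
 let ?A = "%x w. exp (d * x - b w * exp x)"
 let ?B = "%w. f w * cx (b w powr (- d))"
 let ?C = "\<integral>\<^sup>+z. norm ((%(x, w). f w * cx (?A x w)) z) \<partial>(lborel \<Otimes>\<^sub>M M)"
 let ?D = "%w. Gamma d * b w powr (- d)"
 let ?E = "LBINT x. (\<integral>w. f w * cx (?A x w) \<partial>M)"
 let ?F = "%w. NN x. norm (f w) * ennreal (?A x w)"
 interpret M: sigma_finite_measure M by fact
 interpret P: pair_sigma_finite lborel M ..
 have g: "(LBINT x. cx (?A x w)) = cx (?D w)" for w
  using Gamma_integral_log_real(2)[OF d b[of w]] by (simp only: integral_complex_of_real)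
 have gn: "(NN x. ennreal (?A x w)) = ennreal (?D w)" for w
  using Gamma_integral_log_real[OF d b[of w]] by (subst nn_integral_eq_integral) auto
 show int2: "integrable (lborel \<Otimes>\<^sub>M M) (%(x, w). f w * cx (?A x w))"
 proof (rule integrableI_bounded)
  have "?C
    = (\<integral>\<^sup>+w. (?F w) \<partial>M)"
   by (subst P.nn_integral_snd[symmetric]) (auto simp: norm_mult ennreal_mult)
  also have "... = (\<integral>\<^sup>+w. ennreal (Gamma d) * norm (?B w) \<partial>M)"
  proof (rule nn_integral_cong)
   fix w
   have "(?F w) = norm (f w) * (NN x. ennreal (?A x w))"
    by (rule nn_integral_cmult) measurable
   also have "... = norm (f w) * ennreal (?D w)" unfolding gn ..
   also have "... = ennreal (norm (f w) * (?D w))" by (rule ennreal_mult'[symmetric]) simp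
   also have "norm (f w) * (?D w) = Gamma d * norm (?B w)" by (simp add: norm_mult)
   also have "ennreal ... = ennreal (Gamma d) * norm (?B w)" using Gamma_real_pos[OF d] by (intro ennreal_mult') simp
   finally show "(?F w) = ennreal (Gamma d) * norm (?B w)" .
  qed
  also have "... = ennreal (Gamma d) * (\<integral>\<^sup>+w. norm (?B w) \<partial>M)" by (rule nn_integral_cmult) measurable
  also have "... < \<infinity>" using int by (auto simp: integrable_iff_bounded ennreal_mult_less_top)
  finally show "?C < \<infinity>" .
 qed measurable
 have "?E = (\<integral>w. (LBINT x. f w * cx (?A x w)) \<partial>M)"
  by (rule P.Fubini_integral[symmetric]) (use int2 in simp)
 also have "... = (\<integral>w. cx (Gamma d) * (?B w) \<partial>M)"
 proof (rule lintegral_cong[OF refl])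
  fix w
  have "(LBINT x. f w * cx (?A x w)) = f w * (LBINT x. cx (?A x w))" by (rule integral_mult_right_zero)
  also have "... = cx (Gamma d) * (?B w)" unfolding g by simp
  finally show "(LBINT x. f w * cx (?A x w)) = cx (Gamma d) * (?B w)" .
 qed
 finally show "?E = cx (Gamma d) * (\<integral>w. f w * cx (b w powr (- d)) \<partial>M)"
  by simp
qed

text \<open>A Beta integral. In a product of two Gamma integrals the rotation turns exp x + exp y
  into \<open>(2 * cosh p) * exp m\<close>; integrating out \<open>m\<close> leaves
  \<open>Gamma d\<close> times the integral sought.\<close>

lemma cosh_powr_integral:
 assumes d: "d > (abs (Re nu))"
 shows "(LBINT w. exp (nu * cx w) * cx (cosh w powr (- d))) =
   cx (2 powr (d - 1) / Gamma d) * Gamma ((cx d + nu) / 2) * Gamma ((cx d - nu) / 2)"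
proof -
 let ?A = "LBINT w. exp (nu * cx w) * cx (cosh w powr (- d))"
 let ?B = "%f. LBINT p. (LBINT m. f (m + p) (m - p))"
 let ?C = "Gamma d * 2 powr (- d)"
 let ?D = "2 powr (d - 1) / Gamma d"
 have d0: "d > 0" using d by linarith
 define A B where "A = (cx d + nu) / 2" and "B = (cx d - nu) / 2"
 have AB: "Re A > 0" "Re B > 0" using d by (auto simp: A_def B_def)
 define f where "f x y = exp (A * cx x - cx (exp x)) * exp (B * cx y - cx (exp y))" for x y :: real
 have rot: "f (m + p) (m - p) = exp (nu * cx p) * cx (exp (d * m - (2 * cosh p) * exp m))" for m p
 proof -
  have "f (m + p) (m - p) = exp (A * cx (m + p) + B * cx (m - p) - cx (exp (m + p) + exp (m - p)))" by (simp add: f_def algebra_simps flip: exp_add)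
  also have "A * cx (m + p) + B * cx (m - p) = cx (d * m) + nu * cx p" by (simp add: A_def B_def field_simps)
  also have "exp (m + p) + exp (m - p) = (2 * cosh p) * exp m" by (simp add: cosh_def exp_add exp_diff exp_minus field_simps)
  finally show ?thesis by (simp add: exp_add exp_diff exp_minus divide_inverse mult_ac flip: exp_of_real)
 qed
 have p2: "(2 * cosh w) powr (- d) = 2 powr (- d) * cosh w powr (- d)" for w :: real by (simp add: powr_mult)
 have intc: "L1 (%w. exp (nu * cx w) * cx ((2 * cosh w) powr (- d)))"
  using integrable_mult_right[OF cosh_powr_integrable[OF d], of "cx (2 powr (- d))"] unfolding p2 by (simp add: mult_ac)
 note mj = mellin_joint_integrable[OF d0, of "%p. exp (nu * cx p)" lborel "%p. 2 * cosh p", OF _ _ _ _ intc]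
 have int: "integrable lborel2 (%(m, p). f (m + p) (m - p))"
  unfolding rot by (rule mj) (auto intro: lborel.sigma_finite_measure_axioms simp: cosh_real_pos)
 have "(?B f) = (LBINT m. (LBINT p. f (m + p) (m - p)))" by (rule lborel_pair.Fubini_integral) (use int in simp)
 also have "... = cx (Gamma d) * (LBINT w. exp (nu * cx w) * cx ((2 * cosh w) powr (- d)))"
  unfolding rot by (rule mj) (auto intro: lborel.sigma_finite_measure_axioms simp: cosh_real_pos)
 also have "... = cx ?C * ?A"
  unfolding p2 by (simp add: mult_ac flip: integral_mult_right_zero)
 finally have 1: "(?B f) = cx ?C * ?A" .
 have "(LBINT y. (LBINT x. f x y)) = Gamma A * Gamma B" unfolding f_def by (simp add: Gamma_integral_log(2)[OF AB(1)] Gamma_integral_log(2)[OF AB(2)])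
 moreover have "(LBINT y. (LBINT x. f x y)) = 2 * (?B f)" by (rule pair_lborel_rotate(2)[OF _ int]) (simp add: f_def)
 ultimately have "Gamma A * Gamma B = 2 * (?B f)" by (simp only:)
 then have 2: "Gamma A * Gamma B = cx (2 * ?C) * ?A"
  unfolding 1 by (simp add: mult.assoc)
 have 3: "?D * (2 * ?C) = 1" using Gamma_real_pos[OF d0] by (simp add: powr_diff powr_minus field_simps)
 have "cx ?D * Gamma A * Gamma B = cx (?D * (2 * ?C)) * ?A"
  unfolding mult.assoc 2 by simp
 then show ?thesis unfolding 3 A_def B_def by simp
qed

text \<open>The Mellin transform at \<open>al\<close> of the Macdonald function of index
  \<open>nu\<close>, see \<open>KB_mellin\<close>.\<close>

definition hm :: "real => complex => complex" where
 "hm al nu = cx (2 powr (al - 2)) * Gamma ((cx al + nu) / 2) * Gamma ((cx al - nu) / 2)"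

text \<open>The Mellin transform at \<open>de\<close> of a product of two Macdonald functions, see
  \<open>KB_mellin2\<close>. In its second index it carries the Gamma factors of the dual Hahn
  weight that belong to the parameters (de + nu)/2 and (de - nu)/2.\<close>

definition Mm :: "real => complex => complex => complex" where
 "Mm de nu nu' = cx (2 powr (1 - de) / Gamma de) * hm de (nu + nu') * hm de (nu - nu')"

lemma KB_mellin:
 assumes a: "al > (abs (Re nu))"
 shows "L1 (%x. cx (exp (al * x)) * KB nu x)"
  and "(LBINT x. cx (exp (al * x)) * KB nu x) = hm al nu"
proof -
 let ?A = "%x w. exp (al * x - cosh w * exp x)"
 let ?B = "LBINT w. exp (nu * cx w) * cx (cosh w powr (- al))"
 have a0: "al > 0" using a by linarith
 note mj = mellin_joint_integrable[OF a0, of "%p. exp (nu * cx p)" lborel "%p. cosh p", OF _ _ _ _ cosh_powr_integrable[OF a]]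
 have eq: "(LBINT w. exp (nu * cx w) * cx (?A x w)) = 2 * (cx (exp (al * x)) * KB nu x)" for x
 proof -
  have "exp (nu * cx w) * cx (?A x w) = cx (exp (al * x)) * kern nu x w" for w
   by (simp add: exp_diff mult.commute[of "exp x"] flip: exp_of_real)
  then show ?thesis unfolding KB_def by simp
 qed
 have i: "integrable lborel2 (%(x, w). exp (nu * cx w) * cx (?A x w))"
  by (rule mj) (auto intro: lborel.sigma_finite_measure_axioms simp: cosh_real_pos)
 from lborel_pair.integrable_fst[OF i[unfolded]]
 have "L1 (%x. 2 * (cx (exp (al * x)) * KB nu x))" by (simp add: eq)
 from integrable_mult_right[OF this, of "1/2"]
 show "L1 (%x. cx (exp (al * x)) * KB nu x)" by (simp del: of_real_exp exp_of_real)
 have "(LBINT x. (LBINT w. exp (nu * cx w) * cx (?A x w))) = cx (Gamma al) * ?B"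
  by (rule mj) (auto intro: lborel.sigma_finite_measure_axioms simp: cosh_real_pos)
 then have "2 * (LBINT x. cx (exp (al * x)) * KB nu x) = cx (Gamma al) * ?B" unfolding eq by simp
 also have "... = 2 * hm al nu"
 proof -
  have "Gamma al * (2 powr (al - 1) / Gamma al) = 2 * 2 powr (al - 2)" using Gamma_real_pos[OF a0] by (simp add: powr_diff)
  then have "cx (Gamma al) * cx (2 powr (al - 1) / Gamma al) = 2 * cx (2 powr (al - 2))" by (metis of_real_mult of_real_numeral)
  then show ?thesis unfolding cosh_powr_integral[OF a] hm_def mult.assoc[symmetric] by (simp only:)
 qed
 finally show "(LBINT x. cx (exp (al * x)) * KB nu x) = hm al nu" by simp
qed

lemma KR_mellin_integrable:
 assumes "al > (abs s)"
 shows "L1 (%x. exp (al * x) * KR s x)"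
proof -
 have "L1 (%x. cx (exp (al * x)) * KB (cx s) x)" using assms by (intro KB_mellin(1)) simp
 then have "L1 (%x. cx (exp (al * x) * KR s x))" by (simp only: KB_of_real of_real_mult)
 then show ?thesis by (simp only: complex_of_real_integrable_eq)
qed

section \<open>Shifting the contour\<close>

lemma Re_cosh: "Re (cosh z) = cosh (Re z) * cos (Im z)" by (simp add: cosh_def Re_exp field_simps)

lemma cosh_shift_ge: "cosh w <= exp (abs t) * cosh (w + t)" for w t :: real
proof -
 have "exp w <= exp (abs t) * exp (w + t)" "exp (- w) <= exp (abs t) * exp (- (w + t))" by (simp_all flip: exp_add)
 then show ?thesis by (simp add: cosh_def algebra_simps)
qed

text \<open>The integrand of \<open>KB\<close> translated by the complex number \<open>ze\<close>.
  For \<open>abs (Im ze) < pi / 2\<close> the real part of the cosh still tends to +infinity at both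
  ends.\<close>

definition KF :: "complex => real => real => complex => complex" where
 "KF nu x w ze = exp (nu * (cx w + ze) - cx (exp x) * cosh (cx w + ze))"

abbreviation KS :: "complex set" where
 "KS \<equiv> {ze. - (pi/2) < Im ze & Im ze < pi/2}"

lemma open_KS: "open KS" by (intro open_Collect_conj open_Collect_less continuous_intros)

lemma connected_KS: "connected KS"
proof -
 have "KS = {ze. - (pi/2) < Im ze} \<inter> {ze. Im ze < pi/2}" by auto
 then show ?thesis using convex_halfspace_Im_gt[of "- (pi/2)"] convex_halfspace_Im_lt[of "pi/2"] by (simp add: convex_Int convex_connected)
qed

lemma norm_KF: "norm (KF nu x w ze) = exp (Re nu * w + Re (nu * ze) - exp x * (cosh (w + Re ze) * cos (Im ze)))"
proof -
 have "Re (nu * (cx w + ze) - cx (exp x) * cosh (cx w + ze)) =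
   Re nu * w + Re (nu * ze) - exp x * Re (cosh (cx w + ze))" by (simp add: algebra_simps)
 also have "Re (cosh (cx w + ze)) = cosh (w + Re ze) * cos (Im ze)" unfolding Re_cosh by simp
 finally show ?thesis by (simp add: KF_def norm_exp_eq_Re)
qed

lemma borel_measurable_KF [measurable]: "(%w. KF nu x w ze) \<in> borel_measurable borel" unfolding KF_def cosh_def by measurable

lemma KF_dominated:
 assumes z: "z \<in> KS"
 shows "\<exists>r>0. \<exists>g. cball z r \<subseteq> KS & L1 g & (\<forall>w. \<forall>ze\<in>cball z r. norm (KF nu x w ze) <= g w)"
proof -
 define r where "r = (pi/2 - abs (Im z)) / 2"
 define b where "b = abs (Im z) + r"
 have r: "r > 0" and b: "0 <= b" "b < pi/2" using z by (auto simp: r_def b_def field_simps)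
 \<comment> \<open>A lower bound for the cosine of the imaginary part on the disc; as a factor of
   cosh it can be absorbed into the argument of the exponential as \<open>ln ka\<close>.\<close>
 define ka where "ka = cos b"
 have ka: "ka > 0" unfolding ka_def using b pi_gt_zero by (intro cos_gt_zero_pi) linarith+
 define R where "R = norm z + r"
 have Im: "abs (Im ze) <= b" and nz: "norm ze <= R" if "ze \<in> cball z r" for ze
 proof -
  have "norm (z - ze) <= r" using that by (simp add: dist_norm)
  then show "abs (Im ze) <= b" "norm ze <= R"
   using abs_Im_le_cmod[of "z - ze"] norm_triangle_ineq3[of ze z] by (auto simp: b_def R_def norm_minus_commute)
 qed
 define g where "g w = exp (norm nu * R) * exp (Re nu * w - exp (x + ln ka - R) * cosh w)" for w
 have "cball z r \<subseteq> KS" using Im b by fastforce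
 moreover have "L1 g" unfolding g_def by (intro integrable_mult_right KR_integrable)
 moreover have "norm (KF nu x w ze) <= g w" if "ze \<in> cball z r" for w ze
 proof -
  have "cos b <= cos (abs (Im ze))" using Im[OF that] b by (intro cos_monotone_0_pi_le) auto
  then have c: "ka <= cos (Im ze)" by (simp add: ka_def)
  have "abs (Re ze) <= R" using nz[OF that] abs_Re_le_cmod[of ze] by linarith
  then have "exp (- R) * cosh w <= exp (- abs (Re ze)) * cosh w" by (intro mult_right_mono) auto
  also have "... <= exp (- abs (Re ze)) * (exp (abs (Re ze)) * cosh (w + Re ze))" by (intro mult_left_mono cosh_shift_ge) auto
  also have "... = cosh (w + Re ze)" by (simp add: exp_minus)
  finally have ch: "exp (- R) * cosh w <= cosh (w + Re ze)" .
  have "(exp (- R) * cosh w) * ka <= cosh (w + Re ze) * cos (Im ze)" using ch c ka by (intro mult_mono) auto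
  then have "exp x * ((exp (- R) * cosh w) * ka) <= exp x * (cosh (w + Re ze) * cos (Im ze))" by (intro mult_left_mono) auto
  moreover have "exp x * ((exp (- R) * cosh w) * ka) = exp (x + ln ka - R) * cosh w" using ka by (simp add: exp_add exp_diff exp_minus field_simps)
  moreover have "Re (nu * ze) <= norm nu * R"
  proof -
   have "Re (nu * ze) <= norm nu * norm ze" by (metis complex_Re_le_cmod norm_mult)
   also have "... <= norm nu * R" using nz[OF that] by (intro mult_left_mono) auto
   finally show ?thesis .
  qed
  ultimately show ?thesis unfolding norm_KF g_def exp_add[symmetric] exp_le_cancel_iff by linarith
 qed
 ultimately show ?thesis using r by blast
qed

lemma KF_holomorphic: "KF nu x w holomorphic_on KS" unfolding KF_def[abs_def] cosh_def by (intro holomorphic_intros)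

lemma KF_deriv: "deriv (KF nu x w) 0 = (nu - cx (exp x * sinh w)) * kern nu x w"
proof -
 have cs: "cosh (cx w) = cx (cosh w)" "sinh (cx w) = cx (sinh w)" by (simp_all add: cosh_def sinh_def scaleR_conv_of_real flip: exp_of_real)
 have "(KF nu x w has_field_derivative (exp (nu * (cx w + 0) - cx (exp x) * cosh (cx w + 0)) *
   (nu - cx (exp x) * sinh (cx w + 0)))) (at 0)" unfolding KF_def[abs_def] by (auto intro!: derivative_eq_intros)
 from DERIV_imp_deriv[OF this] show ?thesis by (simp only: add_0_right cs of_real_mult mult.commute)
qed

text \<open>For real \<open>z\<close> this is translation invariance of Lebesgue measure. The
  integral is holomorphic in \<open>z\<close> on the strip, hence constant there, and no contour has
  to be closed.\<close>

lemma KF_integral_const: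
 assumes "z \<in> KS"
 shows "(LBINT w. KF nu x w z) = 2 * KB nu x"
proof -
 have real: "(LBINT w. KF nu x w (cx t)) = 2 * KB nu x" for t
 proof -
  have "(LBINT w. KF nu x w (cx t)) = (LBINT w. KF nu x (t + 1 * w) 0)" by (intro lintegral_cong) (simp_all add: KF_def add.commute)
  also have "... = (LBINT w. KF nu x w 0)" using lborel_integral_real_affine[of 1 "%w. KF nu x w 0" t] by simp
  also have "... = 2 * KB nu x"
  proof -
   have "cosh (cx w) = cx (cosh w)" for w by (simp add: cosh_def scaleR_conv_of_real flip: exp_of_real)
   then show ?thesis unfolding KF_def KB_def by simp
  qed
  finally show ?thesis .
 qed
 show ?thesis
 proof (rule holomorphic_equal_on_line[OF open_KS connected_KS, where l = "-1" and r = 1 and sg = 0 and d = 1 and z = z])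
  show "(%z. (LBINT w. KF nu x w z)) holomorphic_on KS"
   by (rule holomorphic_on_integral_parameter[OF open_KS]) (simp_all only: KF_holomorphic KF_dominated borel_measurable_KF measurable_lborel2)
  show "(LBINT w. KF nu x w (0 + cx t * 1)) = 2 * KB nu x" for t using real[of t] by simp
 qed (use assms in auto)
qed

text \<open>At \<open>z = iu te\<close> the factor \<open>exp (nu * z)\<close> contributes
  \<open>exp (- te * Im nu)\<close>, while cosh loses the factor \<open>cos te\<close>, which in the
  logarithmic variable is the shift by \<open>ln (cos te)\<close>.\<close>

lemma KB_contour_shift:
 assumes th: "abs te < pi/2"
 shows "norm (KB nu x) <= exp (- te * Im nu) * KR (Re nu) (x + ln (cos te))"
proof -
 have c: "cos te > 0" using th by (intro cos_gt_zero_pi) auto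
 have "2 * norm (KB nu x) = norm (LBINT w. KF nu x w (iu te))" using th by (subst KF_integral_const) (auto simp: norm_mult)
 also have "... <= (LBINT w. norm (KF nu x w (iu te)))" by (rule integral_norm_bound)
 also have "... = (LBINT w. exp (- te * Im nu) * exp (Re nu * w - exp (x + ln (cos te)) * cosh w))" using c by (intro lintegral_cong refl)
   (simp add: norm_KF exp_add[symmetric] algebra_simps exp_add[of x])
 also have "... = 2 * (exp (- te * Im nu) * KR (Re nu) (x + ln (cos te)))" by (simp add: KR_def)
 finally show ?thesis by simp
qed

text \<open>The angle is chosen so that \<open>cos th0 = exp (- 1)\<close>; what matters is \<open>pi/3 < th0 < pi/2\<close>.\<close>

definition th0 :: real where "th0 = arccos (exp (- 1))"

abbreviation E0 :: "real => real" where
 "E0 v \<equiv> exp (- th0 * abs v)"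

lemma th0: "cos th0 = exp (- 1)" "pi / 3 < th0" "th0 < pi / 2"
proof -
 have e: "exp (- 1) < (1/2 :: real)" "exp (- 1) > (0::real)"
  using exp_ge_add_one_self[of "1::real"] e_approx_32 by (auto simp: exp_minus field_simps abs_if split: if_splits)
 show "cos th0 = exp (- 1)" unfolding th0_def using e by (intro cos_arccos) linarith+
 have "arccos (1/2) < arccos (exp (- 1))" using e by (intro arccos_less_arccos) linarith+
 moreover have "arccos (1/2) = pi/3" using arccos_cos[of "pi/3"] by (simp add: cos_60)
 ultimately show "pi / 3 < th0" by (simp add: th0_def)
 have "arccos (exp (- 1)) < arccos 0" using e by (intro arccos_less_arccos) linarith+
 then show "th0 < pi / 2" by (simp add: th0_def)
qed

text \<open>The sign of the angle is taken according to that of \<open>Im nu\<close>. Since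
  \<open>ln (cos th0) = - 1\<close>, the shift of the argument is by one; this is the origin of
  \<open>x - 1\<close> in \<open>KR0\<close>.\<close>

lemma KB_decay: "norm (KB nu x) <= exp (- th0 * abs (Im nu)) * KR (Re nu) (x - 1)"
proof -
 have 1: "norm (KB nu x) <= exp (- th0 * Im nu) * KR (Re nu) (x - 1)" using KB_contour_shift[of th0 nu x] th0 pi_gt_zero by simp
 have 2: "norm (KB nu x) <= exp (th0 * Im nu) * KR (Re nu) (x - 1)" using KB_contour_shift[of "- th0" nu x] th0 pi_gt_zero by simp
 show ?thesis using 1 2 by (cases "Im nu >= 0") auto
qed

text \<open>The derivative at \<open>0\<close> of the constant function in
  \<open>KF_integral_const\<close>; it plays the part of an integration by parts.\<close>

lemma KB_sinh:
 "L1 (%w. cx (exp x * sinh w) * kern nu x w)"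
 "(LBINT w. cx (exp x * sinh w) * kern nu x w) = 2 * nu * KB nu x"
proof -
 let ?A = "LBINT w. cx (exp x * sinh w) * kern nu x w"
 have eq: "cx (exp x * sinh w) * kern nu x w =
   cx (exp x / 2) * (exp ((nu + 1) * cx w - cx (exp x * cosh w)) - exp ((nu - 1) * cx w - cx (exp x * cosh w)))" for w
 proof -
  define c where "c = cx (exp x * cosh w)"
  have "cx (exp x * sinh w) = cx (exp x / 2) * (exp (cx w) - exp (- cx w))" by (simp add: sinh_def flip: exp_of_real)
  moreover have "(exp (cx w) - exp (- cx w)) * exp (nu * cx w - c) = exp ((nu + 1) * cx w - c) - exp ((nu - 1) * cx w - c)"
   by (simp add: left_diff_distrib distrib_right algebra_simps flip: exp_add)
  ultimately show ?thesis unfolding c_def[symmetric] by (simp only: mult.assoc)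
 qed
 show i: "L1 (%w. cx (exp x * sinh w) * kern nu x w)" unfolding eq by (intro integrable_mult_right lintegrable_diff KB_integrable)
 have "((%z. (LBINT w. KF nu x w z)) has_field_derivative (LBINT w. deriv (KF nu x w) 0)) (at 0)"
  by (rule has_field_derivative_integral_parameter(1)[OF open_KS]) (simp_all only: KF_holomorphic KF_dominated borel_measurable_KF measurable_lborel2, simp)
 moreover have "((%z. (LBINT w. KF nu x w z)) has_field_derivative 0) (at 0)"
 proof (rule has_field_derivative_transform_within_open[OF _ open_KS])
  show "((%z. 2 * KB nu x) has_field_derivative 0) (at 0)" by simp
 qed (auto simp: KF_integral_const)
 ultimately have "(LBINT w. deriv (KF nu x w) 0) = 0" by (rule DERIV_unique)
 then have "0 = (LBINT w. nu * kern nu x w - cx (exp x * sinh w) * kern nu x w)" unfolding KF_deriv left_diff_distrib by simp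
 also have "... = (LBINT w. nu * kern nu x w) - ?A"
  by (intro lintegral_diff i integrable_mult_right KB_integrable)
 also have "(LBINT w. nu * kern nu x w) = 2 * nu * KB nu x" by (simp add: KB_def)
 finally show "?A = 2 * nu * KB nu x" by simp
qed

section \<open>Fourier inversion\<close>

lemma gaussian_integral_complex:
 fixes z :: complex
 assumes b: "b > 0"
 shows "(LBINT v. exp (z * cx v) * cx (exp (- b * v^2))) = cx (sqrt (pi / b)) * exp (z^2 / cx (4 * b))"
proof -
 define R where "R = abs (Re z) + 1"
 show ?thesis
 proof (rule holomorphic_equal_on_line[OF open_strip connected_strip, where l = "- R" and r = R and sg = 0 and d = 1 and z = z])
  show "(%z. (LBINT v. exp (z * cx v) * cx (exp (- b * v^2)))) holomorphic_on {z. - R < Re z & Re z < R}"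
  proof (rule holomorphic_on_laplace)
   fix s
   have "(%w. exp (s * w) * norm (cx (exp (- b * w^2)))) = (%w. exp (- b * w^2 + s * w))"
    by (simp add: fun_eq_iff exp_add[symmetric] add.commute del: of_real_exp)
   then show "L1 (%w. exp (s * w) * norm (cx (exp (- b * w^2))))" using gaussian_integral(1)[OF b, of s] by simp
  qed measurable
  show "(%z. cx (sqrt (pi / b)) * exp (z^2 / cx (4 * b))) holomorphic_on {z. - R < Re z & Re z < R}" using b by (intro holomorphic_intros) auto
  fix t :: real
  have "(LBINT v. exp (cx t * cx v) * cx (exp (- b * v^2))) = (LBINT v. cx (exp (- b * v^2 + t * v)))"
   by (intro lintegral_cong refl) (simp add: exp_add[symmetric] add.commute flip: exp_of_real)
  also have "... = cx (sqrt (pi / b) * exp (t^2 / (4 * b)))" using gaussian_integral(2)[OF b, of t] by (simp only: integral_complex_of_real)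
  also have "... = cx (sqrt (pi / b)) * exp ((cx t)^2 / cx (4 * b))" by (simp flip: exp_of_real)
  finally show "(LBINT v. exp ((0 + cx t * 1) * cx v) * cx (exp (- b * v^2))) = cx (sqrt (pi / b)) * exp ((0 + cx t * 1)^2 / cx (4 * b))" by simp
 qed (auto simp: R_def)
qed

text \<open>Gaussian damping in \<open>v\<close> makes Fubini applicable, and the integral over
  \<open>v\<close> becomes an approximate identity at \<open>y\<close>. Integrability of
  \<open>F\<close> controls the limit on one side, continuity at \<open>y\<close> and the bound
  \<open>B\<close> on the other.\<close>

lemma fourier_inversion:
 fixes f F :: "real => complex"
 assumes f: "L1 f" and cont: "isCont f y" and bnd: "!!w. norm (f w) <= B"
  and F: "!!v. F v = (LBINT w. f w * exp (iu v * cx w))" and Fi: "L1 F"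
 shows "(LBINT v. F v * exp (- (iu v * cx y))) = cx (2 * pi) * f y"
proof -
 let ?A = "%q. exp (- (1/2) * q^2)"
 let ?B = "%v. - (iu v * cx y)"
 let ?C = "%e n. LBINT q. f (y + e n * q) * cx (?A q)"
 let ?D = "%v b. LBINT w. f w * (exp (iu (w - y) * cx v) * cx (exp (- b * v^2)))"
 let ?E = "%v e. %n. F v * exp (?B v) * cx (exp (- (e n)\<^sup>2 / 2 * v^2))"
 let ?F = "LBINT q. f y * cx (?A q)"
 have [measurable]: "f \<in> borel_measurable borel" "F \<in> borel_measurable borel" using f Fi by auto
 define e where "e n = 1 / real (Suc n)" for n
 have e: "e n > 0" for n by (simp add: e_def)
 have e0: "e \<longlonglongrightarrow> 0" unfolding e_def by real_asymp
 define G where "G n = (LBINT v. F v * exp (?B v) * cx (exp (- (e n)\<^sup>2 / 2 * v^2)))" for n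
 have "G \<longlonglongrightarrow> (LBINT v. F v * exp (?B v))" unfolding G_def
 proof (rule integral_dominated_convergence[where w = "%v. norm (F v)"])
  show "AE v in lborel. (?E v e) \<longlonglongrightarrow> F v * exp (?B v)"
  proof (intro AE_I2)
   fix v :: real
   have "(?E v e) \<longlonglongrightarrow> F v * exp (?B v) * cx (exp (- (0::real)\<^sup>2 / 2 * v^2))"
    by (intro tendsto_intros e0) auto
   then show "(?E v e) \<longlonglongrightarrow> F v * exp (?B v)" by simp
  qed
  show "AE v in lborel. norm (F v * exp (?B v) * cx (exp (- (e n)\<^sup>2 / 2 * v^2))) <= norm (F v)" for n
   by (intro AE_I2) (simp add: norm_mult norm_exp_eq_Re mult_left_le del: of_real_exp)
 qed (use Fi in auto)
 moreover have "G \<longlonglongrightarrow> cx (2 * pi) * f y"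
 proof -
  have Gn: "G n = cx (sqrt (2 * pi)) * (?C e n)" for n
  proof -
   define b where "b = (e n)^2 / 2"
   have b: "b > 0" using e[of n] by (simp add: b_def)
   have prodi: "integrable lborel2 (%(w, v). f w * cx (exp (- b * v^2)))"
   proof (rule integrable_prod_pair[OF f])
    have "L1 (%v. exp (- b * v^2 + 0 * v))" by (rule gaussian_integral(1)[OF b])
    then have "L1 (%v. exp (- b * v^2))" by simp
    then show "L1 (%v. cx (exp (- b * v^2)))" by (simp only: complex_of_real_integrable_eq)
   qed
   have i2: "integrable lborel2 (%(w, v). f w * (exp (iu (w - y) * cx v) * cx (exp (- b * v^2))))" by (rule lintegrable_bound[OF prodi])
     (auto simp: norm_mult norm_exp_eq_Re simp del: of_real_exp intro!: AE_I2)
   have "G n = (LBINT v. (?D v b))" unfolding G_def F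
   proof (rule lintegral_cong[OF refl])
    fix v :: real
    have "(LBINT w. f w * exp (iu v * cx w)) * exp (?B v) * cx (exp (- (e n)\<^sup>2 / 2 * v^2))
     = (LBINT w. f w * exp (iu v * cx w) * (exp (?B v) * cx (exp (- (e n)\<^sup>2 / 2 * v^2))))"
     by (subst integral_mult_left_zero) (simp only: mult.assoc)
    also have "... = (?D v b)"
    proof (rule lintegral_cong[OF refl])
     fix w :: real
     have "exp (iu v * cx w) * exp (?B v) = exp (iu (w - y) * cx v)" by (simp add: algebra_simps flip: exp_add)
     moreover have "- (e n)\<^sup>2 / 2 * v^2 = - b * v^2" by (simp add: b_def)
     ultimately show "f w * exp (iu v * cx w) * (exp (?B v) * cx (exp (- (e n)\<^sup>2 / 2 * v^2))) =
      f w * (exp (iu (w - y) * cx v) * cx (exp (- b * v^2)))" by (metis mult.assoc)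
    qed
    finally show "(LBINT w. f w * exp (iu v * cx w)) * exp (?B v) * cx (exp (- (e n)\<^sup>2 / 2 * v^2)) =
     (?D v b)" .
   qed
   also have "... = (LBINT w. (LBINT v. f w * (exp (iu (w - y) * cx v) * cx (exp (- b * v^2)))))" by (rule lborel_pair.Fubini_integral[OF i2])
   also have "... = (LBINT w. f w * (cx (sqrt (pi / b)) * exp ((iu (w - y))^2 / cx (4 * b))))"
    by (simp only: integral_mult_right_zero gaussian_integral_complex[OF b])
   also have "... = abs (e n) *\<^sub>R (LBINT q. f (y + e n * q) * (cx (sqrt (pi / b)) * exp ((iu ((y + e n * q) - y))^2 / cx (4 * b))))"
    by (rule lborel_integral_real_affine) (use e[of n] in simp)
   also have "... = cx (e n) * (LBINT q. cx (sqrt (pi / b)) * (f (y + e n * q) * cx (?A q)))"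
   proof -
    have "exp ((iu ((y + e n * q) - y))^2 / cx (4 * b)) = cx (?A q)" for q
    proof -
     have "(iu ((y + e n * q) - y))^2 / cx (4 * b) = cx (- (1/2) * q^2)" using e[of n] by (simp add: b_def power_mult_distrib)
     then show ?thesis by (simp only: exp_of_real)
    qed
    then show ?thesis using e[of n] by (simp add: scaleR_conv_of_real mult.left_commute)
   qed
   also have "... = cx (e n * sqrt (pi / b)) * (?C e n)"
    by (simp only: integral_mult_right_zero of_real_mult mult.assoc)
   also have "e n * sqrt (pi / b) = sqrt (2 * pi)" using e[of n] by (simp add: b_def real_sqrt_divide real_sqrt_mult)
   finally show ?thesis .
  qed
  have "(%n. (?C e n)) \<longlonglongrightarrow> ?F"
  proof (rule integral_dominated_convergence[where w = "%q. B * exp (- (1/2) * q^2)"])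
   have "L1 (%v::real. exp (- (1/2) * v^2 + 0 * v))" by (rule gaussian_integral(1)) simp
   then show "L1 (%q::real. B * exp (- (1/2) * q^2))" by simp
   show "AE q in lborel. (%n. f (y + e n * q) * cx (?A q)) \<longlonglongrightarrow> f y * cx (?A q)"
   proof (intro AE_I2 tendsto_intros)
    fix q :: real
    have "(%n. y + e n * q) \<longlonglongrightarrow> y + 0 * q" by (intro tendsto_intros e0)
    then have "(%n. y + e n * q) \<longlonglongrightarrow> y" by simp
    with cont show "(%n. f (y + e n * q)) \<longlonglongrightarrow> f y" by (rule isCont_tendsto_compose)
   qed
   show "AE q in lborel. norm (f (y + e n * q) * cx (?A q)) <= B * exp (- (1/2) * q^2)" for n
    using bnd by (intro AE_I2) (simp add: norm_mult del: of_real_exp)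
  qed measurable
  then have "(%n. cx (sqrt (2 * pi)) * (?C e n)) \<longlonglongrightarrow> cx (sqrt (2 * pi)) * ?F"
   by (intro tendsto_intros)
  moreover have "cx (sqrt (2 * pi)) * ?F = cx (2 * pi) * f y"
  proof -
   have "(LBINT v. exp (- (1/2) * v^2 + 0 * v)) = sqrt (pi / (1/2)) * exp (0^2 / (4 * (1/2)))" by (rule gaussian_integral(2)) simp
   then have "(LBINT v. exp (- (1/2) * v^2)) = sqrt (2 * pi)" by (simp add: mult.commute)
   then have "(LBINT v. cx (exp (- (1/2) * v^2))) = cx (sqrt (2 * pi))" by (simp only: integral_complex_of_real)
   then have "cx (sqrt (2 * pi)) * ?F = f y * cx (sqrt (2 * pi) * sqrt (2 * pi))"
    by (simp only: integral_mult_right_zero of_real_mult) simp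
   also have "sqrt (2 * pi) * sqrt (2 * pi) = 2 * pi" by simp
   finally show ?thesis by simp
  qed
  moreover have "G = (%n. cx (sqrt (2 * pi)) * (?C e n))" using Gn by (rule ext)
  ultimately show ?thesis by (simp only:)
 qed
 ultimately show ?thesis by (rule LIMSEQ_unique)
qed

text \<open>After rotation of the two integration variables the sum of the cosh terms becomes the
  product \<open>2 * cosh m * cosh p\<close>. The integral over \<open>x\<close> raises it to the
  power \<open>- de\<close>, and two Beta integrals remain, with indices \<open>nu + nu'\<close> and
  \<open>nu - nu'\<close>.\<close>

lemma KB_mellin2:
 assumes d: "de > (abs (Re nu)) + abs (Re nu')"
 shows "L1 (%x. cx (exp (de * x)) * (KB nu x * KB nu' x))"
  and "(LBINT x. cx (exp (de * x)) * (KB nu x * KB nu' x)) = Mm de nu nu'"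
proof -
 let ?A = "2 powr (de - 1) / Gamma de"
 let ?B = "%m. exp ((nu + nu') * cx m) * cx (cosh m powr (- de))"
 let ?C = "%p. exp ((nu - nu') * cx p) * cx (cosh p powr (- de))"
 let ?D = "%p x. Re (nu - nu') * p - exp x * cosh p"
 let ?E = "LBINT m. exp ((nu + nu') * cx m) * cx (cosh m powr (- de))"
 let ?F = "LBINT p. exp ((nu - nu') * cx p) * cx (cosh p powr (- de))"
 let ?G = "LBINT x. cx (exp (de * x)) * (KB nu x * KB nu' x)"
 let ?H = "%m x. Re (nu + nu') * m - exp x * cosh m"
 have d0: "de > 0" and dp: "de > (abs (Re (nu + nu')))" and dm: "de > (abs (Re (nu - nu')))" using d by auto
 let ?Z = "lborel2 :: (real \<times> real) measure"
 have sf: "sigma_finite_measure ?Z" by (rule lborel_pair.sigma_finite_measure_axioms)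
 define E where "E z = exp ((nu + nu') * cx (fst z)) * exp ((nu - nu') * cx (snd z))" for z :: "real \<times> real"
 define b where "b z = 2 * cosh (fst z) * cosh (snd z)" for z :: "real \<times> real"
 have [measurable]: "E \<in> borel_measurable ?Z" "b \<in> borel_measurable ?Z" unfolding E_def b_def by measurable
 have b0: "b z > 0" for z by (simp add: b_def cosh_real_pos)
 have Eb: "E z * cx (b z powr (- de)) = cx (2 powr (- de)) * (case z of (m, p) => (?B m) * (?C p))" for z
  by (simp add: E_def b_def powr_mult split: prod.split)
 have ip: "integrable ?Z (%(m, p). (?B m) * (?C p))"
  by (rule integrable_prod_pair[OF cosh_powr_integrable[OF dp] cosh_powr_integrable[OF dm]])
 have iE: "integrable ?Z (%z. E z * cx (b z powr (- de)))" unfolding Eb by (rule integrable_mult_right[OF ip])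
 have vE: "(\<integral>z. E z * cx (b z powr (- de)) \<partial>?Z) = cx (2 powr (- de)) * (?E * ?F)"
 proof -
  have "(\<integral>z. (case z of (m, p) => (?B m) * (?C p)) \<partial>?Z)
    = (LBINT m. (LBINT p. (?B m) * (?C p)))"
   using lborel_pair.integral_fst'[OF ip] by simp
  also have "... = ?E * ?F"
   by (simp only: integral_mult_right_zero integral_mult_left_zero)
  finally show ?thesis unfolding Eb integral_mult_right_zero by simp
 qed
 have KK: "integrable ?Z (%z. E z * cx (exp (- b z * exp x))) &
   KB nu x * KB nu' x = (\<integral>z. E z * cx (exp (- b z * exp x)) \<partial>?Z) / 2" for x
 proof -
  define f where "f r w = exp (nu * cx r - cx (exp x * cosh r)) * exp (nu' * cx w - cx (exp x * cosh w))" for r w :: real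
  have rot: "f (m + p) (m - p) = E (m, p) * cx (exp (- b (m, p) * exp x))" for m p
  proof -
   have "cosh (m + p) + cosh (m - p) = b (m, p)" by (simp add: b_def cosh_add cosh_diff)
   then have bb: "exp x * cosh (m + p) + exp x * cosh (m - p) = b (m, p) * exp x" by (metis distrib_left mult.commute)
   have "f (m + p) (m - p) = exp ((nu + nu') * cx m + (nu - nu') * cx p - cx (exp x * cosh (m + p) + exp x * cosh (m - p)))"
    unfolding f_def exp_add[symmetric] by (intro arg_cong[where f = exp]) (simp add: algebra_simps)
   also have "... = E (m, p) * cx (exp (- b (m, p) * exp x))"
    unfolding bb E_def fst_conv snd_conv exp_add[symmetric] exp_of_real[symmetric] by (intro arg_cong[where f = exp]) simp
   finally show ?thesis .
  qed
  have irot: "integrable ?Z (%(m, p). f (m + p) (m - p))"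
  proof (rule lintegrable_bound)
   show "integrable ?Z (%(m, p). exp (?H m x) * exp (?D p x))"
    by (intro integrable_prod_pair KR_integrable)
   show "(%(m, p). f (m + p) (m - p)) \<in> borel_measurable ?Z" unfolding f_def by measurable
   show "AE z in ?Z. norm (case z of (m, p) => f (m + p) (m - p)) <= norm (case z of (m, p) => exp (?H m x) * exp (?D p x))"
   proof (intro AE_I2, clarify)
    fix m p :: real
    \<comment> \<open>\<open>cosh m + cosh p <= 2 * cosh m * cosh p\<close> separates the variables
      in the dominating function.\<close>
    have "1 * cosh m <= cosh p * cosh m" "1 * cosh p <= cosh m * cosh p" by (intro mult_right_mono cosh_real_ge_1 cosh_real_nonneg)+
    moreover have "b (m, p) = cosh p * cosh m + cosh m * cosh p" by (simp add: b_def)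
    ultimately have "cosh m + cosh p <= b (m, p)" by linarith
    then have "exp x * (cosh m + cosh p) <= exp x * b (m, p)" by (intro mult_left_mono) auto
    then have "exp (Re (nu + nu') * m + Re (nu - nu') * p - b (m, p) * exp x) <= exp (Re (nu + nu') * m - exp x * cosh m + (?D p x))"
     by (simp add: algebra_simps)
    moreover have "norm (f (m + p) (m - p)) = exp (Re (nu + nu') * m + Re (nu - nu') * p - b (m, p) * exp x)"
     by (simp only: rot E_def fst_conv snd_conv norm_mult norm_exp_eq_Re norm_of_real abs_exp_cancel exp_add[symmetric]) (simp add: algebra_simps)
    ultimately show "norm (f (m + p) (m - p)) <= norm (exp (?H m x) * exp (?D p x))"
     by (simp add: exp_add)
   qed
  qed
  have "KB nu x * KB nu' x = (LBINT w. (LBINT r. f r w)) / 4" unfolding f_def KB_def by simp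
  also have "(LBINT w. (LBINT r. f r w)) = 2 * (LBINT p. (LBINT m. f (m + p) (m - p)))" by (rule pair_lborel_rotate(2)[OF _ irot]) (simp add: f_def)
  also have "(LBINT p. (LBINT m. f (m + p) (m - p))) = (\<integral>z. (case z of (m, p) => f (m + p) (m - p)) \<partial>?Z)"
   using lborel_pair.integral_snd[of "%m p. f (m + p) (m - p)"] irot by simp
  finally have "KB nu x * KB nu' x = (\<integral>z. E z * cx (exp (- b z * exp x)) \<partial>?Z) / 2" unfolding rot by (simp add: case_prod_unfold)
  with irot show ?thesis unfolding rot by (simp add: case_prod_unfold)
 qed
 have rw: "(\<integral>z. E z * cx (exp (de * x - b z * exp x)) \<partial>?Z) = 2 * (cx (exp (de * x)) * (KB nu x * KB nu' x))" for x
 proof -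
  define J where "J = (\<integral>z. E z * cx (exp (- b z * exp x)) \<partial>?Z)"
  have "exp (de * x - b z * exp x) = exp (de * x) * exp (- b z * exp x)" for z by (simp add: exp_add[symmetric])
  then have "E z * cx (exp (de * x - b z * exp x)) = cx (exp (de * x)) * (E z * cx (exp (- b z * exp x)))" for z
   by (simp only: of_real_mult mult.left_commute)
  then have "(\<integral>z. E z * cx (exp (de * x - b z * exp x)) \<partial>?Z) = cx (exp (de * x)) * J"
   unfolding J_def by (simp only: integral_mult_right_zero)
  moreover have "KB nu x * KB nu' x = J / 2" using KK[of x] unfolding J_def by (rule conjunct2)
  ultimately show ?thesis by (simp add: mult.commute)
 qed
 interpret P: pair_sigma_finite lborel ?Z using sf lborel.sigma_finite_measure_axioms by (simp add: pair_sigma_finite_def)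
 have i: "integrable (lborel \<Otimes>\<^sub>M ?Z) (%(x, z). E z * cx (exp (de * x - b z * exp x)))"
  by (rule mellin_joint_integrable(1)[OF d0 _ _ b0 sf iE]) measurable
 have "L1 (%x. 2 * (cx (exp (de * x)) * (KB nu x * KB nu' x)))" using P.integrable_fst'[OF i] by (simp add: rw del: of_real_exp)
 from integrable_mult_right[OF this, of "1/2"]
 show "L1 (%x. cx (exp (de * x)) * (KB nu x * KB nu' x))" by (simp del: of_real_exp)
 have "(LBINT x. (\<integral>z. E z * cx (exp (de * x - b z * exp x)) \<partial>?Z)) = cx (Gamma de) * (\<integral>z. E z * cx (b z powr (- de)) \<partial>?Z)"
  by (rule mellin_joint_integrable(2)[OF d0 _ _ b0 sf iE]) measurable
 then have 1: "2 * ?G = cx (Gamma de) * (\<integral>z. E z * cx (b z powr (- de)) \<partial>?Z)"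
  unfolding rw integral_mult_right_zero .
 have pw: "Gamma de * (2 powr (- de) * (?A * ?A)) = 2 * (2 powr (1 - de) / Gamma de * 2 powr (de - 2) * 2 powr (de - 2))"
  using Gamma_real_pos[OF d0] by (simp add: powr_diff powr_minus field_simps power2_eq_square)
 define X where "X = Gamma ((cx de + (nu + nu')) / 2) * Gamma ((cx de - (nu + nu')) / 2)"
 define Y where "Y = Gamma ((cx de + (nu - nu')) / 2) * Gamma ((cx de - (nu - nu')) / 2)"
 have "cx (Gamma de) * (\<integral>z. E z * cx (b z powr (- de)) \<partial>?Z) =
   cx (Gamma de) * (cx (2 powr (- de)) * ((cx ?A * X) * (cx ?A * Y)))"
  unfolding vE cosh_powr_integral[OF dp] cosh_powr_integral[OF dm] X_def Y_def by (simp only: mult.assoc)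
 also have "... = cx (Gamma de * (2 powr (- de) * (?A * ?A))) * (X * Y)"
  by (simp only: of_real_mult) (simp add: algebra_simps)
 also have "... = 2 * (cx (2 powr (1 - de) / Gamma de) * (cx (2 powr (de - 2)) * X) * (cx (2 powr (de - 2)) * Y))"
  unfolding pw by (simp only: of_real_mult of_real_numeral) (simp add: algebra_simps)
 also have "... = 2 * Mm de nu nu'" by (simp add: Mm_def hm_def X_def Y_def mult.assoc)
 finally show "?G = Mm de nu nu'" using 1 by simp
qed

section \<open>The transform of an exponential\<close>

text \<open>The spectral density: \<open>pi * ww u\<close> is
  \<open>1 / (cmod (Gamma (iu u)))^2\<close> for u > 0, so \<open>mu\<close> has density
  \<open>2 * ww\<close> on the positive half-line. Being even, \<open>ww\<close> allows integration
  over the whole line with the factor 2 absorbed.\<close>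

definition ww :: "real => real" where "ww v = v * sinh (pi * v) / pi^2"

text \<open>\<open>pi * ww\<close> times the index transform of \<open>exp (x - s * exp x)\<close>,
  see \<open>KB_exponential_transform\<close>. With s = cosh y it is v sin(v y) / sinh y.\<close>

definition SS :: "real => real => real" where "SS s v = v * sin (v * arcosh s) / sqrt (s^2 - 1)"

text \<open>The reflection formula, multiplied out so that \<open>v = 0\<close> is included.\<close>

lemma Gamma_1_imag: "Gamma (1 + iu v) * Gamma (1 - iu v) * cx (sinh (pi * v)) = cx (pi * v)"
proof (cases "v = 0")
 case False
 have ni: "iu v \<notin> \<int>\<^sub>\<le>\<^sub>0"
 proof
  assume "iu v \<in> \<int>\<^sub>\<le>\<^sub>0"
  then obtain n where "iu v = complex_of_int n" by (auto simp: nonpos_Ints_def)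
  then have "v = 0" by (metis Im_complex_of_real Im_i_times Re_complex_of_real complex.sel(2) complex_Im_of_int)
  with False show False by simp
 qed
 have e1: "Gamma (1 + iu v) = iu v * Gamma (iu v)" using Gamma_plus1[OF ni] by (simp add: add.commute)
 have e2: "Gamma (iu v) * Gamma (1 - iu v) = cx pi / sin (cx pi * (iu v))" by (rule Gamma_reflection_complex)
 have e3: "sin (cx pi * (iu v)) = iu (sinh (pi * v))"
 proof -
  have "sin (cx pi * (iu v)) = -\<i> * sinh (\<i> * (cx pi * (iu v)))" by (rule sin_conv_sinh)
  also have "\<i> * (cx pi * (iu v)) = - cx (pi * v)"
  proof -
   have "\<i> * (cx pi * (iu v)) = (\<i> * \<i>) * cx (pi * v)" by (simp only: of_real_mult ac_simps)
   then show ?thesis by simp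
  qed
  also have "sinh (- cx (pi * v)) = - cx (sinh (pi * v))"
  proof -
   have "sinh (cx t) = cx (sinh t)" for t by (simp add: sinh_def scaleR_conv_of_real flip: exp_of_real)
   then show ?thesis by (simp only: sinh_minus)
  qed
  finally show ?thesis by simp
 qed
 define S where "S = cx (sinh (pi * v))"
 have S: "S ~= 0" using False by (simp add: S_def)
 have "Gamma (1 + iu v) * Gamma (1 - iu v) * S = iu v * (Gamma (iu v) * Gamma (1 - iu v)) * S" by (simp only: e1 mult.assoc)
 also have "... = iu v * (cx pi / (\<i> * S)) * S" unfolding e2 e3 S_def ..
 also have "... = cx (pi * v)" using S by simp
 finally show ?thesis by (simp only: S_def)
qed simp

text \<open>\<open>sinh y / (cosh y + cosh w)\<close> is the integral of a quarter of
  \<open>cosh ((w + r) / 2) powr (- 2)\<close> over r in [-y, y]. Exchanging the integrals separates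
  the transform of that power, a Beta integral giving v / sinh(pi v), from the transform of an
  interval, giving the sine.\<close>

lemma cosh_convolution_integral:
 assumes y: "y > 0"
 shows "L1 (%w. exp (iu v * cx w) * cx (1 / (cosh y + cosh w)))"
  and "(LBINT w. exp (iu v * cx w) * cx (1 / (cosh y + cosh w))) * cx (sinh (pi * v)) = cx (2 * pi * sin (v * y) / sinh y)"
proof -
 let ?A = "%w r. (1/4) * (cosh ((w + r) / 2) powr (- 2))"
 let ?B = "%v r. - (iu v * cx r)"
 let ?C = "%v. LBINT w. exp (iu v * cx w) * cx (1 / (cosh y + cosh w))"
 let ?D = "%w. cosh y + cosh w"
 let ?E = "%v w. exp (iu v * cx w) * cx (1 / (?D w))"
 have sech: "L1 (%w. exp (iu v * cx w) * cx (1 / cosh w))" for v using cosh_powr_integrable[of "iu v" 1] by (simp add: powr_minus divide_inverse)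
 show "L1 (%w. exp (iu v * cx w) * cx (1 / (?D w)))"
 proof (rule lintegrable_bound[OF sech[of 0]])
  show "AE w in lborel. norm (?E v w) <= norm (exp (iu 0 * cx w) * cx (1 / cosh w))"
  proof (intro AE_I2)
   fix w :: real
   have p: "0 < cosh w" "0 < cosh y + cosh w" by (simp_all add: cosh_real_pos add_pos_pos)
   then have "1 / (?D w) <= 1 / cosh w" by (intro divide_left_mono) auto
   then have "abs (1 / (?D w)) <= abs (1 / cosh w)" using p by simp
   then show "norm (?E v w) <= norm (exp (iu 0 * cx w) * cx (1 / cosh w))"
    unfolding norm_mult norm_exp_eq_Re norm_of_real by simp
  qed
 qed measurable
 define g where "g w r = exp (iu v * cx w) * cx (indicator {-y..y} r * (?A w r))" for w r :: real
 have inner_r: "(LBINT r. g w r) = cx (sinh y) * (?E v w)" for w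
 proof -
  have "(LBINT r. (?A w r) * indicator {-y..y} r) = (1/2) * tanh ((w + y) / 2) - (1/2) * tanh ((w + - y) / 2)"
  proof (rule integral_FTC_Icc_real)
   show "- y <= y" using y by simp
   show "((%r. 1/2 * tanh ((w + r) / 2)) has_real_derivative (1/4) * (cosh ((w + r) / 2) powr (- 2))) (at r)" for r
    by (auto intro!: derivative_eq_intros simp: tanh_def powr_minus powr_numeral cosh_real_pos field_simps power2_eq_square)
     (use cosh_square_eq[of "(w + r)/2"] in \<open>simp add: power2_eq_square algebra_simps\<close>)
   show "isCont (%r. (1/4) * (cosh ((w + r) / 2) powr (- 2))) r" for r by (intro continuous_intros) auto
  qed
  also have "... = sinh y / (?D w)"
  proof -
   define a b where "a = (w + y) / 2" and "b = (w - y) / 2"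
   have "cosh y + cosh w = 2 * cosh a * cosh b" using cosh_add[of a b] cosh_diff[of a b] by (simp add: a_def b_def field_simps)
   moreover have "sinh y = sinh a * cosh b - cosh a * sinh b" using sinh_diff[of a b] by (simp add: a_def b_def field_simps)
   ultimately show ?thesis by (simp add: a_def[symmetric] b_def[symmetric] tanh_def field_simps)
  qed
  finally have 1: "(LBINT r. indicator {-y..y} r * (?A w r)) = sinh y / (?D w)"
   by (simp only: mult.commute)
  show ?thesis unfolding g_def integral_mult_right_zero integral_complex_of_real 1 by (simp add: field_simps)
 qed
 have d2: "2 > (abs (Re (iu (2 * v))))" by simp
 have aff: "exp (iu v * cx (- r + 2 * p)) * cx ((1/4) * (cosh ((- r + 2 * p + r) / 2) powr (- 2))) =
   (1/4) * exp (?B v r) * (exp (iu (2 * v) * cx p) * cx (cosh p powr (- 2)))" for r p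
 proof -
  have "exp (iu v * cx (- r + 2 * p)) = exp (?B v r) * exp (iu (2 * v) * cx p)"
   unfolding exp_add[symmetric] by (intro arg_cong[where f = exp]) (simp add: algebra_simps)
  then show ?thesis by simp
 qed
 define C where "C = (LBINT w. exp (iu (2 * v) * cx w) * cx (cosh w powr (- 2)))"
 have inner_w: "(LBINT w. g w r) = cx (indicator {-y..y} r) * (exp (?B v r) * (C / 2))" for r
 proof -
  have "(LBINT w. exp (iu v * cx w) * cx (?A w r)) =
   abs 2 *\<^sub>R (LBINT p. exp (iu v * cx (- r + 2 * p)) * cx ((1/4) * (cosh ((- r + 2 * p + r) / 2) powr (- 2))))"
   by (rule lborel_integral_real_affine) simp
  also have "... = exp (?B v r) * (C / 2)" unfolding aff C_def integral_mult_right_zero by (simp add: scaleR_conv_of_real)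
  finally have 1: "(LBINT w. exp (iu v * cx w) * cx (?A w r)) = exp (?B v r) * (C / 2)" .
  have "g w r = cx (indicator {-y..y} r) * (exp (iu v * cx w) * cx (?A w r))" for w by (simp add: g_def)
  then show ?thesis unfolding 1[symmetric] by (simp only: integral_mult_right_zero)
 qed
 have gint: "integrable lborel2 (%(r, w). g w r)"
 proof (rule lborel_pair.Fubini_integrable)
  show "(%(r, w). g w r) \<in> borel_measurable lborel2" unfolding g_def by measurable
  define D where "D = (LBINT w. exp (iu 0 * cx w) * cx (cosh w powr (- 2)))"
  have base: "L1 (%w::real. cosh w powr (- 2))" using cosh_powr_integrable[of 0 2] by (simp add: complex_of_real_integrable_eq)
  have sh: "L1 (%w. cosh ((w + r) / 2) powr (- 2))" for r :: real
  proof -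
   have "L1 (%w. cosh (r / 2 + (1/2) * w) powr (- 2))" by (rule lborel_integrable_real_affine[OF base]) simp
   then show ?thesis by (simp add: add.commute add_divide_distrib)
  qed
  have shv: "(LBINT w. cosh ((w + r) / 2) powr (- 2)) = 2 * (LBINT w. cosh w powr (- 2))" for r :: real
   using lborel_integral_real_affine[of 2 "%w. cosh ((w + r) / 2) powr (- 2)" "- r"] by simp
  have ng: "norm (g w r) = indicator {-y..y} r * (?A w r)" for w r
   unfolding g_def by (simp add: norm_mult norm_exp_eq_Re indicator_def)
  have "L1 (%r::real. indicator {-y..y} r * ((1/4) * (2 * (LBINT w. cosh (w::real) powr (- 2)))))"
   using y by (intro integrable_mult_left integrable_real_indicator) (auto simp: emeasure_lborel_Icc)
  then show "L1 (%r. (LBINT w. norm (case (r, w) of (r, w) => g w r)))" by (simp add: ng shv)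
  show "AE r in lborel. L1 (%w. case (r, w) of (r, w) => g w r)"
  proof (intro AE_I2)
   fix r
   have "L1 (%w. norm (g w r))" unfolding ng using sh[of r] by (intro integrable_mult_right) auto
   moreover have "(%w. g w r) \<in> borel_measurable lborel" unfolding g_def by measurable
   ultimately show "L1 (%w. case (r, w) of (r, w) => g w r)" by (simp add: integrable_norm_iff)
  qed
 qed
 have "cx (sinh y) * (?C v) = (LBINT w. (LBINT r. g w r))"
  unfolding inner_r by (simp only: integral_mult_right_zero)
 also have "... = (LBINT r. (LBINT w. g w r))" by (rule lborel_pair.Fubini_integral[OF gint])
 also have "... = (LBINT r. cx (indicator {-y..y} r) * exp (?B v r)) * (C / 2)"
  unfolding inner_w by (simp only: mult.assoc[symmetric] integral_mult_left_zero)
 finally have 1: "cx (sinh y) * (?C v) = (LBINT r. cx (indicator {-y..y} r) * exp (?B v r)) * (C / 2)" .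
 have Cv: "C * cx (sinh (pi * v)) = cx (2 * pi * v)"
 proof -
  have "C = cx (2 powr (2 - 1) / Gamma 2) * Gamma ((cx 2 + iu (2 * v)) / 2) * Gamma ((cx 2 - iu (2 * v)) / 2)"
   unfolding C_def by (rule cosh_powr_integral[OF d2])
  also have "(cx 2 + iu (2 * v)) / 2 = 1 + iu v" by (simp add: field_simps)
  also have "(cx 2 - iu (2 * v)) / 2 = 1 - iu v" by (simp add: field_simps)
  also have "2 powr (2 - 1) / Gamma 2 = (2::real)" using Gamma_fact[of 1, where 'a = real] by simp
  finally have "C * cx (sinh (pi * v)) = 2 * (Gamma (1 + iu v) * Gamma (1 - iu v) * cx (sinh (pi * v)))" by simp
  then show ?thesis unfolding Gamma_1_imag by simp
 qed
 have trig: "(LBINT r. cx (indicator {-y..y} r) * exp (?B v r)) * cx v = cx (2 * sin (v * y))"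
 proof -
  have "(LBINT r. indicator {-y..y} r *\<^sub>R (cx v * exp (?B v r))) = \<i> * exp (- (iu v * cx y)) - \<i> * exp (- (iu v * cx (- y)))"
  proof (rule integral_FTC_Icc)
   show "- y <= y" using y by simp
   show "((%r. \<i> * exp (?B v r)) has_vector_derivative cx v * exp (?B v r)) (at r within {- y..y})" for r
   proof -
    have d: "((%z. \<i> * exp (- (iu v * z))) has_field_derivative (\<i> * (exp (?B v r) * - (iu v)))) (at (cx r))"
     by (auto intro!: derivative_eq_intros simp: mult.commute[of "cx v" "\<i>"])
    have "\<i> * (exp (?B v r) * - (iu v)) = - (\<i> * \<i>) * (cx v * exp (?B v r))"
     by (simp only: ac_simps mult_minus_left mult_minus_right)
    then have e: "\<i> * (exp (?B v r) * - (iu v)) = cx v * exp (?B v r)" by simp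
    show ?thesis using has_vector_derivative_real_field[OF d, of "{- y..y}"] unfolding e .
   qed
   show "continuous_on {- y..y} (%r. cx v * exp (?B v r))" by (intro continuous_intros)
  qed
  also have "... = cx (2 * sin (v * y))"
  proof -
   have "sin (cx (v * y)) = \<i> * (exp (- (iu (v * y))) - exp (iu (v * y))) / 2" by (rule sin_exp_eq')
   then have "2 * cx (sin (v * y)) = \<i> * (exp (- (iu (v * y))) - exp (iu (v * y)))" by (simp only: sin_of_real) simp
   then show ?thesis by (simp add: algebra_simps)
  qed
  also have "(%r. indicator {-y..y} r *\<^sub>R (cx v * exp (?B v r))) = (%r. (cx (indicator {-y..y} r) * exp (?B v r)) * cx v)"
   by (simp add: fun_eq_iff scaleR_conv_of_real)
  finally show ?thesis by (simp only: integral_mult_left_zero)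
 qed
 have "cx (sinh y) * ((?C v) * cx (sinh (pi * v))) = (LBINT r. cx (indicator {-y..y} r) * exp (?B v r)) * (C * cx (sinh (pi * v)) / 2)"
  unfolding mult.assoc[symmetric] 1 by simp
 also have "... = cx pi * ((LBINT r. cx (indicator {-y..y} r) * exp (?B v r)) * cx v)" unfolding Cv by simp
 also have "... = cx (2 * pi * sin (v * y))" unfolding trig by simp
 finally show "(?C v) * cx (sinh (pi * v)) = cx (2 * pi * sin (v * y) / sinh y)"
  using y by (simp add: field_simps)
qed

text \<open>Integration over \<open>x\<close> leaves the Fourier transform of
  \<open>1 / (s + cosh w)\<close>, and s = cosh y brings it to the preceding form.\<close>

lemma KB_exponential_transform:
 assumes s: "s > 1"
 shows "L1 (%x. cx (exp (x - s * exp x)) * KB (iu v) x)"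
  and "(LBINT x. cx (exp (x - s * exp x)) * KB (iu v) x) * cx (ww v) = cx (SS s v / pi)"
proof -
 let ?A = "LBINT x. cx (exp (x - s * exp x)) * KB (iu v) x"
 let ?B = "%x w. exp (1 * x - (s + cosh w) * exp x)"
 let ?C = "LBINT w. exp (iu v * cx w) * cx ((s + cosh w) powr (- 1))"
 define y where "y = arcosh s"
 have y: "y > 0" "cosh y = s" "sinh y = sqrt (s^2 - 1)" using s by (auto simp: y_def cosh_arcosh_real sinh_arcosh_real)
 have b0: "s + cosh w > 0" for w :: real using s by (simp add: add_pos_pos cosh_real_pos)
 have pw1: "(s + cosh w) powr (- 1) = 1 / (s + cosh w)" for w :: real using b0[of w] by (metis powr_minus_divide powr_one less_imp_le)
 have int: "L1 (%w. exp (iu v * cx w) * cx ((s + cosh w) powr (- 1)))" using cosh_convolution_integral(1)[OF y(1), of v] unfolding y(2) pw1 .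
 note mj = mellin_joint_integrable[OF zero_less_one _ _ b0 lborel.sigma_finite_measure_axioms int]
 have i: "integrable lborel2 (%(x, w). exp (iu v * cx w) * cx (?B x w))" by (rule mj(1)) measurable
 have eq: "(LBINT w. exp (iu v * cx w) * cx (?B x w)) = 2 * (cx (exp (x - s * exp x)) * KB (iu v) x)" for x
 proof -
  have "exp (iu v * cx w) * cx (?B x w) = cx (exp (x - s * exp x)) * exp (iu v * cx w - cx (exp x * cosh w))" for w
   unfolding exp_of_real[symmetric] exp_add[symmetric] by (intro arg_cong[where f = exp]) (simp add: algebra_simps)
  then show ?thesis unfolding KB_def by (simp del: of_real_exp)
 qed
 have "L1 (%x. 2 * (cx (exp (x - s * exp x)) * KB (iu v) x))" using lborel_pair.integrable_fst'[OF i] by (simp add: eq[simplified] del: of_real_exp)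
 from integrable_mult_right[OF this, of "1/2"]
 show "L1 (%x. cx (exp (x - s * exp x)) * KB (iu v) x)" by (simp del: of_real_exp)
 have "(LBINT x. (LBINT w. exp (iu v * cx w) * cx (?B x w))) = cx (Gamma 1) * ?C"
  by (rule mj(2)) measurable
 then have "2 * ?A = ?C"
  unfolding eq integral_mult_right_zero by simp
 also have "... = (LBINT w. exp (iu v * cx w) * cx (1 / (cosh y + cosh w)))" unfolding y(2) pw1 ..
 finally have "2 * ?A * cx (sinh (pi * v)) = cx (2 * pi * sin (v * y) / sinh y)"
  using cosh_convolution_integral(2)[OF y(1), of v] by (simp only:)
 moreover have "cx (2 * pi * sin (v * y) / sinh y) = 2 * cx (pi * sin (v * y) / sinh y)" by simp
 ultimately have 2: "?A * cx (sinh (pi * v)) = cx (pi * sin (v * y) / sinh y)"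
 proof -
  have half: "I * S = c" if "2 * I * S = d" "d = 2 * c" for I S c d :: complex using that by simp
  show ?thesis by (rule half) fact+
 qed
 have "?A * cx (ww v) = ?A * cx (sinh (pi * v)) * cx (v / pi^2)"
 proof -
  have "cx (ww v) = cx (sinh (pi * v)) * cx (v / pi^2)" by (simp add: ww_def)
  then show ?thesis by (simp only: mult.assoc)
 qed
 also have "... = cx (SS s v / pi)" unfolding 2 SS_def y(3)[symmetric] y_def[symmetric] by (simp add: power2_eq_square)
 finally show "?A * cx (ww v) = cx (SS s v / pi)" .
qed

section \<open>Completeness of the Macdonald functions\<close>

lemma real_norm_mono: "0 <= a ==> a <= b ==> norm a <= norm b" for a b :: real by simp

lemma sinh_ge_self: "x <= sinh x" if "x >= 0" for x :: real
proof -
 have "sinh 0 - (0::real) <= sinh x - x" by (rule DERIV_nonneg_imp_nondecreasing[where f = "%x::real. sinh x - x", OF that])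
   (auto intro!: exI derivative_eq_intros simp: cosh_real_ge_1)
 then show ?thesis by simp
qed

lemma integrable_poly_exp:
 assumes c: "c > 0"
 shows "L1 (%v::real. (1 + abs v) ^ n * exp (- c * abs v))"
proof -
 \<comment> \<open>Small enough that \<open>real n * et <= c / 2\<close>: the power of
   \<open>1 + abs v <= exp (et * abs v) / et\<close> then uses up only half of the decay.\<close>
 define et where "et = min 1 (c / (2 * (real n + 1)))"
 have et: "et > 0" "et <= 1" using c by (auto simp: et_def)
 have net: "real n * et <= c / 2"
 proof -
  have "real n * et <= (real n + 1) * (c / (2 * (real n + 1)))" using et by (intro mult_mono) (auto simp: et_def)
  also have "... = c / 2" by (simp add: field_simps)
  finally show ?thesis .
 qed
 show ?thesis
 proof (rule lintegrable_bound)
  show "L1 (%v::real. (1 / et) ^ n * exp (- (c/2) * abs v))" using c by (intro integrable_mult_right integrable_exp_abs) simp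
  show "AE v in lborel. norm ((1 + abs v) ^ n * exp (- c * abs v)) <= norm ((1 / et) ^ n * exp (- (c/2) * abs v))"
  proof (intro AE_I2)
   fix v :: real
   have "1 + abs v <= (1 + et * abs v) / et" using et by (simp add: field_simps)
   also have "... <= exp (et * abs v) / et" using et by (intro divide_right_mono exp_ge_add_one_self) auto
   finally have "(1 + abs v) ^ n <= (1 / et * exp (et * abs v)) ^ n" by (intro power_mono) auto
   also have "... = (1 / et) ^ n * exp (real n * et * abs v)" unfolding power_mult_distrib exp_of_nat_mult[symmetric] mult.assoc ..
   also have "... <= (1 / et) ^ n * exp (c / 2 * abs v)"
   proof -
    have "real n * et * abs v <= c / 2 * abs v" by (rule mult_right_mono[OF net]) simp
    then show ?thesis using et by (intro mult_left_mono) auto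
   qed
   finally have "(1 + abs v) ^ n * exp (- c * abs v) <= (1 / et) ^ n * exp (c / 2 * abs v) * exp (- c * abs v)" by (intro mult_right_mono) auto
   also have "... = (1 / et) ^ n * exp (- (c/2) * abs v)" by (simp add: exp_add[symmetric] mult.assoc field_simps)
   finally show "norm ((1 + abs v) ^ n * exp (- c * abs v)) <= norm ((1 / et) ^ n * exp (- (c/2) * abs v))" using et by simp
  qed
 qed measurable
qed

text \<open>The denominator is sinh y and vanishes as s tends to 1. For small y this is compensated
  by |sin(v y)| <= |v| y, for large y the bound 1 on the sine suffices. The factor 1/s is what makes
  the mixture over s in \<open>parseval_small\<close> converge.\<close>

lemma SS_bound:
 assumes s: "s > 1"
 shows "abs (SS s v) <= 2 * (1 + abs v)^2 / s"
proof -
 define y where "y = arcosh s"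
 have y: "y > 0" "cosh y = s" "sinh y = sqrt (s^2 - 1)" using s by (auto simp: y_def cosh_arcosh_real sinh_arcosh_real)
 have "abs (sin (v * y)) <= abs (v * y)" by (rule abs_sin_x_le_abs_x)
 also have "abs (v * y) <= (1 + abs v) * y" using y by (simp add: abs_mult mult_right_mono)
 finally have 1: "abs (sin (v * y)) <= (1 + abs v) * y" .
 have 2: "abs (sin (v * y)) <= (1 + abs v) * 1" using abs_ge_zero[of v] abs_sin_le_one[of "v * y"] unfolding mult_1_right by linarith
 have 3: "abs (sin (v * y)) <= (1 + abs v) * min 1 y" using 1 2 by (auto simp: min_def)
 have 4: "min 1 y * cosh y <= 2 * sinh y"
 proof (cases "y >= 1")
  case True
  have "3 <= exp (2 * 1 :: real)" using exp_ge_add_one_self[of "2::real"] by simp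
  also have "... <= exp (2 * y)" using True by simp
  finally have "3 * exp (- y) <= exp (2 * y) * exp (- y)" by (intro mult_right_mono) auto
  also have "... = exp y" by (simp add: exp_add[symmetric])
  finally show ?thesis using True by (simp add: cosh_def sinh_def)
 next
  case False
  have "exp y <= exp 1" "exp (- y) <= 1" using False y by auto
  then have "exp y + exp (- y) <= 4" using exp_le by linarith
  then have "cosh y <= 2" by (simp add: cosh_def)
  then have "y * cosh y <= y * 2" using y by (intro mult_left_mono) auto
  also have "... <= 2 * sinh y" using sinh_ge_self[of y] y by simp
  finally show ?thesis using False by simp
 qed
 have sp: "sinh y > 0" using y(1) by simp
 have "abs (SS s v) = abs v * abs (sin (v * y)) / sinh y" using sp by (simp add: SS_def y_def[symmetric] y(3)[symmetric] abs_mult)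
 also have "... <= (1 + abs v) * ((1 + abs v) * min 1 y) / sinh y" using 3 sp y by (intro divide_right_mono mult_mono) auto
 also have "... = (1 + abs v)^2 * (min 1 y / sinh y)" by (simp add: power2_eq_square)
 also have "... <= (1 + abs v)^2 * (2 / s)" using 4 sp s y by (intro mult_left_mono) (auto simp: field_simps)
 finally show ?thesis by (simp add: mult.commute)
qed

lemma borel_measurable_arcosh [measurable (raw)]:
 assumes [measurable]: "f \<in> borel_measurable M"
 shows "(%x. arcosh (f x) :: real) \<in> borel_measurable M"
proof -
 have "arcosh t = ln (t + (t^2 - 1) powr (1/2))" for t :: real by (simp add: arcosh_def)
 then show ?thesis by simp
qed

lemma borel_measurable_SS [measurable (raw)]:
 assumes [measurable]: "f \<in> borel_measurable M" "g \<in> borel_measurable M"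
 shows "(%m. SS (f m) (g m)) \<in> borel_measurable M" unfolding SS_def by measurable

lemma borel_measurable_ww [measurable (raw)]:
 assumes [measurable]: "f \<in> borel_measurable M"
 shows "(%x. ww (f x)) \<in> borel_measurable M" unfolding ww_def by measurable

lemma KB_imag_decay: "norm (KB (iu v) x) <= E0 v * KR0 x" using KB_decay[of "iu v" x] by simp

lemma th0_pos: "th0 > 0" using th0 pi_gt_zero by linarith

text \<open>By \<open>KB_sinh\<close> the function \<open>2 * iu v * KB (iu v) x\<close> is a
  Fourier transform in the integration variable of \<open>KB\<close>. It is inverted at y = arcosh
  s, and adding the reflection v to -v turns the exponential into the sine of
  \<open>SS\<close>.\<close>

lemma KB_SS_inversion:
 assumes s: "s > 1"
 shows "L1 (%v. KB (iu v) x * cx (SS s v))"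
  and "(LBINT v. KB (iu v) x * cx (SS s v)) = cx (pi * exp (x - s * exp x))"
proof -
 let ?A = "%w. exp x * cosh w"
 let ?B = "%v. KB (iu v) x * cx (SS s v)"
 let ?C = "%v. (1 + abs v) ^ 2 * E0 v"
 let ?D = "%v. (1 + abs v) ^ 1 * E0 v"
 show int: "L1 (%v. KB (iu v) x * cx (SS s v))"
 proof (rule lintegrable_bound)
  show "L1 (%v. KR0 x * 2 / s * (?C v))" using th0_pos by (intro integrable_mult_right integrable_poly_exp)
  show "AE v in lborel. norm (?B v) <= norm (KR0 x * 2 / s * (?C v))"
  proof (intro AE_I2)
   fix v
   have "norm (?B v) <= (E0 v * KR0 x) * (2 * (1 + abs v)^2 / s)" unfolding norm_mult norm_of_real
    by (intro mult_mono KB_imag_decay SS_bound s) (auto simp: KR_nonneg)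
   also have "... = KR0 x * 2 / s * (?C v)" by simp
   finally show "norm (?B v) <= norm (KR0 x * 2 / s * (?C v))" by (metis abs_ge_self order_trans real_norm_def)
  qed
 qed measurable
 define y where "y = arcosh s"
 have y: "y > 0" "cosh y = s" "sinh y = sqrt (s^2 - 1)" using s by (auto simp: y_def cosh_arcosh_real sinh_arcosh_real)
 define f where "f w = cx (exp x * sinh w * exp (- (?A w)))" for w
 define F where "F v = 2 * (iu v) * KB (iu v) x" for v
 have feq: "f w * exp (nu * cx w) = cx (exp x * sinh w) * kern nu x w" for w nu
 proof -
  have "kern nu x w = exp (nu * cx w) * cx (exp (- (?A w)))" unfolding exp_of_real[symmetric] exp_add[symmetric] by simp
  then show ?thesis unfolding f_def by (simp only: of_real_mult mult.assoc mult.commute mult.left_commute)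
 qed
 have i1: "(LBINT v. F v * exp (- (iu v * cx y))) = cx (2 * pi) * f y" and Fi: "L1 F"
 proof -
  show Fi: "L1 F"
  proof (rule lintegrable_bound)
   show "L1 (%v. 2 * KR0 x * (?D v))" using th0_pos by (intro integrable_mult_right integrable_poly_exp)
   show "F \<in> borel_measurable lborel" unfolding F_def by measurable
   show "AE v in lborel. norm (F v) <= norm (2 * KR0 x * (?D v))"
   proof (intro AE_I2)
    fix v
    have "norm (F v) = 2 * abs v * norm (KB (iu v) x)" by (simp add: F_def norm_mult)
    also have "... <= 2 * (1 + abs v) * (E0 v * KR0 x)" by (intro mult_mono KB_imag_decay) auto
    also have "... = 2 * KR0 x * (?D v)" by simp
    finally show "norm (F v) <= norm (2 * KR0 x * (?D v))" by (metis abs_ge_self order_trans real_norm_def)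
   qed
  qed
  show "(LBINT v. F v * exp (- (iu v * cx y))) = cx (2 * pi) * f y"
  proof (rule fourier_inversion[where B = 1])
   show "L1 f"
   proof -
    have "f w = cx (exp x * sinh w) * exp (0 * cx w - cx (?A w))" for w
     using feq[of w 0] by (simp only: mult_zero_left exp_zero mult_1_right)
    then have fe: "f = (%w. cx (exp x * sinh w) * exp (0 * cx w - cx (?A w)))" by (rule ext)
    show ?thesis unfolding fe by (rule KB_sinh(1))
   qed
   show "isCont f y" unfolding f_def by (intro continuous_intros)
   show "norm (f w) <= 1" for w
   proof -
    have "abs (sinh w) <= cosh w" by (auto simp: abs_le_iff sinh_def cosh_def)
    then have "exp x * abs (sinh w) * exp (- (?A w)) <= exp x * cosh w * exp (- (?A w))"
     by (intro mult_right_mono mult_left_mono) auto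
    also have "... <= exp (?A w) * exp (- (?A w))"
    proof (rule mult_right_mono)
     show "exp x * cosh w <= exp (?A w)" using exp_ge_add_one_self[of "exp x * cosh w"] by linarith
    qed simp
    also have "... = 1" by (simp add: exp_add[symmetric])
    finally show ?thesis unfolding f_def norm_of_real by (simp add: abs_mult)
   qed
   show "F v = (LBINT w. f w * exp (iu v * cx w))" for v unfolding F_def feq KB_sinh(2) by simp
  qed (rule Fi)
 qed
 define G where "G v = F v * exp (- (iu v * cx y))" for v
 have Gi: "L1 G"
 proof (rule lintegrable_bound[OF Fi])
  show "G \<in> borel_measurable lborel" unfolding G_def F_def by measurable
  show "AE v in lborel. norm (G v) <= norm (F v)" by (intro AE_I2) (simp add: G_def norm_mult norm_exp_eq_Re)
 qed
 have Gm: "(LBINT v. G (0 + (- 1) * v)) = integral\<^sup>L lborel G" using lborel_integral_real_affine[of "-1" G 0] by simp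
 have Gmi: "L1 (%v. G (0 + (- 1) * v))" by (rule lborel_integrable_real_affine[OF Gi]) simp
 have sum: "G v + G (0 + (- 1) * v) = cx (4 * sinh y) * (?B v)" for v
 proof -
  define A where "A = iu (v * y)"
  have sn: "2 * cx (sin (v * y)) = \<i> * (exp (- A) - exp A)" using sin_exp_eq'[of "cx (v * y)"] unfolding A_def by (simp only: sin_of_real) simp
  have KBm: "KB (- (iu v)) x = KB (iu v) x" by (rule KB_minus)
  have "G v + G (0 + (- 1) * v) = 2 * cx v * KB (iu v) x * (\<i> * (exp (- A) - exp A))"
   unfolding G_def F_def A_def using KBm by (simp add: algebra_simps)
  also have "... = cx (4 * (v * sin (v * y))) * KB (iu v) x" unfolding sn[symmetric] by simp
  also have "v * sin (v * y) = sinh y * SS s v" using y by (simp add: SS_def y_def[symmetric] y(3)[symmetric])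
  finally show ?thesis by simp
 qed
 have "cx (4 * sinh y) * (LBINT v. KB (iu v) x * cx (SS s v)) = (LBINT v. G v + G (0 + (- 1) * v))"
  unfolding sum by (simp only: integral_mult_right_zero)
 also have "... = integral\<^sup>L lborel G + (LBINT v. G (0 + (- 1) * v))" by (rule lintegral_add[OF Gi Gmi])
 also have "... = integral\<^sup>L lborel G + integral\<^sup>L lborel G" by (simp only: Gm)
 also have "integral\<^sup>L lborel G = cx (2 * pi) * f y" using i1 by (simp add: G_def[abs_def])
 also have "cx (2 * pi) * f y + cx (2 * pi) * f y = cx (4 * sinh y) * cx (pi * exp (x - s * exp x))"
 proof -
  have "exp x * exp (- (exp x * cosh y)) = exp (x - s * exp x)" using y by (simp add: exp_add[symmetric] mult.commute)
  then have "f y = cx (sinh y * exp (x - s * exp x))" unfolding f_def by (metis mult.assoc mult.commute)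
  then show ?thesis by simp
 qed
 finally show "(LBINT v. KB (iu v) x * cx (SS s v)) = cx (pi * exp (x - s * exp x))" using y(1) by (subst (asm) mult_cancel_left) auto
qed

section \<open>The index transform and Parseval for mixtures\<close>

lemma integral_prod_pair:
 fixes f g :: "real => 'a :: {real_normed_field, banach, second_countable_topology}"
 assumes f: "L1 f" and g: "L1 g"
 shows "(\<integral>(x, y). f x * g y \<partial>lborel2) = integral\<^sup>L lborel f * integral\<^sup>L lborel g"
 using lborel_pair.integral_fst'[OF integrable_prod_pair[OF f g]] by (simp only: prod.case integral_mult_right_zero integral_mult_left_zero)

lemma integrable_prod_measure:
 fixes f :: "'a => real" and g :: "'b => real"
 assumes "sigma_finite_measure M" "sigma_finite_measure N" and f: "integrable M f" and g: "integrable N g"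
 shows "integrable (M \<Otimes>\<^sub>M N) (%(x, y). f x * g y)"
proof -
 interpret pair_sigma_finite M N using assms by (simp add: pair_sigma_finite_def)
 have [measurable]: "f \<in> borel_measurable M" "g \<in> borel_measurable N" using f g by auto
 show ?thesis
 proof (rule Fubini_integrable)
  show "(%(x, y). f x * g y) \<in> borel_measurable (M \<Otimes>\<^sub>M N)" by measurable
  show "integrable M (%x. \<integral>y. norm (case (x, y) of (x, y) => f x * g y) \<partial>N)" using f by (simp add: abs_mult)
  show "AE x in M. integrable N (%y. case (x, y) of (x, y) => f x * g y)" using g by simp
 qed
qed

text \<open>The Kontorovich-Lebedev transform, written in the logarithmic variable.\<close>

definition kt :: "(real => complex) => real => complex" where
 "kt g v = (LBINT x. g x * KB (iu v) x)"

text \<open>Exponential decay at -infinity and at most exponential growth at +infinity, which is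
  enough for integrability against \<open>KR0\<close>.\<close>

definition expbd :: "(real => complex) => bool" where
 "expbd g \<longleftrightarrow> g \<in> borel_measurable borel & (\<exists>C ep. ep > 0 & (\<forall>x. norm (g x) <= C * exp (ep * x)))"

lemma KR0_shift_integrable: "ep > 0 ==> L1 (%x. exp (ep * x) * KR0 x)"
proof -
 assume "ep > 0"
 then have "L1 (%x. exp (ep * x) * KR 0 x)" by (intro KR_mellin_integrable) simp
 then have "L1 (%x. exp (ep * (- 1 + 1 * x)) * KR 0 (- 1 + 1 * x))" by (rule lborel_integrable_real_affine) simp
 from integrable_mult_right[OF this, of "exp ep"]
 show ?thesis by (simp add: exp_add[symmetric] mult.assoc[symmetric] algebra_simps)
qed

lemma kt_integrable:
 assumes g: "expbd g"
 shows "L1 (%x. norm (g x) * KR0 x)"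
  and "L1 (%x. g x * KB (iu v) x)"
  and "norm (kt g v) <= E0 v * (LBINT x. norm (g x) * KR0 x)"
proof -
 let ?A = "%x. norm (g x) * KR0 x"
 obtain C ep where [measurable]: "g \<in> borel_measurable borel" and e: "ep > 0" and C: "!!x. norm (g x) <= C * exp (ep * x)"
  using g by (auto simp: expbd_def)
 show i: "L1 (%x. norm (g x) * KR0 x)"
 proof (rule lintegrable_bound)
  show "L1 (%x. C * (exp (ep * x) * KR0 x))" by (intro integrable_mult_right KR0_shift_integrable e)
  show "AE x in lborel. norm (?A x) <= norm (C * (exp (ep * x) * KR0 x))"
  proof (intro AE_I2)
   fix x
   have "norm (g x) * KR0 x <= C * exp (ep * x) * KR0 x" by (intro mult_right_mono C KR_nonneg)
   then show "norm (?A x) <= norm (C * (exp (ep * x) * KR0 x))"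
    unfolding mult.assoc by (rule real_norm_mono[rotated]) (intro mult_nonneg_nonneg norm_ge_zero KR_nonneg)
  qed
 qed measurable
 have bd: "norm (g x * KB (iu v) x) <= E0 v * (?A x)" for x
 proof -
  have "norm (g x) * norm (KB (iu v) x) <= norm (g x) * (E0 v * KR0 x)" by (intro mult_left_mono KB_imag_decay) auto
  then show ?thesis by (simp only: norm_mult mult.left_commute)
 qed
 show i2: "L1 (%x. g x * KB (iu v) x)"
 proof (rule lintegrable_bound)
  show "L1 (%x. E0 v * (?A x))" by (intro integrable_mult_right i)
  show "AE x in lborel. norm (g x * KB (iu v) x) <= norm (E0 v * (?A x))"
   using bd by (intro AE_I2) (metis abs_ge_self order_trans real_norm_def)
 qed measurable
 have "norm (kt g v) <= (LBINT x. norm (g x * KB (iu v) x))" unfolding kt_def by (rule integral_norm_bound)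
 also have "... <= (LBINT x. E0 v * (?A x))" using i i2 bd by (intro integral_mono) auto
 finally show "norm (kt g v) <= E0 v * (LBINT x. norm (g x) * KR0 x)" by simp
qed

lemma borel_measurable_kt [measurable]:
 assumes [measurable]: "g \<in> borel_measurable borel"
 shows "kt g \<in> borel_measurable borel" unfolding kt_def[abs_def] by measurable

text \<open>The function \<open>exp (de x) KB nu x\<close> is a mixture of the functions \<open>exp (x - s exp x)\<close> with
 \<open>s = exp q + cosh w > 1\<close>, for which inversion is available explicitly.\<close>

lemma parseval_small:
 assumes d: "0 < de" "de < 1" and nu: "abs (Re nu) < de" and g: "expbd g"
 shows "(LBINT v. kt g v * (Mm de nu (iu v) * cx (ww v))) =
   (LBINT x. g x * (cx (exp (de * x)) * KB nu x))"
proof -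
 obtain C ep where gm[measurable]: "g \<in> borel_measurable borel" and e: "ep > 0" and C: "!!x. norm (g x) <= C * exp (ep * x)"
  using g by (auto simp: expbd_def)
 have C0: "C >= 0" using C[of 0] norm_ge_zero[of "g 0"] by (simp add: order_trans[OF norm_ge_zero])
 let ?Z = "lborel2 :: (real \<times> real) measure"
 have sfZ: "sigma_finite_measure ?Z" by (rule lborel_pair.sigma_finite_measure_axioms)
 have sfl: "sigma_finite_measure (lborel :: real measure)" by (rule lborel.sigma_finite_measure_axioms)
 interpret P: pair_sigma_finite "lborel :: real measure" ?Z using sfZ sfl by (intro pair_sigma_finite.intro)
 define s where "s z = exp (fst z) + cosh (snd z)" for z :: "real \<times> real"
 have s1: "s z > 1" for z using cosh_real_ge_1[of "snd z"] by (simp add: s_def add_pos_nonneg) (smt (verit) exp_gt_zero)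
 define E where "E z = cx (exp ((1 - de) * fst z)) * exp (nu * cx (snd z))" for z :: "real \<times> real"
 define R where "R z = exp ((1 - de) * fst z) * exp (Re nu * snd z)" for z :: "real \<times> real"
 have nE: "norm (E z) = R z" for z by (simp add: E_def R_def norm_mult norm_exp_eq_Re del: of_real_exp)
 have R0: "R z >= 0" for z by (simp add: R_def)
 define ph where "ph z x = exp (x - s z * exp x)" for z x
 have [measurable]: "s \<in> borel_measurable ?Z" "E \<in> borel_measurable ?Z" "R \<in> borel_measurable ?Z" unfolding s_def E_def R_def by measurable
 define \<Gamma> where "\<Gamma> = Gamma (1 - de)"
 have \<Gamma>: "\<Gamma> > 0" using d by (simp add: \<Gamma>_def Gamma_real_pos)
 let ?A = "%x. 2 * \<Gamma> * (exp (de * x) * KR (Re nu) x)"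
 let ?B = "%z x. E z * cx (ph z x)"
 let ?C = "%x. exp (de * x) * (KR 0 x * KR (Re nu) x)"
 let ?D = "%v. (1 + abs v) ^ 2 * E0 v"
 let ?E = "%z v. E z * cx (SS (s z) v)"
 let ?F = "%q x. (1 - de) * q - exp x * exp q"
 let ?G = "%x. exp (de * x) * KR (Re nu) x"
 let ?H = "%z v. LBINT x. cx (ph z x) * KB (iu v) x"
 let ?I = "%x. - (1 - de) * x"
 let ?J = "%x. cx (exp (de * x)) * KB nu x"
 let ?K = "%v. Mm de nu (iu v) * cx (ww v)"
 let ?L = "%x. exp ((de + ep) * x) * KR (Re nu) x"
 let ?M = "1 / (2 * \<Gamma> * pi)"
 let ?N = "%z. NN x. ennreal (R z * ph z x)"
 \<comment> \<open>The integral over the first component is a Gamma integral of exponent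
   \<open>1 - de\<close>, which is where \<open>de < 1\<close> enters; the second component produces
   \<open>KB nu x\<close>.\<close>
 have mix: "integrable ?Z (%z. E z * cx (ph z x))"
  "(\<integral>z. E z * cx (ph z x) \<partial>?Z) = cx (2 * \<Gamma>) * (?J x)" for x
 proof -
  have eq: "E z * cx (ph z x) = cx (exp x) * (case z of (q, w) => cx (exp (?F q x)) * kern nu x w)" for z
   unfolding E_def ph_def s_def case_prod_beta exp_of_real[symmetric] exp_add[symmetric]
   by (intro arg_cong[where f = exp]) (simp add: algebra_simps exp_add)
  have iq: "L1 (%q. cx (exp (?F q x)))"
   using Gamma_integral_log_real(1)[of "1 - de" "exp x"] d by (subst complex_of_real_integrable_eq) simp
  have vq: "(LBINT q. cx (exp (?F q x))) = cx (\<Gamma> * exp (?I x))"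
   unfolding integral_complex_of_real using Gamma_integral_log_real(2)[of "1 - de" "exp x"] d by (simp add: \<Gamma>_def powr_def)
  show "integrable ?Z (%z. E z * cx (ph z x))" unfolding eq by (intro integrable_mult_right integrable_prod_pair iq KB_integrable)
  have "(\<integral>z. E z * cx (ph z x) \<partial>?Z) = cx (exp x) * (cx (\<Gamma> * exp (?I x)) * (2 * KB nu x))"
   unfolding eq integral_mult_right_zero integral_prod_pair[OF iq KB_integrable] vq by (simp add: KB_def)
  also have "... = cx (2 * \<Gamma>) * (cx (exp x * exp (?I x)) * KB nu x)" by simp
  also have "exp x * exp (?I x) = exp (de * x)" by (simp add: exp_add[symmetric] algebra_simps)
  finally show "(\<integral>z. E z * cx (ph z x) \<partial>?Z) = cx (2 * \<Gamma>) * (?J x)" .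
 qed
 have mixR: "integrable ?Z (%z. R z * ph z x)"
  "(\<integral>z. R z * ph z x \<partial>?Z) = 2 * \<Gamma> * (?G x)" for x
 proof -
  have eq: "R z * ph z x = exp x * (case z of (q, w) => exp (?F q x) * exp (Re nu * w - exp x * cosh w))" for z
   unfolding R_def ph_def s_def case_prod_beta exp_add[symmetric] by (intro arg_cong[where f = exp]) (simp add: algebra_simps exp_add)
  have iq: "L1 (%q. exp (?F q x))" using d by (intro Gamma_integral_log_real(1)) auto
  have vq: "(LBINT q. exp (?F q x)) = \<Gamma> * exp (?I x)"
   using Gamma_integral_log_real(2)[of "1 - de" "exp x"] d by (simp add: \<Gamma>_def powr_def)
  show "integrable ?Z (%z. R z * ph z x)" unfolding eq by (intro integrable_mult_right integrable_prod_pair iq KR_integrable)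
  have "(\<integral>z. R z * ph z x \<partial>?Z) = exp x * (\<Gamma> * exp (?I x) * (2 * KR (Re nu) x))"
   unfolding eq integral_mult_right_zero integral_prod_pair[OF iq KR_integrable] vq by (simp add: KR_def)
  also have "... = 2 * \<Gamma> * ((exp x * exp (?I x)) * KR (Re nu) x)" by simp
  also have "exp x * exp (?I x) = exp (de * x)" by (simp add: exp_add[symmetric] algebra_simps)
  finally show "(\<integral>z. R z * ph z x \<partial>?Z) = 2 * \<Gamma> * (?G x)" .
 qed
 have nphi: "norm (?B z x) = R z * ph z x" for z x unfolding norm_mult nE norm_of_real by (simp add: ph_def)
 have phm[measurable]: "(%(x, z). ph z x) \<in> borel_measurable (lborel \<Otimes>\<^sub>M ?Z)" unfolding ph_def by measurable
 \<comment> \<open>\<open>1 / s z\<close> is the integral of \<open>ph z\<close> over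
   \<open>x\<close>. Integrating over \<open>z\<close> first instead gives a convergent Mellin
   integral of \<open>KR\<close>, by \<open>mixR\<close>.\<close>
 have Rs: "integrable ?Z (%z. R z / s z)"
 proof (rule integrableI_nonneg)
  show "AE z in ?Z. 0 <= R z / s z" using R0 s1 by (intro AE_I2 divide_nonneg_pos) (auto intro: less_trans[OF zero_less_one])
  have "(NN x. ennreal (ph z x)) = ennreal (1 / s z)" for z
  proof -
   have sz: "s z > 0" using s1[of z] by linarith
   have "(NN x. ennreal (ph z x)) = ennreal (LBINT x. exp (1 * x - s z * exp x))"
    unfolding ph_def using Gamma_integral_log_real(1)[of 1 "s z"] sz by (subst nn_integral_eq_integral) auto
   also have "(LBINT x. exp (1 * x - s z * exp x)) = 1 / s z"
    unfolding Gamma_integral_log_real(2)[OF zero_less_one sz] using sz by (simp add: powr_minus_divide)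
   finally show ?thesis .
  qed
  then have "(\<integral>\<^sup>+z. ennreal (R z / s z) \<partial>?Z) = (\<integral>\<^sup>+z. (?N z) \<partial>?Z)"
  proof (intro nn_integral_cong)
   fix z assume *: "!!z. (NN x. ennreal (ph z x)) = ennreal (1 / s z)"
   have "(?N z) = (NN x. ennreal (R z) * ennreal (ph z x))" by (rule nn_integral_cong) (rule ennreal_mult'[OF R0])
   also have "... = ennreal (R z) * ennreal (1 / s z)" unfolding *[symmetric] by (rule nn_integral_cmult) (simp add: ph_def)
   also have "... = ennreal (R z / s z)" by (subst ennreal_mult'[OF R0, symmetric]) simp
   finally show "ennreal (R z / s z) = (?N z)" by simp
  qed
  also have "... = (NN x. (\<integral>\<^sup>+z. ennreal (R z * ph z x) \<partial>?Z))" by (rule P.Fubini') measurable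
  also have "... = (NN x. ennreal (?A x))"
   using mixR R0 by (intro nn_integral_cong, subst nn_integral_eq_integral) (auto simp: ph_def)
  also have "... < \<infinity>"
  proof -
   have "L1 (%x. 2 * \<Gamma> * (?G x))" using nu by (intro integrable_mult_right KR_mellin_integrable) auto
   then show ?thesis using \<Gamma> by (subst nn_integral_eq_integral) (auto simp: KR_nonneg)
  qed
  finally show "(\<integral>\<^sup>+z. ennreal (R z / s z) \<partial>?Z) < \<infinity>" .
 qed measurable
 \<comment> \<open>The transform of the mixture is the mixture of the transforms. The exchange is
   dominated by a Mellin integral of a product of two functions \<open>KR\<close>.\<close>
 have step3: "Mm de nu (iu v) * cx (ww v) = cx ?M * (\<integral>z. E z * cx (SS (s z) v) \<partial>?Z)" for v
 proof -
  have i: "integrable (lborel \<Otimes>\<^sub>M ?Z) (%(x, z). KB (iu v) x * (?B z x))"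
  proof (rule P.Fubini_integrable)
   show "(%(x, z). KB (iu v) x * (?B z x)) \<in> borel_measurable (lborel \<Otimes>\<^sub>M ?Z)" by measurable
   show "AE x in lborel. integrable ?Z (%z. case (x, z) of (x, z) => KB (iu v) x * (?B z x))"
    unfolding prod.case using mix(1) by (intro AE_I2 integrable_mult_right)
   have "(\<integral>z. norm (KB (iu v) x * (?B z x)) \<partial>?Z) = norm (KB (iu v) x) * (?A x)" for x
    unfolding norm_mult[of "KB _ _"] nphi integral_mult_right_zero mixR(2) ..
   moreover have "L1 (%x. norm (KB (iu v) x) * (?A x))"
   proof (rule lintegrable_bound)
    have "L1 (%x. cx (exp (de * x)) * (KB (cx 0) x * KB (cx (Re nu)) x))" using nu by (intro KB_mellin2(1)) simp
    then have "L1 (%x. cx (?C x))" unfolding KB_of_real of_real_mult .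
    then have "L1 (%x. exp (de * x) * (KR 0 x * KR (Re nu) x))" by (simp only: complex_of_real_integrable_eq)
    then show "L1 (%x. 2 * \<Gamma> * (?C x))" by (rule integrable_mult_right)
    show "AE x in lborel. norm (norm (KB (iu v) x) * (?A x)) <= norm (2 * \<Gamma> * (?C x))"
    proof (intro AE_I2)
     fix x
     have p: "0 <= 2 * \<Gamma> * (?G x)" using \<Gamma> by (simp add: KR_nonneg)
     have "norm (KB (iu v) x) * (?A x) <= KR 0 x * (?A x)"
      using norm_KB_le[of "iu v" x] p by (intro mult_right_mono) auto
     also have "... = 2 * \<Gamma> * (?C x)" by simp
     finally show "norm (norm (KB (iu v) x) * (?A x)) <= norm (2 * \<Gamma> * (?C x))"
      by (rule real_norm_mono[rotated]) (intro mult_nonneg_nonneg norm_ge_zero p)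
    qed
   qed measurable
   ultimately show "L1 (%x. \<integral>z. norm (case (x, z) of (x, z) => KB (iu v) x * (?B z x)) \<partial>?Z)" by (simp only: prod.case)
  qed
  have "cx (2 * \<Gamma>) * Mm de nu (iu v) = (LBINT x. cx (2 * \<Gamma>) * (cx (exp (de * x)) * (KB nu x * KB (iu v) x)))"
   using nu by (subst KB_mellin2(2)[symmetric]) (simp_all only: integral_mult_right_zero, simp)
  also have "... = (LBINT x. (\<integral>z. KB (iu v) x * (?B z x) \<partial>?Z))"
  proof (rule lintegral_cong[OF refl])
   fix x
   show "cx (2 * \<Gamma>) * (cx (exp (de * x)) * (KB nu x * KB (iu v) x)) = (\<integral>z. KB (iu v) x * (?B z x) \<partial>?Z)"
    unfolding integral_mult_right_zero mix(2) by (simp only: mult.assoc mult.commute mult.left_commute)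
  qed
  also have "... = (\<integral>z. (LBINT x. KB (iu v) x * (?B z x)) \<partial>?Z)" by (rule P.Fubini_integral[symmetric]) (use i in simp)
  also have "... = (\<integral>z. E z * (?H z v) \<partial>?Z)"
  proof (rule lintegral_cong[OF refl])
   fix z
   have "KB (iu v) x * (?B z x) = E z * (cx (ph z x) * KB (iu v) x)" for x by (simp only: mult.assoc mult.commute mult.left_commute)
   then show "(LBINT x. KB (iu v) x * (?B z x)) = E z * (?H z v)" by (simp only: integral_mult_right_zero)
  qed
  finally have 1: "cx (2 * \<Gamma>) * Mm de nu (iu v) = (\<integral>z. E z * (?H z v) \<partial>?Z)" .
  have "cx (2 * \<Gamma>) * (?K v) = (\<integral>z. E z * ((?H z v) * cx (ww v)) \<partial>?Z)"
   unfolding mult.assoc[symmetric] 1 integral_mult_left_zero ..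
  also have "... = (\<integral>z. E z * cx (SS (s z) v / pi) \<partial>?Z)" unfolding ph_def KB_exponential_transform(2)[OF s1] ..
  also have "... = cx (1 / pi) * (\<integral>z. E z * cx (SS (s z) v) \<partial>?Z)" by (subst integral_mult_right_zero[symmetric]) simp
  finally have "cx (2 * \<Gamma>) * (?K v) = cx (1 / pi) * (\<integral>z. E z * cx (SS (s z) v) \<partial>?Z)" .
  then show ?thesis using \<Gamma> by (simp add: field_simps)
 qed
 define K where "K = (LBINT x. norm (g x) * KR0 x)"
 have K0: "K >= 0" unfolding K_def by (intro lintegral_nonneg) (simp add: KR_nonneg)
 have pe: "L1 (%v. (1 + abs v) ^ 2 * E0 v)" by (rule integrable_poly_exp[OF th0_pos])
 have i4: "integrable (lborel \<Otimes>\<^sub>M ?Z) (%(v, z :: real \<times> real). kt g v * (?E z v))"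
 proof (rule lintegrable_bound)
  show "integrable (lborel \<Otimes>\<^sub>M ?Z) (%(v, z :: real \<times> real). (2 * K * (?D v)) * (R z / s z))"
   by (rule integrable_prod_measure[OF sfl sfZ integrable_mult_right[OF pe] Rs])
  show "(%(v, z :: real \<times> real). kt g v * (?E z v)) \<in> borel_measurable (lborel \<Otimes>\<^sub>M ?Z)" by measurable
  show "AE p in lborel \<Otimes>\<^sub>M ?Z. norm (case p of (v, z :: real \<times> real) => kt g v * (?E z v)) <= norm (case p of (v, z :: real \<times> real) => (2 * K * (?D v)) * (R z / s z))"
  proof (intro AE_I2, clarify)
   fix v a b :: real
   define z where "z = (a, b)"
   have "norm (kt g v * (?E z v)) <= (E0 v * K) * (R z * (2 * (1 + abs v)^2 / s z))" unfolding norm_mult nE norm_of_real K_def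
    by (intro mult_mono kt_integrable(3)[OF g] SS_bound[OF s1] mult_nonneg_nonneg R0) (auto simp: R0 K0[unfolded K_def])
   also have "... = (2 * K * (?D v)) * (R z / s z)" by simp
   finally show "norm (kt g v * (E (a, b) * cx (SS (s (a, b)) v))) <= norm ((2 * K * (?D v)) * (R (a, b) / s (a, b)))"
    unfolding z_def by (metis abs_ge_self order_trans real_norm_def)
  qed
 qed
 \<comment> \<open>Parseval for a single exponential: Fubini and the inversion formula for
   \<open>SS\<close>.\<close>
 have step5: "(LBINT v. kt g v * cx (SS t v)) = (LBINT x. g x * cx (pi * exp (x - t * exp x)))" if t: "t > 1" for t
 proof -
  have i: "integrable lborel2 (%(v, x). g x * KB (iu v) x * cx (SS t v))"
  proof (rule lintegrable_bound)
   show "integrable lborel2 (%(v, x). (2 / t * (?D v)) * (norm (g x) * KR0 x))"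
    by (rule integrable_prod_measure[OF sfl sfl integrable_mult_right[OF pe] kt_integrable(1)[OF g]])
   show "(%(v, x). g x * KB (iu v) x * cx (SS t v)) \<in> borel_measurable lborel2" by measurable
   show "AE p in lborel2. norm (case p of (v, x) => g x * KB (iu v) x * cx (SS t v)) <= norm (case p of (v, x) => (2 / t * (?D v)) * (norm (g x) * KR0 x))"
   proof (intro AE_I2, clarify)
    fix v x :: real
    have "norm (g x * KB (iu v) x * cx (SS t v)) <= norm (g x) * (E0 v * KR0 x) * (2 * (1 + abs v)^2 / t)" unfolding norm_mult norm_of_real
     by (intro mult_mono KB_imag_decay SS_bound[OF t] mult_nonneg_nonneg) (auto simp: KR_nonneg)
    also have "... = (2 / t * (?D v)) * (norm (g x) * KR0 x)" by simp
    finally show "norm (g x * KB (iu v) x * cx (SS t v)) <= norm ((2 / t * (?D v)) * (norm (g x) * KR0 x))"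
     by (metis abs_ge_self order_trans real_norm_def)
   qed
  qed
  have "(LBINT v. kt g v * cx (SS t v)) = (LBINT v. (LBINT x. g x * KB (iu v) x * cx (SS t v)))" unfolding kt_def integral_mult_left_zero ..
  also have "... = (LBINT x. (LBINT v. g x * KB (iu v) x * cx (SS t v)))" by (rule lborel_pair.Fubini_integral[symmetric]) (use i in simp)
  also have "... = (LBINT x. g x * cx (pi * exp (x - t * exp x)))" unfolding mult.assoc integral_mult_right_zero KB_SS_inversion(2)[OF t] ..
  finally show ?thesis .
 qed
 have i6: "integrable (lborel \<Otimes>\<^sub>M ?Z) (%(x, z). g x * (?B z x))"
 proof (rule P.Fubini_integrable)
  show "(%(x, z). g x * (?B z x)) \<in> borel_measurable (lborel \<Otimes>\<^sub>M ?Z)" by measurable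
  show "AE x in lborel. integrable ?Z (%z. case (x, z) of (x, z) => g x * (?B z x))"
   unfolding prod.case using mix(1) by (intro AE_I2 integrable_mult_right)
  have "(\<integral>z. norm (g x * (?B z x)) \<partial>?Z) = norm (g x) * (?A x)" for x
   unfolding norm_mult[of "g _"] nphi integral_mult_right_zero mixR(2) ..
  moreover have "L1 (%x. norm (g x) * (?A x))"
  proof (rule lintegrable_bound)
   have "L1 (%x. exp ((de + ep) * x) * KR (Re nu) x)" using nu e by (intro KR_mellin_integrable) auto
   then show "L1 (%x. C * 2 * \<Gamma> * (?L x))" by (rule integrable_mult_right)
   show "AE x in lborel. norm (norm (g x) * (?A x)) <= norm (C * 2 * \<Gamma> * (?L x))"
   proof (intro AE_I2)
    fix x
    have p: "0 <= 2 * \<Gamma> * (?G x)" using \<Gamma> by (simp add: KR_nonneg)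
    have "norm (g x) * (?A x) <= C * exp (ep * x) * (?A x)"
     using p by (intro mult_right_mono C)
    also have "... = C * 2 * \<Gamma> * ((exp (de * x) * exp (ep * x)) * KR (Re nu) x)" by simp
    also have "exp (de * x) * exp (ep * x) = exp ((de + ep) * x)" by (simp add: exp_add[symmetric] algebra_simps)
    finally show "norm (norm (g x) * (?A x)) <= norm (C * 2 * \<Gamma> * (?L x))"
     by (rule real_norm_mono[rotated]) (intro mult_nonneg_nonneg norm_ge_zero p)
   qed
  qed measurable
  ultimately show "L1 (%x. \<integral>z. norm (case (x, z) of (x, z) => g x * (?B z x)) \<partial>?Z)" by (simp only: prod.case)
 qed
 have "(LBINT v. kt g v * (?K v)) = cx ?M * (LBINT v. (\<integral>z. kt g v * (?E z v) \<partial>?Z))"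
 proof -
  have "kt g v * (?K v) = cx ?M * (\<integral>z. kt g v * (?E z v) \<partial>?Z)" for v
   unfolding step3 by (subst integral_mult_right_zero, rule mult.left_commute)
  then show ?thesis by (simp only: integral_mult_right_zero)
 qed
 also have "(LBINT v. (\<integral>z. kt g v * (?E z v) \<partial>?Z)) = (\<integral>z. (LBINT v. kt g v * (?E z v)) \<partial>?Z)"
  by (rule P.Fubini_integral[symmetric]) (use i4 in simp)
 also have "... = (\<integral>z. E z * (LBINT v. kt g v * cx (SS (s z) v)) \<partial>?Z)"
 proof -
  have "kt g v * (?E z v) = E z * (kt g v * cx (SS (s z) v))" for v z by (rule mult.left_commute)
  then show ?thesis by (simp only: integral_mult_right_zero)
 qed
 also have "... = (\<integral>z. E z * (LBINT x. g x * cx (pi * ph z x)) \<partial>?Z)" unfolding step5[OF s1] ph_def ..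
 also have "... = cx pi * (\<integral>z. (LBINT x. g x * (?B z x)) \<partial>?Z)"
 proof -
  have "E z * (LBINT x. g x * cx (pi * ph z x)) = cx pi * (LBINT x. g x * (?B z x))" for z
  proof -
   have "g x * cx (pi * ph z x) = cx pi * (g x * cx (ph z x))" for x by (simp only: of_real_mult mult.left_commute)
   moreover have "g x * (?B z x) = E z * (g x * cx (ph z x))" for x by (rule mult.left_commute)
   ultimately show ?thesis by (simp only: integral_mult_right_zero mult.left_commute)
  qed
  then show ?thesis by (simp only: integral_mult_right_zero)
 qed
 also have "(\<integral>z. (LBINT x. g x * (?B z x)) \<partial>?Z) = (LBINT x. (\<integral>z. g x * (?B z x) \<partial>?Z))"
  by (rule P.Fubini_integral) (use i6 in simp)
 also have "... = cx (2 * \<Gamma>) * (LBINT x. g x * (?J x))"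
 proof -
  have "(\<integral>z. g x * (?B z x) \<partial>?Z) = cx (2 * \<Gamma>) * (g x * (?J x))" for x
   by (subst integral_mult_right_zero, subst mix(2), rule mult.left_commute)
  then show ?thesis by (simp only: integral_mult_right_zero)
 qed
 finally show ?thesis using \<Gamma> by (simp add: mult.assoc[symmetric])
qed

section \<open>Parseval identities\<close>

text \<open>The value of \<open>hm al\<close> at imaginary index. For \<open>- 2 < al < 0\<close> it
  is no longer the Mellin transform of \<open>KB\<close>, but the index transform of the corrected
  exponential, see \<open>kt_phia\<close>.\<close>

definition hR :: "real => real => real" where
 "hR al v = 2 powr (al - 2) * (norm (Gamma ((cx al + iu v) / 2)))^2"

definition MR :: "real => real => real => real" where
 "MR de u v = 2 powr (1 - de) / Gamma de * hR de (u + v) * hR de (u - v)"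

lemma Gamma_cnj_mult: "Gamma z * Gamma (cnj z) = cx ((norm (Gamma z))^2)" by (simp add: complex_norm_square cnj_Gamma del: of_real_power)

lemma hm_imag: "hm al (iu v) = cx (hR al v)"
proof -
 have "(cx al - iu v) / 2 = cnj ((cx al + iu v) / 2)" by simp
 then show ?thesis using Gamma_cnj_mult[of "(cx al + iu v) / 2"] by (simp only: hm_def hR_def of_real_mult mult.assoc)
qed

lemma hR_nonneg: "hR al v >= 0" by (simp add: hR_def)

lemma hm_minus: "hm al (- nu) = hm al nu" by (simp add: hm_def mult.commute mult.left_commute)

lemma hR_minus: "hR al (- v) = hR al v"
proof -
 have "cx (hR al (- v)) = cx (hR al v)" using hm_minus[of al "iu v"] hm_imag[of al v] hm_imag[of al "- v"] by simp
 then show ?thesis by (simp only: of_real_eq_iff)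
qed

lemma Mm_imag: "Mm de (iu u) (iu v) = cx (MR de u v)"
proof -
 have "iu u + iu v = iu (u + v)" "iu u - iu v = iu (u - v)" by (simp_all add: algebra_simps)
 then show ?thesis by (simp only: Mm_def MR_def hm_imag of_real_mult)
qed

lemma MR_commute: "MR de u v = MR de v u" using hR_minus[of de "u - v"] by (simp add: MR_def add.commute)

lemma MR_nonneg: "de > 0 ==> MR de u v >= 0"
 unfolding MR_def using Gamma_real_pos[of de] by (intro mult_nonneg_nonneg divide_nonneg_pos hR_nonneg) auto

lemma Re_pos_not_nonpos_Ints: "Re z > 0 ==> z \<notin> \<int>\<^sub>\<le>\<^sub>0" by (auto simp: nonpos_Ints_def)

lemma hR_pos: "al > 0 ==> hR al v > 0"
proof -
 assume "al > 0"
 then have "Re ((cx al + iu v) / 2) > 0" by simp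
 then have "(cx al + iu v) / 2 \<notin> (\<int>\<^sub>\<le>\<^sub>0 :: complex set)" by (rule Re_pos_not_nonpos_Ints)
 then have "Gamma ((cx al + iu v) / 2 :: complex) ~= 0" by (simp add: Gamma_eq_zero_iff)
 then show ?thesis by (simp add: hR_def)
qed

lemma borel_measurable_Gamma [measurable (raw)]:
 assumes [measurable]: "f \<in> borel_measurable M"
 shows "(%x. Gamma (f x) :: complex) \<in> borel_measurable M"
proof -
 have r: "(rGamma :: complex => complex) \<in> borel_measurable borel"
  by (intro borel_measurable_continuous_onI continuous_on_rGamma continuous_on_id)
 have "(%x. inverse (rGamma (f x))) \<in> borel_measurable M" using measurable_compose[OF assms r] by measurable
 then show ?thesis by (simp add: Gamma_def)
qed

lemma borel_measurable_hm [measurable (raw)]: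
 assumes [measurable]: "f \<in> borel_measurable M"
 shows "(%x. hm al (f x)) \<in> borel_measurable M" unfolding hm_def by measurable

lemma borel_measurable_Mm [measurable (raw)]:
 assumes [measurable]: "f \<in> borel_measurable M" "g \<in> borel_measurable M"
 shows "(%x. Mm de (f x) (g x)) \<in> borel_measurable M" unfolding Mm_def by measurable

lemma borel_measurable_hR [measurable (raw)]:
 assumes [measurable]: "f \<in> borel_measurable M"
 shows "(%x. hR al (f x)) \<in> borel_measurable M" unfolding hR_def by measurable

lemma borel_measurable_MR [measurable (raw)]:
 assumes [measurable]: "f \<in> borel_measurable M" "g \<in> borel_measurable M"
 shows "(%x. MR de (f x) (g x)) \<in> borel_measurable M" unfolding MR_def by measurable

section \<open>Decay in the index\<close>

definition HB :: "real => real => real" where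
 "HB de sg = (LBINT x. exp (de * x) * KR sg (x - 1))"

lemma KR_shift_integrable:
 assumes "abs sg < de"
 shows "L1 (%x. exp (de * x) * KR sg (x - 1))"
proof -
 have "L1 (%x. exp (de * x) * KR sg x)" using assms by (intro KR_mellin_integrable) simp
 then have "L1 (%x. exp (de * (- 1 + 1 * x)) * KR sg (- 1 + 1 * x))" by (rule lborel_integrable_real_affine) simp
 from integrable_mult_right[OF this, of "exp de"]
 show ?thesis by (simp add: exp_add[symmetric] mult.assoc[symmetric] algebra_simps)
qed

lemma HB_nonneg: "HB de sg >= 0" unfolding HB_def by (intro lintegral_nonneg) (simp add: KR_nonneg)

text \<open>The decay of the Gamma factors is read off from the Mellin integral together with
  \<open>KB_decay\<close>, in place of Stirling's formula.\<close>

lemma hm_decay: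
 assumes s: "abs (Re nu) <= sg" "sg < de"
 shows "norm (hm de nu) <= exp (- th0 * abs (Im nu)) * HB de sg"
proof -
 let ?A = "- th0 * abs (Im nu)"
 let ?B = "%x. exp (de * x) * KR sg (x - 1)"
 have i: "L1 (%x. exp (de * x) * KR sg (x - 1))" using s by (intro KR_shift_integrable) linarith
 have "norm (hm de nu) = norm (LBINT x. cx (exp (de * x)) * KB nu x)" using s by (subst KB_mellin(2)) auto
 also have "... <= (LBINT x. norm (cx (exp (de * x)) * KB nu x))" by (rule integral_norm_bound)
 also have "... <= (LBINT x. exp ?A * (?B x))"
 proof (rule integral_mono)
  show "L1 (%x. norm (cx (exp (de * x)) * KB nu x))" using s by (intro integrable_norm KB_mellin(1)) auto
  show "L1 (%x. exp ?A * (?B x))" using i by simp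
  fix x
  have "norm (KB nu x) <= exp ?A * KR sg (x - 1)" by (rule order_trans[OF KB_decay mult_left_mono[OF KR_mono[OF s(1)]]]) simp
  then have "exp (de * x) * norm (KB nu x) <= exp (de * x) * (exp ?A * KR sg (x - 1))" by (intro mult_left_mono) auto
  then show "norm (cx (exp (de * x)) * KB nu x) <= exp ?A * (?B x)"
   by (simp only: norm_mult norm_of_real abs_exp_cancel mult.left_commute)
 qed
 finally show ?thesis by (simp add: HB_def)
qed

lemma hR_decay: "de > 0 ==> hR de v <= E0 v * HB de 0" using hm_decay[of "iu v" 0 de] by (simp add: hm_imag hR_nonneg)

definition MB :: "real => real => real" where
 "MB de sg = 2 powr (1 - de) / Gamma de * HB de sg * HB de sg"

lemma MB_nonneg: "de > 0 ==> MB de sg >= 0"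
 unfolding MB_def using Gamma_real_pos[of de] by (intro mult_nonneg_nonneg divide_nonneg_pos HB_nonneg) auto

text \<open>The two factors decay in \<open>Im nu + v\<close> and \<open>Im nu - v\<close>, whose
  absolute values add up to at least \<open>2 * abs v\<close>. The bound is thus uniform in
  \<open>Im nu\<close>.\<close>

lemma Mm_decay:
 assumes s: "abs (Re nu) <= sg" "sg < de"
 shows "norm (Mm de nu (iu v)) <= MB de sg * exp (- 2 * th0 * abs v)"
proof -
 let ?A = "- th0 * abs (Im nu + v)"
 let ?B = "- th0 * abs (Im nu - v)"
 have d: "de > 0" using s by linarith
 have G: "2 powr (1 - de) / Gamma de >= 0" using Gamma_real_pos[OF d] by simp
 have 1: "norm (hm de (nu + iu v)) <= exp ?A * HB de sg" using hm_decay[of "nu + iu v" sg de] s by simp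
 have 2: "norm (hm de (nu - iu v)) <= exp ?B * HB de sg" using hm_decay[of "nu - iu v" sg de] s by simp
 have "norm (Mm de nu (iu v)) = 2 powr (1 - de) / Gamma de * norm (hm de (nu + iu v)) * norm (hm de (nu - iu v))"
  unfolding Mm_def norm_mult norm_of_real using G by (simp only: abs_of_nonneg)
 also have "... <= 2 powr (1 - de) / Gamma de * (exp ?A * HB de sg) * (exp ?B * HB de sg)"
  by (intro mult_mono mult_left_mono 1 2 G mult_nonneg_nonneg HB_nonneg) auto
 also have "... = MB de sg * (exp ?A * exp ?B)" by (simp add: MB_def)
 also have "... <= MB de sg * exp (- 2 * th0 * abs v)"
 proof (rule mult_left_mono[OF _ MB_nonneg[OF d]])
  have "2 * abs v <= abs (Im nu + v) + abs (Im nu - v)" by linarith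
  then have "th0 * (2 * abs v) <= th0 * (abs (Im nu + v) + abs (Im nu - v))" using th0_pos by (intro mult_left_mono) auto
  then show "exp ?A * exp ?B <= exp (- 2 * th0 * abs v)"
   unfolding exp_add[symmetric] exp_le_cancel_iff by (simp add: algebra_simps)
 qed
 finally show ?thesis .
qed

lemma MR_decay: "de > 0 ==> MR de u v <= MB de 0 * exp (- 2 * th0 * abs v)" using Mm_decay[of "iu u" 0 de v] by (simp add: Mm_imag MR_nonneg)

lemma ww_nonneg: "ww v >= 0"
 by (cases "v >= 0") (auto simp: ww_def mult_nonneg_nonneg mult_nonpos_nonpos zero_le_divide_iff zero_le_mult_iff mult_le_0_iff)

lemma ww_bound: "ww v <= (1 + abs v) * exp (pi * abs v)"
proof -
 have half: "abs ((E - e) / 2) <= X" if "E <= X" "e <= X" "0 < E" "0 < e" for E e X :: real using that by (simp add: abs_if field_simps)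
 have "exp (pi * v) <= exp (pi * abs v)" "exp (- (pi * v)) <= exp (pi * abs v)"
  unfolding exp_le_cancel_iff using mult_left_mono[of v "abs v" pi] mult_left_mono[of "- v" "abs v" pi] by auto
 moreover have "exp (pi * v) > 0" "exp (- (pi * v)) > 0" by auto
 ultimately have "abs (sinh (pi * v)) <= exp (pi * abs v)" unfolding sinh_field_def by (rule half)
 moreover have "pi^2 >= 1" using pi_ge_two by (simp add: one_le_power)
 moreover have "ww v = abs v * abs (sinh (pi * v)) / pi^2" using ww_nonneg[of v] by (simp add: ww_def abs_mult[symmetric] zero_le_divide_iff)
 ultimately have "ww v <= abs v * exp (pi * abs v) / 1" by (simp only:) (intro frac_le mult_left_mono, auto)
 also have "... <= (1 + abs v) * exp (pi * abs v)" by simp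
 finally show ?thesis .
qed

text \<open>The net rate of decay: one \<open>th0\<close> from \<open>hR\<close> or
  \<open>kt g\<close> and two from \<open>Mm\<close>, against the growth rate \<open>pi\<close> of
  \<open>ww\<close>.\<close>

definition c0 :: real where "c0 = 3 * th0 - pi"

lemma c0_pos: "c0 > 0" using th0 by (simp add: c0_def)

lemma decay_integrable:
 fixes f :: "real => complex"
 assumes d: "abs (Re nu) < de" and f[measurable]: "f \<in> borel_measurable borel" and b: "!!v. norm (f v) <= E0 v * B"
 shows "L1 (%v. f v * (Mm de nu (iu v) * cx (ww v)))"
proof (rule lintegrable_bound)
 let ?A = "%v. (1 + abs v) ^ 1 * exp (- c0 * abs v)"
 let ?B = "%v. f v * (Mm de nu (iu v) * cx (ww v))"
 have B: "B >= 0" using order_trans[OF norm_ge_zero b[of 0]] by simp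
 have d0: "de > 0" using d by linarith
 show "L1 (%v. B * MB de (abs (Re nu)) * (?A v))" by (intro integrable_mult_right integrable_poly_exp c0_pos)
 show "AE v in lborel. norm (?B v) <= norm (B * MB de (abs (Re nu)) * (?A v))"
 proof (intro AE_I2)
  fix v
  have "norm (?B v) <= (E0 v * B) * ((MB de (abs (Re nu)) * exp (- 2 * th0 * abs v)) * ((1 + abs v) * exp (pi * abs v)))"
   unfolding norm_mult norm_of_real abs_of_nonneg[OF ww_nonneg] using d
   by (intro mult_mono b Mm_decay ww_bound mult_nonneg_nonneg MB_nonneg[OF d0] ww_nonneg B) auto
  also have "... = B * MB de (abs (Re nu)) * ((1 + abs v) ^ 1 * (E0 v * exp (- 2 * th0 * abs v) * exp (pi * abs v)))" by simp
  also have "E0 v * exp (- 2 * th0 * abs v) * exp (pi * abs v) = exp (- c0 * abs v)" unfolding exp_add[symmetric] by (simp add: c0_def algebra_simps)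
  finally show "norm (?B v) <= norm (B * MB de (abs (Re nu)) * (?A v))"
   unfolding real_norm_def by (rule order_trans[OF _ abs_ge_self])
 qed
qed measurable

text \<open>With r = exp x cosh w, the function r^sg exp(-r) is bounded by its maximum
  \<open>M\<close>, attained at r = sg. This extracts \<open>exp (- sg * x)\<close> and leaves an
  integral that converges because \<open>abs s < sg\<close>.\<close>

lemma KR_bound:
 assumes s: "abs s < sg"
 shows "\<exists>C. \<forall>x. KR s x <= C * exp (- sg * x)"
proof -
 let ?A = "%w. exp (s * w) * cosh w powr (- sg)"
 have sg: "sg > 0" using s by linarith
 define M where "M = exp (sg * ln sg - sg)"
 have M: "exp (sg * y - exp y) <= M" for y
 proof -
  have "exp (ln sg) * (1 + (y - ln sg)) <= exp (ln sg) * exp (y - ln sg)" by (intro mult_left_mono exp_ge_add_one_self) auto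
  also have "... = exp y" by (simp add: exp_add[symmetric])
  finally have "sg * (1 + (y - ln sg)) <= exp y" using sg by simp
  then show ?thesis by (simp add: M_def algebra_simps)
 qed
 define D where "D = (LBINT w. exp (s * w) * cosh w powr (- sg))"
 have iD: "L1 (%w. exp (s * w) * cosh w powr (- sg))"
 proof -
  have "L1 (%w. exp (cx s * cx w) * cx (cosh w powr (- sg)))" using s by (intro cosh_powr_integrable) simp
  moreover have "exp (cx s * cx w) * cx (cosh w powr (- sg)) = cx (?A w)" for w by (simp flip: exp_of_real)
  ultimately show ?thesis by (simp only: complex_of_real_integrable_eq)
 qed
 have "KR s x <= (M * D / 2) * exp (- sg * x)" for x
 proof -
  have "(LBINT w. exp (s * w - exp x * cosh w)) <= (LBINT w. M * exp (- sg * x) * (?A w))"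
  proof (rule integral_mono[OF KR_integrable integrable_mult_right[OF iD]])
   fix w :: real
   have "exp x * cosh w = exp (x + ln (cosh w))" by (simp add: exp_add cosh_real_pos)
   then have "exp (- (exp x * cosh w)) = exp (sg * (x + ln (cosh w)) - exp (x + ln (cosh w))) * exp (- sg * (x + ln (cosh w)))"
    by (simp add: exp_add[symmetric])
   also have "... <= M * exp (- sg * (x + ln (cosh w)))" by (intro mult_right_mono M) auto
   also have "exp (- sg * (x + ln (cosh w))) = exp (- sg * x) * cosh w powr (- sg)" by (simp add: powr_def exp_add[symmetric] algebra_simps)
   finally have "exp (s * w) * exp (- (exp x * cosh w)) <= exp (s * w) * (M * (exp (- sg * x) * cosh w powr (- sg)))" by (intro mult_left_mono) auto
   then show "exp (s * w - exp x * cosh w) <= M * exp (- sg * x) * (?A w)"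
    by (simp add: exp_diff exp_minus divide_inverse mult_ac)
  qed
  then show ?thesis unfolding integral_mult_right_zero D_def[symmetric] by (simp add: KR_def mult_ac)
 qed
 then show ?thesis by blast
qed

lemma expbd_exp_KB:
 assumes "abs (Re nu) < de"
 shows "expbd (%x. cx (exp (de * x)) * KB nu x)"
proof -
 define sg where "sg = (abs (Re nu) + de) / 2"
 have sg: "abs (Re nu) < sg" "sg < de" using assms by (auto simp: sg_def)
 obtain C where C: "!!x. KR (Re nu) x <= C * exp (- sg * x)" using KR_bound[OF sg(1)] by blast
 have "norm (cx (exp (de * x)) * KB nu x) <= C * exp ((de - sg) * x)" for x
 proof -
  have "exp (de * x) * norm (KB nu x) <= exp (de * x) * (C * exp (- sg * x))" using norm_KB_le[of nu x] C[of x] by (intro mult_left_mono) auto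
  also have "... = C * (exp (de * x) * exp (- sg * x))" by simp
  also have "exp (de * x) * exp (- sg * x) = exp ((de - sg) * x)" by (simp add: exp_add[symmetric] algebra_simps)
  finally show ?thesis by (simp add: norm_mult del: of_real_exp)
 qed
 then show ?thesis unfolding expbd_def using sg(2) by (intro conjI exI[of _ C] exI[of _ "de - sg"]) auto
qed

lemma expbd_exp: "al > 0 ==> expbd (%x. cx (exp (al * x)))" unfolding expbd_def by (intro conjI exI[of _ 1] exI[of _ al]) (auto simp del: of_real_exp)

lemma expbd_mult_exp:
 assumes "expbd g" "de >= 0"
 shows "expbd (%x. g x * cx (exp (de * x)))"
proof -
 obtain C ep where [measurable]: "g \<in> borel_measurable borel" and e: "ep > 0" and C: "!!x. norm (g x) <= C * exp (ep * x)"
  using assms by (auto simp: expbd_def)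
 have "norm (g x * cx (exp (de * x))) <= C * exp ((ep + de) * x)" for x
 proof -
  have "norm (g x) * exp (de * x) <= C * exp (ep * x) * exp (de * x)" by (intro mult_right_mono C) auto
  then show ?thesis by (simp add: norm_mult mult.assoc exp_add[symmetric] distrib_right del: of_real_exp)
 qed
 then show ?thesis unfolding expbd_def using e assms(2) by (intro conjI exI[of _ C] exI[of _ "ep + de"]) auto
qed

lemma kt_exp_KB: "abs (Re nu) < de ==> kt (%x. cx (exp (de * x)) * KB nu x) v = Mm de nu (iu v)"
 unfolding kt_def by (subst KB_mellin2(2)[symmetric]) (auto simp: mult.assoc)

lemma kt_exp: "al > 0 ==> kt (%x. cx (exp (al * x))) v = cx (hR al v)" unfolding kt_def by (subst KB_mellin(2)) (auto simp: hm_imag)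

text \<open>Multiplying by \<open>exp (de * x)\<close> is multiplying twice by
  \<open>exp (e * x)\<close> with \<open>e = de / 2\<close>, and on the spectral side this composes
  the kernel \<open>MR e\<close> with itself. The induction runs over the halvings needed to bring
  \<open>de\<close> below 1.\<close>

lemma parseval_imag:
 assumes "0 < de" "expbd g"
 shows "(LBINT v. kt g v * (Mm de (iu u) (iu v) * cx (ww v))) =
   (LBINT x. g x * (cx (exp (de * x)) * KB (iu u) x))"
proof -
 let ?A = "%g v. kt g v * cx (ww v)"
 have "0 < de ==> de < 2 ^ n ==> expbd g ==> (LBINT v. kt g v * (Mm de (iu u) (iu v) * cx (ww v))) =
   (LBINT x. g x * (cx (exp (de * x)) * KB (iu u) x))" for n
 proof (induction n arbitrary: de g u)
  case 0
  then show ?case by (intro parseval_small) auto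
 next
  case (Suc n)
  define e where "e = de / 2"
  have e: "0 < e" "e < 2 ^ n" "e + e = de" using Suc.prems by (auto simp: e_def)
  note IH = Suc.IH[OF e(1,2)]
  have gm[measurable]: "g \<in> borel_measurable borel" using Suc.prems by (simp add: expbd_def)
  \<comment> \<open>The composition rule is itself the induction hypothesis, taken for
    \<open>g\<close> equal to \<open>exp (e * x)\<close> times a Macdonald function.\<close>
  have comp: "(LBINT w. cx (MR e v w * (MR e u w * ww w))) = cx (MR de u v)" for u v
  proof -
   have r: "abs (Re (iu v)) < e" using e by simp
   have "(LBINT w. cx (MR e v w * (MR e u w * ww w))) = (LBINT x. (cx (exp (e * x)) * KB (iu v) x) * (cx (exp (e * x)) * KB (iu u) x))"
    using IH[OF expbd_exp_KB[OF r], of u] unfolding kt_exp_KB[OF r] Mm_imag of_real_mult .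
   also have "... = (LBINT x. cx (exp (de * x)) * (KB (iu u) x * KB (iu v) x))"
   proof (rule lintegral_cong[OF refl])
    fix x
    have "exp (de * x) = exp (e * x) * exp (e * x)" unfolding exp_add[symmetric] e(3)[symmetric] by (simp add: algebra_simps)
    then show "(cx (exp (e * x)) * KB (iu v) x) * (cx (exp (e * x)) * KB (iu u) x) = cx (exp (de * x)) * (KB (iu u) x * KB (iu v) x)"
     by (simp add: mult_ac del: of_real_exp)
   qed
   also have "... = cx (MR de u v)" using Suc.prems by (subst KB_mellin2(2)) (auto simp: Mm_imag)
   finally show ?thesis .
  qed
  have icomp: "L1 (%w. MR e v w * (MR e u w * ww w))" for u v
  proof -
   have "L1 (%w. cx (MR e v w) * (Mm e (iu u) (iu w) * cx (ww w)))"
   proof (rule decay_integrable[where B = "MB e 0"])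
    fix w
    have "norm (cx (MR e v w)) = MR e v w" using e by (simp add: MR_nonneg)
    also have "... <= MB e 0 * exp (- 2 * th0 * abs w)" by (rule MR_decay[OF e(1)])
    also have "... <= MB e 0 * E0 w" using th0_pos by (intro mult_left_mono MB_nonneg e) (auto simp: mult_right_mono)
    finally show "norm (cx (MR e v w)) <= E0 w * MB e 0" by (simp add: mult.commute)
   qed (use e in auto)
   then have "L1 (%w. cx (MR e v w * (MR e u w * ww w)))" unfolding Mm_imag of_real_mult .
   then show ?thesis by (simp only: complex_of_real_integrable_eq)
  qed
  have vcomp: "(LBINT w. MR e v w * (MR e u w * ww w)) = MR de u v" for u v using comp[of v u] by (simp only: integral_complex_of_real of_real_eq_iff)
  have gb: "norm (kt g v) <= E0 v * (LBINT x. norm (g x) * KR0 x)" for v by (rule kt_integrable(3)[OF Suc.prems(3)])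
  have i: "integrable lborel2 (%(v, w). (?A g v) * cx (MR e v w * (MR e u w * ww w)))"
  proof (rule lborel_pair.Fubini_integrable)
   show "(%(v, w). (?A g v) * cx (MR e v w * (MR e u w * ww w))) \<in> borel_measurable lborel2" by measurable
   show "AE v in lborel. L1 (%w. case (v, w) of (v, w) => (?A g v) * cx (MR e v w * (MR e u w * ww w)))"
    unfolding prod.case using icomp by (intro AE_I2 integrable_mult_right) (simp only: complex_of_real_integrable_eq)
   have nn: "0 <= MR e v w * (MR e u w * ww w)" for v w using e by (intro mult_nonneg_nonneg MR_nonneg ww_nonneg)
   have "(LBINT w. norm ((?A g v) * cx (MR e v w * (MR e u w * ww w)))) = norm (kt g v * (Mm de (iu u) (iu v) * cx (ww v)))" for v
   proof -
    have "(LBINT w. norm ((?A g v) * cx (MR e v w * (MR e u w * ww w)))) = norm (?A g v) * MR de u v"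
     unfolding norm_mult[of "kt g v * _"] norm_of_real abs_of_nonneg[OF nn] integral_mult_right_zero vcomp ..
    then show ?thesis using Suc.prems MR_nonneg[of de u v] by (simp add: norm_mult Mm_imag)
   qed
   moreover have "L1 (%v. norm (kt g v * (Mm de (iu u) (iu v) * cx (ww v))))" using gb Suc.prems by (intro integrable_norm decay_integrable) auto
   ultimately show "L1 (%v. (LBINT w. norm (case (v, w) of (v, w) => (?A g v) * cx (MR e v w * (MR e u w * ww w)))))"
    by (simp only: prod.case)
  qed
  define g1 where "g1 x = g x * cx (exp (e * x))" for x
  have g1: "expbd g1" unfolding g1_def using Suc.prems e by (intro expbd_mult_exp) auto
  have inner: "(LBINT v. kt g v * cx (MR e w v * ww v)) = kt g1 w" for w
  proof -
   have "(LBINT v. kt g v * cx (MR e w v * ww v)) = (LBINT x. g x * (cx (exp (e * x)) * KB (iu w) x))"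
    using IH[OF Suc.prems(3), of w] unfolding Mm_imag of_real_mult .
   then show ?thesis by (simp only: kt_def g1_def mult.assoc)
  qed
  have "(LBINT v. kt g v * (Mm de (iu u) (iu v) * cx (ww v))) = (LBINT v. (LBINT w. (?A g v) * cx (MR e v w * (MR e u w * ww w))))"
   unfolding integral_mult_right_zero integral_complex_of_real vcomp Mm_imag by (simp only: mult.assoc mult.commute[of "cx (MR _ _ _)"])
  also have "... = (LBINT w. (LBINT v. (?A g v) * cx (MR e v w * (MR e u w * ww w))))"
   by (rule lborel_pair.Fubini_integral[symmetric]) (use i in simp)
  also have "... = (LBINT w. kt g1 w * (Mm e (iu u) (iu w) * cx (ww w)))"
  proof (rule lintegral_cong[OF refl])
   fix w
   have "(?A g v) * cx (MR e v w * (MR e u w * ww w)) = (kt g v * cx (MR e w v * ww v)) * cx (MR e u w * ww w)" for v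
    by (simp add: MR_commute[of e v w])
   then show "(LBINT v. (?A g v) * cx (MR e v w * (MR e u w * ww w))) = kt g1 w * (Mm e (iu u) (iu w) * cx (ww w))"
    by (simp only: integral_mult_left_zero inner) (simp only: Mm_imag of_real_mult)
  qed
  also have "... = (LBINT x. g1 x * (cx (exp (e * x)) * KB (iu u) x))" by (rule IH[OF g1])
  also have "... = (LBINT x. g x * (cx (exp (de * x)) * KB (iu u) x))"
  proof (rule lintegral_cong[OF refl])
   fix x
   have "exp (de * x) = exp (e * x) * exp (e * x)" unfolding exp_add[symmetric] e(3)[symmetric] by (simp add: algebra_simps)
   then show "g1 x * (cx (exp (e * x)) * KB (iu u) x) = g x * (cx (exp (de * x)) * KB (iu u) x)" by (simp add: g1_def mult.assoc del: of_real_exp)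
  qed
  finally show ?case .
 qed
 moreover obtain n :: nat where "de < 2 ^ n" using real_arch_pow[of 2 de] by auto
 ultimately show ?thesis using assms by blast
qed

text \<open>The continuous dual Hahn parameters are \<open>al/2\<close> and \<open>(de \<plusminus> nu)/2\<close>.\<close>

lemma cdh_integral:
 assumes a: "al > 0" and nu: "abs (Re nu) < de"
 shows "L1 (%v. cx (hR al v) * (Mm de nu (iu v) * cx (ww v)))"
  and "(LBINT v. cx (hR al v) * (Mm de nu (iu v) * cx (ww v))) = hm (al + de) nu"
proof -
 let ?A = "%nu. LBINT v. cx (hR al v) * (Mm de nu (iu v) * cx (ww v))"
 let ?B = "%v ze. cx (hR al v) * (Mm de ze (iu v) * cx (ww v))"
 have d: "de > 0" using nu by linarith
 have b: "norm (cx (hR al v)) <= E0 v * HB al 0" for v using hR_decay[OF a, of v] by (simp add: hR_nonneg)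
 show "L1 (%v. cx (hR al v) * (Mm de nu (iu v) * cx (ww v)))" using nu b by (intro decay_integrable) auto
 define S where "S = {z. - de < Re z & Re z < de}"
 have G: "(%z. Gamma ((cx ep + sg * z + c) / 2)) holomorphic_on S" if "ep >= de" "Re c = 0" "sg = 1 \<or> sg = -1" for ep c sg
 proof (intro holomorphic_intros)
  fix z assume "z \<in> S"
  then have "Re ((cx ep + sg * z + c) / 2) > 0" using that by (auto simp: S_def)
  then show "(cx ep + sg * z + c) / 2 \<notin> \<int>\<^sub>\<le>\<^sub>0" by (rule Re_pos_not_nonpos_Ints)
 qed auto
 have hol_hm: "(%z. hm ep (z + c)) holomorphic_on S" if "ep >= de" "Re c = 0" for ep c
 proof -
  have "(%z. cx (2 powr (ep - 2)) * Gamma ((cx ep + 1 * z + c) / 2) * Gamma ((cx ep + (-1) * z + (- c)) / 2)) holomorphic_on S"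
   using that by (intro holomorphic_on_mult holomorphic_on_const G) auto
  then show ?thesis by (simp add: hm_def[abs_def] algebra_simps)
 qed
 \<comment> \<open>For imaginary \<open>nu\<close> this is Parseval with
   \<open>g = exp (al * x)\<close>. Continuation through the strip reaches the real indices, which
   belong to atoms.\<close>
 show "(?A nu) = hm (al + de) nu"
 proof (rule holomorphic_equal_on_line[where S = S and sg = 0 and d = \<i> and l = "-1" and r = 1
   and f = "%nu. (?A nu)" and g = "hm (al + de)" and z = nu])
  show "open S" "connected S" unfolding S_def by (rule open_strip, rule connected_strip)
  show "hm (al + de) holomorphic_on S" using hol_hm[of "al + de" 0] a by simp
  show "(%nu. (?A nu)) holomorphic_on S"
  proof (rule holomorphic_on_integral_parameter)
   show "open S" unfolding S_def by (rule open_strip)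
   show "(%v. cx (hR al v) * (Mm de z (iu v) * cx (ww v))) \<in> borel_measurable lborel" for z by measurable
   show "(%z. cx (hR al v) * (Mm de z (iu v) * cx (ww v))) holomorphic_on S" for v unfolding Mm_def diff_conv_add_uminus[of _ "iu v"]
    by (intro holomorphic_on_mult holomorphic_on_const hol_hm) auto
   fix z assume "z \<in> S"
   then have z: "abs (Re z) < de" by (auto simp: S_def)
   define r where "r = (de - abs (Re z)) / 2"
   define sg where "sg = abs (Re z) + r"
   have r: "r > 0" "0 <= sg" "sg < de" using z by (auto simp: r_def sg_def field_simps)
   have cb: "abs (Re ze) <= sg" if "ze \<in> cball z r" for ze using that abs_Re_le_cmod[of "z - ze"] by (auto simp: dist_norm sg_def)
   have "cball z r \<subseteq> S" using cb r by (fastforce simp: S_def)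
   moreover have "L1 (%v. HB al 0 * MB de sg * ((1 + abs v) ^ 1 * exp (- c0 * abs v)))" by (intro integrable_mult_right integrable_poly_exp c0_pos)
   moreover have "norm (?B v ze) <= HB al 0 * MB de sg * ((1 + abs v) ^ 1 * exp (- c0 * abs v))"
    if "ze \<in> cball z r" for v ze
   proof -
    have "norm (?B v ze) <= (E0 v * HB al 0) * ((MB de sg * exp (- 2 * th0 * abs v)) * ((1 + abs v) * exp (pi * abs v)))"
     unfolding norm_mult[of "cx (hR al v)"] norm_mult[of "Mm _ _ _"] norm_of_real[of "ww v"] abs_of_nonneg[OF ww_nonneg]
     using cb[OF that] r by (intro mult_mono b Mm_decay ww_bound mult_nonneg_nonneg MB_nonneg[OF d] ww_nonneg HB_nonneg) auto
    also have "... = HB al 0 * MB de sg * ((1 + abs v) ^ 1 * (E0 v * exp (- 2 * th0 * abs v) * exp (pi * abs v)))" by simp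
    also have "E0 v * exp (- 2 * th0 * abs v) * exp (pi * abs v) = exp (- c0 * abs v)"
     unfolding exp_add[symmetric] by (simp add: c0_def algebra_simps)
    finally show ?thesis .
   qed
   ultimately show "\<exists>r>0. \<exists>g. cball z r \<subseteq> S & L1 g &
     (\<forall>v. \<forall>ze\<in>cball z r. norm (?B v ze) <= g v)" using r(1) by blast
  qed
  show "(LBINT v. cx (hR al v) * (Mm de (0 + cx t * \<i>) (iu v) * cx (ww v))) = hm (al + de) (0 + cx t * \<i>)" for t
  proof -
   have "(LBINT v. cx (hR al v) * (Mm de (iu t) (iu v) * cx (ww v))) = (LBINT x. cx (exp (al * x)) * (cx (exp (de * x)) * KB (iu t) x))"
    using parseval_imag[OF d expbd_exp[OF a], of t] unfolding kt_exp[OF a] .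
   also have "... = (LBINT x. cx (exp ((al + de) * x)) * KB (iu t) x)" by (simp only: distrib_right exp_add of_real_mult mult.assoc)
   also have "... = hm (al + de) (iu t)" using a d by (intro KB_mellin(2)) simp
   finally show ?thesis by (simp only: add_0_left mult.commute[of _ \<i>])
  qed
  show "0 + cx t * \<i> \<in> S" for t using d by (simp add: S_def)
  show "nu \<in> S" using nu by (auto simp: S_def)
 qed auto
qed

section \<open>The entrance law\<close>

text \<open>The constant for which \<open>kap a * KR (- a) x\<close> is asymptotic to
  \<open>exp (a * x)\<close> as x tends to -infinity.\<close>

definition kap :: "real => real" where "kap a = 2 powr (1 + a) / Gamma (- a)"

definition phia :: "real => real => real" where "phia a x = exp (a * x) - kap a * KR (- a) x"

text \<open>The subtraction in \<open>phia\<close> cancels the singular behaviour at \<open>x \<rightarrow> -\<infinity>\<close> to the next order.\<close>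

lemma expbd_phia:
 assumes a: "- 2 < a" "a < 0"
 obtains ep C where "ep > 0" "ep < - a" "!!x. abs (phia a x) <= C * exp (ep * x)"
proof -
 let ?A = "%A q. \<integral>tu. exp (A * tu - exp tu) * (1 - exp (- q tu)) \<partial>lborel"
 let ?B = "%A q. \<integral>tu. exp (A * tu - exp tu) * exp (- q tu) \<partial>lborel"
 let ?C = "%A tu. A * tu - exp tu"
 define A where "A = - a"
 have A: "0 < A" "A < 2" using a by (auto simp: A_def)
 \<comment> \<open>\<open>p > A / 2\<close> makes the exponent \<open>2 * p - A\<close> positive,
   \<open>p < A\<close> keeps it below \<open>A\<close>, and \<open>p <= 1\<close> gives 1 - exp(-y)
   <= y^p. Such a \<open>p\<close> exists because \<open>A < 2\<close>.\<close>
 define p where "p = (A / 2 + min A 1) / 2"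
 have p: "A / 2 < p" "p < A" "p <= 1" "0 <= p" using A by (auto simp: p_def min_def)
 have GA: "Gamma A > 0" using A by simp
 have i1: "L1 (%tu. exp (?C A tu))" "(\<integral>tu. exp (?C A tu) \<partial>lborel) = Gamma A"
  using Gamma_integral_log_real[of A 1] A by simp_all
 have i2: "L1 (%tu. exp ((A - p) * tu - exp tu))" "(\<integral>tu. exp ((A - p) * tu - exp tu) \<partial>lborel) = Gamma (A - p)"
  using Gamma_integral_log_real[of "A - p" 1] p by simp_all
 have bound: "abs (phia a x) <= (Gamma (A - p) / Gamma A) * exp ((2 * p - A) * x)" for x
 proof -
  define q where "q tu = exp (2 * x - tu) / 4" for tu :: real
  have qpos: "q tu >= 0" for tu by (simp add: q_def)
  \<comment> \<open>The translation by \<open>ln 2 - x\<close> turns \<open>exp x * cosh w\<close>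
    into \<open>exp tu + q tu\<close>, in which \<open>q\<close> tends to 0 as x tends to -infinity
    and the rest integrates to \<open>Gamma A\<close>.\<close>
  have KRe: "2 * KR A x = (\<integral>tu. 2 powr A * exp (- A * x) * (exp (?C A tu) * exp (- q tu)) \<partial>lborel)"
  proof -
   have "2 * KR A x = (LBINT w. exp (A * w - exp x * cosh w))" by (simp add: KR_def)
   also have "... = (\<integral>tu. exp (A * ((ln 2 - x) + 1 * tu) - exp x * cosh ((ln 2 - x) + 1 * tu)) \<partial>lborel)"
    by (subst lborel_integral_real_affine[where c = 1 and t = "ln 2 - x"]) simp_all
   also have "... = (\<integral>tu. 2 powr A * exp (- A * x) * (exp (?C A tu) * exp (- q tu)) \<partial>lborel)"
   proof (rule lintegral_cong[OF refl])
    fix tu :: real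
    have "exp x * exp ((ln 2 - x) + tu) = 2 * exp tu" "exp x * exp (- ((ln 2 - x) + tu)) = 2 * q tu"
     by (simp_all add: q_def exp_add exp_diff exp_minus field_simps) (simp add: exp_add[symmetric])
    then have "exp x * cosh ((ln 2 - x) + tu) = exp tu + q tu" by (simp add: cosh_field_def distrib_left)
    then have "exp (A * ((ln 2 - x) + tu) - exp x * cosh ((ln 2 - x) + tu)) = exp (A * ln 2 + (- A * x) + ((?C A tu) + (- q tu)))"
     by (simp add: algebra_simps)
    then show "exp (A * ((ln 2 - x) + 1 * tu) - exp x * cosh ((ln 2 - x) + 1 * tu)) = 2 powr A * exp (- A * x) * (exp (?C A tu) * exp (- q tu))"
     unfolding exp_add by (simp add: powr_def)
   qed
   finally show ?thesis .
  qed
  have iq: "L1 (%tu. exp (?C A tu) * exp (- q tu))"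
  proof (rule lintegrable_bound[OF i1(1)])
   show "(%tu. exp (?C A tu) * exp (- q tu)) \<in> borel_measurable lborel" unfolding q_def by measurable
  qed (auto intro!: AE_I2 mult_right_le_one_le simp: q_def)
  have e1: "phia a x = exp (- A * x) / Gamma A * (?A A q)"
  proof -
   have "2 powr (1 - A) * 2 powr A = (2::real)" by (simp add: powr_add[symmetric])
   then have "kap a * KR A x = exp (- A * x) / Gamma A * (?B A q)"
   proof -
    assume p2: "2 powr (1 - A) * 2 powr A = (2::real)"
    have k: "kap a = 2 powr (1 - A) / Gamma A" by (simp add: kap_def A_def)
    have "2 * (kap a * KR A x) = kap a * (2 * KR A x)" by simp
    also have "... = (2 powr (1 - A) * 2 powr A) * (exp (- A * x) / Gamma A * (?B A q))"
     unfolding KRe integral_mult_right_zero k by simp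
    finally show ?thesis unfolding p2 by simp
   qed
   moreover have "(?A A q) = Gamma A - (?B A q)"
    unfolding right_diff_distrib mult_1_right using i1 iq by (simp add: lintegral_diff)
   ultimately show ?thesis using GA by (simp add: phia_def A_def[symmetric] right_diff_distrib) (simp add: A_def)
  qed
  have t: "0 <= 1 - exp (- y)" "1 - exp (- y) <= y powr p" if "y >= 0" for y :: real
  proof -
   show "0 <= 1 - exp (- y)" using that by simp
   show "1 - exp (- y) <= y powr p"
   proof (cases "y <= 1")
    case True
    have "1 - exp (- y) <= y" using exp_ge_add_one_self[of "- y"] by linarith
    also have "y <= y powr p" using powr_mono'[of p 1 y] True that p by simp
    finally show ?thesis .
   next
    case False
    then have "1 <= y powr p" using p by (intro ge_one_powr_ge_zero) auto
    then show ?thesis using exp_gt_zero[of "- y"] by linarith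
   qed
  qed
  have qp: "q tu powr p = (1 / 4) powr p * exp (2 * p * x - p * tu)" for tu by (simp add: q_def powr_def ln_div exp_add[symmetric] algebra_simps)
  have "abs (?A A q) = (?A A q)"
   by (intro abs_of_nonneg lintegral_nonneg mult_nonneg_nonneg t qpos) auto
  also have "... <= (\<integral>tu. exp (2 * p * x) * exp ((A - p) * tu - exp tu) \<partial>lborel)"
  proof (rule integral_mono)
   show "L1 (%tu. exp (?C A tu) * (1 - exp (- q tu)))" unfolding right_diff_distrib mult_1_right by (intro lintegrable_diff i1 iq)
   show "L1 (%tu. exp (2 * p * x) * exp ((A - p) * tu - exp tu))" by (intro integrable_mult_right i2)
   fix tu :: real
   have "(1 / 4 :: real) powr p <= 1" using p powr_mono'[of 0 p "1/4"] by simp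
   then have "q tu powr p <= 1 * exp (2 * p * x - p * tu)" unfolding qp by (intro mult_right_mono) auto
   then have "1 - exp (- q tu) <= exp (2 * p * x - p * tu)" using t(2)[OF qpos, of tu] by simp
   then have "exp (?C A tu) * (1 - exp (- q tu)) <= exp (?C A tu) * exp (2 * p * x - p * tu)" by (intro mult_left_mono) auto
   then show "exp (?C A tu) * (1 - exp (- q tu)) <= exp (2 * p * x) * exp ((A - p) * tu - exp tu)"
    by (simp add: exp_add[symmetric] algebra_simps)
  qed
  also have "... = exp (2 * p * x) * Gamma (A - p)" by (simp add: i2)
  finally have b: "abs (?A A q) <= exp (2 * p * x) * Gamma (A - p)" .
  have "abs (phia a x) = exp (- A * x) / Gamma A * abs (?A A q)"
   unfolding e1 abs_mult using GA by simp
  also have "... <= exp (- A * x) / Gamma A * (exp (2 * p * x) * Gamma (A - p))" using GA by (intro mult_left_mono b) auto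
  also have "... = (Gamma (A - p) / Gamma A) * (exp (- A * x) * exp (2 * p * x))" by simp
  also have "exp (- A * x) * exp (2 * p * x) = exp ((2 * p - A) * x)" by (simp add: exp_add[symmetric] algebra_simps)
  finally show ?thesis .
 qed
 show thesis using p by (intro that[of "2 * p - A", OF _ _ bound]) (auto simp: A_def)
qed

text \<open>After multiplication by \<open>exp (t * x)\<close> with \<open>t > - a\<close>, both
  terms of \<open>phia\<close> are convergent Mellin integrals. The resulting identity is continued
  to \<open>t = 0\<close>, which is possible because \<open>phia\<close> decays at
  -infinity.\<close>

lemma kt_phia:
 assumes a: "- 2 < a" "a < 0" and v: "v ~= 0"
 shows "kt (%x. cx (phia a x)) v = cx (hR a v)"
proof -
 obtain ep C where e: "ep > 0" "ep < - a" and C: "!!x. abs (phia a x) <= C * exp (ep * x)" using expbd_phia[OF a] by blast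
 define A where "A = - a"
 have A: "0 < A" "A < 2" "ep < A" using a e by (auto simp: A_def)
 define f where "f x = cx (phia a x) * KB (iu v) x" for x
 have fm[measurable]: "f \<in> borel_measurable borel" unfolding f_def phia_def by measurable
 have fi: "L1 (%x. exp (s * x) * norm (f x))" if "s > - ep" for s
 proof (rule lintegrable_bound)
  show "L1 (%x. C * (exp ((ep + s) * x) * KR 0 x))" using that by (intro integrable_mult_right KR_mellin_integrable) simp
  show "AE x in lborel. norm (exp (s * x) * norm (f x)) <= norm (C * (exp ((ep + s) * x) * KR 0 x))"
  proof (intro AE_I2 real_norm_mono)
   fix x
   have "norm (f x) <= (C * exp (ep * x)) * KR 0 x"
    unfolding f_def norm_mult norm_of_real using norm_KB_le[of "iu v" x] order_trans[OF abs_ge_zero C[of x]] by (intro mult_mono C) auto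
   then have "exp (s * x) * norm (f x) <= exp (s * x) * ((C * exp (ep * x)) * KR 0 x)" by (intro mult_left_mono) auto
   also have "... = C * ((exp (s * x) * exp (ep * x)) * KR 0 x)" by simp
   also have "exp (s * x) * exp (ep * x) = exp ((ep + s) * x)" by (simp add: exp_add[symmetric] algebra_simps)
   finally show "exp (s * x) * norm (f x) <= C * (exp ((ep + s) * x) * KR 0 x)" .
  qed simp
 qed measurable
 define F where "F z = (LBINT x. exp (z * cx x) * f x)" for z :: complex
 define p2 where "p2 z = exp (z * cx (ln 2))" for z :: complex
 have p2_real: "p2 (cx t) = cx (2 powr t)" for t
 proof -
  have "p2 (cx t) = exp (cx (t * ln 2))" by (simp add: p2_def)
  also have "... = cx (exp (t * ln 2))" by (rule exp_of_real)
  finally show ?thesis by (simp add: powr_def)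
 qed
 define h where "h z c = p2 (z - 2) * Gamma ((z + c) / 2) * Gamma ((z - c) / 2)" for z c
 have h_hm: "h (cx t) c = hm t c" for t c
 proof -
  have "cx t - 2 = cx (t - 2)" by simp
  then show ?thesis unfolding h_def hm_def by (simp only: p2_real)
 qed
 define G where "G z = h (z + cx a) (iu v) - cx (kap a) * (p2 (1 - z) * rGamma z * h z (cx A + iu v) * h z (cx A - iu v))" for z
 \<comment> \<open>The Gamma factors in \<open>G\<close> have their poles at imaginary part
   \<open>v\<close> or \<open>- v\<close>, so a strip of half-height \<open>abs v\<close> avoids
   them all.\<close>
 define S where "S = {z. - ep < Re z & Re z < A + 1} \<inter> {z. - abs v < Im z & Im z < abs v}"
 have "open S" unfolding S_def by (intro open_Int open_strip open_Collect_conj open_Collect_less continuous_intros)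
 have "S = {z. Re z > - ep} \<inter> {z. Re z < A + 1} \<inter> ({z. Im z > - abs v} \<inter> {z. Im z < abs v})" by (auto simp: S_def)
 then have "convex S" by (simp only:) (intro convex_Int convex_halfspace_Re_gt convex_halfspace_Re_lt convex_halfspace_Im_gt convex_halfspace_Im_lt)
 then have "connected S" by (rule convex_connected)
 have nz: "(z + c) / 2 \<notin> \<int>\<^sub>\<le>\<^sub>0" if "z \<in> S" "abs (Im c) = abs v" for z c
 proof
  assume "(z + c) / 2 \<in> \<int>\<^sub>\<le>\<^sub>0"
  then obtain n where "(z + c) / 2 = of_int n" by (auto simp: nonpos_Ints_def)
  then have "Im ((z + c) / 2) = 0" by simp
  then have "Im (z + c) = 0" by simp
  then show False using that by (auto simp: S_def)
 qed
 have hol_h: "(%z. h (z + b) c) holomorphic_on S" if "abs (Im c) = abs v" "Im b = 0" for b c unfolding h_def p2_def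
 proof (intro holomorphic_intros)
  fix z assume z: "z \<in> S"
  show "(z + b + c) / 2 \<notin> \<int>\<^sub>\<le>\<^sub>0" using nz[OF z, of "b + c"] that by (simp add: add.assoc)
  show "(z + b - c) / 2 \<notin> \<int>\<^sub>\<le>\<^sub>0" using nz[OF z, of "b - c"] that by (simp add: add_diff_eq)
 qed auto
 have GG: "F 0 = G 0"
 proof (rule holomorphic_equal_on_line[where f = F and g = G and S = S and z = 0 and sg = 0 and d = 1 and l = A and r = "A + 1"])
  have "F holomorphic_on {z. - ep < Re z & Re z < A + 1}" unfolding F_def by (rule holomorphic_on_laplace) (auto intro: fi)
  then show "F holomorphic_on S" by (rule holomorphic_on_subset) (auto simp: S_def)
  show "G holomorphic_on S" unfolding G_def p2_def using hol_h[of "iu v" "cx a"] hol_h[of "cx A + iu v" 0] hol_h[of "cx A - iu v" 0]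
   by (intro holomorphic_intros) auto
  fix t assume t: "A < t" "t < A + 1"
  have t0: "t > 0" using t A by linarith
  have "F (cx t) = (LBINT x. cx (exp ((t + a) * x)) * KB (iu v) x - cx (kap a) * (cx (exp (t * x)) * (KB (cx A) x * KB (iu v) x)))" unfolding F_def
  proof (rule lintegral_cong[OF refl])
   fix x
   have "exp (cx t * cx x) = cx (exp (t * x))" by (simp add: exp_of_real[symmetric])
   then show "exp (cx t * cx x) * f x = cx (exp ((t + a) * x)) * KB (iu v) x - cx (kap a) * (cx (exp (t * x)) * (KB (cx A) x * KB (iu v) x))"
    unfolding f_def phia_def KB_of_real A_def[symmetric] distrib_right exp_add of_real_mult of_real_diff
    by (simp only: left_diff_distrib right_diff_distrib mult_ac)
  qed
  also have "... = hm (t + a) (iu v) - cx (kap a) * Mm t (cx A) (iu v)"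
   using t A by (subst lintegral_diff) (auto simp: KB_mellin KB_mellin2 A_def simp del: of_real_exp)
  also have "... = G (cx t)"
  proof -
   have "p2 (1 - cx t) = cx (2 powr (1 - t))" using p2_real[of "1 - t"] by simp
   moreover have "rGamma (cx t) = cx (1 / Gamma t)" by (simp add: rGamma_inverse_Gamma Gamma_complex_of_real divide_inverse)
   moreover have "cx t + cx a = cx (t + a)" by simp
   ultimately show ?thesis unfolding G_def h_hm Mm_def by (simp only: h_hm of_real_mult[symmetric] divide_inverse mult_1_left mult.assoc)
  qed
  finally show "F (0 + cx t * 1) = G (0 + cx t * 1)" by simp
  show "0 + cx t * 1 \<in> S" using t A e v by (auto simp: S_def)
 qed (use \<open>open S\<close> \<open>connected S\<close> A e v in \<open>auto simp: S_def\<close>)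
 \<comment> \<open>The contribution of the subtracted Macdonald function carries
   \<open>rGamma z\<close>, which vanishes at \<open>0\<close>.\<close>
 have "G 0 = hm a (iu v)" unfolding G_def using h_hm[of a] by simp
 moreover have "F 0 = kt (%x. cx (phia a x)) v" by (simp add: F_def kt_def f_def)
 ultimately show ?thesis using GG by (simp add: hm_imag)
qed

text \<open>The norm is taken only to have a real number: the two \<open>hm\<close> factors are
  complex conjugates, so the value is nonnegative already.\<close>

definition MA :: "real => real => real => real" where
 "MA de u a = norm (Mm de (cx a) (iu u))"

lemma Mm_of_real_imag:
 assumes "de > 0"
 shows "Mm de (cx a) (iu u) = cx (MA de u a)"
proof -
 let ?A = "hm de (cx a + iu u)"
 have "hm de (cx a - iu u) = cnj ?A" by (simp add: hm_def cnj_Gamma)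
 then have "Mm de (cx a) (iu u) = cx (2 powr (1 - de) / Gamma de * (norm ?A)^2)"
  unfolding Mm_def of_real_mult[of "2 powr (1 - de) / Gamma de"] complex_norm_square by (simp only: mult.assoc)
 moreover have "0 <= 2 powr (1 - de) / Gamma de * (norm ?A)^2" using Gamma_real_pos[OF assms] by simp
 ultimately have "MA de u a = 2 powr (1 - de) / Gamma de * (norm ?A)^2" by (simp only: MA_def norm_of_real abs_of_nonneg)
 then show ?thesis using \<open>Mm de _ _ = _\<close> by (simp only:)
qed

lemma MA_nonneg: "MA de u a >= 0" by (simp add: MA_def)

lemma MA_minus: "MA de u (- a) = MA de u a"
proof -
 have "Mm de (- cx a) (iu u) = Mm de (cx a) (iu u)" using hm_minus[of de "cx a + iu u"] hm_minus[of de "cx a - iu u"] by (simp add: Mm_def mult_ac)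
 then show ?thesis by (simp add: MA_def)
qed

lemma hR_shift:
 assumes "a^2 + v^2 ~= 0"
 shows "hR (a + 2) v = (a^2 + v^2) * hR a v"
proof -
 define z where "z = (cx a + iu v) / (2 :: complex)"
 have z0: "z ~= 0" using assms by (auto simp: z_def complex_eq_iff)
 have "(cx (a + 2) + iu v) / (2 :: complex) = z + 1" by (simp add: z_def field_simps)
 then have "hR (a + 2) v = 2 powr (a + 2 - 2) * (norm (Gamma (z + 1)))^2" by (simp only: hR_def)
 moreover have "Gamma (z + 1) = z * Gamma z"
 proof (cases "z \<in> \<int>\<^sub>\<le>\<^sub>0")
  \<comment> \<open>At a pole other than \<open>0\<close> the number \<open>z + 1\<close> is again a
    nonpositive integer, and \<open>Gamma\<close> takes the value 0 at both points.\<close>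
  case True
  then obtain n where n: "z = of_int n" "n <= 0" by (auto simp: nonpos_Ints_def)
  then have "z + 1 = of_int (n + 1)" "n + 1 <= 0" using z0 by (auto simp: order_less_le)
  then have "z + 1 \<in> \<int>\<^sub>\<le>\<^sub>0" unfolding nonpos_Ints_def by blast
  then have "Gamma (z + 1) = 0" "Gamma z = 0" using True by (simp_all add: Gamma_eq_zero_iff)
  then show ?thesis by (simp only: mult_zero_right)
 qed (rule Gamma_plus1)
 moreover have "(norm z)^2 = (a^2 + v^2) / 4" by (simp add: z_def norm_divide power_divide cmod_power2)
 moreover have "2 powr (a + 2 - 2) = 4 * (2 powr (a - 2) :: real)" by (simp add: powr_diff)
 moreover have "hR a v = 2 powr (a - 2) * (norm (Gamma z))^2" by (simp only: hR_def z_def)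
 ultimately show ?thesis by (simp only: norm_mult power_mult_distrib) simp
qed

text \<open>For \<open>a > 0\<close> this is \<open>cdh_integral\<close> at an imaginary index. For
  \<open>a < 0\<close> Parseval is applied to \<open>phia a\<close>; the subtracted Macdonald
  function contributes \<open>kap a * MA de u a\<close>, the effect of the atom.\<close>

lemma entrance_complex:
 assumes a: "a > - 2" "a ~= 0" and d: "de > 0" "a + de > 0"
 shows "L1 (%v. hR a v * (MR de u v * ww v))"
  and "(LBINT v. hR a v * (MR de u v * ww v)) + (if a < 0 then kap a * MA de u a else 0) = hR (a + de) u"
proof -
 let ?A = "%v. MR de u v * ww v"
 let ?B = "LBINT v. hR a v * (?A v)"
 let ?C = "%v. Mm de (iu u) (iu v) * cx (ww v)"
 let ?D = "%v. hR a v * (?A v)"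
 let ?E = "if a < 0 then kap a * MA de u a else 0"
 have "L1 ?D &
  ?B + ?E = hR (a + de) u"
 proof (cases "a > 0")
  case True
  then have *: "cx (hR a v * (?A v)) = cx (hR a v) * (?C v)" for v by (simp add: Mm_imag)
  have r: "abs (Re (iu u)) < de" using d by simp
  have "L1 ?D" using cdh_integral(1)[OF True r] unfolding *[symmetric] complex_of_real_integrable_eq .
  moreover have "?B = hR (a + de) u"
   using cdh_integral(2)[OF True r] unfolding *[symmetric] integral_complex_of_real hm_imag of_real_eq_iff .
  ultimately show ?thesis using True by simp
 next
  case False
  then have a0: "a < 0" using a by simp
  obtain ep C where e: "ep > 0" and C: "!!x. abs (phia a x) <= C * exp (ep * x)" using expbd_phia[OF a(1) a0] by metis
  define g where "g x = cx (phia a x)" for x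
  have g: "expbd g" unfolding expbd_def g_def
   by (rule conjI, unfold phia_def, measurable, fold phia_def, rule exI[of _ C], rule exI[of _ ep]) (use e C in auto)
  then have gm[measurable]: "g \<in> borel_measurable borel" by (simp add: expbd_def)
  have ae: "AE v in lborel. kt g v * (?C v) = cx (hR a v * (?A v))" using AE_lborel_singleton[of 0]
  proof eventually_elim
   case (elim v)
   then show ?case using kt_phia[OF a(1) a0, of v] by (simp add: g_def[abs_def] Mm_imag)
  qed
  have "L1 (%v. kt g v * (?C v))" using kt_integrable(3)[OF g] d by (intro decay_integrable) auto
  then have "L1 (%v. cx (hR a v * (?A v)))" using integrable_cong_AE[OF _ _ ae] by simp
  then have 1: "L1 ?D" by (simp only: complex_of_real_integrable_eq)
  have "cx ?B = (LBINT v. cx (hR a v * (?A v)))" by (rule integral_complex_of_real[symmetric])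
  also have "... = (LBINT v. kt g v * (?C v))" by (rule integral_cong_AE[symmetric, OF _ _ ae]) measurable
  also have "... = (LBINT x. g x * (cx (exp (de * x)) * KB (iu u) x))" by (rule parseval_imag[OF d(1) g])
  also have "... = (LBINT x. cx (exp ((de + a) * x)) * KB (iu u) x - cx (kap a) * (cx (exp (de * x)) * (KB (cx (- a)) x * KB (iu u) x)))"
   unfolding g_def phia_def KB_of_real distrib_right exp_add of_real_mult of_real_diff by (simp only: left_diff_distrib right_diff_distrib mult_ac)
  also have "... = hm (de + a) (iu u) - cx (kap a) * Mm de (cx (- a)) (iu u)"
  proof -
   have r1: "abs (Re (iu u)) < de + a" and r2: "abs (Re (cx (- a))) + abs (Re (iu u)) < de" using d a0 by auto
   show ?thesis by (subst lintegral_diff[OF KB_mellin(1)[OF r1] integrable_mult_right[OF KB_mellin2(1)[OF r2]]])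
     (simp only: KB_mellin(2)[OF r1] KB_mellin2(2)[OF r2] integral_mult_right_zero)
  qed
  also have "... = cx (hR (a + de) u - kap a * MA de u a)" unfolding hm_imag Mm_of_real_imag[OF d(1)] MA_minus by (simp add: add.commute)
  finally show ?thesis using 1 a0 by (simp only: of_real_eq_iff if_True) simp
 qed
 then show "L1 ?D"
  and "?B + ?E = hR (a + de) u" by blast+
qed

lemma tendsto_hR:
 assumes "v ~= 0 \<or> a > 0" "f \<longlonglongrightarrow> a"
 shows "(%n. hR (f n) v) \<longlonglongrightarrow> hR a v"
proof -
 have "(cx a + iu v) / 2 \<notin> (\<int>\<^sub>\<le>\<^sub>0 :: complex set)"
 proof (cases "a > 0")
  case True
  then show ?thesis by (intro Re_pos_not_nonpos_Ints) simp
 next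
  case False
  then show ?thesis using assms(1) by (auto simp: nonpos_Ints_def complex_eq_iff)
 qed
 then show ?thesis unfolding hR_def using assms(2) by (intro tendsto_intros) auto
qed

text \<open>The limit of \<open>entrance_complex\<close> along a = 1/(n + 1). The functions
  \<open>hR a\<close> become singular at \<open>v = 0\<close>, but
  \<open>(a^2 + v^2) * hR a v = hR (a + 2) v\<close> stays bounded, and \<open>ww\<close> supplies a
  factor \<open>v^2\<close>.\<close>

lemma entrance_zero:
 assumes d: "de > 0"
 shows "L1 (%v. hR 0 v * (MR de u v * ww v))"
  and "(LBINT v. hR 0 v * (MR de u v * ww v)) = hR de u"
proof -
 let ?A = "%v. MR de u v * ww v"
 let ?B = "%v. v^2 * exp (pi * abs v)"
 define f where "f n = 1 / real (Suc n)" for n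
 have f: "f n > 0" "f n <= 1" for n by (auto simp: f_def)
 have f0: "f \<longlonglongrightarrow> 0" unfolding f_def by (rule LIMSEQ_Suc[OF lim_1_over_n, unfolded id_def])
 define B where "B = HB 2 0 + HB 3 0"
 have HBB: "HB (f n + 2) 0 <= B" for n
 proof -
  have "HB (f n + 2) 0 <= (LBINT x. exp (2 * x) * KR0 x + exp (3 * x) * KR0 x)" unfolding HB_def
  proof (rule integral_mono)
   show "L1 (%x. exp ((f n + 2) * x) * KR0 x)" using f(1)[of n] by (intro KR_shift_integrable) simp
   show "L1 (%x. exp (2 * x) * KR0 x + exp (3 * x) * KR0 x)" by (intro lintegrable_add KR_shift_integrable) auto
   fix x :: real
   have "exp ((f n + 2) * x) <= exp (2 * x) + exp (3 * x)"
   proof (cases "x >= 0")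
    case True
    then have "(f n + 2) * x <= 3 * x" using f(2)[of n] by (intro mult_right_mono) auto
    then show ?thesis by (smt (verit) exp_le_cancel_iff exp_gt_zero)
   next
    case False
    then have "(f n + 2) * x <= 2 * x" using f(1)[of n] by (intro mult_right_mono_neg) auto
    then show ?thesis by (smt (verit) exp_le_cancel_iff exp_gt_zero)
   qed
   then show "exp ((f n + 2) * x) * KR0 x <= exp (2 * x) * KR0 x + exp (3 * x) * KR0 x"
    unfolding distrib_right[symmetric] by (intro mult_right_mono KR_nonneg)
  qed
  also have "... = B" unfolding B_def HB_def by (intro lintegral_add KR_shift_integrable) auto
  finally show ?thesis .
 qed
 have B: "B >= 0" unfolding B_def by (intro add_nonneg_nonneg HB_nonneg)
 have w2: "ww v <= v^2 * exp (pi * abs v)" for v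
 proof -
  have "sinh y <= y * exp y" if "y >= 0" for y :: real
  proof -
   have "1 + (- 2 * y) <= exp (- 2 * y)" by (rule exp_ge_add_one_self)
   then have "exp y * (1 - exp (- 2 * y)) <= exp y * (2 * y)" by (intro mult_left_mono) auto
   then show ?thesis by (simp add: sinh_field_def right_diff_distrib exp_add[symmetric] mult_ac)
  qed
  from this[of "pi * abs v"] have s: "sinh (pi * abs v) <= (pi * abs v) * exp (pi * abs v)" by simp
  have "ww v = ww (abs v)" by (cases "v >= 0") (auto simp: ww_def)
  also have "... <= abs v * ((pi * abs v) * exp (pi * abs v)) / pi^2" unfolding ww_def by (intro divide_right_mono mult_left_mono s) auto
  also have "... = (?B v) / pi" by (simp add: power2_eq_square)
  also have "... <= (?B v) / 1" using pi_ge_two by (intro divide_left_mono) auto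
  finally show ?thesis by simp
 qed
 define W where "W v = B * MB de 0 * ((1 + abs v) ^ 0 * exp (- c0 * abs v))" for v
 have W: "L1 W" unfolding W_def by (intro integrable_mult_right integrable_poly_exp c0_pos)
 have bnd: "norm (hR (f n) v * (?A v)) <= W v" if "v ~= 0" for n v
 proof -
  have nz: "(f n)^2 + v^2 ~= 0" using that by (simp add: sum_power2_eq_zero_iff)
  have "hR (f n) v * ww v <= hR (f n) v * (?B v)" by (intro mult_left_mono w2 hR_nonneg)
  also have "... <= (((f n)^2 + v^2) * hR (f n) v) * exp (pi * abs v)"
  proof -
   have "hR (f n) v * (?B v) <= hR (f n) v * (((f n)^2 + v^2) * exp (pi * abs v))"
    by (intro mult_left_mono mult_right_mono hR_nonneg) auto
   then show ?thesis by (simp only: mult_ac)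
  qed
  also have "... <= (E0 v * B) * exp (pi * abs v)"
  proof -
   have "hR (f n + 2) v <= E0 v * HB (f n + 2) 0" using f(1)[of n] by (intro hR_decay) simp
   also have "... <= E0 v * B" by (intro mult_left_mono HBB) auto
   finally show ?thesis unfolding hR_shift[OF nz] by (intro mult_right_mono) auto
  qed
  finally have 1: "hR (f n) v * ww v <= (E0 v * B) * exp (pi * abs v)" .
  have "norm (hR (f n) v * (?A v)) = MR de u v * (hR (f n) v * ww v)" using d by (simp add: abs_mult hR_nonneg MR_nonneg ww_nonneg)
  also have "... <= (MB de 0 * exp (- 2 * th0 * abs v)) * ((E0 v * B) * exp (pi * abs v))"
   by (intro mult_mono MR_decay d 1 mult_nonneg_nonneg MB_nonneg hR_nonneg ww_nonneg) auto
  also have "... = B * MB de 0 * ((1 + abs v) ^ 0 * (E0 v * exp (- 2 * th0 * abs v) * exp (pi * abs v)))" by simp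
  also have "E0 v * exp (- 2 * th0 * abs v) * exp (pi * abs v) = exp (- c0 * abs v)" unfolding exp_add[symmetric] by (simp add: c0_def algebra_simps)
  finally show ?thesis by (simp add: W_def)
 qed
 have bnd': "AE v in lborel. norm (hR (f n) v * (?A v)) <= W v" for n using AE_lborel_singleton[of 0] by eventually_elim (rule bnd)
 have lim: "AE v in lborel. (%n. hR (f n) v * (?A v)) \<longlonglongrightarrow> hR 0 v * (?A v)"
  using AE_lborel_singleton[of 0] by eventually_elim (intro tendsto_mult tendsto_const tendsto_hR f0, simp)
 have m1: "(%v. hR 0 v * (?A v)) \<in> borel_measurable lborel"
  and m2: "(%v. hR (f n) v * (?A v)) \<in> borel_measurable lborel" for n by measurable
 show "L1 (%v. hR 0 v * (?A v))" by (rule integrable_dominated_convergence[OF m1 m2 W lim bnd'])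
 have "(%n. (LBINT v. hR (f n) v * (?A v))) \<longlonglongrightarrow> (LBINT v. hR 0 v * (?A v))"
  by (rule integral_dominated_convergence[OF m1 m2 W lim bnd'])
 moreover have "(LBINT v. hR (f n) v * (?A v)) = hR (f n + de) u" for n using entrance_complex(2)[of "f n" de u] f(1)[of n] d by simp
 moreover have "(%n. hR (f n + de) u) \<longlonglongrightarrow> hR de u" using d tendsto_add[OF f0 tendsto_const[of de]] by (intro tendsto_hR) auto
 ultimately show "(LBINT v. hR 0 v * (?A v)) = hR de u" using LIMSEQ_unique by simp
qed

lemma kap_nonneg: "a < 0 ==> kap a >= 0" using Gamma_real_pos[of "- a"] by (simp add: kap_def)

lemma entrance_law:
 assumes a: "a > - 2" and d: "de > 0" "a + de > 0"
 shows "(NN v. ennreal (hR a v * MR de u v * ww v)) + (if a < 0 then ennreal (kap a * MA de u a) else 0) = ennreal (hR (a + de) u)"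
proof -
 let ?A = "LBINT v. hR a v * (MR de u v * ww v)"
 have i: "L1 (%v. hR a v * (MR de u v * ww v))"
  and e: "?A + (if a < 0 then kap a * MA de u a else 0) = hR (a + de) u"
  using entrance_complex[OF a _ d, of u] entrance_zero[OF d(1), of u] by (cases "a = 0"; simp)+
 have nn: "0 <= hR a v * (MR de u v * ww v)" for v using d by (intro mult_nonneg_nonneg hR_nonneg MR_nonneg ww_nonneg)
 have "(NN v. ennreal (hR a v * MR de u v * ww v)) = ennreal ?A"
  unfolding mult.assoc by (rule nn_integral_eq_integral[OF i]) (simp add: nn)
 moreover have "?A >= 0" by (intro lintegral_nonneg nn)
 moreover have "a < 0 ==> kap a * MA de u a >= 0" by (intro mult_nonneg_nonneg kap_nonneg MA_nonneg)
 ultimately show ?thesis using e by (auto simp: ennreal_plus[symmetric] simp del: ennreal_plus)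
qed

section \<open>Continuous dual Hahn polynomials\<close>

text \<open>Subtracting the multiple of \<open>B (degree q)\<close> that cancels the leading term
  lowers the degree. It is applied to the bases \<open>Psi\<close> and \<open>pp\<close>.\<close>

lemma poly_triangular_induct [consumes 2, case_names zero add smult base]:
 fixes B :: "nat => real poly"
 assumes B: "!!m. degree (B m) = m & lead_coeff (B m) = 1" and q: "degree q < n"
  and 0: "P 0" and add: "!!p q. P p ==> P q ==> P (p + q)" and smult: "!!c p. P p ==> P (smult c p)"
  and base: "!!m. m < n ==> P (B m)"
 shows "P q" using q
proof (induction "degree q" arbitrary: q rule: less_induct)
 case less
 define r where "r = q - smult (lead_coeff q) (B (degree q))"
 have q: "q = r + smult (lead_coeff q) (B (degree q))" by (simp add: r_def)
 have c: "coeff r (degree q) = 0" by (simp add: r_def) (metis B)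
 have d: "degree r <= degree q" unfolding r_def using B[of "degree q"] by (intro degree_diff_le) (auto intro: order_trans[OF degree_smult_le])
 have "P r"
 proof (cases "degree q = 0")
  case True
  then have "r = 0" using c d by (simp add: leading_coeff_0_iff[symmetric])
  then show ?thesis using 0 by simp
 next
  case False
  have "degree r < degree q"
  proof (rule ccontr)
   assume "\<not> degree r < degree q"
   then have "degree r = degree q" using d by simp
   then show False using c False by (metis degree_0 leading_coeff_0_iff)
  qed
  then show ?thesis using less by (intro less.hyps) auto
 qed
 then show ?case using less.prems by (subst q) (intro add smult base)
qed

text \<open>The parameters \<open>\<beta>\<close>, \<open>\<gamma>\<close>, real or conjugate, enter
  only through their sum \<open>de\<close> and product: (k + al + \<beta>)(k + al + \<gamma>) = (k +
  al + de/2)^2 + X. For a transition from the point x, \<open>X\<close> is x/4. Keeping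
  \<open>A\<close>, \<open>C\<close> and \<open>p\<close> as parameters treats both cases at
  once.\<close>

locale cdh =
 fixes al de X :: real and A C :: "nat => real" and p :: "nat => real => real"
 assumes al: "al > 0" and de: "de > 0" and X: "X > - (de / 2)\<^sup>2"
  and A: "!!k. A k = (real k + al + de / 2)^2 + X"
  and C: "!!k. C k = real k * (real k - 1 + de)"
  and p0: "!!y. p 0 y = 1" and p1: "!!y. p (Suc 0) y = y - (A 0 + C 0 - al\<^sup>2)"
  and pS: "!!n y. p (Suc (Suc n)) y = (y - (A (Suc n) + C (Suc n) - al\<^sup>2)) * p (Suc n) y - A n * C (Suc n) * p n y"
begin

lemma A_ge: "A k > real k * (real k + de)"
proof -
 have "(real k + de / 2)^2 <= (real k + al + de / 2)^2" using al de by (intro power_mono) auto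
 moreover have "(real k + de / 2)^2 = real k * (real k + de) + (de / 2)^2" by (simp add: power2_eq_square algebra_simps)
 ultimately show ?thesis using X by (simp add: A)
qed

lemma A_pos: "A k > 0" using A_ge[of k] de by (smt (verit) mult_nonneg_nonneg of_nat_0_le_iff)

lemma C_pos: "k > 0 ==> C k > 0" unfolding C using de by (intro mult_pos_pos) (auto simp: Suc_le_eq intro: add_nonneg_pos)

lemma p_rec: "p (Suc n) y = (y - (A n + C n - al\<^sup>2)) * p n y - A (n - 1) * C n * p (n - 1) y" by (cases n) (simp_all add: p0 p1 pS C)

text \<open>The squared modulus of the Pochhammer symbol of al + i sqrt y, for y >= 0. Multiplying
  the weight by it only raises the parameter \<open>al\<close>, so its integrals are
  explicit.\<close>

definition psi :: "nat => real => real" where "psi m y = (\<Prod>j<m. (al + real j)^2 + y)"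

definition a :: "nat => real" where "a m = (\<Prod>j<m. A j)"
definition c :: "nat => real" where "c m = (\<Prod>j<m. C (Suc j))"

fun pp :: "nat => real poly" where
 "pp 0 = 1"
| "pp (Suc 0) = [:- (A 0 + C 0 - al\<^sup>2), 1:]"
| "pp (Suc (Suc n)) = [:- (A (Suc n) + C (Suc n) - al\<^sup>2), 1:] * pp (Suc n) - smult (A n * C (Suc n)) (pp n)"

lemma poly_pp: "poly (pp n) y = p n y" by (induction n rule: pp.induct) (simp_all add: p0 p1 pS algebra_simps)

lemma pp_monic: "degree (pp n) = n & lead_coeff (pp n) = 1"
proof (induction n rule: pp.induct)
 case (3 n)
 let ?q = "[:- (A (Suc n) + C (Suc n) - al\<^sup>2), 1:] * pp (Suc n)"
 have nz: "pp (Suc n) ~= 0" using 3(1) by auto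
 have d: "degree ?q = Suc (Suc n)" using 3(1) nz by (subst degree_mult_eq) auto
 have l: "lead_coeff ?q = 1" using 3(1) by (subst lead_coeff_mult) auto
 have s: "degree (smult (A n * C (Suc n)) (pp n)) < Suc (Suc n)" using 3(2) by (intro le_less_trans[OF degree_smult_le]) auto
 have "degree (?q + - smult (A n * C (Suc n)) (pp n)) = Suc (Suc n)" using s d by (subst degree_add_eq_left) auto
 moreover have "coeff (smult (A n * C (Suc n)) (pp n)) (Suc (Suc n)) = 0" using s by (rule coeff_eq_0)
 ultimately show ?case using l d by simp
qed auto

definition Psi :: "nat => real poly" where "Psi m = (\<Prod>j<m. [:(al + real j)^2, 1:])"

lemma poly_Psi: "poly (Psi m) y = psi m y" by (simp add: Psi_def psi_def poly_prod)

lemma Psi_monic: "degree (Psi m) = m & lead_coeff (Psi m) = 1"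
proof (induction m)
 case (Suc m)
 then have "Psi m ~= 0" by auto
 moreover have "Psi (Suc m) = Psi m * [:(al + real m)^2, 1:]" by (simp add: Psi_def)
 moreover have "coeff (Psi m) m = 1" using Suc by metis
 ultimately show ?case using Suc lead_coeff_mult[of "Psi m" "[:(al + real m)^2, 1:]"] by (simp add: degree_mult_eq del: mult_pCons_right)
qed (simp add: Psi_def)

lemma monic_coeff: "coeff (pp n) n = 1" "coeff (Psi n) n = 1" by (metis pp_monic, metis Psi_monic)

lemma a_Suc: "a (Suc n) = A n * a n" and c_Suc: "c (Suc n) = C (Suc n) * c n" and ac_0: "a 0 = 1" "c 0 = 1" by (simp_all add: a_def c_def)

end

text \<open>Since \<open>psi m\<close> is monic of degree \<open>m\<close>, the last assumption
  fixes all moments; orthogonality and norms are derived from it without further reference to the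
  weight.\<close>

locale cdh_measure_data = cdh +
 fixes R :: "real measure"
 assumes prob: "prob_space R" and sets: "sets R = sets borel"
  and mom: "!!n. integrable R (%x. x ^ n)"
  and psi: "!!m. (\<integral>x. psi m (x / 4) \<partial>R) = a m"
begin

section \<open>Orthogonality and norms from the moments\<close>

lemma poly_integrable: "integrable R (%x. poly q (x / 4))"
 unfolding poly_altdef by (intro lintegrable_sum integrable_mult_right) (simp add: power_divide mom)

lemma prod_integrable:
 "integrable R (%x. p n (x / 4) * poly q (x / 4))" "integrable R (%x. p n (x / 4) * p m (x / 4))" "integrable R (%x. p n (x / 4) * psi m (x / 4))"
 using poly_integrable[of "pp n * q"] poly_integrable[of "pp n * pp m"] poly_integrable[of "pp n * Psi m"] by (simp_all add: poly_pp poly_Psi)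

text \<open>The moments of \<open>p\<^sub>n\<close> against the shifted factorials have a closed form, with \<open>(-m)\<^sub>n\<close> vanishing
 for \<open>m < n\<close>.\<close>

lemma p_psi: "(\<integral>x. p n (x / 4) * psi m (x / 4) \<partial>R) = (- 1) ^ n * pochhammer de n * a m * pochhammer (- real m) n"
proof (induction n arbitrary: m rule: less_induct)
 case (less n)
 let ?J = "%n m. \<integral>x. p n (x / 4) * psi m (x / 4) \<partial>R"
 have a: "a (Suc m) = A m * a m" for m by (simp add: a_def)
 have y: "y * psi m y = psi (Suc m) y - (al + real m)\<^sup>2 * psi m y" for y m by (simp add: psi_def algebra_simps)
 \<comment> \<open>The recurrence of \<open>p\<close>, with the factor \<open>y\<close> absorbed by
   \<open>y * psi m y = psi (Suc m) y - (al + real m)\<^sup>2 * psi m y\<close>.\<close>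
 have rec: "?J (Suc n) m = ?J n (Suc m) - ((al + real m)^2 + A n + C n - al\<^sup>2) * ?J n m - A (n - 1) * C n * ?J (n - 1) m" for n m
 proof -
  have "p (Suc n) y * psi m y = p n y * psi (Suc m) y - ((al + real m)^2 + A n + C n - al\<^sup>2) * (p n y * psi m y) - A (n - 1) * C n * (p (n - 1) y * psi m y)" for y
  proof -
   have "p (Suc n) y * psi m y = p n y * (y * psi m y) - (A n + C n - al\<^sup>2) * (p n y * psi m y) - A (n - 1) * C n * (p (n - 1) y * psi m y)"
    unfolding p_rec[of n] by (simp add: algebra_simps)
   then show ?thesis unfolding y by (simp add: algebra_simps)
  qed
  then show ?thesis by (simp only: lintegral_diff lintegrable_diff prod_integrable integrable_mult_right integral_mult_right_zero)
 qed
 show ?case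
 proof (cases n)
  case 0
  then show ?thesis using psi[of m] by (simp add: p0)
 next
  case (Suc k)
  show ?thesis
  proof (cases k)
   case 0
   have "?J (Suc 0) m = a m * (A m - ((al + real m)^2 + A 0 - al\<^sup>2))"
    unfolding rec[of 0 m] using psi[of m] psi[of "Suc m"] by (simp add: p0 C a algebra_simps)
   then show ?thesis using Suc 0 by (simp add: A[of m] A[of 0] power2_eq_square algebra_simps)
  next
   case (Suc l)
   have n: "n = Suc (Suc l)" using Suc \<open>n = Suc k\<close> by simp
   define P where "P = pochhammer (- real m) l"
   define D where "D = (-1) ^ l * pochhammer de l * a m"
   have e1: "?J k (Suc m) = - ((de + real l) * D * A m * ((- real m - 1) * P))"
   proof -
    have "pochhammer (- real (Suc m)) (Suc l) = (- real m - 1) * P" unfolding pochhammer_rec P_def by simp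
    then show ?thesis using less.IH[of k "Suc m"] Suc n by (simp add: D_def a pochhammer_Suc)
   qed
   have e2: "?J k m = - ((de + real l) * D * ((- real m + real l) * P))" using less.IH[of k m] Suc n by (simp add: D_def P_def pochhammer_Suc)
   have e3: "?J (k - 1) m = D * P" using less.IH[of l m] Suc n by (simp add: D_def P_def)
   have "?J (Suc k) m = D * P * ((de + real l) * A m * (real m + 1) - ((al + real m)^2 + A k + C k - al\<^sup>2) * (de + real l) * (real m - real l) - A l * C k)"
    unfolding rec[of k m] e1 e2 e3 using Suc by (simp add: algebra_simps)
   \<comment> \<open>The induction step comes down to this polynomial identity; its factors
     \<open>real l - real m\<close> and \<open>real l + 1 - real m\<close> extend the Pochhammer
     symbol of \<open>- real m\<close> from length \<open>l\<close> to \<open>l + 2\<close>.\<close>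
   also have "(de + real l) * A m * (real m + 1) - ((al + real m)^2 + A k + C k - al\<^sup>2) * (de + real l) * (real m - real l) - A l * C k
     = (de + real l) * (de + real l + 1) * (real l - real m) * (real l + 1 - real m)" unfolding A C Suc by (simp add: power2_eq_square field_simps)
   finally show ?thesis using n Suc by (simp add: D_def P_def pochhammer_Suc algebra_simps)
  qed
 qed
qed

lemma p_orth_lower:
 assumes "degree q < n"
 shows "(\<integral>x. p n (x / 4) * poly q (x / 4) \<partial>R) = 0" using Psi_monic assms
proof (induction q rule: poly_triangular_induct)
 case (base m)
 then show ?case by (simp add: poly_Psi p_psi pochhammer_of_nat_eq_0_lemma)
next
 case (smult c p)
 then show ?case by (simp add: mult.left_commute[of _ c])
qed (simp_all add: distrib_left lintegral_add prod_integrable)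

text \<open>\<open>pp n - Psi n\<close> has lower degree, so one factor \<open>p n\<close> may be
  replaced by \<open>psi n\<close>, and \<open>p_psi\<close> at \<open>m = n\<close>
  applies.\<close>

lemma p_norm: "(\<integral>x. p n (x / 4) * p n (x / 4) \<partial>R) = a n * c n"
proof -
 have "(\<integral>x. p n (x / 4) * poly (pp n - Psi n) (x / 4) \<partial>R) = 0"
 proof (cases "n = 0")
  case True
  then show ?thesis by (simp add: Psi_def)
 next
  case False
  have "degree (pp n - Psi n) < n"
  proof (rule ccontr)
   assume *: "\<not> degree (pp n - Psi n) < n"
   have "degree (pp n - Psi n) <= n" using pp_monic[of n] Psi_monic[of n] by (intro degree_diff_le) auto
   then have "degree (pp n - Psi n) = n" using * by simp
   moreover have "coeff (pp n - Psi n) n = 0" by (simp add: monic_coeff)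
   ultimately show False using False by (metis degree_0 leading_coeff_0_iff)
  qed
  then show ?thesis by (rule p_orth_lower)
 qed
 then have "(\<integral>x. p n (x / 4) * p n (x / 4) \<partial>R) = (\<integral>x. p n (x / 4) * psi n (x / 4) \<partial>R)"
  by (simp add: poly_pp poly_Psi right_diff_distrib lintegral_diff prod_integrable)
 also have "... = (-1) ^ n * pochhammer (- real n) n * pochhammer de n * a n" unfolding p_psi by simp
 also have "(-1) ^ n * pochhammer (- real n) n = (fact n :: real)" by (simp add: pochhammer_same flip: power_mult_distrib)
 also have "fact n * pochhammer de n = c n"
 proof (induction n)
  case (Suc n)
  show ?case unfolding c_Suc C[of "Suc n"] Suc.IH[symmetric] by (simp add: pochhammer_Suc algebra_simps)
 qed (simp add: ac_0)
 finally show ?thesis by simp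
qed

lemma p_orth: "m ~= n ==> (\<integral>x. p n (x / 4) * p m (x / 4) \<partial>R) = 0"
 using p_orth_lower[of "pp m" n] p_orth_lower[of "pp n" m] pp_monic[of n] pp_monic[of m] by (cases "m < n") (auto simp: poly_pp mult.commute)

end

section \<open>What orthogonality alone says about a measure\<close>

context cdh
begin

text \<open>Orthogonality to \<open>p 0 = 1\<close> gives the integrals of all \<open>p n\<close>
  with n > 0, and the total mass gives that of \<open>p 0\<close>. Expansion in the
  \<open>p n\<close> then yields every moment.\<close>

lemma moments_determined:
 assumes "prob_space R" "!!n. n > 0 ==> has_bochner_integral R (%x. p n (x / 4)) 0"
  and "prob_space R'" "!!n. n > 0 ==> has_bochner_integral R' (%x. p n (x / 4)) 0"
 shows "integrable R (%x. poly q (x / 4)) & integrable R' (%x. poly q (x / 4)) & (\<integral>x. poly q (x / 4) \<partial>R) = (\<integral>x. poly q (x / 4) \<partial>R')"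
 using pp_monic lessI[of "degree q"]
proof (induction q rule: poly_triangular_induct)
 case (base m)
 interpret R: prob_space R by fact
 interpret R': prob_space R' by fact
 show ?case using assms(2,4)[of m] by (cases "m = 0") (auto simp: p0 poly_pp has_bochner_integral_iff R.prob_space R'.prob_space)
qed auto

text \<open>The induction proves more: the signed values \<open>s\<close> satisfy
  \<open>s (Suc n) >= A n * s n\<close>. In these terms
  \<open>s (Suc (Suc n)) - A (Suc n) * s (Suc n)\<close> is a combination, with nonnegative
  coefficients, of \<open>s (Suc n)\<close> and \<open>s (Suc n) - A n * s n\<close>.\<close>

lemma p_left_bound:
 assumes y: "y <= - al\<^sup>2"
 shows "(-1) ^ n * p n y >= a n"
proof -
 define s where "s n = (-1) ^ n * p n y" for n
 have "s n > 0 & s (Suc n) >= A n * s n" for n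
 proof (induction n)
  case 0
  then show ?case using y by (simp add: s_def p0 p1 C)
 next
  case (Suc n)
  have "s (Suc (Suc n)) = (- al\<^sup>2 - y + A (Suc n) + C (Suc n)) * s (Suc n) - A n * C (Suc n) * s n" by (simp add: s_def pS algebra_simps)
  then have "s (Suc (Suc n)) - A (Suc n) * s (Suc n) = (- al\<^sup>2 - y) * s (Suc n) + C (Suc n) * (s (Suc n) - A n * s n)"
   by (simp add: algebra_simps)
  moreover have "s (Suc n) > 0" using Suc A_pos[of n] by (smt (verit) mult_pos_pos)
  moreover have "(- al\<^sup>2 - y) * s (Suc n) >= 0" using y \<open>s (Suc n) > 0\<close> by (intro mult_nonneg_nonneg) auto
  moreover have "C (Suc n) * (s (Suc n) - A n * s n) >= 0" using Suc C_pos[of "Suc n"] by (intro mult_nonneg_nonneg) auto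
  ultimately show ?case by linarith
 qed note s = this
 have "s n >= a n"
 proof (induction n)
  case (Suc n)
  have "a (Suc n) = A n * a n" by (simp add: a_def)
  also have "... <= A n * s n" using Suc A_pos[of n] by (intro mult_left_mono) auto
  finally show ?case using s[of n] by linarith
 qed (simp add: s_def p0 a_def)
 then show ?thesis by (simp add: s_def)
qed

lemma a_pos: "a n > 0" and c_pos: "c n > 0" unfolding a_def c_def by (auto intro!: prod_pos A_pos C_pos)

text \<open>From \<open>A_ge\<close>, \<open>A n / C (Suc n)\<close> is at least n/(n + 1), so
  \<open>a n / c n\<close> is bounded below by a multiple of 1/n and the harmonic series forces
  divergence.\<close>

lemma ratio_divergent: "\<exists>N>0. K <= (\<Sum>n<N. a n / c n)"
proof -
 let ?A = "%n. real (Suc n) / real (Suc (Suc n))"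
 let ?B = "%n. \<Sum>i<n. a i / c i"
 have r: "a (Suc n) / c (Suc n) >= (a 1 / c 1) / real (Suc n)" for n
 proof (induction n)
  case (Suc n)
  have "(?A n) * C (Suc (Suc n)) <= A (Suc n)"
  proof -
   have "(?A n) * C (Suc (Suc n)) = real (Suc n) * (real (Suc n) + de)" unfolding C by (simp add: field_simps)
   then show ?thesis using A_ge[of "Suc n"] by simp
  qed
  then have q: "real (Suc n) / real (Suc (Suc n)) <= A (Suc n) / C (Suc (Suc n))" using C_pos[of "Suc (Suc n)"] by (simp add: pos_le_divide_eq)
  have "(a 1 / c 1) / real (Suc (Suc n)) = ((a 1 / c 1) / real (Suc n)) * (?A n)" by simp
  also have "... <= (a (Suc n) / c (Suc n)) * (A (Suc n) / C (Suc (Suc n)))"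
   using a_pos[of 1] c_pos[of 1] a_pos[of "Suc n"] c_pos[of "Suc n"] by (intro mult_mono Suc q) auto
  also have "... = a (Suc (Suc n)) / c (Suc (Suc n))" by (simp add: a_def c_def)
  finally show ?case .
 qed simp
 have "\<not> summable (%n. a n / c n)"
 proof
  assume "summable (%n. a n / c n)"
  then have "summable (%n. a (Suc n) / c (Suc n))" by (rule summable_Suc_iff[of "%n. a n / c n", THEN iffD2])
  then have "summable (%n. (a 1 / c 1) / real (Suc n))"
   by (rule summable_comparison_test'[where N = 0]) (use r a_pos[of 1] c_pos[of 1] in \<open>auto simp del: of_nat_Suc\<close>)
  then have "summable (%n. (c 1 / a 1) * ((a 1 / c 1) / real (Suc n)))" by (rule summable_mult)
  moreover have "(c 1 / a 1) * ((a 1 / c 1) / real (Suc n)) = inverse (real (Suc n))" for n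
   using a_pos[of 1] c_pos[of 1] by (simp add: field_simps del: of_nat_Suc)
  ultimately have "summable (%n. inverse (real (Suc n)))" by simp
  then have "summable (%n. inverse (real n))" by (subst (asm) summable_Suc_iff)
  then show False using not_summable_harmonic[where 'a = real] by (simp add: inverse_eq_divide)
 qed
 moreover have "summable (%n. a n / c n)" if *: "\<forall>n. (?B n) <= K"
 proof (rule bounded_imp_summable[of _ K])
  show "(\<Sum>k\<le>n. a k / c k) <= K" for n using * unfolding lessThan_Suc_atMost[symmetric] by blast
  show "0 <= a n / c n" for n using a_pos[of n] c_pos[of n] by simp
 qed
 ultimately have "\<not> (\<forall>n. (?B n) <= K)" by blast
 then obtain n where "(?B n) > K" by (auto simp: not_le)
 moreover have "(?B n) <= (\<Sum>i<Suc n. a i / c i)" using a_pos[of n] c_pos[of n] by simp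
 ultimately show ?thesis by (intro exI[of _ "Suc n"]) simp
qed

text \<open>The Christoffel function at the point \<open>-al\<^sup>2\<close> vanishes, and the kernel polynomials are at least
 \<open>1\<close> to the left of it.\<close>

lemma support:
 assumes prob: "prob_space R" and sets: "sets R = sets borel"
  and int: "!!m n. integrable R (%x. p n (x / 4) * p m (x / 4))"
  and orth: "!!m n. m ~= n ==> (\<integral>x. p n (x / 4) * p m (x / 4) \<partial>R) = 0"
  and norm: "!!n. (\<integral>x. p n (x / 4) * p n (x / 4) \<partial>R) = a n * c n"
 shows "AE x in R. x + 4 * al^2 >= 0"
proof -
 let ?A = "%q R. \<integral>x. (q x)^2 \<partial>R"
 interpret prob_space R by fact
 have ev[measurable]: "{..- 4 * al^2} \<in> sets R" using sets by simp
 have bound: "prob {..- 4 * al^2} <= 1 / K" if K: "K > 0" for K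
 proof -
  obtain N where N: "K <= (\<Sum>n<N. a n / c n)" using ratio_divergent by blast
  define Z where "Z = (\<Sum>n<N. a n / c n)"
  have Z: "Z > 0" "K <= Z" using N K by (auto simp: Z_def)
  \<comment> \<open>With these weights \<open>q\<close> is the kernel polynomial at
    \<open>- al\<^sup>2\<close>, where \<open>p n\<close> takes the value
    \<open>(-1) ^ n * a n\<close>, normalised to be 1 there. The integral of its square is
    \<open>1 / Z\<close>, and \<open>q >= 1\<close> to the left turns this into a Chebyshev
    bound.\<close>
  define w where "w n = (-1) ^ n / (c n * Z)" for n
  define q where "q x = (\<Sum>n<N. w n * p n (x / 4))" for x
  have sq: "(q x)^2 = (\<Sum>n<N. \<Sum>m<N. (w n * w m) * (p n (x / 4) * p m (x / 4)))" for x
   unfolding power2_eq_square q_def sum_product by (simp add: mult_ac)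
  have iq: "integrable R (%x. (q x)^2)" unfolding sq by (intro lintegrable_sum integrable_mult_right int)
  have "(?A q R) = (\<Sum>n<N. \<Sum>m<N. (w n * w m) * (\<integral>x. p n (x / 4) * p m (x / 4) \<partial>R))"
   unfolding sq by (simp add: lintegral_sum int)
  also have "... = (\<Sum>n<N. \<Sum>m<N. if m = n then (w n * w n) * (a n * c n) else 0)" by (intro sum.cong refl) (auto simp: orth norm)
  also have "... = (\<Sum>n<N. (a n / c n) / Z^2)"
  proof (intro sum.cong refl)
   fix n assume "n \<in> {..<N}"
   have "w n * w n = 1 / (c n * Z)^2" by (simp add: w_def power2_eq_square flip: power_mult_distrib)
   then have "(w n * w n) * (a n * c n) = (a n / c n) / Z^2" using c_pos[of n] by (simp add: power2_eq_square)
   then show "(\<Sum>m<N. if m = n then (w n * w n) * (a n * c n) else 0) = (a n / c n) / Z^2" using \<open>n \<in> {..<N}\<close> by simp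
  qed
  also have "... = 1 / Z" unfolding sum_divide_distrib[symmetric] Z_def[symmetric] using Z by (simp add: power2_eq_square)
  finally have I: "(?A q R) = 1 / Z" .
  have ge: "q x >= 1" if "x <= - 4 * al^2" for x
  proof -
   have "1 = (\<Sum>n<N. a n / c n) / Z" using Z by (simp add: Z_def)
   also have "... = (\<Sum>n<N. (1 / (c n * Z)) * a n)" by (simp add: sum_divide_distrib)
   also have "... <= (\<Sum>n<N. (1 / (c n * Z)) * ((-1) ^ n * p n (x / 4)))"
    using that Z c_pos by (intro sum_mono mult_left_mono p_left_bound) (auto simp: less_imp_le)
   also have "... = q x" by (simp add: q_def w_def)
   finally show ?thesis .
  qed
  have "prob {..- 4 * al^2} = (\<integral>x. indicator {..- 4 * al^2} x \<partial>R)" using sets_eq_imp_space_eq[OF sets] by simp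
  also have "... <= (?A q R)"
  proof (rule integral_mono[OF _ iq])
   show "integrable R (indicator {..- 4 * al^2} :: _ => real)" by (intro integrable_real_indicator ev) (simp add: emeasure_eq_measure)
   fix x show "indicator {..- 4 * al^2} x <= (q x)^2" using ge[of x] by (auto simp: indicator_def one_le_power)
  qed
  also have "... <= 1 / K" unfolding I using K Z by (intro divide_left_mono) auto
  finally show ?thesis .
 qed
 have "prob {..- 4 * al^2} <= 0"
 proof (rule field_le_epsilon)
  fix e :: real assume "e > 0"
  then show "prob {..- 4 * al^2} <= 0 + e" using bound[of "1 / e"] by simp
 qed
 then have "emeasure R {..- 4 * al^2} = 0" by (simp add: emeasure_eq_measure measure_le_0_iff)
 then have "AE x in R. x \<notin> {..- 4 * al^2}" by (intro AE_not_in null_setsI ev)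
 then show ?thesis by eventually_elim auto
qed

end

section \<open>Uniqueness of the orthogonality measure\<close>

context cdh_measure_data
begin

text \<open>\<open>R'\<close> has the moments of \<open>R\<close> and, by \<open>support\<close>,
  lives above \<open>- 4 * al^2\<close>. Shifting both measures by \<open>4 * al^2\<close> puts them
  on the half-line of \<open>stieltjes_moment_unique\<close>; the shift changes the square root by
  at most \<open>2 * al\<close>, so the exponential moment survives.\<close>

lemma unique:
 assumes nn: "AE x in R. x >= 0" and k: "k > 0" "integrable R (%x. exp (k * sqrt x))"
  and prob': "prob_space R'" and sets': "sets R' = sets borel"
  and orth': "!!m n. m ~= n ==> has_bochner_integral R' (%x. p n (x / 4) * p m (x / 4)) 0"
 shows "R' = R"
proof -
 have hb: "has_bochner_integral R' (%x. p n (x / 4)) 0" "has_bochner_integral R (%x. p n (x / 4)) 0" if "n > 0" for n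
  using orth'[of 0 n] p_orth[of 0 n] prod_integrable(2)[of n 0] that by (auto simp: p0 has_bochner_integral_iff)
 note md = moments_determined[OF prob hb(2) prob' hb(1)]
 have pm: "integrable R' (%x. p n (x / 4) * p m (x / 4))" "(\<integral>x. p n (x / 4) * p m (x / 4) \<partial>R') = (\<integral>x. p n (x / 4) * p m (x / 4) \<partial>R)" for n m
  using md[of "pp n * pp m"] by (auto simp: poly_pp)
 have nn': "AE x in R'. x + 4 * al^2 >= 0" by (rule support[OF prob' sets']) (simp_all add: pm p_orth p_norm)
 have pw: "(x + 4 * al^2) ^ n = poly ([:4 * al^2, 4:] ^ n) (x / 4)" for x n by (simp add: poly_power add.commute)
 let ?f = "%x. x + 4 * al^2"
 have [measurable_cong]: "sets R = sets borel" "sets R' = sets borel" by (fact sets, fact sets')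
 have sm: "sqrt (x + 4 * al^2) <= sqrt x + 2 * al" if "x >= 0" for x
  using sqrt_add_le_add_sqrt[OF that, of "4 * al^2"] al by (simp add: real_sqrt_mult)
 have "distr R borel ?f = distr R' borel ?f"
 proof (rule stieltjes_moment_unique[where k = k])
  show "prob_space (distr R borel ?f)" "prob_space (distr R' borel ?f)" by (intro prob_space.prob_space_distr prob prob'; measurable)+
  show "AE x in distr R borel ?f. 0 <= x" using nn by (subst AE_distr_iff) (auto elim!: eventually_mono)
  show "AE x in distr R' borel ?f. 0 <= x" using nn' by (subst AE_distr_iff) auto
  show "integrable (distr R borel ?f) (%x. x ^ n)" "integrable (distr R' borel ?f) (%x. x ^ n)" for n
   using md[of "[:4 * al^2, 4:] ^ n"] by (simp_all add: integrable_distr_eq pw)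
  show "(\<integral>x. x ^ n \<partial>distr R borel ?f) = (\<integral>x. x ^ n \<partial>distr R' borel ?f)" for n
   using md[of "[:4 * al^2, 4:] ^ n"] by (simp add: integral_distr pw)
  have "integrable R (%x. exp (k * sqrt (x + 4 * al^2)))"
  proof (rule lintegrable_bound)
   show "integrable R (%x. exp (k * (2 * al)) * exp (k * sqrt x))" using k(2) by simp
   show "AE x in R. norm (exp (k * sqrt (x + 4 * al^2))) <= norm (exp (k * (2 * al)) * exp (k * sqrt x))" using nn
   proof eventually_elim
    case (elim x)
    have "k * sqrt (x + 4 * al^2) <= k * (sqrt x + 2 * al)" using sm[OF elim] k(1) by (intro mult_left_mono) auto
    then show ?case by (simp add: exp_add[symmetric] algebra_simps)
   qed
  qed measurable
  then show "integrable (distr R borel ?f) (%x. exp (k * sqrt x))" by (simp add: integrable_distr_eq)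
 qed (use k in auto)
 then have "distr (distr R borel ?f) borel (%x. x - 4 * al^2) = distr (distr R' borel ?f) borel (%x. x - 4 * al^2)" by simp
 then have "distr R borel (%x. x) = distr R' borel (%x. x)" by (subst (asm) (1 2) distr_distr) (auto simp: comp_def)
 then show ?thesis using distr_id2[of borel R] distr_id2[of borel R'] sets sets' by simp
qed

end

text \<open>Resolves the definite description: \<open>R\<close> has the defining property, and
  \<open>unique\<close> excludes every other measure.\<close>

lemma cdh_measure_eqI:
 assumes cdh: "cdh_measure_data al de X (cdh_A al be ga) (cdh_C be ga) (cdh_poly al be ga) R"
  and nn: "AE x in R. x >= 0" and k: "k > 0" "integrable R (%x. exp (k * sqrt x))"
 shows "cdh_measure al be ga = R"
proof -
 interpret cdh_measure_data al de X "cdh_A al be ga" "cdh_C be ga" "cdh_poly al be ga" R by fact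
 show ?thesis unfolding cdh_measure_def
 proof (rule the_equality)
  show "is_cdh_measure al be ga R" unfolding is_cdh_measure_def using prob sets A_pos C_pos
   by (auto intro!: prod_nonneg mult_nonneg_nonneg simp: less_imp_le has_bochner_integral_iff prod_integrable p_orth)
  fix R' assume "is_cdh_measure al be ga R'"
  then show "R' = R" unfolding is_cdh_measure_def by (intro unique[OF nn k]) auto
 qed
qed

section \<open>Transition probabilities in the spectral variable\<close>

text \<open>The indices that occur: a state x is written as -nu^2, with \<open>nu\<close> imaginary
  for x >= 0 and real for a negative state -a^2 such as the atom of \<open>p0\<close>. The bound
  \<open>abs a < de\<close> makes the transition from it absolutely continuous.\<close>

definition spectral :: "complex => real => bool" where
 "spectral nu de \<longleftrightarrow> (\<exists>v. nu = iu v) \<or> (\<exists>a. nu = cx a & abs a < de)"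

lemma spectral_imag [simp]: "spectral (iu v) de" by (auto simp: spectral_def)

lemma spectral_Re: "spectral nu de ==> de > 0 ==> abs (Re nu) < de" by (auto simp: spectral_def)

lemma spectral_Mm: "spectral nu de ==> de > 0 ==> Mm de nu (iu u) = cx (norm (Mm de nu (iu u)))"
 by (auto simp: spectral_def Mm_of_real_imag Mm_imag MR_nonneg MA_nonneg)

lemma spectral_hm_pos:
 assumes "spectral nu de" "de > 0" "de <= al"
 shows "hm al nu = cx (norm (hm al nu))" "norm (hm al nu) > 0"
proof -
 have "hm al nu = cx (norm (hm al nu)) & norm (hm al nu) > 0"
 proof (cases "\<exists>v. nu = iu v")
  case True
  then obtain v where v: "nu = iu v" by blast
  have "hR al v > 0" using assms by (intro hR_pos) simp
  then show ?thesis unfolding v hm_imag by simp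
 next
  case False
  then obtain a where a: "nu = cx a" "abs a < de" using assms by (auto simp: spectral_def)
  define r where "r = 2 powr (al - 2) * Gamma ((al + a) / 2) * Gamma ((al - a) / 2)"
  have "r > 0" unfolding r_def using a assms by (intro mult_pos_pos Gamma_real_pos) auto
  moreover have "hm al nu = cx r" unfolding hm_def a r_def of_real_mult Gamma_complex_of_real[symmetric] by simp
  ultimately show ?thesis by simp
 qed
 then show "hm al nu = cx (norm (hm al nu))" "norm (hm al nu) > 0" by blast+
qed

lemma hm_shift:
 assumes "abs (Re nu) < al"
 shows "hm (al + 2) nu = ((cx al)^2 - nu\<^sup>2) * hm al nu"
proof -
 have 1: "(cx al + nu) / 2 \<notin> \<int>\<^sub>\<le>\<^sub>0" "(cx al - nu) / 2 \<notin> \<int>\<^sub>\<le>\<^sub>0"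
  using assms by (auto intro!: Re_pos_not_nonpos_Ints)
 have "(cx (al + 2) + nu) / 2 = (cx al + nu) / 2 + 1" "(cx (al + 2) - nu) / 2 = (cx al - nu) / 2 + 1" by (simp_all add: field_simps)
 then have "hm (al + 2) nu = cx (2 powr (al + 2 - 2)) * ((cx al + nu) / 2 * Gamma ((cx al + nu) / 2)) * ((cx al - nu) / 2 * Gamma ((cx al - nu) / 2))"
  unfolding hm_def by (simp only: Gamma_plus1[OF 1(1)] Gamma_plus1[OF 1(2)])
 moreover have "2 powr (al + 2 - 2) = 4 * (2 powr (al - 2) :: real)" by (simp add: powr_diff)
 moreover have "cx (4 * P) * ((b + n) / 2 * G1) * ((b - n) / 2 * G2) = (b^2 - n\<^sup>2) * (cx P * G1 * G2)" for P :: real and b n G1 G2 :: complex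
  by (simp add: power2_eq_square field_simps)
 ultimately show ?thesis by (simp only: hm_def)
qed

text \<open>The unnormalised dual Hahn weight in the variable u, where the state is u^2. Its total
  mass is given by \<open>cdw_integral\<close>.\<close>

definition cdw :: "real => real => complex => real => real" where
 "cdw ep de nu u = hR ep u * norm (Mm de nu (iu u)) * ww u"

lemma cdw_nonneg: "cdw ep de nu u >= 0" by (simp add: cdw_def hR_nonneg ww_nonneg)

lemma borel_measurable_cdw [measurable]: "cdw ep de nu \<in> borel_measurable borel" unfolding cdw_def by measurable

lemma cdw_integral:
 assumes e: "ep > 0" and d: "de > 0" and nu: "spectral nu de"
 shows "L1 (cdw ep de nu)" "(LBINT u. cdw ep de nu u) = norm (hm (ep + de) nu)"
proof -
 have eq: "cx (hR ep v) * (Mm de nu (iu v) * cx (ww v)) = cx (cdw ep de nu v)" for v by (subst spectral_Mm[OF nu d]) (simp add: cdw_def)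
 note * = cdh_integral[OF e spectral_Re[OF nu d], unfolded eq]
 show "L1 (cdw ep de nu)" using *(1) by (simp only: complex_of_real_integrable_eq)
 have "cx (LBINT u. cdw ep de nu u) = cx (norm (hm (ep + de) nu))"
  using *(2) spectral_hm_pos(1)[OF nu d, of "ep + de"] e by (simp only: integral_complex_of_real)
 then show "(LBINT u. cdw ep de nu u) = norm (hm (ep + de) nu)" by (simp only: of_real_eq_iff)
qed

lemma cdw_decay:
 assumes e: "ep > 0" and d: "de > 0" and nu: "spectral nu de"
 shows "\<exists>B. \<forall>u. cdw ep de nu u <= B * ((1 + abs u) * exp (- c0 * abs u))"
proof (intro exI allI)
 fix u
 have "cdw ep de nu u <= (E0 u * HB ep 0) * (MB de (abs (Re nu)) * exp (- 2 * th0 * abs u)) * ((1 + abs u) * exp (pi * abs u))"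
  unfolding cdw_def using spectral_Re[OF nu d] d e
  by (intro mult_mono hR_decay Mm_decay ww_bound mult_nonneg_nonneg MB_nonneg ww_nonneg HB_nonneg hR_nonneg) auto
 also have "... = (HB ep 0 * MB de (abs (Re nu))) * ((1 + abs u) * (E0 u * exp (- 2 * th0 * abs u) * exp (pi * abs u)))" by simp
 also have "E0 u * exp (- 2 * th0 * abs u) * exp (pi * abs u) = exp (- c0 * abs u)" unfolding exp_add[symmetric] by (simp add: c0_def algebra_simps)
 finally show "cdw ep de nu u <= (HB ep 0 * MB de (abs (Re nu))) * ((1 + abs u) * exp (- c0 * abs u))" .
qed

lemma cdw_exp_integrable:
 assumes e: "ep > 0" and d: "de > 0" and nu: "spectral nu de"
 shows "L1 (%u. cdw ep de nu u * ((1 + abs u) ^ n * exp (c0 / 2 * abs u)))"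
proof -
 let ?A = "%u. (1 + abs u) ^ n * exp (c0 / 2 * abs u)"
 let ?B = "%u. (1 + abs u) ^ Suc n * exp (- (c0 / 2) * abs u)"
 obtain B where B: "!!u. cdw ep de nu u <= B * ((1 + abs u) * exp (- c0 * abs u))" using cdw_decay[OF assms] by blast
 show ?thesis
 proof (rule lintegrable_bound)
  show "L1 (%u. B * (?B u))" using c0_pos by (intro integrable_mult_right integrable_poly_exp) simp
  show "AE u in lborel. norm (cdw ep de nu u * (?A u)) <= norm (B * (?B u))"
  proof (intro AE_I2 real_norm_mono mult_nonneg_nonneg cdw_nonneg)
   fix u :: real
   have "cdw ep de nu u * (?A u) <= B * ((1 + abs u) * exp (- c0 * abs u)) * (?A u)"
    by (intro mult_right_mono B) auto
   also have "... = B * ((1 + abs u) ^ Suc n * (exp (- c0 * abs u) * exp (c0 / 2 * abs u)))" by simp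
   also have "exp (- c0 * abs u) * exp (c0 / 2 * abs u) = exp (- (c0 / 2) * abs u)" by (simp add: exp_add[symmetric])
   finally show "cdw ep de nu u * (?A u) <= B * (?B u)" .
  qed auto
 qed measurable
qed

definition TR :: "real => real => complex => real measure" where
 "TR ep de nu = distr (density lborel (%u. ennreal (cdw ep de nu u / norm (hm (ep + de) nu)))) borel (%u. u^2)"

lemma sets_TR [simp, measurable_cong]: "sets (TR ep de nu) = sets borel" by (simp add: TR_def)

context
 fixes ep de :: real and nu :: complex
 assumes e: "ep > 0" and d: "de > 0" and nu: "spectral nu de"
begin

lemma hm_norm_pos: "norm (hm (ep + de) nu) > 0" using spectral_hm_pos(2)[OF nu d] e by simp

lemma TR_integrable:
 assumes [measurable]: "f \<in> borel_measurable borel"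
 shows "integrable (TR ep de nu) f \<longleftrightarrow> L1 (%u. cdw ep de nu u * (f (u^2) :: real))" using hm_norm_pos cdw_nonneg unfolding TR_def
 by (subst integrable_distr_eq, simp, simp, subst integrable_real_density) (auto simp: mult.commute[of _ "inverse _"] divide_inverse mult.assoc)

lemma TR_integral:
 assumes [measurable]: "f \<in> borel_measurable borel"
 shows "(\<integral>x. f x \<partial>TR ep de nu) = (LBINT u. cdw ep de nu u * (f (u^2) :: real)) / norm (hm (ep + de) nu)"
 using hm_norm_pos cdw_nonneg unfolding TR_def
 by (subst integral_distr, simp, simp, subst integral_real_density) (auto simp: divide_inverse mult.commute[of _ "inverse _"] mult.assoc)

text \<open>Multiplication by \<open>psi m (u^2 / 4)\<close> replaces \<open>ep\<close> by
  \<open>ep + 2 * real m\<close>, up to a power of 4, by the functional equation of Gamma. The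
  integrals of \<open>psi m\<close> are therefore quotients of total masses, which
  \<open>hm_shift\<close> evaluates to \<open>a m\<close>.\<close>

lemma TR_cdh:
 assumes "cdh (ep / 2) de X A C p" "- nu\<^sup>2 = cx (4 * X)"
 shows "cdh_measure_data (ep / 2) de X A C p (TR ep de nu)"
  and "AE x in TR ep de nu. x >= 0" and "integrable (TR ep de nu) (%x. exp (c0 / 2 * sqrt x))"
proof -
 interpret cdh "ep / 2" de X A C p by fact
 show "integrable (TR ep de nu) (%x. exp (c0 / 2 * sqrt x))" using cdw_exp_integrable[OF e d nu, of 0] by (subst TR_integrable) auto
 show "AE x in TR ep de nu. x >= 0" unfolding TR_def by (subst AE_distr_iff) auto
 show "cdh_measure_data (ep / 2) de X A C p (TR ep de nu)"
 proof (intro cdh_measure_data.intro cdh_measure_data_axioms.intro assms(1))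
  show "prob_space (TR ep de nu)"
  proof
   have "emeasure (TR ep de nu) (space (TR ep de nu)) = (NN u. ennreal (cdw ep de nu u / norm (hm (ep + de) nu)))"
    by (simp add: TR_def emeasure_distr emeasure_density)
   also have "... = ennreal (LBINT u. cdw ep de nu u / norm (hm (ep + de) nu))"
    using cdw_integral(1)[OF e d nu] cdw_nonneg by (intro nn_integral_eq_integral) auto
   also have "(LBINT u. cdw ep de nu u / norm (hm (ep + de) nu)) = 1" using cdw_integral(2)[OF e d nu] hm_norm_pos by simp
   finally show "emeasure (TR ep de nu) (space (TR ep de nu)) = 1" by simp
  qed
  show "integrable (TR ep de nu) (%x. x ^ n)" for n
  proof (subst TR_integrable)
   show "L1 (%u. cdw ep de nu u * (u^2) ^ n)"
   proof (rule lintegrable_bound[OF cdw_exp_integrable[OF e d nu, of "2 * n"]])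
    show "AE u in lborel. norm (cdw ep de nu u * (u^2) ^ n) <= norm (cdw ep de nu u * ((1 + abs u) ^ (2 * n) * exp (c0 / 2 * abs u)))"
    proof (intro AE_I2 real_norm_mono mult_nonneg_nonneg mult_left_mono cdw_nonneg)
     fix u :: real
     have "(u^2) ^ n = abs u ^ (2 * n) * 1" by (simp add: power_mult)
     also have "... <= (1 + abs u) ^ (2 * n) * exp (c0 / 2 * abs u)" using c0_pos by (intro mult_mono power_mono) auto
     finally show "(u^2) ^ n <= (1 + abs u) ^ (2 * n) * exp (c0 / 2 * abs u)" .
    qed auto
   qed measurable
  qed measurable
  show "(\<integral>x. psi m (x / 4) \<partial>TR ep de nu) = a m" for m
  proof -
   have 1: "cdw ep de nu u * psi m (u^2 / 4) = (1 / 4) ^ m * cdw (ep + 2 * real m) de nu u" for u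
   proof (induction m)
    case (Suc m)
    have "hR (ep + 2 * real m + 2) u = ((ep + 2 * real m)^2 + u^2) * hR (ep + 2 * real m) u"
     using e by (intro hR_shift) (simp add: sum_power2_eq_zero_iff)
    then have c: "cdw (ep + 2 * real (Suc m)) de nu u = ((ep + 2 * real m)^2 + u^2) * cdw (ep + 2 * real m) de nu u" by (simp add: cdw_def add_ac)
    have "psi (Suc m) (u^2 / 4) = psi m (u^2 / 4) * (((ep + 2 * real m)^2 + u^2) / 4)" by (simp add: psi_def power2_eq_square field_simps)
    then have "cdw ep de nu u * psi (Suc m) (u^2 / 4) = (cdw ep de nu u * psi m (u^2 / 4)) * (((ep + 2 * real m)^2 + u^2) / 4)"
     by (simp only: mult.assoc)
    then show ?case unfolding c Suc by simp
   qed (simp add: psi_def)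
   have 2: "norm (hm (ep + de + 2 * real m) nu) = 4 ^ m * a m * norm (hm (ep + de) nu)"
   proof (induction m)
    case (Suc m)
    have "hm (ep + de + 2 * real m + 2) nu = ((cx (ep + de + 2 * real m))^2 - nu\<^sup>2) * hm (ep + de + 2 * real m) nu"
     using spectral_Re[OF nu d] e by (intro hm_shift) auto
    also have "(cx (ep + de + 2 * real m))^2 - nu\<^sup>2 = cx (4 * A m)"
    proof -
     have "(ep + de + 2 * real m)^2 + 4 * X = 4 * A m" unfolding A by (simp add: power2_eq_square field_simps)
     then show ?thesis using assms(2) unfolding diff_conv_add_uminus[of _ "nu^2"] by (simp only: of_real_power[symmetric] of_real_add[symmetric])
    qed
    finally have "norm (hm (ep + de + 2 * real m + 2) nu) = 4 * A m * norm (hm (ep + de + 2 * real m) nu)"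
     using A_pos[of m] by (simp only: norm_mult norm_of_real)
    moreover have "ep + de + 2 * real (Suc m) = ep + de + 2 * real m + 2" by simp
    ultimately show ?case using Suc by (simp only:) (simp add: a_Suc)
   qed (simp add: ac_0)
   have mp: "(%x. psi m (x / 4)) \<in> borel_measurable borel" unfolding psi_def by measurable
   have "(\<integral>x. psi m (x / 4) \<partial>TR ep de nu) = (1 / 4) ^ m * norm (hm (ep + 2 * real m + de) nu) / norm (hm (ep + de) nu)"
    unfolding TR_integral[OF mp] 1 using cdw_integral(2)[OF _ d nu, of "ep + 2 * real m"] e by simp
   also have "ep + 2 * real m + de = ep + de + 2 * real m" by simp
   finally show ?thesis unfolding 2 using hm_norm_pos by (simp add: power_divide)
  qed
 qed simp
qed

end

text \<open>Conjugate and real parameters produce the same coefficients, so \<open>main\<close>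
  covers both branches of \<open>T_trans\<close>. The third branch is excluded, as x > -(t - s)^2 >=
  -(c - s)^2.\<close>

lemma T_trans_TR:
 assumes st: "s < t" "t < c" and nu: "spectral nu (t - s)" and x: "- nu\<^sup>2 = cx x"
 shows "T_trans c s t x = TR (c - t) (t - s) nu"
proof -
 let ?A = "%k. real k + (c - t) / 2 + (t - s) / 2"
 have e: "c - t > 0" and d: "t - s > 0" using st by auto
 have X: "x > - (t - s)\<^sup>2"
 proof (cases "\<exists>v. nu = iu v")
  case True
  then obtain v where "nu = iu v" by blast
  then have "cx x = cx (v^2)" using x by (simp add: power_mult_distrib)
  then have "x = v^2" by (simp only: of_real_eq_iff)
  then show ?thesis using d by (smt (verit) zero_le_power2 zero_less_power2)
 next
  case False
  then obtain a where a: "nu = cx a" "abs a < t - s" using nu by (auto simp: spectral_def)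
  then have "cx x = cx (- a\<^sup>2)" using x by simp
  then have "x = - a\<^sup>2" by (simp only: of_real_eq_iff)
  moreover have "(abs a)\<^sup>2 < (t - s)^2" using a(2) by (intro power_strict_mono) auto
  ultimately show ?thesis by simp
 qed
 have main: "cdh_measure ((c - t) / 2) be ga = TR (c - t) (t - s) nu"
  if A: "!!k. cdh_A ((c - t) / 2) be ga k = (?A k)^2 + x / 4" and C: "!!k. cdh_C be ga k = real k * (real k - 1 + (t - s))" for be ga
 proof -
  have "cdh ((c - t) / 2) (t - s) (x / 4) (cdh_A ((c - t) / 2) be ga) (cdh_C be ga) (cdh_poly ((c - t) / 2) be ga)"
   by unfold_locales (use e d X A C in \<open>auto simp: power_divide\<close>)
  moreover have "- nu\<^sup>2 = cx (4 * (x / 4))" using x by simp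
  ultimately have *: "cdh_measure_data ((c - t) / 2) (t - s) (x / 4) (cdh_A ((c - t) / 2) be ga) (cdh_C be ga) (cdh_poly ((c - t) / 2) be ga) (TR (c - t) (t - s) nu)"
   "AE x in TR (c - t) (t - s) nu. x >= 0" "integrable (TR (c - t) (t - s) nu) (%x. exp (c0 / 2 * sqrt x))" by (rule TR_cdh[OF e d nu])+
  show ?thesis by (rule cdh_measure_eqI[OF *(1,2) _ *(3)]) (use c0_pos in simp)
 qed
 show ?thesis
 proof (cases "x >= 0")
  case True
  have r: "sqrt x * sqrt x = x" using True by simp
  have "cdh_A ((c - t) / 2) ((cx (t - s) - iu (sqrt x)) / 2) ((cx (t - s) + iu (sqrt x)) / 2) k = (?A k)^2 + x / 4" for k
   unfolding cdh_A_def using r by (simp add: power2_eq_square field_simps)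
  moreover have "cdh_C ((cx (t - s) - iu (sqrt x)) / 2) ((cx (t - s) + iu (sqrt x)) / 2) k = real k * (real k - 1 + (t - s))" for k
   unfolding cdh_C_def by (simp add: field_simps)
  ultimately show ?thesis unfolding T_trans_def if_P[OF True] by (rule main)
 next
  case False
  then have r: "sqrt (- x) * sqrt (- x) = - x" by simp
  have "(t - s)^2 <= (c - s)^2" using st by (intro power_mono) auto
  then have F2: "- (c - s)\<^sup>2 <= x" using X by simp
  have "cdh_A ((c - t) / 2) (cx ((t - s - sqrt (- x)) / 2)) (cx ((t - s + sqrt (- x)) / 2)) k = (?A k)^2 + x / 4" for k
   unfolding cdh_A_def using r by (simp add: power2_eq_square field_simps)
  moreover have "cdh_C (cx ((t - s - sqrt (- x)) / 2)) (cx ((t - s + sqrt (- x)) / 2)) k = real k * (real k - 1 + (t - s))" for k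
   unfolding cdh_C_def by (simp add: field_simps)
  ultimately show ?thesis unfolding T_trans_def if_not_P[OF False] if_P[OF F2] by (rule main)
 qed
qed

lemma nn_integral_T_trans:
 assumes st: "s < t" "t < c" and nu: "spectral nu (t - s)" and x: "- nu\<^sup>2 = cx x"
  and [measurable]: "f \<in> borel_measurable borel"
 shows "(\<integral>\<^sup>+y. f y \<partial>T_trans c s t x) = (NN u. ennreal (cdw (c - t) (t - s) nu u / norm (hm (c - s) nu)) * f (u^2))"
 unfolding T_trans_TR[OF st nu x] TR_def by (subst nn_integral_distr, simp, simp, subst nn_integral_density) simp_all

section \<open>Positivity of the kernel\<close>

lemma has_real_derivative_integral:
 fixes f f' :: "real => 'a => real"
 assumes r: "r > 0"
  and der: "!!x w. abs (x - x0) < r ==> ((%x. f x w) has_real_derivative f' x w) (at x)"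
  and bd: "!!x w. abs (x - x0) < r ==> abs (f' x w) <= g w"
  and g: "integrable M g" and int: "!!x. abs (x - x0) < r ==> integrable M (f x)"
  and meas: "f' x0 \<in> borel_measurable M"
 shows "((%x. \<integral>w. f x w \<partial>M) has_real_derivative (\<integral>w. f' x0 w \<partial>M)) (at x0)"
proof -
 let ?A = "%M. \<integral>w. f' x0 w \<partial>M"
 let ?B = "%M. \<integral>w. f x0 w \<partial>M"
 let ?C = "%M. %y. ((\<integral>w. f y w \<partial>M) - (?B M)) / (y - x0)"
 have lip: "norm (f y w - f x0 w) <= g w * norm (y - x0)" if "abs (y - x0) < r" for y w
  using that r by (intro field_differentiable_bound[where S = "ball x0 r" and f' = "%x. f' x w"])
   (auto simp: dist_real_def abs_minus_commute intro!: has_field_derivative_at_within der bd)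
 have "((?C M) \<longlongrightarrow> (?A M)) (at x0)"
  unfolding tendsto_at_iff_sequentially
 proof (intro allI impI)
  fix X :: "nat => real" assume X: "\<forall>i. X i \<in> UNIV - {x0}" and Xl: "X \<longlonglongrightarrow> x0"
  have "eventually (%i. abs (X i - x0) < r) sequentially" using Xl r by (auto simp: tendsto_iff dist_real_def)
  then obtain N where N: "!!i. i >= N ==> abs (X i - x0) < r" by (auto simp: eventually_sequentially)
  define Z where "Z i = X (i + N)" for i
  have Z: "abs (Z i - x0) < r" "Z i ~= x0" for i using N X by (auto simp: Z_def)
  have Zl: "Z \<longlonglongrightarrow> x0" unfolding Z_def using Xl by (rule LIMSEQ_ignore_initial_segment)
  have i0: "integrable M (f x0)" using r by (intro int) simp
  have lim: "(%i. \<integral>w. (f (Z i) w - f x0 w) / (Z i - x0) \<partial>M) \<longlonglongrightarrow> (?A M)"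
  proof (rule integral_dominated_convergence[where w = g])
   show "(%w. (f (Z i) w - f x0 w) / (Z i - x0)) \<in> borel_measurable M" for i using int[OF Z(1)[of i]] i0 by auto
   show "AE w in M. (%i. (f (Z i) w - f x0 w) / (Z i - x0)) \<longlonglongrightarrow> f' x0 w"
   proof (rule AE_I2)
    fix w
    have "((%y. (f y w - f x0 w) / (y - x0)) \<longlongrightarrow> f' x0 w) (at x0)" using der[of x0 w] r by (simp add: has_field_derivative_iff)
    then show "(%i. (f (Z i) w - f x0 w) / (Z i - x0)) \<longlonglongrightarrow> f' x0 w"
     unfolding tendsto_at_iff_sequentially comp_def using Z(2) Zl by auto
   qed
   show "AE w in M. norm ((f (Z i) w - f x0 w) / (Z i - x0)) <= g w" for i
    using lip[OF Z(1)[of i]] Z(2)[of i] by (intro AE_I2) (simp add: norm_divide pos_divide_le_eq)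
  qed (use g meas in auto)
  have eq: "(\<integral>w. (f (Z i) w - f x0 w) / (Z i - x0) \<partial>M) = ((\<integral>w. f (Z i) w \<partial>M) - (?B M)) / (Z i - x0)" for i
   using int[OF Z(1)[of i]] i0 by simp
  have "(%i. ((\<integral>w. f (X (i + N)) w \<partial>M) - (?B M)) / (X (i + N) - x0)) \<longlonglongrightarrow> (?A M)"
   using lim unfolding eq unfolding Z_def .
  then show "((?C M) \<circ> X) \<longlonglongrightarrow> (?A M)"
   unfolding comp_def by (rule LIMSEQ_offset)
 qed
 then show ?thesis by (simp add: has_field_derivative_iff)
qed

section \<open>Recurrences and the modified Bessel equation\<close>

lemma KR_antimono: "x <= y ==> KR s y <= KR s x"
 unfolding KR_def by (intro divide_right_mono integral_mono KR_integrable) (auto intro!: mult_right_mono)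

lemma KB_shift_sum:
 "KB (nu + 1) x + KB (nu - 1) x = (LBINT w. cx (cosh w) * kern nu x w)"
proof -
 let ?A = "%w. exp ((nu + 1) * cx w - cx (exp x * cosh w)) + exp ((nu - 1) * cx w - cx (exp x * cosh w))"
 have "KB (nu + 1) x + KB (nu - 1) x = (LBINT w. exp ((nu + 1) * cx w - cx (exp x * cosh w)) + exp ((nu - 1) * cx w - cx (exp x * cosh w))) / 2"
  unfolding KB_def by (subst lintegral_add[OF KB_integrable KB_integrable]) (simp add: add_divide_distrib)
 also have "... = (LBINT w. (?A w) / 2)" by simp
 also have "... = (LBINT w. cx (cosh w) * kern nu x w)"
 proof (rule lintegral_cong[OF refl])
  fix w :: real
  have "exp ((nu + 1) * cx w - c) = exp (cx w) * exp (nu * cx w - c)" "exp ((nu - 1) * cx w - c) = exp (- cx w) * exp (nu * cx w - c)" for c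
   by (simp_all add: exp_add[symmetric] algebra_simps)
  moreover have "cx (cosh w) = (exp (cx w) + exp (- cx w)) / 2"
   by (simp add: cosh_field_def exp_of_real[symmetric] del: exp_of_real of_real_exp) (simp add: exp_of_real[symmetric])
  ultimately show "(?A w) / 2 = cx (cosh w) * kern nu x w"
   by (simp only:) (simp add: distrib_right add_divide_distrib)
 qed
 finally show ?thesis .
qed

text \<open>The difference of the neighbouring indices inserts a factor sinh into the integrand, and
  \<open>KB_sinh\<close> evaluates the result.\<close>

lemma KB_shift_diff: "cx (exp x) * (KB (nu + 1) x - KB (nu - 1) x) = 2 * nu * KB nu x"
proof -
 let ?A = "%w. (exp ((nu + 1) * cx w - cx (exp x * cosh w)) - exp ((nu - 1) * cx w - cx (exp x * cosh w))) / 2"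
 have "cx (exp x) * (KB (nu + 1) x - KB (nu - 1) x) = cx (exp x) * ((LBINT w. exp ((nu + 1) * cx w - cx (exp x * cosh w)) - exp ((nu - 1) * cx w - cx (exp x * cosh w))) / 2)"
  unfolding KB_def by (subst lintegral_diff[OF KB_integrable KB_integrable]) (simp add: diff_divide_distrib)
 also have "... = (LBINT w. cx (exp x) * (?A w))" by simp
 also have "... = (LBINT w. cx (exp x * sinh w) * kern nu x w)"
 proof (rule lintegral_cong[OF refl])
  fix w :: real
  have "exp ((nu + 1) * cx w - c) = exp (cx w) * exp (nu * cx w - c)" "exp ((nu - 1) * cx w - c) = exp (- cx w) * exp (nu * cx w - c)" for c
   by (simp_all add: exp_add[symmetric] algebra_simps)
  moreover have "cx (sinh w) = (exp (cx w) - exp (- cx w)) / 2"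
   by (simp add: sinh_field_def exp_of_real[symmetric] del: exp_of_real of_real_exp) (simp add: exp_of_real[symmetric])
  ultimately show "cx (exp x) * (?A w) = cx (exp x * sinh w) * kern nu x w"
   by (simp only: of_real_mult) (simp add: left_diff_distrib diff_divide_distrib)
 qed
 finally show ?thesis unfolding KB_sinh(2) .
qed

lemma Re_KB_deriv:
 "((%x. Re (KB nu x)) has_real_derivative (- (exp x0 / 2) * Re (KB (nu + 1) x0 + KB (nu - 1) x0))) (at x0)"
proof -
 let ?A = "- cx (exp x0) * (KB (nu + 1) x0 + KB (nu - 1) x0)"
 let ?B = "%w. - (exp (x0 - 1) * cosh w)"
 let ?C = "%x w. - (exp x * cosh w)"
 define f where "f x w = Re (exp (nu * cx w)) * exp (?C x w)" for x w :: real
 define f' where "f' x w = Re (exp (nu * cx w)) * (- (exp x * cosh w) * exp (?C x w))" for x w :: real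
 have fe: "f x w = Re (kern nu x w)" for x w
 proof -
  have "exp (- cx r) = cx (exp (- r))" for r using exp_of_real[of "- r"] by simp
  then have "kern nu x w = exp (nu * cx w) * cx (exp (?C x w))" by (simp only: diff_conv_add_uminus exp_add)
  then show ?thesis by (simp add: f_def)
 qed
 have f'e: "f' x w = Re (- cx (exp x) * (cx (cosh w) * kern nu x w))" for x w
  unfolding mult.assoc[symmetric] of_real_mult[symmetric] of_real_minus[symmetric] Re_complex_of_real times_complex.sel using fe[of x w]
  by (simp add: f_def f'_def)
 have If: "L1 (f x)" "(LBINT w. f x w) = 2 * Re (KB nu x)" for x unfolding fe using KB_integrable[of nu x] by (auto simp: KB_def)
 define g where "g w = exp (x0 + 1) * (exp (Re nu * w) * (cosh w * exp (?B w)))" for w :: real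
 have g: "L1 g"
 proof -
  have eq: "g w = exp (x0 + 1) / 2 * (exp ((Re nu + 1) * w - exp (x0 - 1) * cosh w) + exp ((Re nu - 1) * w - exp (x0 - 1) * cosh w))" for w
  proof -
   have "exp ((Re nu + 1) * w - c) = exp (Re nu * w) * exp w * exp (- c)" "exp ((Re nu - 1) * w - c) = exp (Re nu * w) * exp (- w) * exp (- c)" for c
    by (simp_all add: exp_add[symmetric] algebra_simps)
   moreover have "E * (r * (((a + b) / 2) * e)) = E / 2 * (r * a * e + r * b * e)" for E r a b e :: real by (simp add: field_simps)
   moreover have "g w = exp (x0 + 1) * (exp (Re nu * w) * (((exp w + exp (- w)) / 2) * exp (?B w)))"
    unfolding g_def cosh_field_def[of w, symmetric] ..
   ultimately show ?thesis by (simp only:)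
  qed
  show ?thesis unfolding eq[abs_def] by (intro integrable_mult_right lintegrable_add KR_integrable)
 qed
 have "((%x. (LBINT w. f x w)) has_real_derivative (LBINT w. f' x0 w)) (at x0)"
 proof (rule has_real_derivative_integral[where r = 1 and f' = f' and g = g])
  show "((%x. f x w) has_real_derivative f' x w) (at x)" for x w unfolding f_def f'_def by (auto intro!: derivative_eq_intros)
  show "abs (f' x w) <= g w" if "abs (x - x0) < 1" for x w
  proof -
   have "abs (Re (exp (nu * cx w))) <= exp (Re nu * w)" using abs_Re_le_cmod[of "exp (nu * cx w)"] by simp
   moreover have "exp x * cosh w * exp (?C x w) <= exp (x0 + 1) * (cosh w * exp (?B w))"
   proof -
    have "exp (?C x w) <= exp (?B w)" using that by (auto intro!: mult_right_mono)
    then have "cosh w * exp (?C x w) <= cosh w * exp (?B w)" by (rule mult_left_mono) simp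
    then show ?thesis unfolding mult.assoc using that by (intro mult_mono[of "exp x"]) auto
   qed
   ultimately have "abs (Re (exp (nu * cx w))) * (exp x * cosh w * exp (?C x w)) <= exp (Re nu * w) * (exp (x0 + 1) * (cosh w * exp (?B w)))"
    by (rule mult_mono) auto
   then show ?thesis by (simp add: f'_def g_def abs_mult mult_ac)
  qed
  show "f' x0 \<in> borel_measurable lborel" unfolding f'_def by measurable
 qed (use g If in auto)
 moreover have "(LBINT w. f' x0 w) = Re ?A"
 proof -
  have "L1 (%w. cx (cosh w) * exp (nu * cx w - cx (exp x0 * cosh w)))"
  proof -
   have eq: "cx (cosh w) * exp (nu * cx w - cx (exp x0 * cosh w)) = (exp ((nu + 1) * cx w - cx (exp x0 * cosh w)) + exp ((nu - 1) * cx w - cx (exp x0 * cosh w))) / 2" for w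
   proof -
    have "exp ((nu + 1) * cx w - c) = exp (cx w) * exp (nu * cx w - c)" "exp ((nu - 1) * cx w - c) = exp (- cx w) * exp (nu * cx w - c)" for c
     by (simp_all add: exp_add[symmetric] algebra_simps)
    moreover have "cx (cosh w) = (exp (cx w) + exp (- cx w)) / 2"
     by (simp add: cosh_field_def exp_of_real[symmetric] del: exp_of_real of_real_exp) (simp add: exp_of_real[symmetric])
    ultimately show ?thesis by (simp only:) (simp add: distrib_right add_divide_distrib)
   qed
   show ?thesis unfolding eq using KB_integrable[of "nu + 1" x0] KB_integrable[of "nu - 1" x0] by simp
  qed
  then show ?thesis unfolding f'e KB_shift_sum by (subst integral_Re) auto
 qed
 ultimately have "((%x. 2 * Re (KB nu x)) has_real_derivative Re ?A) (at x0)" by (simp only: If(2))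
 then have "((%x. 2 * Re (KB nu x) / 2) has_real_derivative Re ?A / 2) (at x0)"
  by (rule DERIV_cdivide)
 then show ?thesis by simp
qed

definition kr :: "real => real => real" where "kr v x = Re (KB (iu v) x)"

text \<open>The derivative of \<open>kr v\<close>, expressed through the neighbouring
  indices.\<close>

definition kr1 :: "real => real => real" where
 "kr1 v x = - (exp x / 2) * Re (KB (iu v + 1) x + KB (iu v - 1) x)"

lemma KB_kr: "KB (iu v) x = cx (kr v x)" by (simp add: kr_def KB_imaginary)

lemma kr_bessel: "kr v x = bessel_K v (exp x)" by (simp add: kr_def KB_imaginary)

lemma kr_minus: "kr (- v) x = kr v x" using KB_minus[of "iu v" x] by (simp add: kr_def)

lemma borel_measurable_kr [measurable (raw)]:
 assumes [measurable]: "f \<in> borel_measurable M" "g \<in> borel_measurable M"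
 shows "(%m. kr (f m) (g m)) \<in> borel_measurable M" unfolding kr_def by measurable

lemma kr_decay: "abs (kr v x) <= E0 v * KR0 x" using KB_imag_decay[of v x] by (simp add: KB_kr)

lemma kr_deriv: "(kr v has_real_derivative kr1 v x) (at x)" unfolding kr_def[abs_def] kr1_def by (rule Re_KB_deriv)

text \<open>The modified Bessel equation in the logarithmic variable: \<open>kr v\<close> is an
  eigenfunction of d^2/dx^2 - e^(2x) with eigenvalue -v^2. It follows from the recurrence at
  \<open>nu\<close>, \<open>nu + 1\<close> and \<open>nu - 1\<close>.\<close>

lemma kr1_deriv: "(kr1 v has_real_derivative ((exp x)^2 - v\<^sup>2) * kr v x) (at x)"
proof -
 let ?A = "%x nu. - (exp x / 2) * Re (KB (nu + 1 + 1) x + KB (nu + 1 - 1) x) + - (exp x / 2) * Re (KB (nu - 1 + 1) x + KB (nu - 1 - 1) x)"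
 let ?B = "%nu x. Re (KB (nu + 1) x) + Re (KB (nu - 1) x)"
 define nu where "nu = iu v"
 define E where "E = cx (exp x)"
 have s: "nu + 1 + 1 = nu + 2" "nu + 1 - 1 = nu" "nu - 1 + 1 = nu" "nu - 1 - 1 = nu - 2" by simp_all
 have d0: "E * (KB (nu + 1) x - KB (nu - 1) x) = 2 * nu * KB nu x" unfolding E_def by (rule KB_shift_diff)
 have d1: "E * (KB (nu + 2) x - KB nu x) = 2 * (nu + 1) * KB (nu + 1) x" using KB_shift_diff[of x "nu + 1"] unfolding s E_def .
 have d2: "E * (KB nu x - KB (nu - 2) x) = 2 * (nu - 1) * KB (nu - 1) x" using KB_shift_diff[of x "nu - 1"] unfolding s E_def .
 have key: "- (E / 2) * (KB (nu + 1) x + KB (nu - 1) x) - (E / 2) * (- (E / 2) * (KB (nu + 2) x + KB nu x) + - (E / 2) * (KB nu x + KB (nu - 2) x)) = (E^2 + nu^2) * KB nu x"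
 proof -
  have gen: "- (e / 2) * (p + q) - (e / 2) * (- (e / 2) * (P + k) + - (e / 2) * (k + Q)) = (e^2 + n^2) * k"
   if "e * (p - q) = 2 * n * k" "e * (P - k) = 2 * (n + 1) * p" "e * (k - Q) = 2 * (n - 1) * q" for e p q P Q k n :: complex
  proof -
   have "- (e / 2) * (p + q) - (e / 2) * (- (e / 2) * (P + k) + - (e / 2) * (k + Q)) = - (e / 2) * (p + q) + e^2 * k + (e / 4) * (e * (P - k) - e * (k - Q))"
    by (simp add: power2_eq_square field_simps)
   also have "... = e^2 * k + (n / 2) * (e * (p - q))" unfolding that(2,3) by (simp add: field_simps)
   also have "... = (e^2 + n^2) * k" unfolding that(1) by (simp add: power2_eq_square field_simps)
   finally show ?thesis .
  qed
  show ?thesis by (rule gen[OF d0 d1 d2])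
 qed
 have "((%x. - (exp x / 2) * (?B nu x)) has_real_derivative
   (- (exp x / 2)) * (?B nu x) + (?A x nu) * (- (exp x / 2))) (at x)"
  by (intro DERIV_mult DERIV_add Re_KB_deriv) (auto intro!: derivative_eq_intros)
 moreover have "(- (exp x / 2)) * (?B nu x) + (?A x nu) * (- (exp x / 2))
   = Re (- (E / 2) * (KB (nu + 1) x + KB (nu - 1) x) - (E / 2) * (- (E / 2) * (KB (nu + 2) x + KB nu x) + - (E / 2) * (KB nu x + KB (nu - 2) x)))"
  unfolding s by (simp add: E_def algebra_simps)
 moreover have "... = Re ((E^2 + nu^2) * KB nu x)" unfolding key ..
 moreover have "... = ((exp x)^2 - v\<^sup>2) * kr v x"
 proof -
  have "E^2 + nu^2 = cx ((exp x)^2 - v\<^sup>2)" by (simp add: E_def nu_def power_mult_distrib)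
  then show ?thesis unfolding nu_def KB_kr by (simp only: of_real_mult[symmetric] Re_complex_of_real)
 qed
 ultimately show ?thesis unfolding kr1_def[abs_def] nu_def[symmetric] by simp
qed

lemma kr1_bound: "abs (kr1 v x) <= exp x * (E0 v * KR 1 (x - 1))"
proof -
 let ?A = "Re (KB (iu v + 1) x + KB (iu v - 1) x)"
 have "norm (KB (iu v + 1) x) <= E0 v * KR 1 (x - 1)"
  "norm (KB (iu v - 1) x) <= E0 v * KR 1 (x - 1)" using KB_decay[of "iu v + 1" x] KB_decay[of "iu v - 1" x] KR_minus[of 1] by simp_all
 then have "abs ?A <= 2 * (E0 v * KR 1 (x - 1))"
  using abs_Re_le_cmod[of "KB (iu v + 1) x"] abs_Re_le_cmod[of "KB (iu v - 1) x"] by simp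
 then have "exp x / 2 * abs ?A <= exp x / 2 * (2 * (E0 v * KR 1 (x - 1)))" by (rule mult_left_mono) simp
 then show ?thesis unfolding kr1_def abs_mult by simp
qed

lemma kr_integral_deriv:
 assumes [measurable]: "g \<in> borel_measurable borel" and gb: "!!v. abs (g v) <= C * (1 + abs v) ^ n"
 shows "L1 (%v. kr v x * g v)"
  and "((%x. (LBINT v. kr v x * g v)) has_real_derivative (LBINT v. kr1 v x * g v)) (at x)"
  and "((%x. (LBINT v. kr1 v x * g v)) has_real_derivative (LBINT v. ((exp x)^2 - v\<^sup>2) * kr v x * g v)) (at x)"
proof -
 let ?A = "%x v. (exp x)^2 - v\<^sup>2"
 have C: "C >= 0" using gb[of 0] by simp
 define G where "G B m v = B * ((1 + abs v) ^ m * E0 v)" for B m and v :: real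
 have G: "L1 (G B m)" for B m unfolding G_def by (intro integrable_mult_right integrable_poly_exp th0_pos)
 have b0: "abs (kr v x * g v) <= G (C * KR0 x) n v" for v x
 proof -
  have "abs (kr v x) * abs (g v) <= (E0 v * KR0 x) * (C * (1 + abs v) ^ n)" by (intro mult_mono kr_decay gb) (auto simp: KR_nonneg)
  then show ?thesis by (simp add: G_def abs_mult mult_ac)
 qed
 have b1: "abs (kr1 v x * g v) <= G (C * (exp x * KR 1 (x - 1))) n v" for v x
 proof -
  have "abs (kr1 v x) * abs (g v) <= (exp x * (E0 v * KR 1 (x - 1))) * (C * (1 + abs v) ^ n)" by (intro mult_mono kr1_bound gb) (auto simp: KR_nonneg)
  then show ?thesis by (simp add: G_def abs_mult mult_ac)
 qed
 have b2: "abs ((?A x v) * kr v x * g v) <= G (C * KR0 x * ((exp x)^2 + 1)) (n + 2) v" for v x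
 proof -
  have "abs (?A x v) <= (exp x)^2 + v^2" using zero_le_power2[of "exp x"] zero_le_power2[of v] by linarith
  also have "... <= ((exp x)^2 + 1) * (1 + abs v)^2"
  proof -
   have 1: "1 <= (1 + abs v)^2" by (rule one_le_power) simp
   have v: "(abs v)\<^sup>2 <= (1 + abs v)^2" by (rule power_mono) auto
   have "(exp x)^2 * 1 <= (exp x)^2 * (1 + abs v)^2" by (rule mult_left_mono[OF 1]) simp
   from add_mono[OF this v] show ?thesis by (simp only: distrib_right mult_1_left mult_1_right power2_abs)
  qed
  finally have "abs (?A x v) * abs (kr v x * g v) <= (((exp x)^2 + 1) * (1 + abs v)^2) * G (C * KR0 x) n v"
   by (intro mult_mono b0) auto
  moreover have "(1 + abs v) ^ (n + 2) = (1 + abs v)^2 * (1 + abs v) ^ n" by (simp only: power_add mult.commute)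
  ultimately show ?thesis by (simp only: G_def abs_mult mult_ac)
 qed
 have m1: "(%v. kr1 v x) \<in> borel_measurable borel" for x unfolding kr1_def by measurable
 note [measurable] = m1
 show i0: "L1 (%v. kr v x * g v)" for x
  by (rule lintegrable_bound[OF G[of "C * KR0 x" n]]) (use b0 in \<open>auto intro!: AE_I2 order_trans[OF _ abs_ge_self]\<close>)
 have i1: "L1 (%v. kr1 v x * g v)" for x
  by (rule lintegrable_bound[OF G[of "C * (exp x * KR 1 (x - 1))" n]]) (use b1 in \<open>auto intro!: AE_I2 order_trans[OF _ abs_ge_self]\<close>)
 have Gmono: "G B m v <= G B' m v" if "B <= B'" for B B' m v unfolding G_def using that by (intro mult_right_mono) auto
 show "((%x. (LBINT v. kr v x * g v)) has_real_derivative (LBINT v. kr1 v x * g v)) (at x)"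
 proof (rule has_real_derivative_integral[where r = 1 and f' = "%x v. kr1 v x * g v" and g = "G (C * (exp (x + 1) * KR 1 (x - 2))) n"])
  fix y v assume y: "abs (y - x) < 1"
  have "C * (exp y * KR 1 (y - 1)) <= C * (exp (x + 1) * KR 1 (x - 2))"
   using y C by (intro mult_left_mono mult_mono KR_antimono) (auto simp: KR_nonneg)
  then show "abs (kr1 v y * g v) <= G (C * (exp (x + 1) * KR 1 (x - 2))) n v" using b1[of v y] Gmono by (meson order_trans)
 qed (auto intro!: derivative_eq_intros kr_deriv G i0)
 show "((%x. (LBINT v. kr1 v x * g v)) has_real_derivative (LBINT v. (?A x v) * kr v x * g v)) (at x)"
 proof (rule has_real_derivative_integral[where r = 1 and f' = "%x v. (?A x v) * kr v x * g v" and g = "G (C * KR 0 (x - 2) * ((exp (x + 1))^2 + 1)) (n + 2)"])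
  fix y v assume y: "abs (y - x) < 1"
  have "C * KR0 y * ((exp y)^2 + 1) <= C * KR 0 (x - 2) * ((exp (x + 1))^2 + 1)"
   using y C by (intro mult_left_mono mult_mono KR_antimono add_right_mono power_mono) (auto simp: KR_nonneg)
  then show "abs (((exp y)^2 - v\<^sup>2) * kr v y * g v) <= G (C * KR 0 (x - 2) * ((exp (x + 1))^2 + 1)) (n + 2) v" using b2[of y v] Gmono by (meson order_trans)
 qed (auto intro!: derivative_eq_intros kr1_deriv G i1)
qed

section \<open>Minimum principle, resolvent and heat semigroup\<close>

lemma second_derivative_at_min:
 fixes f f1 :: "real => real"
 assumes f1: "!!x. (f has_real_derivative f1 x) (at x)" and f2: "(f1 has_real_derivative d) (at x0)"
  and min: "!!x. f x0 <= f x"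
 shows "d >= 0"
proof (rule ccontr)
 assume "\<not> d >= 0"
 then have "d < 0" by simp
 have 0: "f1 x0 = 0" by (rule DERIV_local_min[OF f1[of x0], of 1]) (auto intro: min)
 obtain e where e: "e > 0" "!!h. 0 < h ==> h < e ==> f1 (x0 + h) < f1 x0" using DERIV_neg_dec_right[OF f2 \<open>d < 0\<close>] by blast
 have "f (x0 + e / 2) < f x0"
 proof (rule DERIV_neg_imp_decreasing_open[of x0])
  fix x assume "x0 < x" "x < x0 + e / 2"
  then have "f1 x < 0" using e(2)[of "x - x0"] e(1) 0 by simp
  then show "\<exists>y. DERIV f x :> y & y < 0" using f1 by blast
 qed (use e f1 in \<open>auto intro!: DERIV_continuous_on[of _ f f1] simp: has_field_derivative_at_within\<close>)
 then show False using min[of "x0 + e / 2"] by simp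
qed

text \<open>Minimum principle for \<open>1 - ep (d^2/dx^2 - e\<^sup>2\<^sup>x)\<close>, with the barrier \<open>et cosh (s x)\<close>.\<close>

lemma minimum_principle:
 fixes h h1 h2 :: "real => real"
 assumes d1: "!!x. (h has_real_derivative h1 x) (at x)" and d2: "!!x. (h1 has_real_derivative h2 x) (at x)"
  and e: "ep > 0" and pos: "!!x. h x - ep * (h2 x - (exp x)\<^sup>2 * h x) >= 0"
  and growth: "!!sg. sg > 0 ==> \<exists>C. \<forall>x. abs (h x) <= C * exp (- sg * x)"
 shows "h x >= 0"
proof -
 \<comment> \<open>\<open>ep * s^2 <= 1\<close> makes cosh(s x) a supersolution, while its growth
   rate \<open>s\<close> still beats the rate \<open>s / 2\<close> at which \<open>h\<close> is
   allowed to grow.\<close>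
 define s where "s = 1 / sqrt (1 + ep)"
 have s: "s > 0" "ep * s^2 <= 1" using e by (auto simp: s_def power_divide field_simps)
 obtain C where C: "!!x. abs (h x) <= C * exp (- (s / 2) * x)" using growth[of "s / 2"] s by auto
 have C0: "C >= 0" using C[of 0] by simp
 have key: "h x + et * cosh (s * x) >= 0" if eta: "et > 0" for et x
 proof -
  define w where "w x = h x + et * cosh (s * x)" for x
  have w1: "(w has_real_derivative h1 x + et * (s * sinh (s * x))) (at x)" for x unfolding w_def[abs_def] by (auto intro!: derivative_eq_intros d1)
  have w2: "((%x. h1 x + et * (s * sinh (s * x))) has_real_derivative h2 x + et * (s^2 * cosh (s * x))) (at x)" for x
   by (auto intro!: derivative_eq_intros d2 simp: power2_eq_square)
  \<comment> \<open>Beyond \<open>R\<close> one has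
    \<open>et * exp ((s / 2) * abs x) >= 2 * C\<close>, so the barrier outweighs \<open>h\<close>
    there and a negative minimum could only lie inside.\<close>
  define R where "R = (2 / s) * (2 * C / et + 1)"
  have R0: "R > 0" unfolding R_def using C0 eta s by (intro mult_pos_pos divide_pos_pos add_nonneg_pos) auto
  have out: "w x >= 0" if "abs x >= R" for x
  proof -
   have "2 * C / et <= (s / 2) * R" using s by (simp add: R_def)
   also have "... <= (s / 2) * abs x" using that s by (intro mult_left_mono) auto
   also have "... <= exp ((s / 2) * abs x)" using exp_ge_add_one_self[of "(s / 2) * abs x"] by linarith
   finally have 1: "2 * C <= et * exp ((s / 2) * abs x)" using eta by (simp add: pos_divide_le_eq mult.commute)
   have "abs (h x) <= C * exp ((s / 2) * abs x)"
   proof (rule order_trans[OF C[of x]], intro mult_left_mono C0)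
    have "- (s / 2) * x <= (s / 2) * abs x" using mult_left_mono[of "- x" "abs x" "s / 2"] s by simp
    then show "exp (- (s / 2) * x) <= exp ((s / 2) * abs x)" by (simp only: exp_le_cancel_iff)
   qed
   also have "... <= (et * exp ((s / 2) * abs x) / 2) * exp ((s / 2) * abs x)" using 1 by (intro mult_right_mono) auto
   also have "... = et * (exp (s * abs x) / 2)" by (simp add: exp_add[symmetric])
   also have "... <= et * cosh (s * x)"
   proof (intro mult_left_mono)
    have "cosh (s * x) = cosh (s * abs x)" using s by (cases "x >= 0") auto
    moreover have "exp (s * abs x) / 2 <= cosh (s * abs x)" by (simp add: cosh_field_def)
    ultimately show "exp (s * abs x) / 2 <= cosh (s * x)" by (simp only:)
   qed (use eta in simp)
   finally show ?thesis by (simp add: w_def)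
  qed
  have "continuous_on {-R..R} w" by (rule DERIV_continuous_on[OF has_field_derivative_at_within[OF w1]])
  then obtain m where m: "m \<in> {-R..R}" "!!y. y \<in> {-R..R} ==> w m <= w y" using continuous_attains_inf[of "{-R..R}" w] R0 by fastforce
  have "w m >= 0"
  proof (rule ccontr)
   assume "\<not> w m >= 0"
   then have neg: "w m < 0" by simp
   have "w m <= w y" for y using m(2)[of y] out[of y] neg by (cases "abs y <= R") (auto simp: abs_le_iff)
   then have "h2 m + et * (s^2 * cosh (s * m)) >= 0" by (rule second_derivative_at_min[OF w1 w2])
   then have "ep * (h2 m + et * (s^2 * cosh (s * m))) >= 0" using e by simp
   moreover have "ep * (et * (s^2 * cosh (s * m))) <= et * cosh (s * m)"
    using mult_right_mono[OF s(2), of "et * cosh (s * m)"] eta by (simp add: mult_ac)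
   moreover have "ep * ((exp m)^2 * h m) < ep * ((exp m)^2 * 0)"
   proof -
    have "et * cosh (s * m) > 0" by (intro mult_pos_pos eta cosh_real_pos)
    then have "h m < 0" using neg by (simp add: w_def)
    then show ?thesis using e by (intro mult_strict_left_mono) auto
   qed
   ultimately show False using pos[of m] neg by (simp add: w_def distrib_left right_diff_distrib)
  qed
  then have "w x >= 0" using m(2)[of x] out[of x] by (cases "abs x <= R") (auto simp: abs_le_iff)
  then show ?thesis by (simp add: w_def)
 qed
 show ?thesis
 proof (rule field_le_epsilon)
  fix e :: real assume "e > 0"
  then show "0 <= h x + e" using key[of "e / cosh (s * x)" x] cosh_real_pos[of "s * x"] by simp
 qed
qed

lemma KR0_growth:
 assumes "sg > 0"
 shows "\<exists>C. \<forall>x. KR0 x <= C * exp (- sg * x)"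
proof -
 obtain C where C: "!!x. KR 0 x <= C * exp (- sg * x)" using KR_bound[of 0 sg] assms by auto
 have "KR0 x <= (C * exp sg) * exp (- sg * x)" for x using C[of "x - 1"] by (simp add: mult.assoc exp_add[symmetric] algebra_simps)
 then show ?thesis by blast
qed

text \<open>Dividing \<open>g\<close> by \<open>1 + ep * v^2\<close> applies the resolvent of
  d^2/dx^2 - e^(2x). The new integral thus solves the equation of \<open>minimum_principle\<close>
  with the given nonnegative function as right-hand side; its growth is that of
  \<open>KR0\<close>.\<close>

lemma resolvent_positive:
 assumes gm[measurable]: "g \<in> borel_measurable borel" and gb: "!!v. abs (g v) <= C * (1 + abs v) ^ n"
  and pos: "!!x. (LBINT v. kr v x * g v) >= 0" and e: "ep > 0"
 shows "(LBINT v. kr v x * (g v / (1 + ep * v^2))) >= 0"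
proof -
 let ?A = "%x q. LBINT v. kr v x * q v"
 let ?B = "%x q. LBINT v. ((exp x)^2 - v\<^sup>2) * kr v x * q v"
 let ?C = "%v. (1 + abs v) ^ n * E0 v"
 define q where "q v = g v / (1 + ep * v^2)" for v
 have qm[measurable]: "q \<in> borel_measurable borel" unfolding q_def by measurable
 have p: "1 + ep * v^2 >= 1" for v using e by simp
 have qb: "abs (q v) <= C * (1 + abs v) ^ n" for v
 proof -
  have "abs (q v) = abs (g v) / (1 + ep * v^2)" unfolding q_def abs_divide using p[of v] by simp
  also have "... <= abs (g v) / 1" using p[of v] by (intro divide_left_mono) auto
  finally show ?thesis using gb[of v] by simp
 qed
 note kd = kr_integral_deriv[OF qm qb]
 show ?thesis unfolding q_def[symmetric]
 proof (rule minimum_principle[OF kd(2,3) e])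
  fix x
  have I: "L1 (%v. kr v x * g v)" by (rule kr_integral_deriv(1)[OF gm gb])
  have qg: "kr v x * g v = kr v x * q v + ep * (v^2 * kr v x * q v)" for v
  proof -
   have "g v = q v * (1 + ep * v^2)" using p[of v] by (simp add: q_def)
   then show ?thesis by (simp add: algebra_simps)
  qed
  have I2: "L1 (%v. v^2 * kr v x * q v)"
  proof -
   have "v^2 * kr v x * q v = (kr v x * g v - kr v x * q v) * (1 / ep)" for v unfolding qg using e by simp
   then show ?thesis using I kd(1)[of x] by simp
  qed
  have "(?B x q) = (LBINT v. (exp x)^2 * (kr v x * q v) - v\<^sup>2 * kr v x * q v)"
   by (simp add: algebra_simps)
  also have "... = (exp x)^2 * (?A x q) - (LBINT v. v^2 * kr v x * q v)" using I2 kd(1)[of x] by simp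
  finally have s: "(?B x q) - (exp x)\<^sup>2 * (?A x q) = - (LBINT v. v^2 * kr v x * q v)"
   by simp
  have "(LBINT v. kr v x * g v) = (?A x q) + ep * (LBINT v. v^2 * kr v x * q v)" unfolding qg using I2 kd(1)[of x] by simp
  then show "(?A x q) - ep * ((?B x q) - (exp x)\<^sup>2 * (?A x q)) >= 0"
   unfolding s using pos[of x] by simp
 next
  fix sg :: real assume "sg > 0"
  then obtain K where K: "!!x. KR0 x <= K * exp (- sg * x)" using KR0_growth by blast
  define I where "I = (LBINT v. C * (?C v))"
  have iI: "L1 (%v. C * (?C v))" by (intro integrable_mult_right integrable_poly_exp th0_pos)
  have C: "C >= 0" using gb[of 0] by simp
  have I0: "I >= 0" unfolding I_def using C by (intro lintegral_nonneg) auto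
  have "abs (?A x q) <= (I * K) * exp (- sg * x)" for x
  proof -
   have "abs (?A x q) <= (LBINT v. abs (kr v x * q v))" by (rule integral_abs_bound)
   also have "... <= (LBINT v. KR0 x * (C * (?C v)))"
   proof (rule integral_mono)
    fix v
    have "abs (kr v x) * abs (q v) <= (E0 v * KR0 x) * (C * (1 + abs v) ^ n)" by (intro mult_mono kr_decay qb) (auto simp: KR_nonneg)
    then show "abs (kr v x * q v) <= KR0 x * (C * (?C v))" by (simp add: abs_mult mult_ac)
   qed (use kd(1)[of x] iI in auto)
   also have "... = KR0 x * I" by (simp add: I_def)
   also have "... <= (K * exp (- sg * x)) * I" by (intro mult_right_mono K I0)
   finally show ?thesis by (simp add: mult_ac)
  qed
  then show "\<exists>C. \<forall>x. abs (?A x q) <= C * exp (- sg * x)" by blast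
 qed
qed

text \<open>\<open>exp (- t * v^2)\<close> is the limit of \<open>(1 + t v^2 / m)\<close> to the
  power -m, that is, of iterated resolvents; polynomial growth of \<open>g\<close> against the decay
  of \<open>kr\<close> dominates the limit.\<close>

lemma heat_positive:
 assumes gm[measurable]: "g \<in> borel_measurable borel" and gb: "!!v. abs (g v) <= C * (1 + abs v) ^ n"
  and pos: "!!x. (LBINT v. kr v x * g v) >= 0" and t: "t > 0"
 shows "(LBINT v. kr v x * (g v * exp (- t * v^2))) >= 0"
proof -
 let ?A = "%v m. g v / (1 + (t / real (Suc m)) * v^2) ^ Suc m"
 let ?B = "%v. C * ((1 + abs v) ^ n * E0 v)"
 have p: "(1 + e * v^2) ^ m >= 1" if "e >= 0" for e v :: real and m using that by (intro one_le_power) simp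
 have qb: "abs (g v / (1 + e * v^2) ^ m) <= C * (1 + abs v) ^ n" if "e >= 0" for e v m
 proof -
  have "abs (g v / (1 + e * v^2) ^ m) = abs (g v) / (1 + e * v^2) ^ m" unfolding abs_divide using p[OF that, of v m] by simp
  also have "... <= abs (g v) / 1" using p[OF that, of v m] by (intro divide_left_mono) auto
  finally show ?thesis using gb[of v] by simp
 qed
 have it: "(LBINT v. kr v x * (g v / (1 + e * v^2) ^ m)) >= 0" if e: "e > 0" for e m x
 proof (induction m arbitrary: x)
  case 0
  then show ?case using pos by simp
 next
  case (Suc m)
  have "(LBINT v. kr v x * ((g v / (1 + e * v^2) ^ m) / (1 + e * v^2))) >= 0" by (rule resolvent_positive[OF _ qb Suc e]) (use e in auto)
  then show ?case by (simp add: mult.commute)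
 qed
 have "(%m. (LBINT v. kr v x * (?A v m))) \<longlonglongrightarrow> (LBINT v. kr v x * (g v * exp (- t * v^2)))"
 proof (rule integral_dominated_convergence[where w = "%v. KR0 x * (?B v)"])
  show "L1 (%v. KR0 x * (?B v))" by (intro integrable_mult_right integrable_poly_exp th0_pos)
  show "AE v in lborel. (%m. kr v x * (?A v m)) \<longlonglongrightarrow> kr v x * (g v * exp (- t * v^2))"
  proof (rule AE_I2)
   fix v
   have "(%m. (1 + (t * v^2) / real (Suc m)) ^ Suc m) \<longlonglongrightarrow> exp (t * v^2)" by (rule LIMSEQ_Suc[OF tendsto_exp_limit_sequentially])
   then have "(%m. kr v x * (g v / (1 + (t * v^2) / real (Suc m)) ^ Suc m)) \<longlonglongrightarrow> kr v x * (g v / exp (t * v^2))"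
    by (intro tendsto_intros) auto
   then show "(%m. kr v x * (?A v m)) \<longlonglongrightarrow> kr v x * (g v * exp (- t * v^2))"
    by (simp add: exp_minus divide_inverse mult_ac del: of_nat_Suc power_Suc)
  qed
  show "AE v in lborel. norm (kr v x * (?A v m)) <= KR0 x * (?B v)" for m
  proof (rule AE_I2)
   fix v
   have "abs (kr v x) * abs (?A v m) <= (E0 v * KR0 x) * (C * (1 + abs v) ^ n)"
    using t by (intro mult_mono kr_decay qb) (auto simp: KR_nonneg)
   then show "norm (kr v x * (?A v m)) <= KR0 x * (?B v)"
    unfolding real_norm_def abs_mult by (simp add: mult_ac del: power_Suc)
  qed
 qed measurable
 then show ?thesis by (rule LIMSEQ_le_const, intro exI[of _ 0] allI impI it) (use t in simp)
qed

section \<open>Spectral form, continuity and exchange of integrals for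
  \<open>p_kernel\<close>\<close>

lemma gauss_exp_bound:
 fixes v :: real
 assumes t: "t > 0"
 shows "exp (- t * v^2) * exp (K * abs v) <= exp ((K + 1)^2 / (4 * t)) * exp (- 1 * abs v)"
proof -
 have "0 <= (2 * t * abs v - (K + 1))^2 / (4 * t)" using t by simp
 also have "... = t * v^2 - (K + 1) * abs v + (K + 1)^2 / (4 * t)" using t by (simp add: power2_eq_square field_simps)
 finally have "- t * v^2 + K * abs v <= (K + 1)^2 / (4 * t) + - 1 * abs v" by (simp add: distrib_right)
 then show ?thesis unfolding exp_add[symmetric] exp_le_cancel_iff .
qed

lemma gauss_ww_bound:
 assumes t: "t > 0"
 shows "exp (- t * v^2) * ww v <= exp ((pi + 1)^2 / (4 * t)) * ((1 + abs v) ^ 1 * exp (- 1 * abs v))"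
proof -
 have "exp (- t * v^2) * ww v <= exp (- t * v^2) * ((1 + abs v) * exp (pi * abs v))" by (intro mult_left_mono ww_bound) auto
 also have "... = (1 + abs v) * (exp (- t * v^2) * exp (pi * abs v))" by simp
 also have "... <= (1 + abs v) * (exp ((pi + 1)^2 / (4 * t)) * exp (- 1 * abs v))" by (intro mult_left_mono gauss_exp_bound t) auto
 finally show ?thesis by (simp add: mult_ac)
qed

lemma gauss_ww_integrable: "t > 0 ==> L1 (%v. exp (- t * v^2) * ww v)"
 by (rule lintegrable_bound[where f = "%v. exp ((pi + 1)^2 / (4 * t)) * ((1 + abs v) ^ 1 * exp (- 1 * abs v))"],
  intro integrable_mult_right integrable_poly_exp, simp, measurable, intro AE_I2 real_norm_mono gauss_ww_bound)
  (simp add: ww_nonneg)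

lemma kr_bound: "abs (kr v x) <= KR0 x"
proof -
 have "E0 v * KR0 x <= 1 * KR0 x" using th0_pos by (intro mult_right_mono) (auto simp: KR_nonneg)
 then show ?thesis using kr_decay[of v x] by simp
qed

lemma kr_continuous: "continuous_on UNIV (kr v)" by (rule DERIV_continuous_on[OF has_field_derivative_at_within[OF kr_deriv]])

lemma cmod_Gamma_ww:
 assumes "u > 0"
 shows "1 / (cmod (Gamma (iu u)))^2 = pi * ww u"
proof -
 have "iu u \<notin> \<int>\<^sub>\<le>\<^sub>0" using assms by (auto simp: nonpos_Ints_def complex_eq_iff)
 then have nz: "Gamma (iu u) ~= 0" "iu u \<notin> \<int>\<^sub>\<le>\<^sub>0" by (auto simp: Gamma_eq_zero_iff)
 have "Gamma (1 + iu u) = iu u * Gamma (iu u)" using Gamma_plus1[OF nz(2)] by (simp add: add.commute)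
 moreover have "1 - iu u = cnj (1 + iu u)" by simp
 ultimately have "cx ((norm (iu u * Gamma (iu u)))^2 * sinh (pi * u)) = cx (pi * u)"
  using Gamma_1_imag[of u] Gamma_cnj_mult[of "1 + iu u"] by (simp only: of_real_mult)
 then have "(norm (iu u * Gamma (iu u)))^2 * sinh (pi * u) = pi * u" by (simp only: of_real_eq_iff)
 then have "u * (cmod (Gamma (iu u)))^2 * sinh (pi * u) = pi" using assms by (simp add: norm_mult power_mult_distrib power2_eq_square mult_ac)
 moreover have "1 / G = pi * (u * s / pi^2)" if "u * G * s = pi" "G > 0" for G s
 proof -
  have "u * s = pi / G" using that by (simp add: field_simps)
  then show ?thesis by (simp add: power2_eq_square)
 qed
 ultimately show ?thesis using nz(1) by (simp add: ww_def)
qed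

lemma mu_eq: "mu = density lborel (%u. ennreal (2 * (indicator {0<..} u * ww u)))" unfolding mu_def
proof (rule arg_cong[where f = "density lborel"], rule ext)
 fix u :: real
 show "indicator {0<..} u * ennreal (2 / pi * (1 / (cmod (Gamma (iu u)))^2)) = ennreal (2 * (indicator {0<..} u * ww u))"
 proof (cases "u > 0")
  case True
  show ?thesis unfolding cmod_Gamma_ww[OF True] using True by simp
 qed simp
qed

lemma pk_integrable:
 assumes t: "t > 0"
 shows "L1 (%v. exp (- t * v^2) * ww v * (kr v x * kr v y))"
proof (rule lintegrable_bound)
 let ?A = "%v. exp (- t * v^2) * ww v"
 show "L1 (%v. (?A v) * (KR0 x * KR0 y))" by (intro integrable_mult_left gauss_ww_integrable t)
 show "AE v in lborel. norm (exp (- t * v^2) * ww v * (kr v x * kr v y)) <= norm ((?A v) * (KR0 x * KR0 y))"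
 proof (rule AE_I2)
  fix v
  have "(?A v) * (abs (kr v x) * abs (kr v y)) <= (?A v) * (KR0 x * KR0 y)"
   by (intro mult_left_mono mult_mono kr_bound) (auto simp: ww_nonneg KR_nonneg)
  then show "norm (exp (- t * v^2) * ww v * (kr v x * kr v y)) <= norm ((?A v) * (KR0 x * KR0 y))"
   unfolding real_norm_def abs_mult abs_exp_cancel abs_of_nonneg[OF ww_nonneg] abs_of_nonneg[OF KR_nonneg] .
 qed
qed measurable

lemma p_kernel_eq:
 assumes t: "t > 0"
 shows "p_kernel t x y = (LBINT v. exp (- t * v^2) * ww v * (kr v x * kr v y))"
proof -
 have "p_kernel t x y = (LBINT u. 2 * (indicator {0<..} u * ww u) * (exp (- t * u^2) * kr u x * kr u y))"
  unfolding p_kernel_def mu_eq kr_bessel[symmetric] by (subst integral_real_density) (auto intro!: AE_I2 simp: ww_nonneg)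
 also have "... = 2 * (LBINT u. indicator {0<..} u *\<^sub>R (exp (- t * u^2) * ww u * (kr u x * kr u y)))"
  unfolding integral_mult_right_zero[symmetric] by (intro lintegral_cong refl) (simp add: mult_ac)
 also have "... = (LBINT v. exp (- t * v^2) * ww v * (kr v x * kr v y))"
  by (subst integral_even_half[OF pk_integrable[OF t]]) (auto simp: kr_minus ww_def)
 finally show ?thesis .
qed

lemma borel_measurable_p_kernel [measurable (raw)]:
 assumes t: "t > 0" and [measurable]: "f \<in> borel_measurable M" "g \<in> borel_measurable M"
 shows "(%m. p_kernel t (f m) (g m)) \<in> borel_measurable M" unfolding p_kernel_eq[OF t] by measurable

lemma p_kernel_continuous:
 assumes t: "t > 0"
 shows "continuous_on UNIV (p_kernel t x)" unfolding continuous_on_sequentially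
proof (intro allI ballI impI, elim conjE)
 fix y :: real and X assume X: "X \<longlonglongrightarrow> y"
 have "eventually (%i. abs (X i - y) < 1) sequentially" using X by (auto simp: tendsto_iff dist_real_def)
 then obtain N where N: "!!i. i >= N ==> abs (X i - y) < 1" by (auto simp: eventually_sequentially)
 define Z where "Z i = X (i + N)" for i
 have Z: "abs (Z i - y) < 1" for i using N by (auto simp: Z_def)
 have Zl: "Z \<longlonglongrightarrow> y" unfolding Z_def using X by (rule LIMSEQ_ignore_initial_segment)
 have "(%i. (LBINT v. exp (- t * v^2) * ww v * (kr v x * kr v (Z i)))) \<longlonglongrightarrow> (LBINT v. exp (- t * v^2) * ww v * (kr v x * kr v y))"
 proof (rule integral_dominated_convergence[where w = "%v. (exp (- t * v^2) * ww v) * (KR0 x * KR 0 (y - 2))"])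
  show "L1 (%v. (exp (- t * v^2) * ww v) * (KR0 x * KR 0 (y - 2)))" by (intro integrable_mult_left gauss_ww_integrable t)
  show "AE v in lborel. (%i. exp (- t * v^2) * ww v * (kr v x * kr v (Z i))) \<longlonglongrightarrow> exp (- t * v^2) * ww v * (kr v x * kr v y)"
   by (intro AE_I2 tendsto_intros continuous_on_tendsto_compose[OF kr_continuous Zl]) auto
  show "AE v in lborel. norm (exp (- t * v^2) * ww v * (kr v x * kr v (Z i))) <= (exp (- t * v^2) * ww v) * (KR0 x * KR 0 (y - 2))" for i
  proof (rule AE_I2)
   fix v
   have "KR 0 (Z i - 1) <= KR 0 (y - 2)" using Z[of i] by (intro KR_antimono) linarith
   then have "abs (kr v (Z i)) <= KR 0 (y - 2)" using kr_bound[of v "Z i"] by linarith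
   then show "norm (exp (- t * v^2) * ww v * (kr v x * kr v (Z i))) <= (exp (- t * v^2) * ww v) * (KR0 x * KR 0 (y - 2))"
    unfolding real_norm_def abs_mult abs_exp_cancel abs_of_nonneg[OF ww_nonneg]
    by (intro mult_left_mono mult_mono kr_bound) (auto simp: ww_nonneg KR_nonneg)
  qed
 qed measurable
 then have "(%i. p_kernel t x (X (i + N))) \<longlonglongrightarrow> p_kernel t x y" by (simp add: p_kernel_eq[OF t] Z_def)
 then show "(p_kernel t x \<circ> X) \<longlonglongrightarrow> p_kernel t x y" unfolding comp_def by (rule LIMSEQ_offset)
qed

lemma kernel_fubini:
 assumes Hi: "L1 (%v. H v * ww v)" and Fi: "L1 (%x. F x * KR0 x)"
  and [measurable]: "H \<in> borel_measurable borel" "F \<in> borel_measurable borel"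
 shows "L1 (%x. F x * (LBINT v. H v * ww v * kr v x))"
  and "(LBINT x. F x * (LBINT v. H v * ww v * kr v x)) = (LBINT v. H v * ww v * (LBINT x. F x * kr v x))"
proof -
 let ?A = "%v x. H v * ww v * kr v x"
 let ?B = "LBINT x. F x * (LBINT v. H v * ww v * kr v x)"
 let ?C = "LBINT v. H v * ww v * (LBINT x. F x * kr v x)"
 have i: "integrable lborel2 (%(x, v). F x * (?A v x))"
 proof (rule lintegrable_bound)
  show "integrable lborel2 (%(x, v). (F x * KR0 x) * (H v * ww v))" by (rule integrable_prod_pair[OF Fi Hi])
  show "AE p in lborel2. norm (case p of (x, v) => F x * (?A v x)) <= norm (case p of (x, v) => (F x * KR0 x) * (H v * ww v))"
  proof (rule AE_I2)
   fix p :: "real \<times> real"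
   obtain x v where p: "p = (x, v)" by (cases p)
   have "(abs (F x) * abs (H v * ww v)) * abs (kr v x) <= (abs (F x) * abs (H v * ww v)) * KR0 x" by (intro mult_left_mono kr_bound) auto
   then show "norm (case p of (x, v) => F x * (?A v x)) <= norm (case p of (x, v) => (F x * KR0 x) * (H v * ww v))"
    unfolding p by (simp add: abs_mult KR_nonneg mult_ac)
  qed
 qed measurable
 show "L1 (%x. F x * (LBINT v. H v * ww v * kr v x))" using lborel_pair.integrable_fst[OF i] by simp
 have "?B = (LBINT x. (LBINT v. F x * (?A v x)))" by simp
 also have "... = (LBINT v. (LBINT x. F x * (?A v x)))" by (rule lborel_pair.Fubini_integral[symmetric]) (use i in simp)
 also have "... = ?C"
 proof (rule lintegral_cong[OF refl])
  fix v
  have "F x * (?A v x) = H v * ww v * (F x * kr v x)" for x by simp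
  then show "(LBINT x. F x * (?A v x)) = H v * ww v * (LBINT x. F x * kr v x)" by (simp only: integral_mult_right_zero)
 qed
 finally show "?B = ?C" .
qed

lemma p_kernel_fubini:
 assumes t: "t > 0" and Fi: "L1 (%x. F x * KR0 x)" and [measurable]: "F \<in> borel_measurable borel"
 shows "L1 (%x. F x * p_kernel t x y)"
  and "(LBINT x. F x * p_kernel t x y) = (LBINT v. exp (- t * v^2) * kr v y * ww v * (LBINT x. F x * kr v x))"
proof -
 let ?A = "%v. exp (- t * v^2) * kr v y"
 have eq: "p_kernel t x y = (LBINT v. (?A v) * ww v * kr v x)" for x
  unfolding p_kernel_eq[OF t] by (intro lintegral_cong refl) simp
 have "L1 (%v. (?A v) * ww v)"
 proof (rule lintegrable_bound)
  show "L1 (%v. (exp (- t * v^2) * ww v) * KR0 y)" by (intro integrable_mult_left gauss_ww_integrable t)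
  show "AE v in lborel. norm ((?A v) * ww v) <= norm ((exp (- t * v^2) * ww v) * KR0 y)"
  proof (rule AE_I2)
   fix v
   have "exp (- t * v^2) * ww v * abs (kr v y) <= exp (- t * v^2) * ww v * KR0 y" by (intro mult_left_mono kr_bound) (simp add: ww_nonneg)
   then show "norm ((?A v) * ww v) <= norm ((exp (- t * v^2) * ww v) * KR0 y)" by (simp add: abs_mult ww_nonneg KR_nonneg mult_ac)
  qed
 qed measurable
 note kf = kernel_fubini[OF this Fi]
 show "L1 (%x. F x * p_kernel t x y)" unfolding eq by (rule kf(1)) measurable
 show "(LBINT x. F x * p_kernel t x y) = (LBINT v. exp (- t * v^2) * kr v y * ww v * (LBINT x. F x * kr v x))" unfolding eq by (rule kf(2)) measurable
qed

section \<open>Testing the sign of the kernel\<close>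

lemma p_kernel_commute: "p_kernel t x y = p_kernel t y x" unfolding p_kernel_def by (simp add: mult_ac)

text \<open>The integral is the heat semigroup applied to \<open>exp (y - s * exp y)\<close>, a
  function whose index transform is known explicitly.\<close>

lemma p_kernel_test:
 assumes t: "t > 0" and s: "s > 1"
 shows "L1 (%y. exp (y - s * exp y) * p_kernel t x y)"
  and "(LBINT y. exp (y - s * exp y) * p_kernel t x y) = (LBINT v. kr v x * (SS s v / pi * exp (- t * v^2)))"
proof -
 let ?A = "%v. LBINT y. exp (y - s * exp y) * kr v y"
 let ?B = "LBINT v. kr v x * (SS s v / pi * exp (- t * v^2))"
 let ?C = "LBINT y. exp (y - s * exp y) * p_kernel t x y"
 have i: "L1 (%y. exp (y - s * exp y) * KR0 y)"
 proof (rule lintegrable_bound[OF KR0_shift_integrable[of 1]])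
  show "AE y in lborel. norm (exp (y - s * exp y) * KR0 y) <= norm (exp (1 * y) * KR0 y)"
   using s by (intro AE_I2) (auto simp: KR_nonneg intro!: mult_right_mono)
 qed (use s in auto)
 show "L1 (%y. exp (y - s * exp y) * p_kernel t x y)" unfolding p_kernel_commute[of t x] by (rule p_kernel_fubini(1)[OF t i]) measurable
 have k: "(?A v) * ww v = SS s v / pi" for v
 proof -
  have "cx ((?A v) * ww v) = cx (SS s v / pi)"
   using KB_exponential_transform(2)[OF s, of v] unfolding KB_kr of_real_mult[symmetric] integral_complex_of_real .
  then show ?thesis by (simp only: of_real_eq_iff)
 qed
 have "?C = (LBINT v. exp (- t * v^2) * kr v x * ww v * (?A v))"
  unfolding p_kernel_commute[of t x] by (rule p_kernel_fubini(2)[OF t i]) measurable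
 also have "... = ?B" unfolding k[symmetric] by (simp only: mult_ac)
 finally show "?C = ?B" .
qed

text \<open>With z = exp(-exp y), the function \<open>exp (y - 2 * exp y) * z ^ j\<close> is again
  of the explicit kind, with \<open>s = 2 + j\<close>. A polynomial that is nonnegative on [0, 1]
  thus gives a nonnegative initial datum, to which \<open>heat_positive\<close> applies.\<close>

lemma p_kernel_poly_test:
 assumes t: "t > 0" and q: "!!z. 0 <= z ==> z <= 1 ==> poly q z >= 0"
 shows "(LBINT y. exp (y - 2 * exp y) * poly q (exp (- exp y)) * p_kernel t x y) >= 0"
proof -
 let ?A = "%v x. \<Sum>j\<le>degree q. coeff q j * (kr v x * (SS (2 + real j) v / pi * exp (- t * v^2)))"
 have pe: "exp (y - 2 * exp y) * poly q (exp (- exp y)) = (\<Sum>j\<le>degree q. coeff q j * exp (y - (2 + real j) * exp y))" for y :: real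
  unfolding poly_altdef sum_distrib_left by (intro sum.cong refl) (simp add: exp_of_nat_mult[symmetric] exp_add[symmetric] algebra_simps)
 define g where "g v = (\<Sum>j\<le>degree q. coeff q j * (SS (2 + real j) v / pi))" for v
 define C where "C = (\<Sum>j\<le>degree q. abs (coeff q j) * (2 / pi))"
 have gb: "abs (g v) <= C * (1 + abs v)^2" for v unfolding g_def C_def sum_distrib_right
 proof (rule order_trans[OF sum_abs], rule sum_mono)
  fix j
  have "abs (SS (2 + real j) v) <= 2 * (1 + abs v)^2 / (2 + real j)" by (rule SS_bound) simp
  also have "... <= 2 * (1 + abs v)^2 / 1" by (intro divide_left_mono) auto
  finally have "abs (coeff q j) * (abs (SS (2 + real j) v) / pi) <= abs (coeff q j) * ((2 * (1 + abs v)^2) / pi)"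
   by (intro mult_left_mono divide_right_mono) auto
  then show "abs (coeff q j * (SS (2 + real j) v / pi)) <= abs (coeff q j) * (2 / pi) * (1 + abs v)^2" by (simp add: abs_mult)
 qed
 have gm[measurable]: "g \<in> borel_measurable borel" unfolding g_def by measurable
 have krSS: "L1 (%v. kr v x * SS s v)" "(LBINT v. kr v x * SS s v) = pi * exp (x - s * exp x)" if "s > 1" for s x
 proof -
  show "L1 (%v. kr v x * SS s v)" using KB_SS_inversion(1)[OF that, of x] unfolding KB_kr of_real_mult[symmetric] complex_of_real_integrable_eq .
  show "(LBINT v. kr v x * SS s v) = pi * exp (x - s * exp x)"
   using KB_SS_inversion(2)[OF that, of x] unfolding KB_kr of_real_mult[symmetric] integral_complex_of_real of_real_eq_iff .
 qed
 have pos: "(LBINT v. kr v x * g v) >= 0" for x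
 proof -
  have "kr v x * g v = (\<Sum>j\<le>degree q. (coeff q j / pi) * (kr v x * SS (2 + real j) v))" for v
   unfolding g_def sum_distrib_left by (intro sum.cong refl) simp
  then have "(LBINT v. kr v x * g v) = (\<Sum>j\<le>degree q. (coeff q j / pi) * (pi * exp (x - (2 + real j) * exp x)))"
   by (simp add: lintegral_sum krSS)
  also have "... = exp (x - 2 * exp x) * poly q (exp (- exp x))" unfolding pe by simp
  also have "... >= 0" by (intro mult_nonneg_nonneg q) auto
  finally show ?thesis .
 qed
 have iks: "L1 (%v. kr v x * (SS s v / pi * exp (- t * v^2)))" if "s > 1" for s
 proof (rule lintegrable_bound)
  show "L1 (%v. (kr v x * SS s v) * (1 / pi))" using krSS(1)[OF that] by simp
  show "AE v in lborel. norm (kr v x * (SS s v / pi * exp (- t * v^2))) <= norm ((kr v x * SS s v) * (1 / pi))"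
  proof (rule AE_I2)
   fix v
   have "abs (kr v x * SS s v / pi) * exp (- t * v^2) <= abs (kr v x * SS s v / pi) * 1" using t by (intro mult_left_mono) auto
   then show "norm (kr v x * (SS s v / pi * exp (- t * v^2))) <= norm ((kr v x * SS s v) * (1 / pi))" by (simp add: abs_mult mult_ac)
  qed
 qed (use krSS(1)[OF that] in measurable)
 have "(LBINT y. exp (y - 2 * exp y) * poly q (exp (- exp y)) * p_kernel t x y) =
  (LBINT y. (\<Sum>j\<le>degree q. coeff q j * (exp (y - (2 + real j) * exp y) * p_kernel t x y)))"
  unfolding pe sum_distrib_right by (simp only: mult.assoc)
 also have "... = (\<Sum>j\<le>degree q. coeff q j * (LBINT v. kr v x * (SS (2 + real j) v / pi * exp (- t * v^2))))"
  using p_kernel_test[OF t, of "2 + real j" x for j] by (simp add: lintegral_sum)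
 also have "... = (LBINT v. (?A v x))"
  by (subst lintegral_sum, intro integrable_mult_right iks, simp, simp only: integral_mult_right_zero)
 also have "... = (LBINT v. kr v x * (g v * exp (- t * v^2)))"
 proof (rule lintegral_cong[OF refl])
  fix v
  show "(?A v x) = kr v x * (g v * exp (- t * v^2))"
   unfolding g_def sum_distrib_right sum_distrib_left by (intro sum.cong refl) (simp only: mult_ac)
 qed
 also have "... >= 0" by (rule heat_positive[OF gm gb pos t])
 finally show ?thesis .
qed

text \<open>Bernstein polynomials of a nonnegative function are nonnegative on [0, 1] and converge
  uniformly there; the weight \<open>exp (y - 2 * exp y) * p_kernel t x y\<close> is
  integrable.\<close>

lemma p_kernel_cont_test:
 assumes t: "t > 0" and psi: "continuous_on {0..1} ps" "!!z. 0 <= z ==> z <= 1 ==> ps z >= (0 :: real)"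
  and [measurable]: "ps \<in> borel_measurable borel" and b: "!!z. abs (ps z) <= B"
 shows "L1 (%y. exp (y - 2 * exp y) * ps (exp (- exp y)) * p_kernel t x y)"
  and "(LBINT y. exp (y - 2 * exp y) * ps (exp (- exp y)) * p_kernel t x y) >= 0"
proof -
 let ?A = "%y. exp (y - 2 * exp y) * p_kernel t x y"
 let ?B = "LBINT y. exp (y - 2 * exp y) * ps (exp (- exp y)) * p_kernel t x y"
 let ?C = "%q y. poly q (exp (- exp y)) - ps (exp (- exp y))"
 have ip: "L1 (%y. exp (y - 2 * exp y) * p_kernel t x y)" by (rule p_kernel_test[OF t]) simp
 have tm[measurable]: "(%y. p_kernel t x y) \<in> borel_measurable borel" using t by measurable
 have i: "L1 (%y. exp (y - 2 * exp y) * f (exp (- exp y)) * p_kernel t x y)"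
  if [measurable]: "f \<in> borel_measurable borel" and fb: "!!z. 0 <= z ==> z <= 1 ==> abs (f z) <= K" for f :: "real => real" and K
 proof (rule lintegrable_bound)
  show "L1 (%y. (?A y) * K)" using ip by simp
  show "AE y in lborel. norm (exp (y - 2 * exp y) * f (exp (- exp y)) * p_kernel t x y) <= norm ((?A y) * K)"
  proof (rule AE_I2)
   fix y :: real
   have "abs (?A y) * abs (f (exp (- exp y))) <= abs (?A y) * abs K"
    by (intro mult_left_mono order_trans[OF fb abs_ge_self]) auto
   then show "norm (exp (y - 2 * exp y) * f (exp (- exp y)) * p_kernel t x y) <= norm ((?A y) * K)"
    by (simp only: real_norm_def abs_mult mult_ac)
  qed
 qed measurable
 show I: "L1 (%y. exp (y - 2 * exp y) * ps (exp (- exp y)) * p_kernel t x y)" by (rule i) (use b in auto)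
 define L where "L = (LBINT y. abs (?A y))"
 have L: "L >= 0" unfolding L_def by (intro lintegral_nonneg) auto
 show "?B >= 0"
 proof (rule field_le_epsilon)
  fix e :: real assume e: "e > 0"
  define et where "et = e / (L + 1)"
  have eta: "et > 0" "et * L <= e" using e L by (auto simp: et_def field_simps)
  obtain N where N: "!!n z. N <= n ==> z \<in> {0..1} ==> abs (ps z - (\<Sum>k\<le>n. ps (real k / real n) * Bernstein n k z)) < et"
   using Bernstein_Weierstrass[OF psi(1) eta(1)] by blast
  define q where "q = (\<Sum>k\<le>Suc N. smult (ps (real k / real (Suc N)) * real (Suc N choose k)) ([:0, 1:] ^ k * [:1, - 1:] ^ (Suc N - k)))"
  have q: "poly q z = (\<Sum>k\<le>Suc N. ps (real k / real (Suc N)) * Bernstein (Suc N) k z)" for z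
   unfolding q_def poly_sum by (intro sum.cong refl) (simp add: Bernstein_def poly_power mult.assoc)
  have "poly q z >= 0" if "0 <= z" "z <= 1" for z
   unfolding q using that by (intro sum_nonneg mult_nonneg_nonneg psi(2) Bernstein_nonneg) (auto simp del: of_nat_Suc)
  note 1 = p_kernel_poly_test[OF t this, of x]
  have d: "abs (ps z - poly q z) <= et" if "0 <= z" "z <= 1" for z using N[of "Suc N" z] that unfolding q by simp
  have iq: "L1 (%y. exp (y - 2 * exp y) * poly q (exp (- exp y)) * p_kernel t x y)"
  proof (rule i)
   show "(%z. poly q z) \<in> borel_measurable borel" by (intro borel_measurable_continuous_onI continuous_intros)
   show "abs (poly q z) <= B + et" if "0 <= z" "z <= 1" for z using d[OF that] b[of z] by linarith
  qed
  have "(LBINT y. exp (y - 2 * exp y) * poly q (exp (- exp y)) * p_kernel t x y) - ?B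
   = (LBINT y. exp (y - 2 * exp y) * poly q (exp (- exp y)) * p_kernel t x y - exp (y - 2 * exp y) * ps (exp (- exp y)) * p_kernel t x y)"
   using iq I by simp
  also have "... <= (LBINT y. et * abs (?A y))"
  proof (rule integral_mono)
   fix y :: real
   have "abs (?C q y) <= et" using d[of "exp (- exp y)"] by (simp add: abs_minus_commute)
   then have "abs (?C q y) * abs (?A y) <= et * abs (?A y)"
    by (rule mult_right_mono) simp
   then have "(?C q y) * (?A y) <= et * abs (?A y)"
    unfolding abs_mult[symmetric] by linarith
   then show "exp (y - 2 * exp y) * poly q (exp (- exp y)) * p_kernel t x y - exp (y - 2 * exp y) * ps (exp (- exp y)) * p_kernel t x y <= et * abs (?A y)"
    by (simp only: left_diff_distrib right_diff_distrib mult_ac)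
  qed (use iq I ip in auto)
  also have "... = et * L" by (simp add: L_def)
  finally show "0 <= ?B + e" using 1 eta by linarith
 qed
qed

text \<open>A negative value would persist in a neighbourhood. A bump \<open>ps\<close> supported
  there, in the variable z = exp(-exp y), gives a nonpositive integrand with nonnegative integral,
  which by continuity vanishes everywhere, contradicting its value at \<open>y\<close>.\<close>

lemma p_kernel_nonneg:
 assumes t: "t > 0"
 shows "p_kernel t x y >= 0"
proof (rule ccontr)
 assume "\<not> p_kernel t x y >= 0"
 then have neg: "p_kernel t x y < 0" by simp
 have cont: "continuous_on UNIV (p_kernel t x)" by (rule p_kernel_continuous[OF t])
 define z0 where "z0 = exp (- exp y)"
 have z0: "0 < z0" "z0 < 1" by (auto simp: z0_def)
 have ly: "ln (- ln z0) = y" by (simp add: z0_def)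
 define h where "h z = p_kernel t x (ln (- ln z))" for z
 have "isCont h z0" unfolding h_def
 proof (rule isCont_o2[of _ _ "p_kernel t x"])
  show "isCont (%z. ln (- ln z)) z0" using z0 by (intro continuous_intros) auto
  show "isCont (p_kernel t x) (ln (- ln z0))" using cont by (simp add: continuous_on_eq_continuous_at)
 qed
 then have "(h \<longlongrightarrow> h z0) (nhds z0)" unfolding isCont_def tendsto_at_iff_tendsto_nhds .
 then have "eventually (%z. h z < 0) (nhds z0)" by (rule order_tendstoD(2)) (simp add: h_def ly neg)
 then obtain r where r: "r > 0" "!!z. abs (z - z0) < r ==> p_kernel t x (ln (- ln z)) < 0" by (auto simp: eventually_nhds_metric dist_real_def h_def)
 define ps where "ps z = max 0 (r - abs (z - z0))" for z :: real
 have pc: "continuous_on A ps" for A unfolding ps_def[abs_def] by (intro continuous_intros)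
 have pm[measurable]: "ps \<in> borel_measurable borel" by (intro borel_measurable_continuous_onI pc)
 define f where "f y = exp (y - 2 * exp y) * ps (exp (- exp y)) * p_kernel t x y" for y
 have "L1 f" "(LBINT y. f y) >= 0" unfolding f_def using r by (intro p_kernel_cont_test[OF t pc _ pm, where B = r]; auto simp: ps_def)+
 moreover have f0: "f y <= 0" for y
 proof (cases "abs (exp (- exp y) - z0) < r")
  case True
  then show ?thesis using r(2)[of "exp (- exp y)"] by (simp add: f_def ps_def mult_nonneg_nonpos)
 next
  case False
  then show ?thesis by (simp add: f_def ps_def)
 qed
 ultimately have "(LBINT y. - f y) = 0" "L1 (%y. - f y)" using lintegral_nonneg[of lborel "%y. - f y"] by auto
 then have "AE y in lborel. - f y = 0" using integral_nonneg_eq_0_iff_AE[of lborel "%y. - f y"] f0 by simp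
 then have "AE y in lebesgue. y \<in> {y. f y = 0}" by (intro AE_completion) simp
 moreover have "continuous_on UNIV f" unfolding f_def by (intro continuous_intros cont continuous_on_compose2[OF pc[of UNIV]]) auto
 then have "closed {y. f y = 0}" by (intro closed_Collect_eq continuous_on_const)
 ultimately have "y \<in> {y. f y = 0}" by (intro mem_closed_if_AE_lebesgue)
 then show False using neg r by (simp add: f_def ps_def z0_def[symmetric])
qed

section \<open>Exponential functionals of the process Y\<close>

text \<open>The spectral coefficients of the chain of integrals: a kernel \<open>p_kernel\<close>
  acts as multiplication by a Gaussian factor, and \<open>exp (de k * x)\<close> acts through
  \<open>MR (de k)\<close>, or through \<open>hR\<close> when it multiplies the constant 1.\<close>

primrec HR :: "(nat => real) => (nat => real) => nat => real => real" where
 "HR de tu 0 v = exp (- tu 1 * v^2) * hR (de 0) v"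
| "HR de tu (Suc n) v = exp (- tu (Suc (Suc n)) * v^2) * (LBINT w. HR de tu n w * (MR (de (Suc n)) v w * ww w))"

text \<open>\<open>GG de tu n x\<close> is the chain integrated over all variables before the last,
  whose value is x, see \<open>chain_integral\<close>.\<close>

definition GG :: "(nat => real) => (nat => real) => nat => real => real" where
 "GG de tu n x = (LBINT v. HR de tu n v * ww v * kr v x)"

definition chain :: "(nat => real) => (nat => real) => nat => (nat => real) => real" where
 "chain de tu n x = exp (\<Sum>k<n. de k * x k) * (\<Prod>k=1..n. p_kernel (tu k) (x (k - 1)) (x k))"

lemma KR0_square_integrable:
 assumes "de > 0"
 shows "L1 (%x. exp (de * x) * (KR0 x * KR0 x))"
proof -
 have "L1 (%x. cx (exp (de * x)) * (KB (cx 0) x * KB (cx 0) x))" using assms by (intro KB_mellin2(1)) simp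
 then have "L1 (%x. exp (de * x) * (KR 0 x * KR 0 x))" unfolding KB_of_real of_real_mult[symmetric] complex_of_real_integrable_eq .
 then have "L1 (%x. exp (de * (- 1 + 1 * x)) * (KR 0 (- 1 + 1 * x) * KR 0 (- 1 + 1 * x)))" by (rule lborel_integrable_real_affine) simp
 note i = integrable_mult_right[OF this, of "exp de"]
 have eq: "exp de * (exp (de * (- 1 + 1 * x)) * q) = exp (de * x) * q" for x q :: real
 proof -
  have "exp de * exp (de * (- 1 + 1 * x)) = exp (de * x)" unfolding exp_add[symmetric] by (simp add: right_diff_distrib)
  then show ?thesis by (simp only: mult.assoc[symmetric])
 qed
 show ?thesis using i unfolding eq by simp
qed

lemma kr_kr_integral: "de > 0 ==> (LBINT x. exp (de * x) * kr v x * kr w x) = MR de v w"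
proof -
 assume "de > 0"
 then have "(LBINT x. cx (exp (de * x)) * (KB (iu v) x * KB (iu w) x)) = Mm de (iu v) (iu w)" by (intro KB_mellin2(2)) simp
 then show ?thesis unfolding KB_kr of_real_mult[symmetric] integral_complex_of_real Mm_imag of_real_eq_iff mult.assoc .
qed

lemma kr_mellin: "de > 0 ==> (LBINT x. exp (de * x) * kr v x) = hR de v"
proof -
 assume "de > 0"
 then have "(LBINT x. cx (exp (de * x)) * KB (iu v) x) = hm de (iu v)" by (intro KB_mellin(2)) simp
 then show ?thesis unfolding KB_kr of_real_mult[symmetric] integral_complex_of_real hm_imag of_real_eq_iff .
qed

lemma exp_KR0_integrable: "de > 0 ==> L1 (%x. exp (de * x) * KR0 x)" by (rule KR0_shift_integrable)

context
 fixes de tu :: "nat => real"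
 assumes de: "!!k. de k > 0" and tu: "!!k. tu k > 0"
begin

lemma HR_measurable [measurable]: "HR de tu n \<in> borel_measurable borel"
proof (induction n)
 case 0
 have "HR de tu 0 = (%v. exp (- tu 1 * v^2) * hR (de 0) v)" by (rule ext) simp
 then show ?case by simp
next
 case (Suc n)
 note [measurable] = Suc
 have "HR de tu (Suc n) = (%v. exp (- tu (Suc (Suc n)) * v^2) * (LBINT w. HR de tu n w * (MR (de (Suc n)) v w * ww w)))" by (rule ext) simp
 then show ?case by simp
qed

lemma MR_bound: "ep > 0 ==> MR ep v w <= MB ep 0"
proof -
 assume e: "ep > 0"
 have "MB ep 0 * exp (- 2 * th0 * abs w) <= MB ep 0 * 1" using th0_pos by (intro mult_left_mono MB_nonneg e) auto
 then show ?thesis using MR_decay[OF e, of v w] by simp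
qed

lemma hR_bound: "ep > 0 ==> hR ep v <= HB ep 0"
proof -
 assume e: "ep > 0"
 have "E0 v * HB ep 0 <= 1 * HB ep 0" using th0_pos by (intro mult_right_mono HB_nonneg) auto
 then show ?thesis using hR_decay[OF e, of v] by simp
qed

lemma HR_nonneg: "HR de tu n v >= 0" by (induction n arbitrary: v) (auto intro!: mult_nonneg_nonneg hR_nonneg lintegral_nonneg MR_nonneg de ww_nonneg)

lemma HR_bound: "\<exists>B. \<forall>v. HR de tu n v <= B * exp (- tu (Suc n) * v^2)"
proof (induction n)
 case 0
 have "HR de tu 0 v <= HB (de 0) 0 * exp (- tu 1 * v^2)" for v
  using mult_left_mono[OF hR_bound[OF de[of 0], of v], of "exp (- tu 1 * v^2)"] by (simp add: mult.commute)
 then show ?case by auto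
next
 case (Suc n)
 then obtain B where B: "!!v. HR de tu n v <= B * exp (- tu (Suc n) * v^2)" by blast
 have B0: "B >= 0" using order_trans[OF HR_nonneg B[of 0]] by simp
 define J where "J = (LBINT w. (B * exp (- tu (Suc n) * w^2)) * (MB (de (Suc n)) 0 * ww w))"
 have "(LBINT w. HR de tu n w * (MR (de (Suc n)) v w * ww w)) <= J" for v unfolding J_def
 proof (rule integral_mono')
  have "L1 (%w. (B * MB (de (Suc n)) 0) * (exp (- tu (Suc n) * w^2) * ww w))" by (intro integrable_mult_right gauss_ww_integrable tu)
  then show "L1 (%w. (B * exp (- tu (Suc n) * w^2)) * (MB (de (Suc n)) 0 * ww w))" by (simp only: mult_ac)
  fix w
  show "HR de tu n w * (MR (de (Suc n)) v w * ww w) <= (B * exp (- tu (Suc n) * w^2)) * (MB (de (Suc n)) 0 * ww w)"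
   by (intro mult_mono B mult_right_mono MR_bound de mult_nonneg_nonneg MR_nonneg ww_nonneg B0 MB_nonneg) auto
  show "0 <= (B * exp (- tu (Suc n) * w^2)) * (MB (de (Suc n)) 0 * ww w)" by (intro mult_nonneg_nonneg MB_nonneg de ww_nonneg B0) auto
 qed
 then have "HR de tu (Suc n) v <= J * exp (- tu (Suc (Suc n)) * v^2)" for v unfolding HR.simps(2) mult.commute[of J] by (rule mult_left_mono) simp
 then show ?case by blast
qed

lemma HR_integrable:
 assumes [measurable]: "f \<in> borel_measurable borel" and f: "!!v. abs (f v) <= K"
 shows "L1 (%v. HR de tu n v * (f v * ww v))"
proof -
 let ?A = "%w. exp (- tu (Suc n) * w^2) * ww w"
 obtain B where B: "!!v. HR de tu n v <= B * exp (- tu (Suc n) * v^2)" using HR_bound by blast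
 have B0: "B >= 0" using order_trans[OF HR_nonneg B[of 0]] by simp
 have K0: "K >= 0" using order_trans[OF abs_ge_zero f] .
 show ?thesis
 proof (rule lintegrable_bound)
  show "L1 (%w. (B * K) * (?A w))" by (intro integrable_mult_right gauss_ww_integrable tu)
  show "AE w in lborel. norm (HR de tu n w * (f w * ww w)) <= norm ((B * K) * (?A w))"
  proof (rule AE_I2)
   fix w
   have "HR de tu n w * (abs (f w) * ww w) <= (B * exp (- tu (Suc n) * w^2)) * (K * ww w)"
    by (intro mult_mono B mult_right_mono f mult_nonneg_nonneg ww_nonneg B0 K0) auto
   also have "... = (B * K) * (?A w)" by simp
   finally show "norm (HR de tu n w * (f w * ww w)) <= norm ((B * K) * (?A w))"
    unfolding real_norm_def abs_mult[of "HR de tu n w"] abs_mult[of "f w"] abs_of_nonneg[OF HR_nonneg] abs_of_nonneg[OF ww_nonneg]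
    by (rule order_trans[OF _ abs_ge_self])
  qed
 qed measurable
qed

lemma HR_MR_integrable: "ep > 0 ==> L1 (%w. HR de tu n w * (MR ep v w * ww w))"
 by (rule HR_integrable[where K = "MB ep 0"]) (simp_all add: MR_nonneg MR_bound)

lemma HR_hR_integrable: "ep > 0 ==> L1 (%w. HR de tu n w * (hR ep w * ww w))"
 by (rule HR_integrable[where K = "HB ep 0"]) (simp_all add: hR_nonneg hR_bound)

lemma HR_ww_integrable: "L1 (%w. HR de tu n w * ww w)" using HR_integrable[of "%_. 1" 1] by simp

lemma GG_measurable [measurable]: "GG de tu n \<in> borel_measurable borel" unfolding GG_def[abs_def] by measurable

lemma GG_bound: "\<exists>I. \<forall>x. abs (GG de tu n x) <= I * KR0 x"
proof (intro exI allI)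
 fix x
 have "abs (GG de tu n x) <= (LBINT v. abs (HR de tu n v * ww v * kr v x))" unfolding GG_def by (rule integral_abs_bound)
 also have "... <= (LBINT v. (HR de tu n v * ww v) * KR0 x)"
 proof (rule integral_mono')
  show "L1 (%v. (HR de tu n v * ww v) * KR0 x)" by (intro integrable_mult_left HR_ww_integrable)
 qed (auto simp: abs_mult HR_nonneg ww_nonneg KR_nonneg intro!: mult_left_mono kr_bound)
 finally show "abs (GG de tu n x) <= (LBINT v. HR de tu n v * ww v) * KR0 x" by simp
qed

lemma exp_GG_integrable:
 assumes e: "ep > 0"
 shows "L1 (%x. (exp (ep * x) * GG de tu n x) * KR0 x)"
proof -
 let ?A = "%x. exp (ep * x) * (KR0 x * KR0 x)"
 let ?B = "%x. (exp (ep * x) * GG de tu n x) * KR0 x"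
 obtain I where I: "!!x. abs (GG de tu n x) <= I * KR0 x" using GG_bound by blast
 show ?thesis
 proof (rule lintegrable_bound)
  show "L1 (%x. I * (?A x))" by (intro integrable_mult_right KR0_square_integrable e)
  show "AE x in lborel. norm (?B x) <= norm (I * (?A x))"
  proof (rule AE_I2)
   fix x
   have "(exp (ep * x) * KR0 x) * abs (GG de tu n x) <= (exp (ep * x) * KR0 x) * (I * KR0 x)" by (intro mult_left_mono I) (simp add: KR_nonneg)
   then have "norm (?B x) <= I * (?A x)" by (simp add: abs_mult KR_nonneg mult_ac)
   then show "norm (?B x) <= norm (I * (?A x))"
    unfolding real_norm_def by (rule order_trans[OF _ abs_ge_self])
  qed
 qed measurable
qed

lemma GG_0: "(LBINT x. exp (de 0 * x) * p_kernel (tu 1) x y) = GG de tu 0 y"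
proof -
 have "(LBINT x. exp (de 0 * x) * p_kernel (tu 1) x y) =
  (LBINT v. exp (- tu 1 * v^2) * kr v y * ww v * (LBINT x. exp (de 0 * x) * kr v x))"
  by (rule p_kernel_fubini(2)[OF tu exp_KR0_integrable[OF de]]) measurable
 then show ?thesis unfolding kr_mellin[OF de] GG_def HR.simps(1) by (simp only: mult_ac)
qed

lemma GG_MR:
 assumes e: "ep > 0"
 shows "(LBINT x. exp (ep * x) * GG de tu n x * kr v x) = (LBINT w. HR de tu n w * (MR ep v w * ww w))"
proof -
 let ?A = "%x. exp (ep * x) * kr v x"
 have i: "L1 (%x. (?A x) * KR0 x)"
 proof (rule lintegrable_bound[OF KR0_square_integrable[OF e]])
  show "AE x in lborel. norm ((?A x) * KR0 x) <= norm (exp (ep * x) * (KR0 x * KR0 x))"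
  proof (rule AE_I2)
   fix x
   have "(exp (ep * x) * KR0 x) * abs (kr v x) <= (exp (ep * x) * KR0 x) * KR0 x" by (intro mult_left_mono kr_bound) (simp add: KR_nonneg)
   then show "norm ((?A x) * KR0 x) <= norm (exp (ep * x) * (KR0 x * KR0 x))" by (simp add: abs_mult KR_nonneg mult_ac)
  qed
 qed measurable
 have "(LBINT x. exp (ep * x) * GG de tu n x * kr v x) = (LBINT x. (?A x) * (LBINT w. HR de tu n w * ww w * kr w x))"
  unfolding GG_def by (simp only: mult_ac)
 also have "... = (LBINT w. HR de tu n w * ww w * (LBINT x. (?A x) * kr w x))"
  by (rule kernel_fubini(2)[OF HR_ww_integrable i]) measurable
 also have "... = (LBINT w. HR de tu n w * (MR ep v w * ww w))" unfolding kr_kr_integral[OF e] by (simp only: mult_ac)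
 finally show ?thesis .
qed

lemma GG_Suc: "(LBINT x. exp (de (Suc n) * x) * GG de tu n x * p_kernel (tu (Suc (Suc n))) x y) = GG de tu (Suc n) y"
proof -
 have "(LBINT x. exp (de (Suc n) * x) * GG de tu n x * p_kernel (tu (Suc (Suc n))) x y) =
  (LBINT v. exp (- tu (Suc (Suc n)) * v^2) * kr v y * ww v * (LBINT x. exp (de (Suc n) * x) * GG de tu n x * kr v x))"
  by (rule p_kernel_fubini(2)[OF tu exp_GG_integrable[OF de]]) measurable
 also have "... = GG de tu (Suc n) y" unfolding GG_MR[OF de] unfolding GG_def HR.simps(2) by (simp only: mult_ac)
 finally show ?thesis .
qed

lemma GG_final:
 assumes e: "ep > 0"
 shows "L1 (%x. exp (ep * x) * GG de tu n x)"
  and "(LBINT x. exp (ep * x) * GG de tu n x) = (LBINT v. HR de tu n v * (hR ep v * ww v))"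
proof -
 show "L1 (%x. exp (ep * x) * GG de tu n x)" unfolding GG_def by (rule kernel_fubini(1)[OF HR_ww_integrable exp_KR0_integrable[OF e]]) measurable
 have "(LBINT x. exp (ep * x) * GG de tu n x) = (LBINT v. HR de tu n v * ww v * (LBINT x. exp (ep * x) * kr v x))"
  unfolding GG_def by (rule kernel_fubini(2)[OF HR_ww_integrable exp_KR0_integrable[OF e]]) measurable
 then show "(LBINT x. exp (ep * x) * GG de tu n x) = (LBINT v. HR de tu n v * (hR ep v * ww v))" unfolding kr_mellin[OF e] by (simp only: mult_ac)
qed

text \<open>Not visible in the spectral formula; it comes from the representations
  \<open>GG_0\<close> and \<open>GG_Suc\<close>, which integrate the nonnegative kernel.\<close>

lemma GG_nonneg: "GG de tu n y >= 0"
proof (induction n arbitrary: y)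
 case 0
 show ?case unfolding GG_0[symmetric] by (intro lintegral_nonneg mult_nonneg_nonneg p_kernel_nonneg tu) auto
next
 case (Suc n)
 show ?case unfolding GG_Suc[symmetric] by (intro lintegral_nonneg mult_nonneg_nonneg p_kernel_nonneg tu Suc) auto
qed

lemma nn_GG_0: "(NN x. ennreal (exp (de 0 * x) * p_kernel (tu 1) x y)) = ennreal (GG de tu 0 y)" unfolding GG_0[symmetric]
 by (rule nn_integral_eq_integral[OF p_kernel_fubini(1)[OF tu exp_KR0_integrable[OF de]]]) (auto simp: p_kernel_nonneg tu)

lemma nn_GG_Suc: "(NN x. ennreal (GG de tu n x) * ennreal (exp (de (Suc n) * x) * p_kernel (tu (Suc (Suc n))) x y)) = ennreal (GG de tu (Suc n) y)"
proof -
 have "(NN x. ennreal (exp (de (Suc n) * x) * GG de tu n x * p_kernel (tu (Suc (Suc n))) x y)) = ennreal (GG de tu (Suc n) y)"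
  unfolding GG_Suc[symmetric]
  by (rule nn_integral_eq_integral[OF p_kernel_fubini(1)[OF tu exp_GG_integrable[OF de]]]) (auto simp: p_kernel_nonneg tu GG_nonneg)
 then show ?thesis by (simp add: ennreal_mult[symmetric] GG_nonneg p_kernel_nonneg tu mult_ac)
qed

lemma nn_GG_final:
 assumes e: "ep > 0"
 shows "(NN x. ennreal (GG de tu n x) * ennreal (exp (ep * x))) = ennreal (LBINT v. HR de tu n v * (hR ep v * ww v))"
proof -
 have "(NN x. ennreal (exp (ep * x) * GG de tu n x)) = ennreal (LBINT v. HR de tu n v * (hR ep v * ww v))"
  unfolding GG_final(2)[OF e, symmetric] by (rule nn_integral_eq_integral[OF GG_final(1)[OF e]]) (simp add: GG_nonneg)
 then show ?thesis by (simp add: ennreal_mult[symmetric] GG_nonneg mult_ac)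
qed

lemma chain_nonneg: "chain de tu n x >= 0" unfolding chain_def by (intro mult_nonneg_nonneg prod_nonneg p_kernel_nonneg tu ballI) auto

lemma chain_measurable:
 assumes "n <= m"
 shows "chain de tu n \<in> borel_measurable (PiM {0..m} (%_. lborel))"
proof -
 have c[measurable]: "(%x. x k) \<in> borel_measurable (PiM {0..m} (%_. lborel))" if "k <= n" for k :: nat
  using that assms by (subst measurable_cong_sets[OF refl sets_lborel[symmetric]]) (auto intro: measurable_component_singleton)
 show ?thesis unfolding chain_def[abs_def]
  by (intro borel_measurable_times borel_measurable_prod borel_measurable_p_kernel c tu measurable_compose[OF _ borel_measurable_exp] borel_measurable_sum borel_measurable_const) auto
qed

lemma chain_Suc: "chain de tu (Suc n) (x(Suc n := y)) = chain de tu n x * (exp (de n * x n) * p_kernel (tu (Suc n)) (x n) y)"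
proof -
 have "(\<Sum>k<Suc n. de k * (x(Suc n := y)) k) = (\<Sum>k<Suc n. de k * x k)" by (intro sum.cong) auto
 moreover have "(\<Prod>k=1..n. p_kernel (tu k) ((x(Suc n := y)) (k - 1)) ((x(Suc n := y)) k)) = (\<Prod>k=1..n. p_kernel (tu k) (x (k - 1)) (x k))"
  by (intro prod.cong) auto
 ultimately show ?thesis by (simp add: chain_def exp_add mult_ac)
qed

text \<open>The last coordinate is fixed, and the factor linking it to its predecessor becomes part
  of the test function in the induction hypothesis. This is why \<open>ph\<close> is
  arbitrary.\<close>

lemma chain_integral:
 assumes [measurable]: "ph \<in> borel_measurable borel"
 shows "(\<integral>\<^sup>+x. ennreal (chain de tu (Suc n) x) * ph (x (Suc n)) \<partial>PiM {0..Suc n} (%_. lborel)) = (NN y. ennreal (GG de tu n y) * ph y)"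
 using assms
proof (induction n arbitrary: ph)
 interpret product_sigma_finite "%_ :: nat. lborel :: real measure" ..
 have step: "(\<integral>\<^sup>+x. ennreal (chain de tu (Suc n) x) * ph (x (Suc n)) \<partial>PiM {0..Suc n} (%_. lborel)) =
   (NN y. (\<integral>\<^sup>+x. ennreal (chain de tu n x) * (ennreal (exp (de n * x n) * p_kernel (tu (Suc n)) (x n) y) * ph y) \<partial>PiM {0..n} (%_. lborel)))"
  if [measurable]: "ph \<in> borel_measurable borel" for n and ph :: "real => ennreal"
 proof -
  have ins: "{0..Suc n} = insert (Suc n) {0..n}" by auto
  have m: "(%x. ennreal (chain de tu (Suc n) x) * ph (x (Suc n))) \<in> borel_measurable (PiM {0..Suc n} (%_. lborel))"
  proof -
   have "(%x. x (Suc n)) \<in> measurable (PiM {0..Suc n} (%_. lborel)) lborel" by (rule measurable_component_singleton) simp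
   then have "(%x. ph (x (Suc n))) \<in> borel_measurable (PiM {0..Suc n} (%_. lborel))" by (rule measurable_compose) simp
   then show ?thesis using chain_measurable[of "Suc n" "Suc n"] by (intro borel_measurable_times_ennreal measurable_compose[OF _ measurable_ennreal]) auto
  qed
  show ?thesis unfolding ins
   by (subst product_nn_integral_insert_rev) (use m in \<open>auto simp: ins[symmetric] chain_Suc ennreal_mult chain_nonneg p_kernel_nonneg tu mult.assoc\<close>)
 qed
 {
  case 0
  show ?case
  proof (subst step[OF 0], rule nn_integral_cong)
   fix y :: real
   have "(\<integral>\<^sup>+x. ennreal (chain de tu 0 x) * (ennreal (exp (de 0 * x 0) * p_kernel (tu (Suc 0)) (x 0) y) * ph y) \<partial>PiM {0..0} (%_. lborel)) =
    (\<integral>\<^sup>+x. (%z. ennreal (exp (de 0 * z) * p_kernel (tu 1) z y) * ph y) (x 0) \<partial>PiM {0 :: nat} (%_. lborel))"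
    by (simp add: chain_def)
   also have "... = (NN z. ennreal (exp (de 0 * z) * p_kernel (tu 1) z y) * ph y)" using tu[of 1] by (intro product_nn_integral_singleton) measurable
   also have "... = ennreal (GG de tu 0 y) * ph y" using tu[of 1] by (subst nn_integral_multc) (simp_all add: nn_GG_0[unfolded One_nat_def])
   finally show "(\<integral>\<^sup>+x. ennreal (chain de tu 0 x) * (ennreal (exp (de 0 * x 0) * p_kernel (tu (Suc 0)) (x 0) y) * ph y) \<partial>PiM {0..0} (%_. lborel)) = ennreal (GG de tu 0 y) * ph y" .
  qed
 next
  case (Suc n)
  show ?case
  proof (subst step[OF Suc.prems], rule nn_integral_cong)
   fix y :: real
   have "(\<integral>\<^sup>+x. ennreal (chain de tu (Suc n) x) * (ennreal (exp (de (Suc n) * x (Suc n)) * p_kernel (tu (Suc (Suc n))) (x (Suc n)) y) * ph y) \<partial>PiM {0..Suc n} (%_. lborel)) =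
    (NN z. ennreal (GG de tu n z) * (ennreal (exp (de (Suc n) * z) * p_kernel (tu (Suc (Suc n))) z y) * ph y))"
    using tu[of "Suc (Suc n)"] by (intro Suc.IH) measurable
   also have "... = ennreal (GG de tu (Suc n) y) * ph y"
    unfolding mult.assoc[symmetric] using tu[of "Suc (Suc n)"] by (subst nn_integral_multc) (simp_all add: nn_GG_Suc)
   finally show "(\<integral>\<^sup>+x. ennreal (chain de tu (Suc n) x) * (ennreal (exp (de (Suc n) * x (Suc n)) * p_kernel (tu (Suc (Suc n))) (x (Suc n)) y) * ph y) \<partial>PiM {0..Suc n} (%_. lborel)) = ennreal (GG de tu (Suc n) y) * ph y" .
  qed
 }
qed

end

section \<open>The initial measure and the dual Hahn chain\<close>

lemma nn_integral_sum_measures: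
 assumes M: "sets M = sets L" and N: "sets N = sets L"
  and eq: "!!E. E \<in> sets L ==> emeasure L E = emeasure M E + emeasure N E"
  and f: "f \<in> borel_measurable L"
 shows "(\<integral>\<^sup>+x. f x \<partial>L) = (\<integral>\<^sup>+x. f x \<partial>M) + (\<integral>\<^sup>+x. f x \<partial>N)"
proof -
 have mM: "g \<in> borel_measurable M" "g \<in> borel_measurable N" if "g \<in> borel_measurable L" for g :: "'a => ennreal"
  unfolding measurable_cong_sets[OF M refl] measurable_cong_sets[OF N refl] by (fact that)+
 show ?thesis using f
proof (induction rule: borel_measurable_induct)
 case (cong f g)
 have sp: "space M = space L" "space N = space L" using M N by (auto dest: sets_eq_imp_space_eq)
 have "(\<integral>\<^sup>+x. f x \<partial>K) = (\<integral>\<^sup>+x. g x \<partial>K)" if "space K = space L" for K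
  using cong that by (intro nn_integral_cong) simp
 then show ?case using cong sp by simp
next
 case (set A)
 then show ?case using M N eq by simp
next
 case (mult f c)
 then show ?case using mM[OF mult(2)] by (simp add: nn_integral_cmult distrib_left)
next
 case (add f g)
 then show ?case using mM[OF add(1)] mM[OF add(3)] by (simp add: nn_integral_add add_ac)
next
 case (seq U)
 have Um: "U i \<in> borel_measurable M" "U i \<in> borel_measurable N" for i using mM[OF seq(1)] by auto
 have inc: "incseq (%i. \<integral>\<^sup>+x. U i x \<partial>K)" for K using seq(3) by (auto simp: incseq_def le_fun_def intro!: nn_integral_mono)
 have sup: "(\<integral>\<^sup>+x. (SUP i. U i) x \<partial>K) = (SUP i. \<integral>\<^sup>+x. U i x \<partial>K)" if "!!i. U i \<in> borel_measurable K" for K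
  unfolding SUP_apply by (intro nn_integral_monotone_convergence_SUP seq that)
 have "(SUP i. (\<integral>\<^sup>+x. U i x \<partial>M) + (\<integral>\<^sup>+x. U i x \<partial>N)) = (SUP i. \<integral>\<^sup>+x. U i x \<partial>M) + (SUP i. \<integral>\<^sup>+x. U i x \<partial>N)"
  by (intro ennreal_SUP_add inc)
 then show ?case using sup[of L] sup[of M] sup[of N] seq Um by simp
qed
qed

text \<open>The substitution x = u^2 on compact intervals, followed by monotone convergence.\<close>

lemma nn_integral_square:
 fixes f :: "real => ennreal"
 assumes [measurable]: "f \<in> borel_measurable borel"
 shows "(NN x. f x * indicator {0<..} x) = (NN u. f (u^2) * ennreal (2 * u) * indicator {0<..} u)"
proof -
 have eq: "(NN x. (f x * indicator {0<..} x) * indicator {0..(real (Suc n))^2} x) = (NN u. (f (u^2) * ennreal (2 * u) * indicator {0<..} u) * indicator {0..real (Suc n)} u)" for n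
 proof -
  have "(NN x. (f x * indicator {0<..} x) * indicator {0^2..(real (Suc n))^2} x) = (NN u. (f (u^2) * indicator {0<..} (u^2)) * ennreal (2 * u) * indicator {0..real (Suc n)} u)"
   by (rule nn_integral_substitution_aux[where g = "%u. u^2"]) (auto intro!: derivative_eq_intros continuous_intros simp del: of_nat_Suc)
  also have "... = (NN u. (f (u^2) * ennreal (2 * u) * indicator {0<..} u) * indicator {0..real (Suc n)} u)"
   by (rule nn_integral_cong) (auto simp: indicator_def)
  finally show ?thesis by simp
 qed
 have lim: "(NN x. g x * indicator {0<..} x) = (SUP n. (NN x. (g x * indicator {0<..} x) * indicator {0..b n} x))"
  if [measurable]: "g \<in> borel_measurable borel" and b: "incseq b" "!!x. \<exists>n. x <= b n" for g and b :: "nat => real"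
 proof -
  have "(SUP n. (NN x. (g x * indicator {0<..} x) * indicator {0..b n} x)) = (NN x. (SUP n. (g x * indicator {0<..} x) * indicator {0..b n} x))"
  proof (rule nn_integral_monotone_convergence_SUP[symmetric])
   show "incseq (%n x. (g x * indicator {0<..} x) * indicator {0..b n} x)"
    using b(1) by (auto simp: incseq_def le_fun_def indicator_def intro: order_trans)
  qed measurable
  also have "... = (NN x. g x * indicator {0<..} x)"
  proof (rule nn_integral_cong)
   fix x :: real
   obtain n where "x <= b n" using b(2) by blast
   then show "(SUP n. (g x * indicator {0<..} x) * indicator {0..b n} x) = g x * indicator {0<..} x"
    by (intro antisym SUP_least SUP_upper2[of n]) (auto simp: indicator_def)
  qed
  finally show ?thesis ..
 qed
 have b1: "incseq (%n. (real (Suc n))^2)" "incseq (%n. real (Suc n))" by (auto simp: incseq_def intro!: power_mono)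
 have b2: "\<exists>n. x <= real (Suc n)" for x using real_arch_simple[of x] by (meson le_SucI of_nat_le_iff order_trans order_refl)
 have b3: "\<exists>n. x <= (real (Suc n))^2" for x
 proof -
  obtain n where "x <= real (Suc n)" using b2 by blast
  also have "... <= (real (Suc n))^2" unfolding power2_eq_square by simp
  finally show ?thesis by blast
 qed
 show ?thesis using lim[OF assms b1(1) b3] lim[OF _ b1(2) b2, of "%u. f (u^2) * ennreal (2 * u)"] eq by simp
qed

lemma nn_integral_even_half:
 fixes f :: "real => ennreal"
 assumes [measurable]: "f \<in> borel_measurable borel" and even: "!!x. f (- x) = f x"
 shows "(NN x. f x) = 2 * (NN x. f x * indicator {0<..} x)"
proof -
 have "(NN x. f x) = (NN x. f x * indicator {0<..} x + f x * indicator {..<0} x)"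
  using AE_lborel_singleton[of 0] by (intro nn_integral_cong_AE) (auto simp: indicator_def elim!: eventually_mono)
 also have "... = (NN x. f x * indicator {0<..} x) + (NN x. f x * indicator {..<0} x)" by (rule nn_integral_add) auto
 also have "(NN x. f x * indicator {..<0} x) = (NN x. f (0 + (- 1) * x) * indicator {..<0} (0 + (- 1) * x))"
  by (subst nn_integral_real_affine[where c = "- 1" and t = 0]) auto
 also have "... = (NN x. f x * indicator {0<..} x)" by (rule nn_integral_cong) (auto simp: even indicator_def)
 finally show ?thesis by (simp add: mult_2)
qed

text \<open>The factor common to the density and to the atom of \<open>p0\<close> once these are
  written with \<open>hR\<close>, \<open>hm\<close> and \<open>kap\<close>.\<close>

definition Kp :: "real => real => real" where
 "Kp a c = (a + c) * (a + c + 2) / 32 * 2 powr (4 - a - c)"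

lemma p0_dens_eq:
 assumes u: "u > 0"
 shows "p0_dens a c (u^2) * (2 * u) = 2 * Kp a c * (hR a u * hR c u * ww u)"
proof -
 have s: "sqrt (u^2) = u" using u by simp
 have p: "2 powr (4 - a - c) * (2 powr (a - 2) * 2 powr (c - 2)) = (1 :: real)" by (simp add: powr_add[symmetric])
 have gen: "K / (16 * pi) * ((A * C)^2 / (2 * u * G)) * (2 * u) = 2 * (K / 32 * P) * ((p1 * A^2) * (p2 * C^2) * w)"
  if "1 / G = pi * w" "P * (p1 * p2) = 1" for K A C G P p1 p2 w :: real
 proof -
  have "K / (16 * pi) * ((A * C)^2 / (2 * u * G)) * (2 * u) = K / (16 * pi) * (A * C)^2 * (1 / G)" using u by simp
  also have "... = K / 16 * (A * C)^2 * w" unfolding that(1) by simp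
  also have "... = (P * (p1 * p2)) * (K / 16 * (A * C)^2 * w)" unfolding that(2) by simp
  finally show ?thesis by (simp add: power_mult_distrib mult_ac)
 qed
 show ?thesis unfolding p0_dens_def Kp_def hR_def s norm_mult by (rule gen[OF cmod_Gamma_ww[OF u] p])
qed

text \<open>In the variable u with x = u^2 the density becomes
  \<open>hR a u * hR c u * ww u\<close>. The atom gets the weight
  \<open>kap a * norm (hm c (cx a))\<close>, with the \<open>kap a\<close> of the entrance
  law.\<close>

lemma nn_integral_p0:
 assumes a: "a > - 2" and ac: "a + c > 0" and [measurable]: "f \<in> borel_measurable borel"
 shows "(\<integral>\<^sup>+x. f x \<partial>p0 a c) = ennreal (Kp a c) * ((NN u. ennreal (hR a u * hR c u * ww u) * f (u^2)) +
  (if a < 0 then ennreal (kap a * norm (hm c (cx a))) * f (- a\<^sup>2) else 0))"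
proof -
 let ?B = "%u. hR a u * hR c u * ww u"
 let ?C = "kap a * norm (hm c (cx a))"
 let ?E = "2 powr (1 + a) * 2 powr (c - 2)"
 let ?F = "2 * ennreal (Kp a c)"
 let ?D = "density lborel (%x. ennreal (p0_dens a c x) * indicator {0<..} x)"
 have Kp: "Kp a c >= 0" using ac by (simp add: Kp_def)
 define m where "m = (if a < 0 then ennreal (p0_mass a c 0) else 0)"
 let ?A = "scale_measure m (return borel (- a\<^sup>2))"
 \<comment> \<open>Since a > -2, only \<open>j = 0\<close> can satisfy the condition.\<close>
 have S: "{j :: nat. 2 * real j + a < 0} = (if a < 0 then {0} else {})"
 proof -
  have "j = 0" if "2 * real j + a < 0" for j :: nat using that a by (cases j) auto
  then show ?thesis by auto
 qed
 have pm[measurable]: "p0_dens a c \<in> borel_measurable borel" unfolding p0_dens_def by measurable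
 have "(\<integral>\<^sup>+x. f x \<partial>p0 a c) = (\<integral>\<^sup>+x. f x \<partial>?D) + (\<integral>\<^sup>+x. f x \<partial>?A)"
 proof (rule nn_integral_sum_measures)
  fix E assume "E \<in> sets (p0 a c)"
  then have E: "E \<in> sets borel" by simp
  show "emeasure (p0 a c) E = emeasure ?D E + emeasure ?A E" unfolding emeasure_p0[OF E] S m_def by simp
 qed auto
 also have "(\<integral>\<^sup>+x. f x \<partial>?D) = (NN x. (ennreal (p0_dens a c x) * f x) * indicator {0<..} x)"
  by (subst nn_integral_density) (simp_all add: mult_ac)
 also have "... = (NN u. (ennreal (p0_dens a c (u^2)) * f (u^2)) * ennreal (2 * u) * indicator {0<..} u)" by (rule nn_integral_square) measurable
 also have "... = (NN u. ?F * ((ennreal (?B u) * f (u^2)) * indicator {0<..} u))"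
 proof (rule nn_integral_cong)
  fix u :: real
  show "(ennreal (p0_dens a c (u^2)) * f (u^2)) * ennreal (2 * u) * indicator {0<..} u = ?F * ((ennreal (?B u) * f (u^2)) * indicator {0<..} u)"
  proof (cases "u > 0")
   case True
   have n: "0 <= hR a u * hR c u * ww u" by (intro mult_nonneg_nonneg hR_nonneg ww_nonneg)
   have "p0_dens a c (u^2) = 2 * Kp a c * (?B u) / (2 * u)" using p0_dens_eq[OF True, of a c] True by (simp add: field_simps)
   then have pn: "p0_dens a c (u^2) >= 0" using n Kp True by simp
   have "ennreal (p0_dens a c (u^2)) * ennreal (2 * u) = ?F * ennreal (?B u)"
    using p0_dens_eq[OF True, of a c] pn n Kp True by (simp add: ennreal_mult[symmetric] flip: ennreal_numeral)
   then show ?thesis using True by (simp add: mult_ac) (metis mult.assoc mult.left_commute)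
  qed simp
 qed
 also have "... = ennreal (Kp a c) * (NN u. ennreal (?B u) * f (u^2))"
  by (subst nn_integral_cmult, simp, subst nn_integral_even_half[of "%u. ennreal (?B u) * f (u^2)"])
   (simp_all add: hR_minus ww_def mult_ac)
 also have "(\<integral>\<^sup>+x. f x \<partial>?A) = ennreal (Kp a c) * (if a < 0 then ennreal ?C * f (- a\<^sup>2) else 0)"
 proof (cases "a < 0")
  case True
  have c: "c > 0" using True ac by simp
  have hn: "norm (hm c (cx a)) = 2 powr (c - 2) * Gamma ((c + a) / 2) * Gamma ((c - a) / 2)"
  proof -
   have "hm c (cx a) = cx (2 powr (c - 2) * Gamma ((c + a) / 2) * Gamma ((c - a) / 2))"
    unfolding hm_def of_real_mult Gamma_complex_of_real[symmetric] by simp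
   moreover have "0 <= 2 powr (c - 2) * Gamma ((c + a) / 2) * Gamma ((c - a) / 2)"
    using True ac c by (intro mult_nonneg_nonneg less_imp_le[OF Gamma_real_pos]) auto
   ultimately show ?thesis by (simp only: norm_of_real abs_of_nonneg)
  qed
  have pw: "2 powr (4 - a - c) * ?E = (8 :: real)"
  proof -
   have "2 powr (4 - a - c) * ?E = (2 :: real) powr 3" unfolding powr_add[symmetric] by simp
   then show ?thesis by simp
  qed
  have "Kp a c * ?C = (a + c) * (a + c + 2) / 32 * (2 powr (4 - a - c) * ?E) * (Gamma ((c + a) / 2) * Gamma ((c - a) / 2) / Gamma (- a))"
   unfolding hn Kp_def kap_def by simp
  also have "... = p0_mass a c 0" unfolding pw p0_mass_def using True by (simp add: add.commute)
  finally have e: "p0_mass a c 0 = Kp a c * ?C" ..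
  have "m = ennreal (Kp a c) * ennreal ?C" unfolding m_def using True Kp kap_nonneg[OF True] by (simp add: e ennreal_mult)
  then show ?thesis using True by (simp add: nn_integral_scale_measure nn_integral_return mult.assoc)
 next
  case False
  then show ?thesis by (simp add: m_def nn_integral_scale_measure)
 qed
 finally show ?thesis by (simp add: distrib_left)
qed

text \<open>The list runs through the values at \<open>s k\<close>, ..., \<open>s 1\<close> in this
  order, so \<open>ys ! (k - j)\<close> is the value at \<open>s j\<close>.\<close>

definition Fw :: "(nat => real) => nat => real list => ennreal" where
 "Fw tu k ys = ennreal (exp (- (\<Sum>j=1..k. tu j * ys ! (k - j))))"

lemma Fw_Suc: "Fw tu (Suc k) (y # ys) = ennreal (exp (- tu (Suc k) * y)) * Fw tu k ys"
proof -
 have "(\<Sum>j=1..Suc k. tu j * (y # ys) ! (Suc k - j)) = (\<Sum>j=1..k. tu j * ys ! (k - j)) + tu (Suc k) * y" by (simp add: Suc_diff_le)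
 then show ?thesis by (simp add: Fw_def ennreal_mult[symmetric] exp_add[symmetric])
qed

section \<open>Expectations along the dual Hahn chain\<close>

definition Lw :: "(nat => real) => nat => real list" where "Lw s k = map s (rev [1..<Suc k])"

lemma Lw_Suc: "Lw s (Suc k) = s (Suc k) # Lw s k" and Lw_0: "Lw s 0 = []" by (simp_all add: Lw_def)

context
 fixes c :: real and s tu de :: "nat => real"
 assumes tu: "!!k. tu k > 0" and de: "!!k. de k > 0" and de0: "de 0 = c - s 1"
begin

text \<open>The transition densities have the form of an h-transform: the numerator
  \<open>hR (c - t)\<close> of one step cancels the denominator left by the steps after it. What
  remains is \<open>HR\<close> and one normalising factor at the start. The constant
  \<open>K\<close> absorbs the weight of each state passed.\<close>

lemma markov_expect_T:
 assumes dec: "!!k. k < n ==> de (Suc k) = s (Suc k) - s (Suc (Suc k))"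
  and sig: "sg < s (Suc n)" and nu: "spectral nu (s (Suc n) - sg)" and x: "- nu\<^sup>2 = cx x"
 shows "markov_expect (T_trans c) sg x (Lw s (Suc n)) (%ys. K * Fw tu (Suc n) ys) =
  K * (NN v. ennreal (HR de tu n v * (norm (Mm (s (Suc n) - sg) nu (iu v)) * ww v) / norm (hm (c - sg) nu)))" using dec sig nu x
proof (induction n arbitrary: sg nu x K)
 case 0
 have Hm[measurable]: "HR de tu 0 \<in> borel_measurable borel" by (rule HR_measurable[OF de tu])
 have sc: "s 1 < c" using de[of 0] de0 by simp
 have s1: "sg < s 1" and nu: "spectral nu (s 1 - sg)" using 0 by auto
 have "markov_expect (T_trans c) sg x (Lw s (Suc 0)) (%ys. K * Fw tu (Suc 0) ys) = (\<integral>\<^sup>+y. K * ennreal (exp (- tu 1 * y)) \<partial>T_trans c sg (s 1) x)"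
  by (simp add: Lw_Suc Lw_0 Fw_def)
 also have "... = (NN u. ennreal (cdw (c - s 1) (s 1 - sg) nu u / norm (hm (c - sg) nu)) * (K * ennreal (exp (- tu 1 * u^2))))"
  by (rule nn_integral_T_trans[OF s1 sc nu 0(4)]) measurable
 also have "... = (NN u. K * ennreal (HR de tu 0 u * (norm (Mm (s (Suc 0) - sg) nu (iu u)) * ww u) / norm (hm (c - sg) nu)))"
 proof (rule nn_integral_cong)
  fix u
  have "ennreal (cdw (c - s 1) (s 1 - sg) nu u / norm (hm (c - sg) nu)) * ennreal (exp (- tu 1 * u^2)) = ennreal (HR de tu 0 u * (norm (Mm (s (Suc 0) - sg) nu (iu u)) * ww u) / norm (hm (c - sg) nu))"
  proof -
   have "HR de tu 0 u * (norm (Mm (s (Suc 0) - sg) nu (iu u)) * ww u) / norm (hm (c - sg) nu) =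
    cdw (c - s 1) (s 1 - sg) nu u / norm (hm (c - sg) nu) * exp (- tu 1 * u^2)" by (simp add: cdw_def de0 mult_ac)
   then show ?thesis by (simp only:, intro ennreal_mult[symmetric]) (auto simp: cdw_nonneg)
  qed
  then show "ennreal (cdw (c - s 1) (s 1 - sg) nu u / norm (hm (c - sg) nu)) * (K * ennreal (exp (- tu 1 * u^2))) = K * ennreal (HR de tu 0 u * (norm (Mm (s (Suc 0) - sg) nu (iu u)) * ww u) / norm (hm (c - sg) nu))"
   by (simp only: mult.left_commute[of _ K])
 qed
 also have "... = K * (NN u. ennreal (HR de tu 0 u * (norm (Mm (s (Suc 0) - sg) nu (iu u)) * ww u) / norm (hm (c - sg) nu)))"
  by (rule nn_integral_cmult) measurable
 finally show ?case .
next
 case (Suc n)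
 let ?t = "s (Suc (Suc n))"
 have Hm[measurable]: "HR de tu m \<in> borel_measurable borel" for m by (rule HR_measurable[OF de tu])
 have dn: "de (Suc n) = s (Suc n) - ?t" using Suc.prems(1)[of n] by simp
 have tc: "?t < c"
 proof -
  have "s (Suc k) < c" if "k <= Suc n" for k using that
  proof (induction k)
   case 0
   then show ?case using de[of 0] de0 by simp
  next
   case (Suc k)
   then show ?case using de[of "Suc k"] Suc.prems \<open>!!k. k < Suc n ==> de (Suc k) = s (Suc k) - s (Suc (Suc k))\<close>[of k] by simp
  qed
  then show ?thesis by blast
 qed
 have hp: "hR (c - ?t) u > 0" for u using tc by (intro hR_pos) simp
 define f where "f y = markov_expect (T_trans c) ?t y (Lw s (Suc n)) (%ys. (K * ennreal (exp (- tu (Suc (Suc n)) * y))) * Fw tu (Suc n) ys)" for y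
 \<comment> \<open>An explicitly measurable function of u that agrees with \<open>f (u^2)\<close>.
   The transition measure lives on nonnegative states, so \<open>f y\<close> may be replaced by
   \<open>h (sqrt y)\<close> under the integral.\<close>
 define h where "h u = (K * ennreal (exp (- tu (Suc (Suc n)) * u^2))) * (NN w. ennreal (HR de tu n w * (MR (de (Suc n)) u w * ww w) / hR (c - ?t) u))" for u
 have hm[measurable]: "h \<in> borel_measurable borel" unfolding h_def by measurable
 have fh: "f (u^2) = h u" for u
 proof -
  have "f (u^2) = (K * ennreal (exp (- tu (Suc (Suc n)) * u^2))) * (NN w. ennreal (HR de tu n w * (norm (Mm (s (Suc n) - ?t) (iu u) (iu w)) * ww w) / norm (hm (c - ?t) (iu u))))"
   unfolding f_def
  proof (rule Suc.IH)
   show "de (Suc k) = s (Suc k) - s (Suc (Suc k))" if "k < n" for k using Suc.prems(1)[of k] that by simp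
   show "?t < s (Suc n)" using dn de[of "Suc n"] by simp
   show "- (iu u)\<^sup>2 = cx (u^2)" by (simp add: power_mult_distrib)
  qed simp
  then show ?thesis unfolding h_def dn[symmetric] Mm_imag hm_imag norm_of_real using hp[of u] by (simp add: MR_nonneg[OF de] less_imp_le)
 qed
 have tr: "T_trans c sg ?t x = TR (c - ?t) (?t - sg) nu" by (rule T_trans_TR[OF Suc.prems(2) tc Suc.prems(3,4)])
 have "markov_expect (T_trans c) sg x (Lw s (Suc (Suc n))) (%ys. K * Fw tu (Suc (Suc n)) ys) = (\<integral>\<^sup>+y. f y \<partial>T_trans c sg ?t x)"
  unfolding Lw_Suc[of s "Suc n"] markov_expect.simps Fw_Suc f_def by (simp only: mult.assoc)
 also have "... = (\<integral>\<^sup>+y. h (sqrt y) \<partial>T_trans c sg ?t x)"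
 proof (rule nn_integral_cong_AE)
  have "AE y in T_trans c sg ?t x. y >= 0" unfolding tr TR_def by (subst AE_distr_iff) auto
  then show "AE y in T_trans c sg ?t x. f y = h (sqrt y)"
  proof eventually_elim
   case (elim y)
   then show ?case using fh[of "sqrt y"] by simp
  qed
 qed
 also have "... = (NN u. ennreal (cdw (c - ?t) (?t - sg) nu u / norm (hm (c - sg) nu)) * h (sqrt (u^2)))"
  by (rule nn_integral_T_trans[OF Suc.prems(2) tc Suc.prems(3,4)]) measurable
 also have "... = (NN u. K * ennreal (HR de tu (Suc n) u * (norm (Mm (?t - sg) nu (iu u)) * ww u) / norm (hm (c - sg) nu)))"
 proof (rule nn_integral_cong)
  fix u :: real
  have "h (sqrt (u^2)) = f ((abs u)\<^sup>2)" unfolding fh by simp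
  then have e: "h (sqrt (u^2)) = h u" using fh[of u] by simp
  define I where "I = (LBINT w. HR de tu n w * (MR (de (Suc n)) u w * ww w))"
  have I0: "I >= 0" unfolding I_def by (intro lintegral_nonneg mult_nonneg_nonneg HR_nonneg[OF de tu] MR_nonneg de ww_nonneg)
  have "(NN w. ennreal (HR de tu n w * (MR (de (Suc n)) u w * ww w) / hR (c - ?t) u)) = ennreal (LBINT w. HR de tu n w * (MR (de (Suc n)) u w * ww w) / hR (c - ?t) u)"
   using hp[of u] by (intro nn_integral_eq_integral integrable_divide HR_MR_integrable[OF de tu] de AE_I2 divide_nonneg_pos mult_nonneg_nonneg HR_nonneg[OF de tu] MR_nonneg ww_nonneg) auto
  also have "... = ennreal (I / hR (c - ?t) u)" by (simp add: I_def)
  finally have hu: "h u = K * ennreal (exp (- tu (Suc (Suc n)) * u^2) * (I / hR (c - ?t) u))"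
   unfolding h_def using I0 hp[of u] by (subst ennreal_mult) (simp_all add: mult.assoc)
  have "ennreal (cdw (c - ?t) (?t - sg) nu u / norm (hm (c - sg) nu)) * ennreal (exp (- tu (Suc (Suc n)) * u^2) * (I / hR (c - ?t) u)) =
   ennreal (HR de tu (Suc n) u * (norm (Mm (?t - sg) nu (iu u)) * ww u) / norm (hm (c - sg) nu))"
  proof -
   have "exp (- tu (Suc (Suc n)) * u^2) * I * (norm (Mm (?t - sg) nu (iu u)) * ww u) / norm (hm (c - sg) nu) =
    cdw (c - ?t) (?t - sg) nu u / norm (hm (c - sg) nu) * (exp (- tu (Suc (Suc n)) * u^2) * (I / hR (c - ?t) u))"
    using hp[of u] by (simp add: cdw_def mult_ac)
   then show ?thesis unfolding HR.simps(2) I_def[symmetric]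
    by (simp only:, intro ennreal_mult[symmetric]) (use hp[of u] I0 in \<open>auto simp: cdw_nonneg less_imp_le\<close>)
  qed
  then show "ennreal (cdw (c - ?t) (?t - sg) nu u / norm (hm (c - sg) nu)) * h (sqrt (u^2)) = K * ennreal (HR de tu (Suc n) u * (norm (Mm (?t - sg) nu (iu u)) * ww u) / norm (hm (c - sg) nu))"
   unfolding e hu by (simp only: mult.left_commute[of _ K])
 qed
 also have "... = K * (NN u. ennreal (HR de tu (Suc n) u * (norm (Mm (?t - sg) nu (iu u)) * ww u) / norm (hm (c - sg) nu)))"
  by (rule nn_integral_cmult) measurable
 finally show ?case .
qed

text \<open>The normalising factor left by \<open>markov_expect_T\<close> cancels
  \<open>hR c\<close> in the density and \<open>hm c\<close> in the atom. After Fubini, the inner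
  integral together with the atom is the left-hand side of \<open>entrance_law\<close>, which leaves
  \<open>hR (a + s (Suc n))\<close>.\<close>

lemma p0_chain:
 assumes a: "a > - 2" and c: "c > 0" and ac: "a + c > 0"
  and dec: "!!k. k < n ==> de (Suc k) = s (Suc k) - s (Suc (Suc k))"
  and sn: "s (Suc n) > 0" "a + s (Suc n) > 0" and scn: "s (Suc n) < c"
 shows "(\<integral>\<^sup>+x. markov_expect (T_trans c) 0 x (Lw s (Suc n)) (Fw tu (Suc n)) \<partial>p0 a c) =
  ennreal (Kp a c) * ennreal (LBINT v. HR de tu n v * (hR (a + s (Suc n)) v * ww v))"
proof -
 let ?A = "%v. HR de tu n v * ww v"
 let ?B = "%g. if a < 0 then ennreal (kap a * norm (hm c (cx a))) * g (- a\<^sup>2) else 0"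
 let ?C = "%u. hR a u * hR c u * ww u"
 have Hm[measurable]: "HR de tu m \<in> borel_measurable borel" for m by (rule HR_measurable[OF de tu])
 let ?ep = "s (Suc n)"
 define f where "f x = markov_expect (T_trans c) 0 x (Lw s (Suc n)) (Fw tu (Suc n))" for x
 define \<Psi> where "\<Psi> nu = (NN v. ennreal (HR de tu n v * (norm (Mm ?ep nu (iu v)) * ww v)))" for nu
 have fe: "f x = ennreal (1 / norm (hm c nu)) * \<Psi> nu" if nu: "spectral nu ?ep" and x: "- nu\<^sup>2 = cx x" for nu x
 proof -
  have "f x = (NN v. ennreal (HR de tu n v * (norm (Mm ?ep nu (iu v)) * ww v) / norm (hm c nu)))"
   using markov_expect_T[of n 0 nu x 1, OF dec] sn nu x by (simp add: f_def)
  also have "... = (NN v. ennreal (1 / norm (hm c nu)) * ennreal (HR de tu n v * (norm (Mm ?ep nu (iu v)) * ww v)))"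
   by (intro nn_integral_cong) (auto simp: ennreal_mult[symmetric] HR_nonneg[OF de tu] ww_nonneg)
  also have "... = ennreal (1 / norm (hm c nu)) * \<Psi> nu" unfolding \<Psi>_def by (rule nn_integral_cmult) measurable
  finally show ?thesis .
 qed
 \<comment> \<open>A measurable version of \<open>f\<close>: explicit on the nonnegative half-line
   and constant elsewhere. \<open>p0\<close> charges no negative state besides the atom
   \<open>- a\<^sup>2\<close>, so the two agree almost everywhere.\<close>
 define g where "g x = (if x >= 0 then ennreal (1 / hR c (sqrt x)) * \<Psi> (iu (sqrt x)) else f (- a\<^sup>2))" for x :: real
 have \<Psi>m[measurable]: "(%x. \<Psi> (iu (k x))) \<in> borel_measurable borel" if [measurable]: "k \<in> borel_measurable borel" for k :: "real => real"
  unfolding \<Psi>_def by measurable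
 have gm[measurable]: "g \<in> borel_measurable borel" unfolding g_def by measurable
 have fg: "f x = g x" if "x >= 0" for x
  using fe[of "iu (sqrt x)" x] that by (simp add: g_def hm_imag hR_nonneg power_mult_distrib flip: of_real_power)
 have "(\<integral>\<^sup>+x. f x \<partial>p0 a c) = (\<integral>\<^sup>+x. g x \<partial>p0 a c)"
 proof (rule nn_integral_cong_AE)
  let ?N = "({..<0} - {- a\<^sup>2}) \<union> (if a < 0 then {} else {..<0 :: real})"
  have Nm: "?N \<in> sets borel" by (cases "a < 0") auto
  have "emeasure (p0 a c) ?N = (\<integral>\<^sup>+x. indicator ?N x \<partial>p0 a c)" using Nm by simp
  also have "... = 0" unfolding nn_integral_p0[OF a ac borel_measurable_indicator[OF Nm]] by (auto simp: indicator_def)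
  finally have "AE x in p0 a c. x \<notin> ?N" using Nm by (intro AE_not_in null_setsI) auto
  then show "AE x in p0 a c. f x = g x"
  proof eventually_elim
   case (elim x)
   then show ?case using fg[of x] by (cases "x >= 0") (auto simp: g_def split: if_splits)
  qed
 qed
 also have "... = ennreal (Kp a c) * ((NN u. ennreal (?C u) * g (u^2)) +
  (?B g))" by (rule nn_integral_p0[OF a ac gm])
 also have "(NN u. ennreal (?C u) * g (u^2)) = (NN u. (NN v. ennreal (?A v) * ennreal (hR a u * MR ?ep v u * ww u)))"
 proof (rule nn_integral_cong)
  fix u :: real
  have "g (u^2) = f (u^2)" using fg by simp
  also have "... = ennreal (1 / hR c u) * \<Psi> (iu u)" using fe[of "iu u" "u^2"] by (simp add: hm_imag hR_nonneg power_mult_distrib)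
  finally have "ennreal (?C u) * g (u^2) = ennreal (hR a u * ww u) * \<Psi> (iu u)"
   using hR_pos[OF c, of u] by (simp add: mult.assoc[symmetric] ennreal_mult[symmetric] hR_nonneg ww_nonneg)
  also have "... = (NN v. ennreal (hR a u * ww u) * ennreal (HR de tu n v * (norm (Mm ?ep (iu u) (iu v)) * ww v)))"
   unfolding \<Psi>_def by (rule nn_integral_cmult[symmetric]) measurable
  also have "... = (NN v. ennreal (?A v) * ennreal (hR a u * MR ?ep v u * ww u))"
   using sn(1) by (intro nn_integral_cong) (simp add: Mm_imag ennreal_mult[symmetric] hR_nonneg ww_nonneg MR_nonneg HR_nonneg[OF de tu] MR_commute[of _ u] mult_ac)
  finally show "ennreal (?C u) * g (u^2) = (NN v. ennreal (?A v) * ennreal (hR a u * MR ?ep v u * ww u))" .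
 qed
 also have "... = (NN v. (NN u. ennreal (?A v) * ennreal (hR a u * MR ?ep v u * ww u)))"
  by (rule lborel_pair.Fubini'[symmetric]) measurable
 also have "... = (NN v. ennreal (?A v) * (NN u. ennreal (hR a u * MR ?ep v u * ww u)))"
  by (intro nn_integral_cong nn_integral_cmult) measurable
 also have "(?B g) = (NN v. ennreal (?A v) * (if a < 0 then ennreal (kap a * MA ?ep v a) else 0))"
 proof (cases "a < 0")
  case True
  have sp: "spectral (cx a) ?ep" using True sn by (auto simp: spectral_def intro!: exI[of _ a])
  have hp: "norm (hm c (cx a)) > 0" using spectral_hm_pos(2)[OF sp sn(1)] scn by simp
  have "g (- a\<^sup>2) = f (- a\<^sup>2)" using True by (simp add: g_def)
  also have "... = ennreal (1 / norm (hm c (cx a))) * \<Psi> (cx a)" by (rule fe[OF sp]) simp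
  finally have "ennreal (kap a * norm (hm c (cx a))) * g (- a\<^sup>2) = ennreal (kap a) * \<Psi> (cx a)"
   using hp kap_nonneg[OF True] by (simp add: mult.assoc[symmetric] ennreal_mult[symmetric])
  also have "... = (NN v. ennreal (kap a) * ennreal (HR de tu n v * (norm (Mm ?ep (cx a) (iu v)) * ww v)))"
   unfolding \<Psi>_def by (rule nn_integral_cmult[symmetric]) measurable
  also have "... = (NN v. ennreal (?A v) * ennreal (kap a * MA ?ep v a))"
   using kap_nonneg[OF True] by (intro nn_integral_cong) (simp add: MA_def ennreal_mult[symmetric] ww_nonneg HR_nonneg[OF de tu] mult_ac)
  finally show ?thesis using True by simp
 qed simp
 also have "(NN v. ennreal (?A v) * (NN u. ennreal (hR a u * MR ?ep v u * ww u))) + (NN v. ennreal (?A v) * (if a < 0 then ennreal (kap a * MA ?ep v a) else 0))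
  = (NN v. ennreal (?A v) * (NN u. ennreal (hR a u * MR ?ep v u * ww u)) + ennreal (?A v) * (if a < 0 then ennreal (kap a * MA ?ep v a) else 0))"
 proof (rule nn_integral_add[symmetric])
  show "(%v. ennreal (?A v) * (if a < 0 then ennreal (kap a * MA ?ep v a) else 0)) \<in> borel_measurable lborel"
   by (cases "a < 0") (simp_all add: MA_def)
 qed measurable
 also have "... = (NN v. ennreal (HR de tu n v * (hR (a + ?ep) v * ww v)))" unfolding distrib_left[symmetric] entrance_law[OF a sn]
  by (intro nn_integral_cong) (simp add: ennreal_mult[symmetric] hR_nonneg ww_nonneg HR_nonneg[OF de tu] mult_ac)
 also have "... = ennreal (LBINT v. HR de tu n v * (hR (a + ?ep) v * ww v))"
  by (intro nn_integral_eq_integral HR_hR_integrable[OF de tu] sn AE_I2 mult_nonneg_nonneg HR_nonneg[OF de tu] hR_nonneg ww_nonneg)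
 finally show ?thesis by (simp add: f_def)
qed

end

section \<open>Joint functionals of the Brownian motion and Y\<close>

lemma (in prob_space) indep_var_nn_integral_mult:
 fixes F G :: "_ => ennreal"
 assumes ind: "indep_var S X T Y" and F[measurable]: "F \<in> borel_measurable S" and G[measurable]: "G \<in> borel_measurable T"
 shows "(\<integral>\<^sup>+om. F (X om) * G (Y om) \<partial>M) = (\<integral>\<^sup>+om. F (X om) \<partial>M) * (\<integral>\<^sup>+om. G (Y om) \<partial>M)"
proof -
 let ?A = "\<integral>\<^sup>+y. G y \<partial>distr M T Y"
 have X[measurable]: "X \<in> measurable M S" and Y[measurable]: "Y \<in> measurable M T"
  and eq: "distr M S X \<Otimes>\<^sub>M distr M T Y = distr M (S \<Otimes>\<^sub>M T) (%x. (X x, Y x))"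
  using ind unfolding indep_var_distribution_eq by auto
 interpret D1: prob_space "distr M S X" by (rule prob_space_distr) measurable
 interpret D2: prob_space "distr M T Y" by (rule prob_space_distr) measurable
 have "(\<integral>\<^sup>+om. F (X om) * G (Y om) \<partial>M) = (\<integral>\<^sup>+p. F (fst p) * G (snd p) \<partial>distr M (S \<Otimes>\<^sub>M T) (%x. (X x, Y x)))"
  by (subst nn_integral_distr) simp_all
 also have "... = (\<integral>\<^sup>+x. \<integral>\<^sup>+y. F x * G y \<partial>distr M T Y \<partial>distr M S X)"
  unfolding eq[symmetric] by (subst D2.nn_integral_fst[symmetric]) simp_all
 also have "... = (\<integral>\<^sup>+x. F x * ?A \<partial>distr M S X)"
  by (intro nn_integral_cong nn_integral_cmult) simp
 also have "... = (\<integral>\<^sup>+x. F x \<partial>distr M S X) * ?A"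
  by (intro nn_integral_multc) simp
 also have "... = (\<integral>\<^sup>+om. F (X om) \<partial>M) * (\<integral>\<^sup>+om. G (Y om) \<partial>M)" by (simp add: nn_integral_distr)
 finally show ?thesis .
qed

lemma normal_exp_integral:
 assumes "sg > 0"
 shows "(NN x. ennreal (normal_density 0 sg x) * ennreal (exp (te * x))) = ennreal (exp (te^2 * sg^2 / 2))"
proof -
 let ?A = "1 / sqrt (2 * pi * sg^2)"
 define b where "b = 1 / (2 * sg^2)"
 have b: "b > 0" using assms by (simp add: b_def)
 have e: "normal_density 0 sg x * exp (te * x) = ?A * exp (- b * x^2 + te * x)" for x
  unfolding normal_density_def exp_add by (simp add: b_def)
 have "(NN x. ennreal (normal_density 0 sg x) * ennreal (exp (te * x))) = (NN x. ennreal (?A * exp (- b * x^2 + te * x)))"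
  by (simp add: ennreal_mult[symmetric] e)
 also have "... = ennreal (LBINT x. ?A * exp (- b * x^2 + te * x))"
  by (intro nn_integral_eq_integral integrable_mult_right gaussian_integral(1)[OF b]) auto
 also have "(LBINT x. ?A * exp (- b * x^2 + te * x)) = ?A * (sqrt (pi / b) * exp (te^2 / (4 * b)))"
  unfolding integral_mult_right_zero gaussian_integral(2)[OF b] ..
 also have "pi / b = 2 * pi * sg^2" by (simp add: b_def)
 also have "te^2 / (4 * b) = te^2 * sg^2 / 2" by (simp add: b_def)
 finally show ?thesis using assms by simp
qed

lemma brownian_exp:
 fixes u te :: "nat => real"
 assumes BM: "standard_brownian_motion M B" and u: "0 <= u 0" "!!k. k < n ==> u k < u (Suc k)"
 shows "(\<integral>\<^sup>+om. ennreal (exp (\<Sum>k<n. te k * (B (u (Suc k)) om - B (u k) om))) \<partial>M) = ennreal (exp (\<Sum>k<n. (te k)^2 * (u (Suc k) - u k) / 2))"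
proof -
 let ?A = "%k u. \<integral>\<^sup>+om. ennreal (exp (te k * (B (u (Suc k)) om - B (u k) om))) \<partial>M"
 let ?B = "%k u. exp ((te k)^2 * (u (Suc k) - u k) / 2)"
 interpret prob_space M using BM by (simp add: standard_brownian_motion_def)
 have pos: "0 <= u k" if "k <= n" for k using that
 proof (induction k)
  case (Suc k)
  then show ?case using u(2)[of k] by simp
 qed (use u in simp)
 have ind: "indep_vars (%_. borel) (%k om. B (u (Suc k)) om - B (u k) om) {..<n}" using BM u unfolding standard_brownian_motion_def by blast
 have "(\<integral>\<^sup>+om. ennreal (exp (\<Sum>k<n. te k * (B (u (Suc k)) om - B (u k) om))) \<partial>M) = (\<integral>\<^sup>+om. (\<Prod>k<n. ennreal (exp (te k * (B (u (Suc k)) om - B (u k) om)))) \<partial>M)"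
  by (simp add: exp_sum prod_ennreal)
 also have "... = (\<Prod>k<n. \<integral>\<^sup>+om. ennreal (exp (te k * (B (u (Suc k)) om - B (u k) om))) \<partial>M)"
  by (intro indep_vars_nn_integral indep_vars_compose2[OF ind]) auto
 also have "... = (\<Prod>k<n. ennreal (?B k u))"
 proof (intro prod.cong refl)
  fix k assume "k \<in> {..<n}"
  then have k: "0 <= u k" "u k < u (Suc k)" using pos[of k] u(2)[of k] by auto
  have d: "distributed M lborel (%om. B (u (Suc k)) om - B (u k) om) (%x. ennreal (normal_density 0 (sqrt (u (Suc k) - u k)) x))"
   using BM k unfolding standard_brownian_motion_def by blast
  have "(?A k u) = (NN x. ennreal (normal_density 0 (sqrt (u (Suc k) - u k)) x) * ennreal (exp (te k * x)))"
   by (rule distributed_nn_integral[OF d, symmetric]) simp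
  also have "... = ennreal (?B k u)" using k by (subst normal_exp_integral) simp_all
  finally show "(?A k u) = ennreal (?B k u)" .
 qed
 also have "... = ennreal (exp (\<Sum>k<n. (te k)^2 * (u (Suc k) - u k) / 2))" by (simp add: exp_sum prod_ennreal)
 finally show ?thesis .
qed

text \<open>The normalising constant is a separate argument, so that reversing time exchanges
  \<open>a\<close> and \<open>c\<close> in the exponents and leaves the constant as it is.\<close>

definition ydens :: "real => real => real => (nat => real) => nat => (nat => real) => real" where
 "ydens ka a c v n x = ka * exp (c * x 0 + a * x (Suc n)) * (\<Prod>k=1..Suc n. p_kernel (v k - v (k - 1)) (x (k - 1)) (x k))"

lemma brownian_Y:
 fixes u v te :: "nat => real"
 assumes BM: "standard_brownian_motion M B" and Y: "Y_process (1 / 4) a c M Y" and ind: "indep_processes M {0..} B {0..1 / 4} Y"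
  and u: "0 <= u 0" "!!k. k < Suc n ==> u k < u (Suc k)"
  and v: "v 0 = 0" "!!k. k <= n ==> v k < v (Suc k)" "v (Suc n) = 1 / 4"
  and g: "g \<in> borel_measurable (PiM {0..Suc n} (%_. lborel))"
 shows "(\<integral>\<^sup>+om. ennreal (exp (\<Sum>k<Suc n. te k * (B (u (Suc k)) om - B (u k) om))) * g (\<lambda>k\<in>{0..Suc n}. Y (v k) om) \<partial>M) =
  ennreal (exp (\<Sum>k<Suc n. (te k)^2 * (u (Suc k) - u k) / 2)) * (\<integral>\<^sup>+x. ennreal (ydens (1 / C_norm (1 / 4) a c) a c v n x) * g x \<partial>PiM {0..Suc n} (%_. lborel))"
proof -
 interpret prob_space M using BM by (simp add: standard_brownian_motion_def)
 have upos: "0 <= u k" if "k <= Suc n" for k using that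
 proof (induction k)
  case (Suc k)
  then show ?case using u(2)[of k] by simp
 qed (use u in simp)
 have vr: "0 <= v k & v k <= 1 / 4" if "k <= Suc n" for k
 proof -
  have mono: "v i <= v j" if "i <= j" "j <= Suc n" for i j using that
  proof (induction j)
   case (Suc j)
   then show ?case using v(2)[of j] by (cases "i = Suc j") auto
  qed simp
  show ?thesis using mono[of 0 k] mono[of k "Suc n"] that v by simp
 qed
 define F where "F b = ennreal (exp (\<Sum>k<Suc n. te k * (b (u (Suc k)) - b (u k))))" for b :: "real => real"
 define G where "G y = g (\<lambda>k\<in>{0..Suc n}. y (v k))" for y :: "real => real"
 have F: "F \<in> borel_measurable (PiM {0..} (%_. borel))"
 proof -
  have c[measurable]: "(%b. b (u k)) \<in> borel_measurable (PiM {0..} (%_. borel))" if "k <= Suc n" for k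
   using upos[OF that] by (intro measurable_component_singleton) simp
  have "(%b. \<Sum>k<Suc n. te k * (b (u (Suc k)) - b (u k))) \<in> borel_measurable (PiM {0..} (%_. borel))"
   by (intro borel_measurable_sum borel_measurable_times borel_measurable_diff borel_measurable_const c) auto
  then show ?thesis unfolding F_def[abs_def] by measurable
 qed
 have G: "G \<in> borel_measurable (PiM {0..1 / 4} (%_. borel))"
 proof -
  have "(%y. \<lambda>k\<in>{0..Suc n}. y (v k)) \<in> measurable (PiM {0..1 / 4} (%_. borel)) (PiM {0..Suc n} (%_. lborel))"
  proof (rule measurable_restrict)
   fix k assume "k \<in> {0..Suc n}"
   then have "(%y. y (v k)) \<in> measurable (PiM {0..1 / 4} (%_. borel)) borel" using vr[of k] by (intro measurable_component_singleton) simp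
   then show "(%y. y (v k)) \<in> measurable (PiM {0..1 / 4} (%_. borel)) lborel" by simp
  qed
  then show ?thesis unfolding G_def[abs_def] by (rule measurable_compose) (rule g)
 qed
 have FB: "F (\<lambda>s\<in>{0..}. B s om) = ennreal (exp (\<Sum>k<Suc n. te k * (B (u (Suc k)) om - B (u k) om)))" for om
 proof -
  have "(\<Sum>k<Suc n. te k * ((\<lambda>s\<in>{0..}. B s om) (u (Suc k)) - (\<lambda>s\<in>{0..}. B s om) (u k))) = (\<Sum>k<Suc n. te k * (B (u (Suc k)) om - B (u k) om))"
   by (intro sum.cong refl) (simp add: upos)
  then show ?thesis by (simp only: F_def)
 qed
 have GY: "G (\<lambda>t\<in>{0..1 / 4}. Y t om) = g (\<lambda>k\<in>{0..Suc n}. Y (v k) om)" for om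
 proof -
  have "(\<lambda>k\<in>{0..Suc n}. (\<lambda>t\<in>{0..1 / 4}. Y t om) (v k)) = (\<lambda>k\<in>{0..Suc n}. Y (v k) om)"
   using vr by (intro restrict_ext) auto
  then show ?thesis by (simp only: G_def)
 qed
 have d: "distributed M (PiM {0..Suc n} (%_. lborel)) (%om. \<lambda>k\<in>{0..Suc n}. Y (v k) om) (%x. ennreal (ydens (1 / C_norm (1 / 4) a c) a c v n x))"
  using Y v unfolding Y_process_def ydens_def by blast
 have e1: "(\<integral>\<^sup>+om. F (\<lambda>s\<in>{0..}. B s om) \<partial>M) = ennreal (exp (\<Sum>k<Suc n. (te k)^2 * (u (Suc k) - u k) / 2))"
  unfolding FB by (rule brownian_exp[OF BM u]) auto
 have e2: "(\<integral>\<^sup>+om. G (\<lambda>t\<in>{0..1 / 4}. Y t om) \<partial>M) = (\<integral>\<^sup>+x. ennreal (ydens (1 / C_norm (1 / 4) a c) a c v n x) * g x \<partial>PiM {0..Suc n} (%_. lborel))"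
  unfolding GY by (rule distributed_nn_integral[OF d g, symmetric])
 have "(\<integral>\<^sup>+om. F (\<lambda>s\<in>{0..}. B s om) * G (\<lambda>t\<in>{0..1 / 4}. Y t om) \<partial>M) = (\<integral>\<^sup>+om. F (\<lambda>s\<in>{0..}. B s om) \<partial>M) * (\<integral>\<^sup>+om. G (\<lambda>t\<in>{0..1 / 4}. Y t om) \<partial>M)"
  using ind unfolding indep_processes_def by (rule indep_var_nn_integral_mult) (fact F, fact G)
 then show ?thesis unfolding e1 e2 unfolding FB GY .
qed

section \<open>Time reversal\<close>

lemma measurable_reverse:
 fixes n :: nat
 shows "(%x. \<lambda>k\<in>{0..n}. x (n - k)) \<in> measurable (PiM {0..n} (%_. lborel)) (PiM {0..n} (%_. lborel :: real measure))"
proof (rule measurable_restrict)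
 fix k assume "k \<in> {0..n}"
 then have "n - k \<in> {0..n}" by simp
 then show "(%x. x (n - k)) \<in> measurable (PiM {0..n} (%_. lborel)) (lborel :: real measure)" by (rule measurable_component_singleton)
qed

lemma PiM_lborel_reverse:
 fixes n :: nat
 shows "distr (PiM {0..n} (%_. lborel)) (PiM {0..n} (%_. lborel)) (%x. \<lambda>k\<in>{0..n}. x (n - k)) = (PiM {0..n} (%_. lborel :: real measure))"
proof -
 interpret product_sigma_finite "%_ :: nat. lborel :: real measure" ..
 note m = measurable_reverse[of n]
 show ?thesis
 proof (rule PiM_eqI)
  fix A :: "nat => real set" assume A: "!!i. i \<in> {0..n} ==> A i \<in> sets lborel"
  have "(%x. \<lambda>k\<in>{0..n}. x (n - k)) -` Pi\<^sub>E {0..n} A \<inter> space (PiM {0..n} (%_. lborel)) = Pi\<^sub>E {0..n} (%k. A (n - k))"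
  proof (intro set_eqI iffI)
   fix x assume x: "x \<in> (%x. \<lambda>k\<in>{0..n}. x (n - k)) -` Pi\<^sub>E {0..n} A \<inter> space (PiM {0..n} (%_. lborel))"
   have "x k \<in> A (n - k)" if "k \<in> {0..n}" for k
   proof -
    have x': "(\<lambda>k\<in>{0..n}. x (n - k)) \<in> Pi\<^sub>E {0..n} A" using x by blast
    show ?thesis using PiE_mem[OF x', of "n - k"] that by simp
   qed
   moreover have "x \<in> extensional {0..n}" using x by (auto simp: space_PiM PiE_def)
   ultimately show "x \<in> Pi\<^sub>E {0..n} (%k. A (n - k))" by (auto simp: PiE_def)
  next
   fix x assume x: "x \<in> Pi\<^sub>E {0..n} (%k. A (n - k))"
   have "x (n - k) \<in> A k" if "k \<in> {0..n}" for k using PiE_mem[OF x, of "n - k"] that by simp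
   then show "x \<in> (%x. \<lambda>k\<in>{0..n}. x (n - k)) -` Pi\<^sub>E {0..n} A \<inter> space (PiM {0..n} (%_. lborel))"
    using x by (auto simp: space_PiM PiE_def)
  qed
  moreover have "Pi\<^sub>E {0..n} A \<in> sets (PiM {0..n} (%_. lborel :: real measure))" using A by (intro sets_PiM_I_finite) auto
  ultimately have "emeasure (distr (PiM {0..n} (%_. lborel)) (PiM {0..n} (%_. lborel)) (%x. \<lambda>k\<in>{0..n}. x (n - k))) (Pi\<^sub>E {0..n} A) = emeasure (PiM {0..n} (%_. lborel)) (Pi\<^sub>E {0..n} (%k. A (n - k)))"
   by (simp add: emeasure_distr[OF m])
  also have "... = (\<Prod>k\<in>{0..n}. emeasure lborel (A (n - k)))" using A by (intro emeasure_PiM) auto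
  also have "... = (\<Prod>k\<in>{0..n}. emeasure lborel (A k))" by (rule prod.reindex_bij_witness[where i = "%k. n - k" and j = "%k. n - k"]) auto
  finally show "emeasure (distr (PiM {0..n} (%_. lborel)) (PiM {0..n} (%_. lborel)) (%x. \<lambda>k\<in>{0..n}. x (n - k))) (Pi\<^sub>E {0..n} A) = (\<Prod>k\<in>{0..n}. emeasure lborel (A k))" .
 qed auto
qed

text \<open>The joint law of the increments of a Brownian motion (run at half speed) and an independent process \<open>Z\<close>
 whose law has density proportional to that of \<open>Y\<^bsub>t/4\<^esub>\<close>. Reversing time exchanges \<open>a\<close> and \<open>c\<close>.\<close>

definition BZ :: "real => real => real => 'a measure => (real => 'a => real) => (real => 'a => real) => bool" where
 "BZ ka a c M Bp Z \<longleftrightarrow> (\<forall>n t te g. t 0 = 0 & (\<forall>k\<le>n. t k < t (Suc k)) & t (Suc n) = 1 & g \<in> borel_measurable (PiM {0..Suc n} (%_. lborel)) -->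
  (\<integral>\<^sup>+om. ennreal (exp (\<Sum>k=1..Suc n. te k * (Bp (t k) om - Bp (t (k - 1)) om))) * g (\<lambda>k\<in>{0..Suc n}. Z (t k) om) \<partial>M) =
  ennreal (exp (\<Sum>k=1..Suc n. (te k)^2 * (t k - t (k - 1)) / 4)) * (\<integral>\<^sup>+x. ennreal (ydens ka a c (%k. t k / 4) n x) * g x \<partial>PiM {0..Suc n} (%_. lborel)))"

lemma sum_shift_Suc: "(\<Sum>k=1..n. f k) = (\<Sum>k<n. f (Suc k))" for f :: "nat => real"
 by (rule sum.reindex_bij_witness[where i = Suc and j = "%k. k - 1"]) auto

context
 fixes M :: "'a measure" and a c and B Y
 assumes BM: "standard_brownian_motion M B" and Y: "Y_process (1 / 4) a c M Y" and ind: "indep_processes M {0..} B {0..1 / 4} Y"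
begin

lemma BZ_forward: "BZ (1 / C_norm (1 / 4) a c) a c M (%t. B (t / 2)) (%t. Y (t / 4))" unfolding BZ_def
proof (intro allI impI, elim conjE)
 fix n :: nat and t te :: "nat => real" and g :: "(nat => real) => ennreal"
 assume t: "t 0 = 0" "\<forall>k\<le>n. t k < t (Suc k)" "t (Suc n) = 1" and g: "g \<in> borel_measurable (PiM {0..Suc n} (%_. lborel))"
 have 1: "(\<Sum>k<Suc n. te (Suc k) * (B (t (Suc k) / 2) om - B (t k / 2) om)) = (\<Sum>k=1..Suc n. te k * (B (t k / 2) om - B (t (k - 1) / 2) om))" for om
  by (simp only: sum_shift_Suc diff_Suc_1)
 have 2: "(\<Sum>k<Suc n. (te (Suc k))^2 * (t (Suc k) / 2 - t k / 2) / 2) = (\<Sum>k=1..Suc n. (te k)^2 * (t k - t (k - 1)) / 4)"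
  unfolding sum_shift_Suc by (intro sum.cong refl) (simp add: field_simps)
 show "(\<integral>\<^sup>+om. ennreal (exp (\<Sum>k=1..Suc n. te k * (B (t k / 2) om - B (t (k - 1) / 2) om))) * g (\<lambda>k\<in>{0..Suc n}. Y (t k / 4) om) \<partial>M) =
  ennreal (exp (\<Sum>k=1..Suc n. (te k)^2 * (t k - t (k - 1)) / 4)) * (\<integral>\<^sup>+x. ennreal (ydens (1 / C_norm (1 / 4) a c) a c (%k. t k / 4) n x) * g x \<partial>PiM {0..Suc n} (%_. lborel))"
  using brownian_Y[OF BM Y ind, of "%k. t k / 2" n "%k. t k / 4" g "%k. te (Suc k)"] t g unfolding 1 2 by simp
qed

text \<open>Product Lebesgue measure is invariant under reversing the order of the coordinates, and
  \<open>p_kernel\<close> is symmetric; the reversed density therefore differs only in that the end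
  point weights are exchanged.\<close>

lemma BZ_backward: "BZ (1 / C_norm (1 / 4) a c) c a M (%t. B ((1 - t) / 2)) (%t. Y ((1 - t) / 4))" unfolding BZ_def
proof (intro allI impI, elim conjE)
 fix n :: nat and t te :: "nat => real" and g :: "(nat => real) => ennreal"
 assume t: "t 0 = 0" "\<forall>k\<le>n. t k < t (Suc k)" "t (Suc n) = 1" and g[measurable]: "g \<in> borel_measurable (PiM {0..Suc n} (%_. lborel))"
 let ?d = "Suc n" and ?ka = "1 / C_norm (1 / 4) a c"
 let ?P = "PiM {0..?d} (%_. lborel :: real measure)"
 define rev where "rev x = (\<lambda>k\<in>{0..?d}. x (?d - k))" for x :: "nat => real"
 have rm[measurable]: "rev \<in> measurable ?P ?P" unfolding rev_def[abs_def] by (rule measurable_reverse)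
 define t' where "t' k = 1 - t (?d - k)" for k
 have t': "t' 0 = 0" "!!k. k <= n ==> t' k < t' (Suc k)" "t' ?d = 1"
 proof -
  show "t' 0 = 0" "t' ?d = 1" using t by (simp_all add: t'_def)
  fix k assume "k <= n"
  then show "t' k < t' (Suc k)" using t(2)[rule_format, of "n - k"] by (simp add: t'_def Suc_diff_le)
 qed
 have g': "(%x. g (rev x)) \<in> borel_measurable ?P" by measurable
 \<comment> \<open>The increments of the reversed Brownian motion change sign as well as order,
   hence \<open>- te (?d - k)\<close>.\<close>
 note main = brownian_Y[OF BM Y ind, of "%k. t' k / 2" n "%k. t' k / 4" "%x. g (rev x)" "%k. - te (?d - k)"]
 have 1: "(\<Sum>k<Suc n. - te (?d - k) * (B (t' (Suc k) / 2) om - B (t' k / 2) om)) = (\<Sum>k=1..Suc n. te k * (B ((1 - t k) / 2) om - B ((1 - t (k - 1)) / 2) om))" for om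
  by (rule sum.reindex_bij_witness[where i = "%k. ?d - k" and j = "%k. ?d - k"]) (auto simp: t'_def algebra_simps)
 have 2: "(\<Sum>k<Suc n. (- te (?d - k))^2 * (t' (Suc k) / 2 - t' k / 2) / 2) = (\<Sum>k=1..Suc n. (te k)^2 * (t k - t (k - 1)) / 4)"
  by (rule sum.reindex_bij_witness[where i = "%k. ?d - k" and j = "%k. ?d - k"]) (auto simp: t'_def field_simps)
 have 3: "rev (\<lambda>k\<in>{0..?d}. Y (t' k / 4) om) = (\<lambda>k\<in>{0..?d}. Y ((1 - t k) / 4) om)" for om
  unfolding rev_def by (intro restrict_ext) (auto simp: t'_def)
 have yr: "ydens ?ka a c (%k. t' k / 4) n (rev x) = ydens ?ka c a (%k. t k / 4) n x" for x
 proof -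
  have "(\<Prod>k=1..?d. p_kernel (t' k / 4 - t' (k - 1) / 4) (rev x (k - 1)) (rev x k)) = (\<Prod>k=1..?d. p_kernel (t k / 4 - t (k - 1) / 4) (x (k - 1)) (x k))"
  proof (rule prod.reindex_bij_witness[where i = "%k. Suc ?d - k" and j = "%k. Suc ?d - k"])
   fix k assume k: "k \<in> {1..?d}"
   have "Suc ?d - k - 1 = ?d - k" "?d - (k - 1) = Suc ?d - k" using k by auto
   then have "t' k / 4 - t' (k - 1) / 4 = t (Suc ?d - k) / 4 - t (Suc ?d - k - 1) / 4" "rev x (k - 1) = x (Suc ?d - k)" "rev x k = x (Suc ?d - k - 1)"
    using k by (auto simp: t'_def rev_def diff_divide_distrib)
   then show "p_kernel (t (Suc ?d - k) / 4 - t (Suc ?d - k - 1) / 4) (x (Suc ?d - k - 1)) (x (Suc ?d - k)) = p_kernel (t' k / 4 - t' (k - 1) / 4) (rev x (k - 1)) (rev x k)"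
    by (simp only: p_kernel_commute)
  qed auto
  then show ?thesis unfolding ydens_def by (simp add: rev_def add.commute)
 qed
 have rr: "rev (rev x) = x" if "x \<in> space ?P" for x using that by (auto simp: rev_def space_PiM PiE_def extensional_def)
 have ym: "(%x. ennreal (ydens ?ka a c (%k. t' k / 4) n x) * g (rev x)) \<in> borel_measurable ?P"
 proof -
  have cm[measurable]: "(%x. x k) \<in> borel_measurable ?P" if "k <= ?d" for k
   using measurable_component_singleton[of k "{0..?d}" "%_. lborel"] that by simp
  have tk: "t' (k - Suc 0) < t' k" if "Suc 0 <= k" "k <= ?d" for k using t'(2)[of "k - 1"] that by simp
  have "ydens ?ka a c (%k. t' k / 4) n \<in> borel_measurable ?P" unfolding ydens_def[abs_def]
   by (intro borel_measurable_times borel_measurable_prod borel_measurable_p_kernel cm measurable_compose[OF _ borel_measurable_exp] borel_measurable_add borel_measurable_const) (auto simp: tk)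
  then show ?thesis by measurable
 qed
 have "(\<integral>\<^sup>+x. ennreal (ydens ?ka a c (%k. t' k / 4) n x) * g (rev x) \<partial>?P) = (\<integral>\<^sup>+x. ennreal (ydens ?ka a c (%k. t' k / 4) n x) * g (rev x) \<partial>distr ?P ?P rev)"
  using PiM_lborel_reverse[of ?d] by (simp only: rev_def[abs_def])
 also have "... = (\<integral>\<^sup>+x. ennreal (ydens ?ka a c (%k. t' k / 4) n (rev x)) * g (rev (rev x)) \<partial>?P)"
  by (rule nn_integral_distr[OF rm]) (use ym in simp)
 also have "... = (\<integral>\<^sup>+x. ennreal (ydens ?ka c a (%k. t k / 4) n x) * g x \<partial>?P)" by (rule nn_integral_cong) (simp only: yr rr)
 finally have 4: "(\<integral>\<^sup>+x. ennreal (ydens ?ka a c (%k. t' k / 4) n x) * g (rev x) \<partial>?P) = (\<integral>\<^sup>+x. ennreal (ydens ?ka c a (%k. t k / 4) n x) * g x \<partial>?P)" .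
 show "(\<integral>\<^sup>+om. ennreal (exp (\<Sum>k=1..Suc n. te k * (B ((1 - t k) / 2) om - B ((1 - t (k - 1)) / 2) om))) * g (\<lambda>k\<in>{0..Suc n}. Y ((1 - t k) / 4) om) \<partial>M) =
  ennreal (exp (\<Sum>k=1..Suc n. (te k)^2 * (t k - t (k - 1)) / 4)) * (\<integral>\<^sup>+x. ennreal (ydens ?ka c a (%k. t k / 4) n x) * g x \<partial>?P)"
  using main[unfolded 1 2 3 4] t' g' by (simp add: divide_strict_right_mono)
qed

text \<open>\<open>Y_process\<close> speaks only of vectors along grids from 0 to 1/4, so the time
  is placed in such a grid: one step for the end points, two steps for an interior time.\<close>

lemma Y_measurable:
 assumes "t \<in> {0..1 / 4}"
 shows "Y t \<in> borel_measurable M"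
proof -
 have gen: "Y (v k) \<in> borel_measurable M" if v: "v 0 = 0" "\<forall>k\<le>d. v k < v (Suc k)" "v (Suc d) = 1 / 4" and k: "k <= Suc d" for d v and k :: nat
 proof -
  have "distributed M (PiM {0..Suc d} (%_. lborel)) (%om. \<lambda>k\<in>{0..Suc d}. Y (v k) om) (%x. ennreal (ydens (1 / C_norm (1 / 4) a c) a c v d x))"
   using Y v unfolding Y_process_def ydens_def by blast
  then have "(%om. \<lambda>k\<in>{0..Suc d}. Y (v k) om) \<in> measurable M (PiM {0..Suc d} (%_. lborel))" by (simp add: distributed_def)
  from measurable_compose[OF this measurable_component_singleton[of k "{0..Suc d}"]] k
  show ?thesis by simp
 qed
 show ?thesis
 proof (cases "t = 0 \<or> t = 1 / 4")
  case True
  have "Y 0 \<in> borel_measurable M" "Y (1 / 4) \<in> borel_measurable M" using gen[of "%k. real k / 4" 0 0] gen[of "%k. real k / 4" 0 1] by simp_all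
  then show ?thesis using True by metis
 next
  case False
  define v where "v k = (if k = 0 then 0 else if k = 1 then t else (1 / 4 :: real))" for k :: nat
  have "\<forall>k\<le>1. v k < v (Suc k)" using False assms by (auto simp: v_def le_Suc_eq)
  then have "Y (v 1) \<in> borel_measurable M" by (intro gen[of v 1 1]) (auto simp: v_def)
  then show ?thesis by (simp add: v_def)
 qed
qed

text \<open>Otherwise \<open>1 / C_norm\<close> would be nonpositive, the value 0 for a vanishing
  denominator included. The density would then be nonpositive and the law of \<open>Y\<close> would
  have mass 0.\<close>

lemma C_norm_pos: "C_norm (1 / 4) a c > 0"
proof (rule ccontr)
 assume "\<not> C_norm (1 / 4) a c > 0"
 then have neg: "1 / C_norm (1 / 4) a c <= 0" by (simp add: divide_nonneg_nonpos)
 interpret prob_space M using BM by (simp add: standard_brownian_motion_def)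
 have "ydens (1 / C_norm (1 / 4) a c) a c (%k. real k / 4) 0 x <= 0" for x
  unfolding ydens_def by (intro mult_nonpos_nonneg[OF mult_nonpos_nonneg[OF neg]] prod_nonneg ballI p_kernel_nonneg) auto
 then have "ennreal (ydens (1 / C_norm (1 / 4) a c) a c (%k. real k / 4) 0 x) = 0" for x by (simp add: ennreal_neg)
 then have "(\<integral>\<^sup>+om. ennreal (exp (\<Sum>k=1..Suc 0. (0 :: real) * (B (real k / 2) om - B (real (k - 1) / 2) om))) * 1 \<partial>M) = 0"
  using BZ_forward[unfolded BZ_def, rule_format, of "%k. real k" 0 "%_. 1" "%_. 0"] by simp
 then show False by (simp add: emeasure_space_1)
qed

end

section \<open>Identification of the laws\<close>

lemma abel_summation:
 fixes s b :: "nat => real"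
 shows "(\<Sum>k=1..d. (s k - s (Suc k)) * b k) = (\<Sum>k=1..d. s k * (b k - b (k - 1))) + s 1 * b 0 - s (Suc d) * b d"
 by (induction d) (simp_all add: algebra_simps)

text \<open>The exponents of \<open>x 0\<close>, ..., \<open>x n\<close> after summation by parts.
  The value 1 beyond \<open>n\<close> is a filler that keeps the whole sequence positive.\<close>

definition dl :: "real => (nat => real) => nat => nat => real" where
 "dl c s n k = (if k = 0 then c - s 1 else if k <= n then s k - s (Suc k) else 1)"

text \<open>The steps of the grid on the clock of \<open>Y\<close>, which runs at a quarter of the
  speed; again 1 is a positive filler.\<close>

definition ta :: "(nat => real) => nat => nat => real" where
 "ta t n k = (if k \<in> {1..Suc n} then (t k - t (k - 1)) / 4 else 1)"

text \<open>The part of the two Laplace transforms that depends on \<open>s\<close> in the same way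
  on both sides, apart from the Gaussian factor \<open>Gs\<close>.\<close>

definition TOT :: "real => real => (nat => real) => (nat => real) => nat => real" where
 "TOT a c s t n = (LBINT v. HR (dl c s n) (ta t n) n v * (hR (a + s (Suc n)) v * ww v))"

definition Gs :: "(nat => real) => (nat => real) => nat => real" where
 "Gs s t n = exp (\<Sum>k=1..Suc n. (s k)^2 * (t k - t (k - 1)) / 4)"

text \<open>The initial value is counted as 0, so the partial sums are the values
  \<open>X (t m)\<close> themselves, which is what \<open>H_laplace\<close> refers to.\<close>

definition inc0 :: "(real => 'a => real) => (nat => real) => nat => 'a => real" where
 "inc0 X t k om = X (t k) om - (if k = 1 then 0 else X (t (k - 1)) om)"

lemma inc0_sum: "(\<Sum>k=1..m. inc0 X t k om) = (if m = 0 then 0 else X (t m) om)" by (induction m) (auto simp: inc0_def)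

lemma inc0_abel:
 assumes "s (Suc d) = 0"
 shows "(\<Sum>k=1..d. s k * inc0 X t k om) = (\<Sum>k=1..d. (s k - s (Suc k)) * X (t k) om)"
proof -
 define b where "b k = (if k = 0 then 0 else X (t k) om)" for k
 have "(\<Sum>k=1..d. (s k - s (Suc k)) * X (t k) om) = (\<Sum>k=1..d. (s k - s (Suc k)) * b k)" by (intro sum.cong) (auto simp: b_def)
 also have "... = (\<Sum>k=1..d. s k * (b k - b (k - 1)))" unfolding abel_summation using assms by (simp add: b_def)
 also have "... = (\<Sum>k=1..d. s k * inc0 X t k om)" by (intro sum.cong) (auto simp: b_def inc0_def)
 finally show ?thesis ..
qed

definition grid :: "(nat => real) => nat => bool" where
 "grid t n \<longleftrightarrow> t 0 = 0 & (\<forall>k\<le>n. t k < t (Suc k)) & t (Suc n) = 1"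

text \<open>The smallest positive exponent \<open>s (Suc n)\<close> is also required to exceed
  \<open>- a\<close>, as \<open>entrance_law\<close> demands. This still leaves an open set of
  exponents, enough for uniqueness.\<close>

definition box :: "real => real => (nat => real) => nat => bool" where
 "box a c s n \<longleftrightarrow> s 1 < min c 2 & (\<forall>k\<in>{1..n}. s (Suc k) < s k) & s (Suc n) > 0 & a + s (Suc n) > 0 & s (Suc (Suc n)) = 0"

lemma dl_pos: "box a c s n ==> dl c s n k > 0" by (auto simp: box_def dl_def)

lemma ta_pos: "grid t n ==> ta t n k > 0"
proof -
 assume g: "grid t n"
 have "t (k - 1) < t k" if "k \<in> {1..Suc n}" using g that unfolding grid_def by (cases k) auto
 then show ?thesis by (simp add: ta_def)
qed

lemma box_last: "box a c s n ==> s (Suc n) < c"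
proof -
 assume b: "box a c s n"
 have "s (Suc k) <= s 1" if "k <= n" for k using that
 proof (induction k)
  case (Suc k)
  then have "s (Suc (Suc k)) < s (Suc k)" using b by (simp add: box_def)
  then show ?case using Suc by simp
 qed simp
 then have "s (Suc n) <= s 1" by simp
 then show ?thesis using b by (auto simp: box_def)
qed

lemma p0_TOT:
 assumes "a > - 2" "c > 0" "a + c > 0" and b: "box a c s n" and g: "grid t n"
 shows "(\<integral>\<^sup>+x. markov_expect (T_trans c) 0 x (Lw s (Suc n)) (Fw (ta t n) (Suc n)) \<partial>p0 a c) = ennreal (Kp a c) * ennreal (TOT a c s t n)"
 unfolding TOT_def
proof (rule p0_chain)
 show "0 < ta t n k" for k by (rule ta_pos[OF g])
 show "0 < dl c s n k" for k by (rule dl_pos[OF b])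
 show "s (Suc n) < c" by (rule box_last[OF b])
qed (use assms(1-3) b in \<open>auto simp: dl_def box_def\<close>)

lemma laplace_X:
 assumes "a > - 2" "c > 0" "a + c > 0" and b: "box a c s n" and g: "grid t n" and L: "H_laplace a c N X"
 shows "(\<integral>\<^sup>+om. ennreal (exp (\<Sum>k=1..Suc n. - s k * inc0 X t k om)) \<partial>N) =
  ennreal (Gs s t n) * (ennreal (Kp a c) * ennreal (TOT a c s t n) / (\<integral>\<^sup>+x. ennreal (exp (- x / 4)) \<partial>p0 a c))"
proof -
 let ?A = "%T k. T k - T (k - 1)"
 let ?d = "Suc n"
 \<comment> \<open>\<open>H_laplace\<close> is used with \<open>d = Suc n\<close> and both final
   times equal to 1, so the state at parameter 0 enters with weight zero.\<close>
 define T where "T k = (if k <= ?d then t k else 1)" for k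
 have T: "T 0 = 0" "\<forall>k<?d. T k < T (Suc k)" "T ?d <= T (Suc ?d)" "T (Suc ?d) = 1" "T ?d = 1" using g by (auto simp: T_def grid_def)
 have s: "s 1 < min c 2" "\<forall>k\<in>{1..?d}. s k > s (Suc k)" "s (Suc ?d) = 0" using b by (auto simp: box_def le_Suc_eq)
 have Tk: "T k - T (k - 1) = t k - t (k - 1)" if "k \<in> {1..?d}" for k
 proof -
  have "k <= ?d" "k - 1 <= ?d" using that by auto
  then show ?thesis by (simp only: T_def if_True)
 qed
 have F: "ennreal (exp (- 1 / 4 * (\<Sum>k=1..Suc ?d. (?A T k) * (x # ys) ! (Suc ?d - k)))) = Fw (ta t n) ?d ys" for x ys
 proof -
  have "- 1 / 4 * (\<Sum>k=1..Suc ?d. (?A T k) * (x # ys) ! (Suc ?d - k)) = - 1 / 4 * (\<Sum>k=1..?d. (?A T k) * (x # ys) ! (Suc ?d - k))"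
   using T by simp
  also have "... = - (\<Sum>k=1..?d. ta t n k * ys ! (?d - k))"
  proof -
   have "(\<Sum>k=1..?d. (?A T k) * (x # ys) ! (Suc ?d - k)) = (\<Sum>k=1..?d. 4 * (ta t n k * ys ! (?d - k)))"
   proof (rule sum.cong[OF refl])
    fix k assume k: "k \<in> {1..?d}"
    then have "Suc ?d - k = Suc (?d - k)" by auto
    then show "(?A T k) * (x # ys) ! (Suc ?d - k) = 4 * (ta t n k * ys ! (?d - k))" unfolding Tk[OF k] using k by (simp add: ta_def)
   qed
   then show ?thesis by (simp only: sum_distrib_left[symmetric])
  qed
  finally show ?thesis by (simp only: Fw_def)
 qed
 have G: "1 / 4 * (\<Sum>k=1..Suc ?d. (?A T k) * (s k)^2) = (\<Sum>k=1..Suc n. (s k)^2 * (t k - t (k - 1)) / 4)"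
 proof -
  have "(\<Sum>k=1..Suc ?d. (?A T k) * (s k)^2) = (\<Sum>k=1..?d. (?A T k) * (s k)^2)" using T by simp
  also have "... = (\<Sum>k=1..?d. 4 * ((s k)^2 * (t k - t (k - 1)) / 4))"
  proof (rule sum.cong[OF refl])
   fix k assume "k \<in> {1..?d}"
   from Tk[OF this] show "(?A T k) * (s k)^2 = 4 * ((s k)^2 * (t k - t (k - 1)) / 4)" by simp
  qed
  finally show ?thesis by (simp only: sum_distrib_left[symmetric])
 qed
 have S: "- (\<Sum>k=1..?d. (s k - s (Suc k)) * X (T k) om) = (\<Sum>k=1..Suc n. - s k * inc0 X t k om)" for om
 proof -
  have "(\<Sum>k=1..?d. (s k - s (Suc k)) * X (T k) om) = (\<Sum>k=1..?d. (s k - s (Suc k)) * X (t k) om)" by (intro sum.cong refl) (simp add: T_def)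
  then show ?thesis using inc0_abel[of s ?d X t om] s(3) by (simp add: sum_negf)
 qed
 have "(\<integral>\<^sup>+om. ennreal (exp (- (\<Sum>k=1..?d. (s k - s (Suc k)) * X (T k) om))) \<partial>N) =
   ennreal (exp (1 / 4 * (\<Sum>k=1..Suc ?d. (?A T k) * (s k)^2))) *
   ((\<integral>\<^sup>+x. markov_expect (T_trans c) 0 x (map s (rev [1..<Suc ?d]))
     (%ys. ennreal (exp (- 1 / 4 * (\<Sum>k=1..Suc ?d. (?A T k) * (x # ys) ! (Suc ?d - k))))) \<partial>(p0 a c))
    / (\<integral>\<^sup>+x. ennreal (exp (- x / 4)) \<partial>(p0 a c)))" using L[unfolded H_laplace_def, rule_format, of ?d T s] T s by simp
 then show ?thesis unfolding F G S Lw_def[symmetric] p0_TOT[OF assms(1-3) b g] Gs_def[symmetric] .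
qed

text \<open>The Brownian increments give \<open>Gs\<close>. For the rest, summation by parts turns
  exponents of increments into exponents of the values \<open>x k\<close>, which brings the density
  of \<open>Z\<close> into the form \<open>chain\<close> with a last factor
  \<open>exp ((a + s (Suc n)) * x (Suc n))\<close>.\<close>

lemma laplace_W:
 assumes b: "box a c s n" and g: "grid t n" and bz: "BZ ka a c M Bp Z" and ka: "ka > 0"
 shows "(\<integral>\<^sup>+om. ennreal (exp (\<Sum>k=1..Suc n. - s k * inc0 (%t om. Bp t om - Bp 0 om - Z t om + Z 0 om) t k om)) \<partial>M) =
  ennreal (Gs s t n) * (ennreal ka * ennreal (TOT a c s t n))"
proof -
 let ?A = "%t om. Bp t om - Bp 0 om - Z t om + Z 0 om"
 let ?B = "%x k. x k - x (k - 1)"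
 let ?d = "Suc n" and ?de = "dl c s n" and ?tu = "ta t n"
 let ?P = "PiM {0..?d} (%_. lborel :: real measure)"
 note de = dl_pos[OF b] and tu = ta_pos[OF g]
 note chain_nonneg = chain_nonneg[where de = ?de and tu = ?tu, OF de tu]
  and chain_measurable = chain_measurable[where de = ?de and tu = ?tu, OF de tu]
  and chain_integral = chain_integral[where de = ?de and tu = ?tu, OF de tu]
  and nn_GG_final = nn_GG_final[where de = ?de and tu = ?tu, OF de tu]
 have e: "a + s ?d > 0" and s0: "s (Suc ?d) = 0" using b by (auto simp: box_def)
 have t0: "t 0 = 0" using g by (simp add: grid_def)
 define h where "h x = ennreal (exp (\<Sum>k=1..?d. s k * (?B x k)))" for x :: "nat => real"
 have cm: "(%x. x k) \<in> borel_measurable ?P" if "k <= ?d" for k using measurable_component_singleton[of k "{0..?d}" "%_. lborel"] that by simp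
 have hm: "h \<in> borel_measurable ?P"
 proof -
  have "(%x. \<Sum>k=1..?d. s k * (?B x k)) \<in> borel_measurable ?P"
   by (intro borel_measurable_sum borel_measurable_times borel_measurable_diff borel_measurable_const cm) auto
  then show ?thesis unfolding h_def[abs_def] by measurable
 qed
 have split: "ennreal (exp (\<Sum>k=1..?d. - s k * inc0 ?A t k om)) =
  ennreal (exp (\<Sum>k=1..?d. - s k * (Bp (t k) om - Bp (t (k - 1)) om))) * h (\<lambda>k\<in>{0..?d}. Z (t k) om)" for om
 proof -
  have "(\<Sum>k=1..?d. - s k * inc0 ?A t k om) =
   (\<Sum>k=1..?d. - s k * (Bp (t k) om - Bp (t (k - 1)) om) + s k * ((\<lambda>k\<in>{0..?d}. Z (t k) om) k - (\<lambda>k\<in>{0..?d}. Z (t k) om) (k - 1)))"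
  proof (rule sum.cong[OF refl])
   fix k assume k: "k \<in> {1..?d}"
   have k1: "k \<in> {0..?d}" "k - 1 \<in> {0..?d}" using k by auto
   have ieq: "inc0 ?A t k om = (Bp (t k) om - Bp (t (k - 1)) om) - (Z (t k) om - Z (t (k - 1)) om)"
    using t0 k by (auto simp: inc0_def)
   then show "- s k * inc0 ?A t k om = - s k * (Bp (t k) om - Bp (t (k - 1)) om) + s k * ((\<lambda>k\<in>{0..?d}. Z (t k) om) k - (\<lambda>k\<in>{0..?d}. Z (t k) om) (k - 1))"
    unfolding ieq restrict_apply if_P[OF k1(1)] if_P[OF k1(2)] by (simp add: algebra_simps)
  qed
  then show ?thesis unfolding h_def sum.distrib by (simp only: exp_add ennreal_mult exp_ge_zero)
 qed
 have dens: "ennreal (ydens ka a c (%k. t k / 4) n x) * h x = ennreal ka * (ennreal (chain ?de ?tu ?d x) * ennreal (exp ((a + s ?d) * x ?d)))" for x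
 proof -
  have "(\<Sum>k=1..?d. s k * (?B x k)) = (\<Sum>k=1..?d. (s k - s (Suc k)) * x k) - s 1 * x 0" unfolding abel_summation s0 by simp
  also have "(\<Sum>k=1..?d. (s k - s (Suc k)) * x k) = (\<Sum>k=1..n. ?de k * x k) + s ?d * x ?d" using s0 by (simp add: dl_def)
  finally have E: "c * x 0 + a * x ?d + (\<Sum>k=1..?d. s k * (?B x k)) = (\<Sum>k<?d. ?de k * x k) + (a + s ?d) * x ?d"
   unfolding sum.lessThan_Suc_shift sum_shift_Suc[of _ n] by (simp add: dl_def algebra_simps)
  have Pr: "(\<Prod>k=1..?d. p_kernel (t k / 4 - t (k - 1) / 4) (x (k - 1)) (x k)) = (\<Prod>k=1..?d. p_kernel (?tu k) (x (k - 1)) (x k))"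
   by (intro prod.cong refl) (simp add: ta_def diff_divide_distrib)
  have "ydens ka a c (%k. t k / 4) n x * exp (\<Sum>k=1..?d. s k * (?B x k)) = ka * (chain ?de ?tu ?d x * exp ((a + s ?d) * x ?d))"
  proof -
   have "exp (c * x 0 + a * x ?d) * exp (\<Sum>k=1..?d. s k * (?B x k)) = exp (\<Sum>k<?d. ?de k * x k) * exp ((a + s ?d) * x ?d)"
    unfolding exp_add[symmetric] E ..
   moreover have "ydens ka a c (%k. t k / 4) n x * exp (\<Sum>k=1..?d. s k * (?B x k)) =
    ka * ((\<Prod>k=1..?d. p_kernel (?tu k) (x (k - 1)) (x k)) * (exp (c * x 0 + a * x ?d) * exp (\<Sum>k=1..?d. s k * (?B x k))))"
    unfolding ydens_def Pr by (simp only: mult_ac)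
   ultimately show ?thesis unfolding chain_def by (simp only:) (simp only: mult_ac)
  qed
  moreover have "0 <= ydens ka a c (%k. t k / 4) n x"
   unfolding ydens_def Pr using ka by (intro mult_nonneg_nonneg prod_nonneg ballI p_kernel_nonneg tu) auto
  ultimately show ?thesis unfolding h_def using ka chain_nonneg[of ?d x] by (simp add: ennreal_mult[symmetric] del: ennreal_mult)
 qed
 have "(\<integral>\<^sup>+om. ennreal (exp (\<Sum>k=1..Suc n. - s k * inc0 ?A t k om)) \<partial>M) =
  ennreal (exp (\<Sum>k=1..?d. (- s k)^2 * (t k - t (k - 1)) / 4)) * (\<integral>\<^sup>+x. ennreal (ydens ka a c (%k. t k / 4) n x) * h x \<partial>?P)"
  unfolding split using bz[unfolded BZ_def, rule_format, of t n h "%k. - s k"] g hm by (simp add: grid_def)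
 also have "(\<integral>\<^sup>+x. ennreal (ydens ka a c (%k. t k / 4) n x) * h x \<partial>?P) = ennreal ka * (\<integral>\<^sup>+x. ennreal (chain ?de ?tu ?d x) * ennreal (exp ((a + s ?d) * x ?d)) \<partial>?P)"
 proof (simp only: dens, rule nn_integral_cmult)
  have "(%x. exp ((a + s ?d) * x ?d)) \<in> borel_measurable ?P" using cm[of ?d] by simp
  then show "(%x. ennreal (chain ?de ?tu ?d x) * ennreal (exp ((a + s ?d) * x ?d))) \<in> borel_measurable ?P"
   using chain_measurable[of ?d ?d] by measurable
 qed
 also have "(\<integral>\<^sup>+x. ennreal (chain ?de ?tu ?d x) * ennreal (exp ((a + s ?d) * x ?d)) \<partial>?P) = ennreal (TOT a c s t n)"
  unfolding TOT_def nn_GG_final[OF e, symmetric] by (rule chain_integral) measurable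
 finally show ?thesis by (simp add: Gs_def)
qed

text \<open>Both transforms are \<open>Gs * TOT\<close> times a factor independent of the exponents.
  Each law is scaled by the factor of the other, uniqueness identifies the scaled measures, and
  evaluating them on the whole space removes the factors.\<close>

lemma law_increments:
 fixes X :: "real => 'b => real" and Bp Z :: "real => 'a => real"
 assumes a: "a > - 2" and c: "c > 0" and ac: "a + c > 0" and g: "grid t n"
  and N: "prob_space N" and Xm: "!!t. t \<in> {0..1} ==> X t \<in> borel_measurable N" and L: "H_laplace a c N X"
  and M: "prob_space M" and Wm: "!!t. t \<in> {0..1} ==> W t \<in> borel_measurable M"
  and W: "W = (%t om. Bp t om - Bp 0 om - Z t om + Z 0 om)" and bz: "BZ ka a c M Bp Z" and ka: "ka > 0"
 shows "distr N (PiM {1..Suc n} (%_. borel)) (%om. \<lambda>k\<in>{1..Suc n}. inc0 X t k om) = distr M (PiM {1..Suc n} (%_. borel)) (%om. \<lambda>k\<in>{1..Suc n}. inc0 W t k om)"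
proof -
 interpret N: prob_space N by fact
 interpret M: prob_space M by fact
 let ?I = "{1..Suc n}" and ?d = "Suc n"
 let ?P = "PiM ?I (%_. borel :: real measure)"
 \<comment> \<open>The interval (lo, hi) is cut into pieces of width \<open>w\<close>, and
   \<open>s k\<close> ranges over every second one of them. The gaps make every choice strictly
   decreasing in k; \<open>l\<close> and \<open>r\<close> are the ends with the sign
   reversed.\<close>
 define lo hi w where "lo = max 0 (- a)" and "hi = min c 2" and "w = (hi - lo) / (2 * real ?d + 2)"
 have w: "w > 0" using a c ac by (simp add: w_def lo_def hi_def)
 have whi: "lo + 2 * real ?d * w < hi"
 proof -
  have "w * (2 * real ?d + 2) = hi - lo" by (simp add: w_def)
  then show ?thesis using w by (simp add: algebra_simps)
 qed
 define l r where "l k = - (lo + (2 * (real ?d - real k) + 2) * w)" and "r k = - (lo + (2 * (real ?d - real k) + 1) * w)" for k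
 have lr: "l k < r k" for k using w by (simp add: l_def r_def algebra_simps)
 define S where "S e k = (if k \<in> ?I then - e k else 0 :: real)" for e :: "nat => real" and k
 have bx: "box a c (S e) n" if e: "!!i. i \<in> ?I ==> l i < e i & e i < r i" for e
 proof -
  have "S e 1 < hi"
  proof -
   have "S e 1 < lo + 2 * real ?d * w" using e[of 1] by (simp add: S_def l_def algebra_simps)
   then show ?thesis using whi by simp
  qed
  moreover have "S e (Suc k) < S e k" if "k \<in> {1..n}" for k using e[of k] e[of "Suc k"] that by (simp add: S_def l_def r_def algebra_simps)
  moreover have "S e ?d > lo" using e[of ?d] w by (simp add: S_def r_def)
  ultimately show ?thesis unfolding box_def hi_def lo_def by (auto simp: S_def)
 qed
 have Se: "(\<Sum>k\<in>?I. e k * inc0 U t k om) = (\<Sum>k=1..Suc n. - S e k * inc0 U t k om)" for e and U :: "real => 'z => real" and om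
  by (intro sum.cong) (auto simp: S_def)
 have t01: "t k \<in> {0..1}" if "k <= ?d" for k
 proof -
  have mono: "t i <= t j" if "i <= j" "j <= ?d" for i j using that
  proof (induction j)
   case (Suc j)
   then show ?case using g by (cases "i = Suc j") (auto simp: grid_def intro: order_trans less_imp_le)
  qed simp
  show ?thesis using mono[of 0 k] mono[of k ?d] that g by (simp add: grid_def)
 qed
 have VX: "inc0 X t k \<in> borel_measurable N" if "k \<in> ?I" for k
  unfolding inc0_def[abs_def] using Xm[OF t01[of k]] Xm[OF t01[of "k - 1"]] that by (cases "k = 1") auto
 have VW: "inc0 W t k \<in> borel_measurable M" if "k \<in> ?I" for k
  unfolding inc0_def[abs_def] using Wm[OF t01[of k]] Wm[OF t01[of "k - 1"]] that by (cases "k = 1") auto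
 define KK where "KK = (\<integral>\<^sup>+x. ennreal (exp (- x / 4)) \<partial>p0 a c)"
 have EX: "(\<integral>\<^sup>+om. ennreal (exp (\<Sum>k\<in>?I. e k * inc0 X t k om)) \<partial>N) = ennreal (Gs (S e) t n) * (ennreal (Kp a c) * ennreal (TOT a c (S e) t n) / KK)"
  if "!!i. i \<in> ?I ==> l i < e i & e i < r i" for e unfolding Se[of e] KK_def by (rule laplace_X[OF a c ac bx[of e, OF that] g L])
 have EW: "(\<integral>\<^sup>+om. ennreal (exp (\<Sum>k\<in>?I. e k * inc0 W t k om)) \<partial>M) = ennreal (Gs (S e) t n) * (ennreal ka * ennreal (TOT a c (S e) t n))"
  if "!!i. i \<in> ?I ==> l i < e i & e i < r i" for e unfolding Se[of e] W by (rule laplace_W[OF bx[of e, OF that] g bz ka])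
 \<comment> \<open>If \<open>KK\<close> were zero then \<open>p0\<close> would be null, so
   \<open>TOT\<close> would vanish, although it is a factor in the transform of \<open>W\<close>,
   which is positive.\<close>
 have KK0: "KK ~= 0"
 proof
  assume KK: "KK = 0"
  define e where "e k = (l k + r k) / 2" for k
  have e: "l i < e i & e i < r i" for i using lr[of i] by (simp add: e_def)
  have "(\<integral>\<^sup>+om. ennreal (exp (\<Sum>k\<in>?I. e k * inc0 W t k om)) \<partial>M) ~= 0"
  proof
   assume *: "(\<integral>\<^sup>+om. ennreal (exp (\<Sum>k\<in>?I. e k * inc0 W t k om)) \<partial>M) = 0"
   have "(%om. ennreal (exp (\<Sum>k\<in>?I. e k * inc0 W t k om))) \<in> borel_measurable M"
    using VW by (intro measurable_compose[OF _ measurable_ennreal] measurable_compose[OF _ borel_measurable_exp] borel_measurable_sum borel_measurable_times) auto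
   then have "AE om in M. ennreal (exp (\<Sum>k\<in>?I. e k * inc0 W t k om)) = 0" using * by (simp add: nn_integral_0_iff_AE)
   then have "AE om in M. False" by eventually_elim (simp add: ennreal_eq_0_iff not_le[symmetric])
   then show False by simp
  qed
  then have TT: "ennreal (TOT a c (S e) t n) ~= 0" unfolding EW[of e, OF e] by auto
  have "AE x in p0 a c. ennreal (exp (- x / 4)) = 0" using KK unfolding KK_def by (subst (asm) nn_integral_0_iff_AE) auto
  then have "AE x in p0 a c. False" by eventually_elim (simp add: ennreal_eq_0_iff not_le[symmetric])
  then have "(\<integral>\<^sup>+x. markov_expect (T_trans c) 0 x (Lw (S e) (Suc n)) (Fw (ta t n) (Suc n)) \<partial>p0 a c) = (\<integral>\<^sup>+x. 0 \<partial>p0 a c)"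
   by (intro nn_integral_cong_AE) (auto elim: eventually_mono)
  then have "ennreal (Kp a c) * ennreal (TOT a c (S e) t n) = 0" unfolding p0_TOT[OF a c ac bx[of e, OF e] g] by simp
  moreover have "Kp a c > 0" using ac by (simp add: Kp_def)
  ultimately show False using TT by (simp add: ennreal_eq_0_iff)
 qed
 \<comment> \<open>Kept in the extended reals, so that finiteness of \<open>KK\<close> need not be
   known beforehand.\<close>
 define ka2 where "ka2 = ennreal (Kp a c) / KK"
 have eq: "distr (scale_measure (ennreal ka) N) ?P (%om. \<lambda>k\<in>?I. inc0 X t k om) = distr (scale_measure ka2 M) ?P (%om. \<lambda>k\<in>?I. inc0 W t k om)"
 proof (rule laplace_unique_vec[where l = l and r = r])
  have sX: "(\<integral>\<^sup>+om. ennreal (exp (\<Sum>k\<in>?I. e k * inc0 X t k om)) \<partial>scale_measure (ennreal ka) N) = ennreal ka * (\<integral>\<^sup>+om. ennreal (exp (\<Sum>k\<in>?I. e k * inc0 X t k om)) \<partial>N)" for e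
   using VX by (intro nn_integral_scale_measure measurable_compose[OF _ measurable_ennreal] measurable_compose[OF _ borel_measurable_exp] borel_measurable_sum borel_measurable_times) auto
  have sW: "(\<integral>\<^sup>+om. ennreal (exp (\<Sum>k\<in>?I. e k * inc0 W t k om)) \<partial>scale_measure ka2 M) = ka2 * (\<integral>\<^sup>+om. ennreal (exp (\<Sum>k\<in>?I. e k * inc0 W t k om)) \<partial>M)" for e
   using VW by (intro nn_integral_scale_measure measurable_compose[OF _ measurable_ennreal] measurable_compose[OF _ borel_measurable_exp] borel_measurable_sum borel_measurable_times) auto
  fix e :: "nat => real" assume e: "!!i. i \<in> ?I ==> l i < e i & e i < r i"
  have EXe: "(\<integral>\<^sup>+om. ennreal (exp (\<Sum>k\<in>?I. e k * inc0 X t k om)) \<partial>N) = ennreal (Gs (S e) t n) * (ennreal (Kp a c) * ennreal (TOT a c (S e) t n) / KK)"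
   by (rule EX, rule e)
  have EWe: "(\<integral>\<^sup>+om. ennreal (exp (\<Sum>k\<in>?I. e k * inc0 W t k om)) \<partial>M) = ennreal (Gs (S e) t n) * (ennreal ka * ennreal (TOT a c (S e) t n))"
   by (rule EW, rule e)
  show "(\<integral>\<^sup>+om. ennreal (exp (\<Sum>k\<in>?I. e k * inc0 X t k om)) \<partial>scale_measure (ennreal ka) N) = (\<integral>\<^sup>+om. ennreal (exp (\<Sum>k\<in>?I. e k * inc0 W t k om)) \<partial>scale_measure ka2 M)"
   unfolding sX sW EXe EWe unfolding ka2_def divide_ennreal_def by (simp only: mult_ac)
  show "(\<integral>\<^sup>+om. ennreal (exp (\<Sum>k\<in>?I. e k * inc0 X t k om)) \<partial>scale_measure (ennreal ka) N) < \<infinity>"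
  proof -
   have "ennreal (Kp a c) * ennreal (TOT a c (S e) t n) / KK < \<top>"
    using KK0 by (simp add: less_top[symmetric] ennreal_divide_eq_top_iff ennreal_mult_eq_top_iff)
   then show ?thesis unfolding sX EXe by (simp add: ennreal_mult_less_top)
  qed
 qed (use VX VW lr in \<open>auto simp: measurable_def space_scale_measure\<close>)
 have mX: "(%om. \<lambda>k\<in>?I. inc0 X t k om) \<in> measurable N ?P" by (intro measurable_restrict VX)
 have mW: "(%om. \<lambda>k\<in>?I. inc0 W t k om) \<in> measurable M ?P" by (intro measurable_restrict VW)
 have em: "ennreal ka * emeasure (distr N ?P (%om. \<lambda>k\<in>?I. inc0 X t k om)) A = ka2 * emeasure (distr M ?P (%om. \<lambda>k\<in>?I. inc0 W t k om)) A" if A: "A \<in> sets ?P" for A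
 proof -
  have "(%om. \<lambda>k\<in>?I. inc0 X t k om) \<in> measurable (scale_measure (ennreal ka) N) ?P" "(%om. \<lambda>k\<in>?I. inc0 W t k om) \<in> measurable (scale_measure ka2 M) ?P"
   using mX mW by (simp_all add: measurable_def space_scale_measure)
  then show ?thesis using arg_cong[OF eq, of "%Q. emeasure Q A"] A mX mW by (simp add: emeasure_distr space_scale_measure)
 qed
 have "ennreal ka = ka2"
 proof -
  have "space ?P \<in> sets ?P" by simp
  from em[OF this] show ?thesis
   using prob_space.emeasure_space_1[OF N.prob_space_distr[OF mX]] prob_space.emeasure_space_1[OF M.prob_space_distr[OF mW]] by simp
 qed
 then have em': "emeasure (distr N ?P (%om. \<lambda>k\<in>?I. inc0 X t k om)) A = emeasure (distr M ?P (%om. \<lambda>k\<in>?I. inc0 W t k om)) A" if "A \<in> sets ?P" for A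
  using em[OF that] ka by (metis ennreal_mult_cancel_left ennreal_eq_0_iff ennreal_neq_top not_le)
 show ?thesis by (rule measure_eqI) (use em' in auto)
qed

section \<open>From increments to finite dimensional distributions\<close>

lemma distr_transfer:
 assumes eq: "distr N P U = distr M P U'" and Ph: "Ph \<in> measurable P Q"
  and U: "U \<in> measurable N P" "U' \<in> measurable M P" and A: "A \<in> measurable N Q" "A' \<in> measurable M Q"
  and ae: "AE om in N. A om = Ph (U om)" "AE om in M. A' om = Ph (U' om)"
 shows "distr N Q A = distr M Q A'"
proof -
 have "distr N Q A = distr N Q (%om. Ph (U om))" by (rule distr_cong_AE) (use ae A measurable_compose[OF U(1) Ph] in auto)
 also have "... = distr (distr N P U) Q Ph" using distr_distr[OF Ph U(1)] by (simp add: comp_def)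
 also have "... = distr M Q (%om. Ph (U' om))" unfolding eq using distr_distr[OF Ph U(2)] by (simp add: comp_def)
 also have "... = distr M Q A'" by (rule distr_cong_AE) (use ae A measurable_compose[OF U(2) Ph] in \<open>auto elim: eventually_mono\<close>)
 finally show ?thesis .
qed

text \<open>The given times are completed by 0 and 1 and sorted into a grid. Each value is a partial
  sum of \<open>inc0\<close>, so the vector in question is a measurable image of the vector of
  increments.\<close>

lemma fdd_eqI_increments:
 fixes X :: "real => 'b => real" and W :: "real => 'a => real"
 assumes Xm: "!!t. t \<in> {0..1} ==> X t \<in> borel_measurable N" and Wm: "!!t. t \<in> {0..1} ==> W t \<in> borel_measurable M"
  and X0: "AE om in N. X 0 om = 0" and W0: "AE om in M. W 0 om = 0"
  and law: "!!t n. grid t n ==> distr N (PiM {1..Suc n} (%_. borel)) (%om. \<lambda>k\<in>{1..Suc n}. inc0 X t k om) = distr M (PiM {1..Suc n} (%_. borel)) (%om. \<lambda>k\<in>{1..Suc n}. inc0 W t k om)"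
 shows "fdd_eq {0..1} N X M W" unfolding fdd_eq_def
proof (intro allI impI, elim conjE)
 fix J :: "real set" assume J: "finite J" "J \<subseteq> {0..1}"
 define S where "S = J \<union> {0, 1}"
 have S: "finite S" "0 \<in> S" "1 \<in> S" "S \<subseteq> {0..1}" using J by (auto simp: S_def)
 define xs where "xs = sorted_list_of_set S"
 have xs: "sorted xs" "distinct xs" "set xs = S" using S by (auto simp: xs_def)
 have "card {0, 1 :: real} <= card S" using S by (intro card_mono) auto
 then have "length xs >= 2" using xs distinct_card[of xs] by simp
 then obtain n where n: "length xs = Suc (Suc n)" by (metis Suc_le_D numeral_2_eq_2 Suc_le_mono)
 define t where "t k = xs ! k" for k
 have tin: "t k \<in> S" if "k <= Suc n" for k using that n xs(3) nth_mem[of k xs] by (auto simp: t_def)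
 have g: "grid t n" unfolding grid_def
 proof (intro conjI allI impI)
  obtain i where i: "i < length xs" "xs ! i = 0" using S(2) xs(3) by (metis in_set_conv_nth)
  have "t 0 <= 0" using sorted_nth_mono[OF xs(1), of 0 i] i by (simp add: t_def)
  then show "t 0 = 0" using tin[of 0] S(4) by auto
  obtain j where j: "j < length xs" "xs ! j = 1" using S(3) xs(3) by (metis in_set_conv_nth)
  have "1 <= t (Suc n)" using sorted_nth_mono[OF xs(1), of j "Suc n"] j n by (simp add: t_def)
  then show "t (Suc n) = 1" using tin[of "Suc n"] S(4) by auto
  fix k assume k: "k <= n"
  have "t k <= t (Suc k)" using sorted_nth_mono[OF xs(1), of k "Suc k"] k n by (simp add: t_def)
  moreover have "t k ~= t (Suc k)" using nth_eq_iff_index_eq[OF xs(2), of k "Suc k"] k n by (simp add: t_def)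
  ultimately show "t k < t (Suc k)" by simp
 qed
 define idx where "idx u = (SOME k. k <= Suc n & t k = u)" for u
 have idx: "idx u <= Suc n & t (idx u) = u" if "u \<in> J" for u
 proof -
  have "u \<in> set xs" using that xs(3) by (simp add: S_def)
  then have "\<exists>k. k <= Suc n & t k = u" using n by (auto simp: in_set_conv_nth t_def less_Suc_eq_le)
  then show ?thesis unfolding idx_def by (rule someI_ex)
 qed
 let ?I = "{1..Suc n}"
 define Ph where "Ph v = (\<lambda>u\<in>J. \<Sum>k=1..idx u. v k)" for v :: "nat => real"
 have Phm: "Ph \<in> measurable (PiM ?I (%_. borel)) (PiM J (%_. borel))" unfolding Ph_def[abs_def]
 proof (rule measurable_restrict, rule borel_measurable_sum)
  fix u k assume "u \<in> J" "k \<in> {1..idx u}"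
  then have "k \<in> ?I" using idx[of u] by auto
  then show "(%v. v k) \<in> borel_measurable (PiM ?I (%_. borel))" by (rule measurable_component_singleton)
 qed
 have Phe: "(\<lambda>u\<in>J. U u om) = Ph (\<lambda>k\<in>?I. inc0 U t k om)" if "U 0 om = 0" for U :: "real => 'z => real" and om unfolding Ph_def
 proof (rule restrict_ext)
  fix u assume u: "u \<in> J"
  have "(\<Sum>k=1..idx u. (\<lambda>k\<in>?I. inc0 U t k om) k) = (\<Sum>k=1..idx u. inc0 U t k om)" using idx[OF u] by (intro sum.cong refl) auto
  also have "... = U u om" unfolding inc0_sum using idx[OF u] that g by (auto simp: grid_def)
  finally show "U u om = (\<Sum>k=1..idx u. (\<lambda>k\<in>?I. inc0 U t k om) k)" ..
 qed
 have tm: "t k \<in> {0..1}" if "k <= Suc n" for k using tin[OF that] S(4) by blast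
 have mi: "(%om. \<lambda>k\<in>?I. inc0 U t k om) \<in> measurable K (PiM ?I (%_. borel))" if "!!t. t \<in> {0..1} ==> U t \<in> borel_measurable K" for U :: "real => 'z => real" and K
 proof (rule measurable_restrict)
  fix k assume "k \<in> ?I"
  then show "inc0 U t k \<in> borel_measurable K" unfolding inc0_def[abs_def] using that[OF tm[of k]] that[OF tm[of "k - 1"]] by (cases "k = 1") auto
 qed
 show "distr N (PiM J (%_. borel)) (%om. \<lambda>u\<in>J. X u om) = distr M (PiM J (%_. borel)) (%om. \<lambda>u\<in>J. W u om)"
 proof (rule distr_transfer[OF law[OF g] Phm mi[OF Xm] mi[OF Wm]])
  show "(%om. \<lambda>u\<in>J. X u om) \<in> measurable N (PiM J (%_. borel))" "(%om. \<lambda>u\<in>J. W u om) \<in> measurable M (PiM J (%_. borel))"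
   using J by (auto intro!: measurable_restrict Xm Wm)
  show "AE om in N. (\<lambda>u\<in>J. X u om) = Ph (\<lambda>k\<in>?I. inc0 X t k om)" using X0 by eventually_elim (rule Phe)
  show "AE om in M. (\<lambda>u\<in>J. W u om) = Ph (\<lambda>k\<in>?I. inc0 W t k om)" using W0 by eventually_elim (rule Phe)
 qed
qed

text \<open>The reversed process involves the value at time 1, so the reflected set of times is
  enlarged by 1.\<close>

lemma fdd_eq_reverse:
 fixes X A :: "real => 'b => real" and R A' :: "real => 'a => real"
 assumes eq: "fdd_eq {0..1} N X M R"
  and Xm: "!!t. t \<in> {0..1} ==> X t \<in> borel_measurable N" and Rm: "!!t. t \<in> {0..1} ==> R t \<in> borel_measurable M"
  and Am: "!!t. t \<in> {0..1} ==> A t \<in> borel_measurable N" and A'm: "!!t. t \<in> {0..1} ==> A' t \<in> borel_measurable M"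
  and ae: "AE om in N. \<forall>t\<in>{0..1}. A t om = X (1 - t) om - X 1 om" "AE om in M. \<forall>t\<in>{0..1}. A' t om = R (1 - t) om - R 1 om"
 shows "fdd_eq {0..1} N A M A'" unfolding fdd_eq_def
proof (intro allI impI, elim conjE)
 fix J :: "real set" assume J: "finite J" "J \<subseteq> {0..1}"
 define J' where "J' = insert 1 ((%t. 1 - t) ` J)"
 have J': "finite J'" "J' \<subseteq> {0..1}" using J by (auto simp: J'_def)
 define Ph where "Ph v = (\<lambda>u\<in>J. v (1 - u) - v 1)" for v :: "real => real"
 have Phm: "Ph \<in> measurable (PiM J' (%_. borel)) (PiM J (%_. borel))" unfolding Ph_def[abs_def]
 proof (rule measurable_restrict, rule borel_measurable_diff)
  fix u assume "u \<in> J"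
  then have "1 - u \<in> J'" by (simp add: J'_def)
  then show "(%v. v (1 - u)) \<in> borel_measurable (PiM J' (%_. borel))" by (rule measurable_component_singleton)
  have "1 \<in> J'" by (simp add: J'_def)
  then show "(%v. v 1) \<in> borel_measurable (PiM J' (%_. borel))" by (rule measurable_component_singleton)
 qed
 have Phe: "(\<lambda>u\<in>J. V u om) = Ph (\<lambda>u\<in>J'. U u om)" if "\<forall>t\<in>{0..1}. V t om = U (1 - t) om - U 1 om" for U V :: "real => 'z => real" and om
  unfolding Ph_def using that J by (intro restrict_ext) (auto simp: J'_def)
 show "distr N (PiM J (%_. borel)) (%om. \<lambda>u\<in>J. A u om) = distr M (PiM J (%_. borel)) (%om. \<lambda>u\<in>J. A' u om)"
 proof (rule distr_transfer[OF _ Phm])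
  show "distr N (PiM J' (%_. borel)) (%om. \<lambda>t\<in>J'. X t om) = distr M (PiM J' (%_. borel)) (%om. \<lambda>t\<in>J'. R t om)"
   using eq J' unfolding fdd_eq_def by blast
  show "(%om. \<lambda>u\<in>J'. X u om) \<in> measurable N (PiM J' (%_. borel))" "(%om. \<lambda>u\<in>J'. R u om) \<in> measurable M (PiM J' (%_. borel))"
   using J' by (auto intro!: measurable_restrict Xm Rm)
  show "(%om. \<lambda>u\<in>J. A u om) \<in> measurable N (PiM J (%_. borel))" "(%om. \<lambda>u\<in>J. A' u om) \<in> measurable M (PiM J (%_. borel))"
   using J by (auto intro!: measurable_restrict Am A'm)
  show "AE om in N. (\<lambda>u\<in>J. A u om) = Ph (\<lambda>t\<in>J'. X t om)" using ae(1) by eventually_elim (rule Phe)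
  show "AE om in M. (\<lambda>u\<in>J. A' u om) = Ph (\<lambda>t\<in>J'. R t om)" using ae(2) by eventually_elim (rule Phe)
 qed
qed

lemma fdd_eq_cong_right:
 fixes X :: "real => 'b => real" and R A' :: "real => 'a => real"
 assumes eq: "fdd_eq T N X M R"
  and Rm: "!!t. t \<in> T ==> R t \<in> borel_measurable M" and A'm: "!!t. t \<in> T ==> A' t \<in> borel_measurable M"
  and ae: "AE om in M. \<forall>t\<in>T. A' t om = R t om"
 shows "fdd_eq T N X M A'" unfolding fdd_eq_def
proof (intro allI impI, elim conjE)
 fix J :: "real set" assume J: "finite J" "J \<subseteq> T"
 have "distr N (PiM J (%_. borel)) (%om. \<lambda>t\<in>J. X t om) = distr M (PiM J (%_. borel)) (%om. \<lambda>t\<in>J. R t om)"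
  using eq J unfolding fdd_eq_def by blast
 also have "... = distr M (PiM J (%_. borel)) (%om. \<lambda>t\<in>J. A' t om)"
 proof (rule distr_cong_AE)
  show "AE om in M. (\<lambda>t\<in>J. R t om) = (\<lambda>t\<in>J. A' t om)" using ae by eventually_elim (use J in \<open>auto intro!: restrict_ext\<close>)
 qed (use J in \<open>auto intro!: measurable_restrict Rm A'm\<close>)
 finally show "distr N (PiM J (%_. borel)) (%om. \<lambda>t\<in>J. X t om) = distr M (PiM J (%_. borel)) (%om. \<lambda>t\<in>J. A' t om)" .
qed

theorem proposition1p4:
  fixes a c :: real
    and N :: "'b measure" and H :: "real \<Rightarrow> 'b \<Rightarrow> real"
    and M :: "'a measure" and Y B :: "real \<Rightarrow> 'a \<Rightarrow> real"
  assumes "a + c > 0" and "min a c > - 2"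
    and "corwin_knizel a c N H"
    and "Y_process (1 / 4) a c M Y"
    and "standard_brownian_motion M B"
    and "indep_processes M {0..} B {0..1 / 4} Y"
  shows "fdd_eq {0..1} N H M (\<lambda>t \<omega>. B (t / 2) \<omega> - Y (t / 4) \<omega> + Y 0 \<omega>)"
proof -
 have N: "prob_space N" and Hm: "!!t. t \<in> {0..1} ==> H t \<in> borel_measurable N" and H0: "AE om in N. H 0 om = 0"
  using assms(3) by (auto simp: corwin_knizel_def)
 have M: "prob_space M" and Bm: "!!t. t >= 0 ==> B t \<in> borel_measurable M" and B0: "AE om in M. B 0 om = 0"
  using assms(5) by (auto simp: standard_brownian_motion_def)
 note ctx = assms(5,4,6)
 have Ym: "Y t \<in> borel_measurable M" if "0 <= t" "t <= 1 / 4" for t using Y_measurable[OF ctx, of t] that by simp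
 have ka: "1 / C_norm (1 / 4) a c > 0" using C_norm_pos[OF ctx] by simp
 have Tm: "(%om. B (t / 2) om - Y (t / 4) om + Y 0 om) \<in> borel_measurable M" if "t \<in> {0..1}" for t
  using that Bm[of "t / 2"] Ym[of "t / 4"] Ym[of 0] by simp
 show ?thesis
 proof (cases "c > 0")
  case True
  \<comment> \<open>The motion starts at 0 only almost surely; subtracting its initial value makes
    \<open>W 0\<close> vanish identically.\<close>
  define W where "W = (%t om. B (t / 2) om - B (0 / 2) om - Y (t / 4) om + Y (0 / 4) om)"
  have Wm: "W t \<in> borel_measurable M" if "t \<in> {0..1}" for t using that Bm[of "t / 2"] Bm[of 0] Ym[of "t / 4"] Ym[of 0] by (simp add: W_def)
  have "fdd_eq {0..1} N H M W"
  proof (rule fdd_eqI_increments)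
   show "H t \<in> borel_measurable N" "W t \<in> borel_measurable M" if "t \<in> {0..1}" for t by (rule Hm[OF that], rule Wm[OF that])
   show "AE om in N. H 0 om = 0" "AE om in M. W 0 om = 0" using H0 by (simp_all add: W_def)
   fix t n assume g: "grid t n"
   show "distr N (PiM {1..Suc n} (%_. borel)) (%om. \<lambda>k\<in>{1..Suc n}. inc0 H t k om) = distr M (PiM {1..Suc n} (%_. borel)) (%om. \<lambda>k\<in>{1..Suc n}. inc0 W t k om)"
   proof (rule law_increments[where ka = "1 / C_norm (1 / 4) a c" and Bp = "%t. B (t / 2)" and Z = "%t. Y (t / 4)"])
    show "H_laplace a c N H" using assms(3) True by (simp add: corwin_knizel_def)
    show "H t \<in> borel_measurable N" "W t \<in> borel_measurable M" if "t \<in> {0..1}" for t by (rule Hm[OF that], rule Wm[OF that])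
   qed (use g assms(1,2) True N M ka BZ_forward[OF ctx] in \<open>simp_all add: W_def\<close>)
  qed
  then show ?thesis
  proof (rule fdd_eq_cong_right)
   show "AE om in M. \<forall>t\<in>{0..1}. B (t / 2) om - Y (t / 4) om + Y 0 om = W t om" using B0 by eventually_elim (simp add: W_def)
  qed (fact Wm, fact Tm)
 next
  case False
  have a: "a > 0" using False assms(1) by simp
  \<comment> \<open>Here a > 0, so the formula with \<open>a\<close> and \<open>c\<close> exchanged
    is available for the reversed process. Both reversed processes are compared, and a second
    reversal returns to \<open>H\<close>.\<close>
  define X where "X = (%t om. H (1 - t) om - H 1 om)"
  define W where "W = (%t om. B ((1 - t) / 2) om - B ((1 - 0) / 2) om - Y ((1 - t) / 4) om + Y ((1 - 0) / 4) om)"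
  have Xm: "X t \<in> borel_measurable N" if "t \<in> {0..1}" for t using that Hm[of "1 - t"] Hm[of 1] by (simp add: X_def)
  have Wm: "W t \<in> borel_measurable M" if "t \<in> {0..1}" for t
   using that Bm[of "(1 - t) / 2"] Bm[of "1 / 2"] Ym[of "(1 - t) / 4"] Ym[of "1 / 4"] by (simp add: W_def)
  have ca: "c + a > 0" using assms(1) by simp
  have "fdd_eq {0..1} N X M W"
  proof (rule fdd_eqI_increments)
   show "X t \<in> borel_measurable N" "W t \<in> borel_measurable M" if "t \<in> {0..1}" for t by (rule Xm[OF that], rule Wm[OF that])
   show "AE om in N. X 0 om = 0" "AE om in M. W 0 om = 0" by (simp_all add: X_def W_def)
   fix t n assume g: "grid t n"
   show "distr N (PiM {1..Suc n} (%_. borel)) (%om. \<lambda>k\<in>{1..Suc n}. inc0 X t k om) = distr M (PiM {1..Suc n} (%_. borel)) (%om. \<lambda>k\<in>{1..Suc n}. inc0 W t k om)"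
   proof (rule law_increments[where ka = "1 / C_norm (1 / 4) a c" and Bp = "%t. B ((1 - t) / 2)" and Z = "%t. Y ((1 - t) / 4)"])
    show "H_laplace c a N X" using assms(3) a by (simp add: corwin_knizel_def X_def)
    show "X t \<in> borel_measurable N" "W t \<in> borel_measurable M" if "t \<in> {0..1}" for t by (rule Xm[OF that], rule Wm[OF that])
   qed (use g assms(2) a ca N M ka BZ_backward[OF ctx] in \<open>simp_all add: W_def\<close>)
  qed
  then show ?thesis
  proof (rule fdd_eq_reverse)
   show "X t \<in> borel_measurable N" "W t \<in> borel_measurable M" "H t \<in> borel_measurable N" "(%om. B (t / 2) om - Y (t / 4) om + Y 0 om) \<in> borel_measurable M" if "t \<in> {0..1}" for t
    by (rule Xm[OF that], rule Wm[OF that], rule Hm[OF that], rule Tm[OF that])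
   show "AE om in N. \<forall>t\<in>{0..1}. H t om = X (1 - t) om - X 1 om" using H0 by eventually_elim (simp add: X_def)
   show "AE om in M. \<forall>t\<in>{0..1}. B (t / 2) om - Y (t / 4) om + Y 0 om = W (1 - t) om - W 1 om"
    using B0 by eventually_elim (simp add: W_def)
  qed
 qed
qed

end
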